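(* For each pair of weaknesses $w' \leq w$ in $\{s,p,l,c\}$, the $\mathcal F$-sketches $\mathcal{M}\mathrm{od}_{\overline{w'}, \overline w}(-, -)$ and $\mathcal{M}\mathrm{od}_{w', w}(-, -)$ equip the multicategory $\mathcal F\text{-}\mathrm{SK}_{w', w}$ with left- and right-closed structure respectively.
   Context: **$\mathcal F$-categories.** $\mathcal F$ is the full subcategory of the arrow category $\mathrm{CAT}^{\to}$ of the category of small categories spanned by the full embeddings $A\colon A_\tau \to A_\lambda$ (fully faithful, injective-on-objects functors); it is complete, cocomplete and cartesian closed. An $\mathcal F$-category $\mathbb C$ is a category enriched in $\mathcal F$; equivalently, a 2-category $\mathbb C_\lambda$, whose 1-cells are called loose morphisms, with a wide, locally full sub-2-category $\mathbb C_\tau$, whose 1-cells are called tight. An $\mathcal F$-functor is a 2-functor $\mathbb C_\lambda\to\mathbb D_\lambda$ preserving tightness. $\mathcal F$ itself is an $\mathcal F$-category $\mathbb F$: loose morphisms $A\to B$ are functors $A_\lambda\to B_\lambda$, the tight ones are those restricting to $A_\tau \to B_\tau$, 2-cells are natural transformations. All $\mathcal F$-categories and sketches are small. **Weaknesses.** The weaknesses $\{s,p,l,c\}$ (strict, pseudo, lax, colax) are ordered by $s\le p$, $p\le l$, $p\le c$, with involution $\overline{(-)}$ fixing $s,p$ and exchanging $l,c$. For a square with top $f$, left $g$, right $h$, bottom $k$: an $l$-cell is a 2-cell $hf\Rightarrow kg$; a $c$-cell is a 2-cell $kg\Rightarrow hf$; a $p$-cell is an invertible $l$-cell (inverses being taken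 where the direction must be reversed); an $s$-cell is an identity. **Functor $\mathcal F$-categories.** $\mathbb{F}\mathrm{un}_{w',w}(\mathbb S,\mathbb C)$ has objects the $\mathcal F$-functors $\mathbb S\to\mathbb C$; loose morphisms $M\to N$ the loose $w$-natural transformations $\phi$ (loose components $\phi_S$, and for each loose $s\colon S\to S'$ a $w$-cell $\phi_s$ in the square with top $\phi_S$, left $M(s)$, right $N(s)$, bottom $\phi_{S'}$, subject to the usual 2-natural/pseudonatural/lax/colax axioms) such that $\phi_s$ is a $w'$-cell whenever $s$ is tight; such a morphism is tight when every $\phi_S$ is tight and every $\phi_s$ is a $w'$-cell; 2-cells are modifications. **Multifunctors.** For $n>0$, a $(w',w)$-natural $\mathcal F$-multifunctor $M\colon(\mathbb S_1,\dots,\mathbb S_n)\to\mathbb C$ consists of: (1) objects $M(S_1,\dots,S_n)\in\mathbb C$, each assignment $M(S_1,\dots,-_i,\dots,S_n)$ being equipped with the structure of an $\mathcal F$-functor $\mathbb S_i\to\mathbb C$; (2) for $i<j$ and loose $s_i\colon S_i\to S_i'$, $s_j\colon S_j\to S_j'$ (other arguments fixed and suppressed), a $w$-cell $M(s_i,s_j)$ in the square with top $M(s_i,S_j)$, left $M(S_i,s_j)$, right $M(S_i',s_j)$, bottom $M(s_i,S_j')$, such that (a) $M(s_i,s_j)$ is a $w'$-cell if $s_i$ or $s_j$ is tight; (b) the cells $M(s_i,-_j)$ form a loose $w$-natural transformation $M(S_i,-_j)\Rightarrow M(S_i',-_j)$; (c) the cells $M(-_i,s_j)$ form a loose $\overline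 w$-natural transformation $M(-_i,S_j)\Rightarrow M(-_i,S_j')$; (d) for $i<j<k$ and loose $s_i,s_j,s_k$, the cubical compatibility condition: the two composite 2-cells between the composites (first $s_i$, then $s_j$, then $s_k$) and (first $s_k$, then $s_j$, then $s_i$) obtained by pasting the cells on the faces of the cube are equal. A nullary multifunctor to $\mathbb C$ is an object of $\mathbb C$. **Sketches and multimodels.** An $\mathcal F$-weight is an $\mathcal F$-functor $W\colon\mathbb J\to\mathbb F$ with $\mathbb J$ small; a $W$-weighted cone over $D\colon\mathbb J\to\mathbb S$ is an object $X$ with an $\mathcal F$-natural transformation $W\Rightarrow\mathbb S(X,D-)$. A (limit) $\mathcal F$-sketch $\mathcal S$ is a small $\mathcal F$-category $\mathbb S$ with a class of weighted cones. A model of $\mathcal S$ in $\mathcal C$ (sketch morphism) is an $\mathcal F$-functor $\mathbb S\to\mathbb C$ sending specified cones to specified cones. A $(w',w)$-natural $\mathcal F$-multimodel $(\mathcal S_1,\dots,\mathcal S_n)\to\mathcal C$ ($n>0$) is a $(w',w)$-natural $\mathcal F$-multifunctor $M$ such that each $M(S_1,\dots,-_i,\dots,S_n)$ is a model of $\mathcal S_i$ in $\mathcal C$; a nullary one is an object of $\mathbb C$. These are the multimorphisms of the multicategory $\mathcal F\text{-}\mathrm{SK}_{w',w}$, with composition by substitution. **Internal homs.** $\mathbb{M}\mathrm{od}_{w',w}(\mathcal S,\mathcal C)$ is the full sub-$\mathcal F$-category of $\mathbb{F}\mathrm{un}_{w',w}(\mathbb S,\mathbb C)$ on the models. $\mathcal{M}\mathrm{od}_{w',w}(\mathcal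 S,\mathcal C)$ is the $\mathcal F$-sketch on this $\mathcal F$-category whose specified weighted cones are precisely those whose composite with each evaluation $\mathcal F$-functor $(-)(S)\colon\mathbb{M}\mathrm{od}_{w',w}(\mathcal S,\mathcal C)\to\mathbb C$, $S\in\mathbb S$, is a specified weighted cone of $\mathcal C$. **Closedness.** A multicategory $\mathscr M$ is left-closed with homs $[X,Z]_l$ if there are natural isomorphisms $\mathscr M(X,Y_1,\dots,Y_n;Z)\cong\mathscr M(Y_1,\dots,Y_n;[X,Z]_l)$, and right-closed with homs $[Y,Z]_r$ if there are natural isomorphisms $\mathscr M(X_1,\dots,X_n,Y;Z)\cong\mathscr M(X_1,\dots,X_n;[Y,Z]_r)$. *)

theory Defs
  imports Main "HOL-Library.FuncSet" "HOL-Library.Equipollence"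
begin

(* Conventions.  Every structure has explicit carrier sets; composition is written in
   application order (comp g f = "g after f") and is only constrained on composable pairs.
   Functors, transformations, modifications, cones and multifunctors are extensional
   (undefined off their domain), so that HOL equality is the mathematical equality. *)

section \<open>Weaknesses\<close>

datatype weakness = Strict | Pseudo | Lax | Colax

definition weak_le :: "weakness \<Rightarrow> weakness \<Rightarrow> bool"  (infix "\<preceq>" 50) where
  "v \<preceq> w \<longleftrightarrow> v = w \<or> v = Strict \<or> (v = Pseudo \<and> w \<noteq> Strict)"

fun dual :: "weakness \<Rightarrow> weakness" where
  "dual Strict = Strict"
| "dual Pseudo = Pseudo"
| "dual Lax = Colax"
| "dual Colax = Lax"

section \<open>Universes\<close>

(* A Grothendieck universe, up to cardinality: the small subsets of 'u are closed under
   smaller or equal cardinality, power sets and small unions.  No small infinite set is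
   demanded. *)
definition universe :: "('u set \<Rightarrow> bool) \<Rightarrow> bool" where
  "universe small \<longleftrightarrow>
     small {} \<and>
     (\<forall>A B. small A \<and> B \<lesssim> A \<longrightarrow> small B) \<and>
     (\<forall>A. small A \<longrightarrow> (\<exists>P. small P \<and> Pow A \<lesssim> P)) \<and>
     (\<forall>A F. small A \<and> (\<forall>a\<in>A. small (F a)) \<longrightarrow> small (\<Union>a\<in>A. F a))"

section \<open>Categories and functors\<close>

record ('o, 'a) cat =
  c_ob :: "'o set"
  c_ar :: "'a set"
  c_dom :: "'a \<Rightarrow> 'o"
  c_cod :: "'a \<Rightarrow> 'o"
  c_id :: "'o \<Rightarrow> 'a"
  c_comp :: "'a \<Rightarrow> 'a \<Rightarrow> 'a"

definition category :: "('o, 'a) cat \<Rightarrow> bool" where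
  "category C \<longleftrightarrow>
     (\<forall>f\<in>c_ar C. c_dom C f \<in> c_ob C \<and> c_cod C f \<in> c_ob C) \<and>
     (\<forall>x\<in>c_ob C. c_id C x \<in> c_ar C \<and> c_dom C (c_id C x) = x \<and> c_cod C (c_id C x) = x) \<and>
     (\<forall>f\<in>c_ar C. \<forall>g\<in>c_ar C. c_dom C g = c_cod C f \<longrightarrow>
        c_comp C g f \<in> c_ar C \<and> c_dom C (c_comp C g f) = c_dom C f \<and>
        c_cod C (c_comp C g f) = c_cod C g) \<and>
     (\<forall>f\<in>c_ar C. c_comp C f (c_id C (c_dom C f)) = f \<and> c_comp C (c_id C (c_cod C f)) f = f) \<and>
     (\<forall>f\<in>c_ar C. \<forall>g\<in>c_ar C. \<forall>h\<in>c_ar C. c_dom C g = c_cod C f \<and> c_dom C h = c_cod C g \<longrightarrow>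
        c_comp C h (c_comp C g f) = c_comp C (c_comp C h g) f)"

definition c_hom :: "('o, 'a) cat \<Rightarrow> 'o \<Rightarrow> 'o \<Rightarrow> 'a set" where
  "c_hom C x y = {f \<in> c_ar C. c_dom C f = x \<and> c_cod C f = y}"

definition small_cat :: "('u set \<Rightarrow> bool) \<Rightarrow> ('u, 'u) cat \<Rightarrow> bool" where
  "small_cat small C \<longleftrightarrow> category C \<and> small (c_ob C) \<and> small (c_ar C)"

record ('o, 'a, 'p, 'b) cfun =
  f_ob :: "'o \<Rightarrow> 'p"
  f_ar :: "'a \<Rightarrow> 'b"

definition is_functor ::
  "('o, 'a) cat \<Rightarrow> ('p, 'b) cat \<Rightarrow> ('o, 'a, 'p, 'b) cfun \<Rightarrow> bool" where
  "is_functor A B F \<longleftrightarrow>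
     f_ob F \<in> c_ob A \<rightarrow>\<^sub>E c_ob B \<and>
     f_ar F \<in> c_ar A \<rightarrow>\<^sub>E c_ar B \<and>
     (\<forall>f\<in>c_ar A. c_dom B (f_ar F f) = f_ob F (c_dom A f) \<and>
                  c_cod B (f_ar F f) = f_ob F (c_cod A f)) \<and>
     (\<forall>x\<in>c_ob A. f_ar F (c_id A x) = c_id B (f_ob F x)) \<and>
     (\<forall>f\<in>c_ar A. \<forall>g\<in>c_ar A. c_dom A g = c_cod A f \<longrightarrow>
        f_ar F (c_comp A g f) = c_comp B (f_ar F g) (f_ar F f))"

definition cfun_id :: "('o, 'a) cat \<Rightarrow> ('o, 'a, 'o, 'a) cfun" where
  "cfun_id A = \<lparr>f_ob = (\<lambda>x\<in>c_ob A. x), f_ar = (\<lambda>f\<in>c_ar A. f)\<rparr>"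

(* The first argument is the domain category, to whose carriers the composite is restricted. *)
definition cfun_comp :: "('o, 'a) cat \<Rightarrow> ('p, 'b, 'q, 'c) cfun \<Rightarrow> ('o, 'a, 'p, 'b) cfun \<Rightarrow>
    ('o, 'a, 'q, 'c) cfun" where
  "cfun_comp A G F =
     \<lparr>f_ob = (\<lambda>x\<in>c_ob A. f_ob G (f_ob F x)), f_ar = (\<lambda>f\<in>c_ar A. f_ar G (f_ar F f))\<rparr>"

section \<open>The category of full embeddings\<close>

record ('o, 'a) fobj =
  tau :: "('o, 'a) cat"
  lam :: "('o, 'a) cat"
  emb :: "('o, 'a, 'o, 'a) cfun"

definition full_embedding :: "('o, 'a) fobj \<Rightarrow> bool" where
  "full_embedding A \<longleftrightarrow>
     category (tau A) \<and> category (lam A) \<and> is_functor (tau A) (lam A) (emb A) \<and>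
     inj_on (f_ob (emb A)) (c_ob (tau A)) \<and>
     (\<forall>x\<in>c_ob (tau A). \<forall>y\<in>c_ob (tau A).
        bij_betw (f_ar (emb A)) (c_hom (tau A) x y)
          (c_hom (lam A) (f_ob (emb A) x) (f_ob (emb A) y)))"

definition restricts :: "('o, 'a) fobj \<Rightarrow> ('p, 'b) fobj \<Rightarrow> ('o, 'a, 'p, 'b) cfun \<Rightarrow> bool" where
  "restricts A B F \<longleftrightarrow>
     (\<exists>G. is_functor (tau A) (tau B) G \<and>
          cfun_comp (tau A) (emb B) G = cfun_comp (tau A) F (emb A))"

section \<open>\<open>\<F>\<close>-categories\<close>

(* A 2-category with a distinguished set of tight 1-cells. *)
record ('o, 'a, 't) fcat =
  Obj :: "'o set"
  Arr :: "'a set"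
  Tight :: "'a set"
  Cell :: "'t set"
  Dom :: "'a \<Rightarrow> 'o"
  Cod :: "'a \<Rightarrow> 'o"
  Idn :: "'o \<Rightarrow> 'a"
  Cmp :: "'a \<Rightarrow> 'a \<Rightarrow> 'a"
  Src :: "'t \<Rightarrow> 'a"
  Tgt :: "'t \<Rightarrow> 'a"
  VId :: "'a \<Rightarrow> 't"
  VCmp :: "'t \<Rightarrow> 't \<Rightarrow> 't"
  HCmp :: "'t \<Rightarrow> 't \<Rightarrow> 't"

definition arrow_cat :: "('o, 'a, 't) fcat \<Rightarrow> ('o, 'a) cat" where
  "arrow_cat C = \<lparr>c_ob = Obj C, c_ar = Arr C, c_dom = Dom C, c_cod = Cod C,
                  c_id = Idn C, c_comp = Cmp C\<rparr>"

definition vertical_cat :: "('o, 'a, 't) fcat \<Rightarrow> ('a, 't) cat" where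
  "vertical_cat C = \<lparr>c_ob = Arr C, c_ar = Cell C, c_dom = Src C, c_cod = Tgt C,
                     c_id = VId C, c_comp = VCmp C\<rparr>"

definition horizontal_cat :: "('o, 'a, 't) fcat \<Rightarrow> ('o, 't) cat" where
  "horizontal_cat C = \<lparr>c_ob = Obj C, c_ar = Cell C,
     c_dom = (\<lambda>\<alpha>. Dom C (Src C \<alpha>)), c_cod = (\<lambda>\<alpha>. Cod C (Src C \<alpha>)),
     c_id = (\<lambda>x. VId C (Idn C x)), c_comp = HCmp C\<rparr>"

definition two_category :: "('o, 'a, 't) fcat \<Rightarrow> bool" where
  "two_category C \<longleftrightarrow>
     category (arrow_cat C) \<and> category (vertical_cat C) \<and> category (horizontal_cat C) \<and>
     (\<forall>\<alpha>\<in>Cell C. Dom C (Tgt C \<alpha>) = Dom C (Src C \<alpha>) \<and> Cod C (Tgt C \<alpha>) = Cod C (Src C \<alpha>)) \<and>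
     (\<forall>\<alpha>\<in>Cell C. \<forall>\<beta>\<in>Cell C. Dom C (Src C \<beta>) = Cod C (Src C \<alpha>) \<longrightarrow>
        Src C (HCmp C \<beta> \<alpha>) = Cmp C (Src C \<beta>) (Src C \<alpha>) \<and>
        Tgt C (HCmp C \<beta> \<alpha>) = Cmp C (Tgt C \<beta>) (Tgt C \<alpha>)) \<and>
     (\<forall>f\<in>Arr C. \<forall>g\<in>Arr C. Dom C g = Cod C f \<longrightarrow>
        HCmp C (VId C g) (VId C f) = VId C (Cmp C g f)) \<and>
     (\<forall>\<alpha>\<in>Cell C. \<forall>\<alpha>'\<in>Cell C. \<forall>\<beta>\<in>Cell C. \<forall>\<beta>'\<in>Cell C.
        Src C \<alpha>' = Tgt C \<alpha> \<and> Src C \<beta>' = Tgt C \<beta> \<and> Dom C (Src C \<beta>) = Cod C (Src C \<alpha>) \<longrightarrow>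
        HCmp C (VCmp C \<beta>' \<beta>) (VCmp C \<alpha>' \<alpha>) = VCmp C (HCmp C \<beta>' \<alpha>') (HCmp C \<beta> \<alpha>))"

definition fcategory :: "('o, 'a, 't) fcat \<Rightarrow> bool" where
  "fcategory C \<longleftrightarrow>
     two_category C \<and> Tight C \<subseteq> Arr C \<and> (\<forall>x\<in>Obj C. Idn C x \<in> Tight C) \<and>
     (\<forall>f\<in>Tight C. \<forall>g\<in>Tight C. Dom C g = Cod C f \<longrightarrow> Cmp C g f \<in> Tight C)"

definition small_fcat :: "('u set \<Rightarrow> bool) \<Rightarrow> ('u, 'u, 'u) fcat \<Rightarrow> bool" where
  "small_fcat small C \<longleftrightarrow> fcategory C \<and> small (Obj C) \<and> small (Arr C) \<and> small (Cell C)"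

definition full_sub :: "('o, 'a, 't) fcat \<Rightarrow> 'o set \<Rightarrow> ('o, 'a, 't) fcat" where
  "full_sub C P = C
     \<lparr>Obj := Obj C \<inter> P,
      Arr := {f \<in> Arr C. Dom C f \<in> P \<and> Cod C f \<in> P},
      Tight := {f \<in> Tight C. Dom C f \<in> P \<and> Cod C f \<in> P},
      Cell := {\<alpha> \<in> Cell C. Dom C (Src C \<alpha>) \<in> P \<and> Cod C (Src C \<alpha>) \<in> P}\<rparr>"

definition inverse_cells :: "('o, 'a, 't) fcat \<Rightarrow> 't \<Rightarrow> 't \<Rightarrow> bool" where
  "inverse_cells C \<alpha> \<beta> \<longleftrightarrow>
     \<alpha> \<in> Cell C \<and> \<beta> \<in> Cell C \<and> Src C \<beta> = Tgt C \<alpha> \<and> Tgt C \<beta> = Src C \<alpha> \<and>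
     VCmp C \<beta> \<alpha> = VId C (Src C \<alpha>) \<and> VCmp C \<alpha> \<beta> = VId C (Tgt C \<alpha>)"

definition whisker_left :: "('o, 'a, 't) fcat \<Rightarrow> 'a \<Rightarrow> 't \<Rightarrow> 't" where
  "whisker_left C g \<alpha> = HCmp C (VId C g) \<alpha>"

definition whisker_right :: "('o, 'a, 't) fcat \<Rightarrow> 't \<Rightarrow> 'a \<Rightarrow> 't" where
  "whisker_right C \<alpha> f = HCmp C \<alpha> (VId C f)"

record ('o, 'a, 't, 'p, 'b, 's) ffun =
  F0 :: "'o \<Rightarrow> 'p"
  F1 :: "'a \<Rightarrow> 'b"
  F2 :: "'t \<Rightarrow> 's"

definition ffunctor ::
  "('o, 'a, 't) fcat \<Rightarrow> ('p, 'b, 's) fcat \<Rightarrow> ('o, 'a, 't, 'p, 'b, 's) ffun \<Rightarrow> bool" where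
  "ffunctor A B F \<longleftrightarrow>
     is_functor (arrow_cat A) (arrow_cat B) \<lparr>f_ob = F0 F, f_ar = F1 F\<rparr> \<and>
     is_functor (vertical_cat A) (vertical_cat B) \<lparr>f_ob = F1 F, f_ar = F2 F\<rparr> \<and>
     is_functor (horizontal_cat A) (horizontal_cat B) \<lparr>f_ob = F0 F, f_ar = F2 F\<rparr> \<and>
     (\<forall>f\<in>Tight A. F1 F f \<in> Tight B)"

definition ffun_id :: "('o, 'a, 't) fcat \<Rightarrow> ('o, 'a, 't, 'o, 'a, 't) ffun" where
  "ffun_id A = \<lparr>F0 = (\<lambda>x\<in>Obj A. x), F1 = (\<lambda>f\<in>Arr A. f), F2 = (\<lambda>\<alpha>\<in>Cell A. \<alpha>)\<rparr>"

definition ffun_comp :: "('o, 'a, 't) fcat \<Rightarrow> ('p, 'b, 's, 'q, 'c, 'r) ffun \<Rightarrow>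
    ('o, 'a, 't, 'p, 'b, 's) ffun \<Rightarrow> ('o, 'a, 't, 'q, 'c, 'r) ffun" where
  "ffun_comp A G F =
     \<lparr>F0 = (\<lambda>x\<in>Obj A. F0 G (F0 F x)), F1 = (\<lambda>f\<in>Arr A. F1 G (F1 F f)),
      F2 = (\<lambda>\<alpha>\<in>Cell A. F2 G (F2 F \<alpha>))\<rparr>"

section \<open>\<open>\<F>\<close> as an \<open>\<F>\<close>-category\<close>

record ('o, 'a) farr =
  fa_dom :: "('o, 'a) fobj"
  fa_cod :: "('o, 'a) fobj"
  fa_fun :: "('o, 'a, 'o, 'a) cfun"

record ('o, 'a) fnat =
  fn_src :: "('o, 'a) farr"
  fn_tgt :: "('o, 'a) farr"
  fn_cmp :: "'o \<Rightarrow> 'a"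

definition FF_ob :: "('u set \<Rightarrow> bool) \<Rightarrow> ('u, 'u) fobj set" where
  "FF_ob small = {A. full_embedding A \<and> small_cat small (tau A) \<and> small_cat small (lam A)}"

definition FF_ar :: "('u set \<Rightarrow> bool) \<Rightarrow> ('u, 'u) farr set" where
  "FF_ar small = {f. fa_dom f \<in> FF_ob small \<and> fa_cod f \<in> FF_ob small \<and>
                     is_functor (lam (fa_dom f)) (lam (fa_cod f)) (fa_fun f)}"

definition FF_cell :: "('u set \<Rightarrow> bool) \<Rightarrow> ('u, 'u) fnat set" where
  "FF_cell small = {n.
     fn_src n \<in> FF_ar small \<and> fn_tgt n \<in> FF_ar small \<and>
     fa_dom (fn_tgt n) = fa_dom (fn_src n) \<and> fa_cod (fn_tgt n) = fa_cod (fn_src n) \<and>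
     (let A = lam (fa_dom (fn_src n)); B = lam (fa_cod (fn_src n));
          F = fa_fun (fn_src n); G = fa_fun (fn_tgt n)
      in fn_cmp n \<in> extensional (c_ob A) \<and>
         (\<forall>x\<in>c_ob A. fn_cmp n x \<in> c_hom B (f_ob F x) (f_ob G x)) \<and>
         (\<forall>a\<in>c_ar A. c_comp B (f_ar G a) (fn_cmp n (c_dom A a)) =
                      c_comp B (fn_cmp n (c_cod A a)) (f_ar F a)))}"

definition FF_idn :: "('u, 'u) fobj \<Rightarrow> ('u, 'u) farr" where
  "FF_idn A = \<lparr>fa_dom = A, fa_cod = A, fa_fun = cfun_id (lam A)\<rparr>"

definition FF_cmp :: "('u, 'u) farr \<Rightarrow> ('u, 'u) farr \<Rightarrow> ('u, 'u) farr" where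
  "FF_cmp g f = \<lparr>fa_dom = fa_dom f, fa_cod = fa_cod g,
                 fa_fun = cfun_comp (lam (fa_dom f)) (fa_fun g) (fa_fun f)\<rparr>"

definition FF :: "('u set \<Rightarrow> bool) \<Rightarrow> (('u, 'u) fobj, ('u, 'u) farr, ('u, 'u) fnat) fcat" where
  "FF small =
     \<lparr>Obj = FF_ob small,
      Arr = FF_ar small,
      Tight = {f \<in> FF_ar small. restricts (fa_dom f) (fa_cod f) (fa_fun f)},
      Cell = FF_cell small,
      Dom = fa_dom,
      Cod = fa_cod,
      Idn = FF_idn,
      Cmp = FF_cmp,
      Src = fn_src,
      Tgt = fn_tgt,
      VId = (\<lambda>f. \<lparr>fn_src = f, fn_tgt = f,
                  fn_cmp = (\<lambda>x\<in>c_ob (lam (fa_dom f)). c_id (lam (fa_cod f)) (f_ob (fa_fun f) x))\<rparr>),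
      VCmp = (\<lambda>n m. \<lparr>fn_src = fn_src m, fn_tgt = fn_tgt n,
                  fn_cmp = (\<lambda>x\<in>c_ob (lam (fa_dom (fn_src m))).
                     c_comp (lam (fa_cod (fn_src m))) (fn_cmp n x) (fn_cmp m x))\<rparr>),
      HCmp = (\<lambda>n m. \<lparr>fn_src = FF_cmp (fn_src n) (fn_src m), fn_tgt = FF_cmp (fn_tgt n) (fn_tgt m),
                  fn_cmp = (\<lambda>x\<in>c_ob (lam (fa_dom (fn_src m))).
                     c_comp (lam (fa_cod (fn_src n)))
                       (f_ar (fa_fun (fn_tgt n)) (fn_cmp m x))
                       (fn_cmp n (f_ob (fa_fun (fn_src m)) x)))\<rparr>)\<rparr>"

section \<open>Weighted cones, sketches and models\<close>

definition hom_cat :: "('o, 'a, 't) fcat \<Rightarrow> 'o \<Rightarrow> 'o \<Rightarrow> ('a, 't) cat" where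
  "hom_cat C x y =
     \<lparr>c_ob = {f \<in> Arr C. Dom C f = x \<and> Cod C f = y},
      c_ar = {\<alpha> \<in> Cell C. Dom C (Src C \<alpha>) = x \<and> Cod C (Src C \<alpha>) = y},
      c_dom = Src C, c_cod = Tgt C, c_id = VId C, c_comp = VCmp C\<rparr>"

definition tight_hom_cat :: "('o, 'a, 't) fcat \<Rightarrow> 'o \<Rightarrow> 'o \<Rightarrow> ('a, 't) cat" where
  "tight_hom_cat C x y =
     \<lparr>c_ob = {f \<in> Tight C. Dom C f = x \<and> Cod C f = y},
      c_ar = {\<alpha> \<in> Cell C. Src C \<alpha> \<in> Tight C \<and> Tgt C \<alpha> \<in> Tight C \<and>
                Dom C (Src C \<alpha>) = x \<and> Cod C (Src C \<alpha>) = y},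
      c_dom = Src C, c_cod = Tgt C, c_id = VId C, c_comp = VCmp C\<rparr>"

definition hom_fobj :: "('o, 'a, 't) fcat \<Rightarrow> 'o \<Rightarrow> 'o \<Rightarrow> ('a, 't) fobj" where
  "hom_fobj C x y = \<lparr>tau = tight_hom_cat C x y, lam = hom_cat C x y,
                     emb = cfun_id (tight_hom_cat C x y)\<rparr>"

(* The functor C(x, Dom f) -> C(x, Cod f) given by composition with f. *)
definition postcomp :: "('o, 'a, 't) fcat \<Rightarrow> 'o \<Rightarrow> 'a \<Rightarrow> ('a, 't, 'a, 't) cfun" where
  "postcomp C x f =
     \<lparr>f_ob = (\<lambda>h\<in>c_ob (hom_cat C x (Dom C f)). Cmp C f h),
      f_ar = (\<lambda>\<alpha>\<in>c_ar (hom_cat C x (Dom C f)). whisker_left C f \<alpha>)\<rparr>"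

record ('u, 'o, 'a, 't) wcone =
  shape :: "('u, 'u, 'u) fcat"
  weight :: "('u, 'u, 'u, ('u, 'u) fobj, ('u, 'u) farr, ('u, 'u) fnat) ffun"
  diag :: "('u, 'u, 'u, 'o, 'a, 't) ffun"
  apex :: "'o"
  leg :: "'u \<Rightarrow> ('u, 'u, 'a, 't) cfun"

(* The last three conditions say that the legs form an F-natural transformation
   weight => S(apex, diag -): each is a tight morphism of F, and they are natural with
   respect to loose morphisms and to 2-cells of the shape. *)
definition weighted_cone ::
  "('u set \<Rightarrow> bool) \<Rightarrow> ('o, 'a, 't) fcat \<Rightarrow> ('u, 'o, 'a, 't) wcone \<Rightarrow> bool" where
  "weighted_cone small S c \<longleftrightarrow>
     (let J = shape c; W = weight c; D = diag c; X = apex c in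
      small_fcat small J \<and> ffunctor J (FF small) W \<and> ffunctor J S D \<and> X \<in> Obj S \<and>
      leg c \<in> extensional (Obj J) \<and>
      (\<forall>j\<in>Obj J. is_functor (lam (F0 W j)) (hom_cat S X (F0 D j)) (leg c j) \<and>
                  restricts (F0 W j) (hom_fobj S X (F0 D j)) (leg c j)) \<and>
      (\<forall>f\<in>Arr J.
         cfun_comp (lam (F0 W (Dom J f))) (leg c (Cod J f)) (fa_fun (F1 W f)) =
         cfun_comp (lam (F0 W (Dom J f))) (postcomp S X (F1 D f)) (leg c (Dom J f))) \<and>
      (\<forall>\<alpha>\<in>Cell J. let j = Dom J (Src J \<alpha>); k = Cod J (Src J \<alpha>) in
         \<forall>x\<in>c_ob (lam (F0 W j)).
           f_ar (leg c k) (fn_cmp (F2 W \<alpha>) x) =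
           whisker_right S (F2 D \<alpha>) (f_ob (leg c j) x)))"

definition map_cone :: "('o, 'a, 't, 'p, 'b, 's) ffun \<Rightarrow> ('u, 'o, 'a, 't) wcone \<Rightarrow>
    ('u, 'p, 'b, 's) wcone" where
  "map_cone F c =
     \<lparr>shape = shape c, weight = weight c, diag = ffun_comp (shape c) F (diag c),
      apex = F0 F (apex c),
      leg = (\<lambda>j\<in>Obj (shape c).
        cfun_comp (lam (F0 (weight c) j)) \<lparr>f_ob = F1 F, f_ar = F2 F\<rparr> (leg c j))\<rparr>"

record ('u, 'o, 'a, 't) sketch =
  scat :: "('o, 'a, 't) fcat"
  cones :: "('u, 'o, 'a, 't) wcone set"

type_synonym 'u sk = "('u, 'u, 'u, 'u) sketch"

definition small_sketch :: "('u set \<Rightarrow> bool) \<Rightarrow> 'u sk \<Rightarrow> bool" where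
  "small_sketch small S \<longleftrightarrow>
     small_fcat small (scat S) \<and> (\<forall>c\<in>cones S. weighted_cone small (scat S) c)"

definition model :: "('u, 'o, 'a, 't) sketch \<Rightarrow> ('u, 'p, 'b, 's) sketch \<Rightarrow>
    ('o, 'a, 't, 'p, 'b, 's) ffun \<Rightarrow> bool" where
  "model S C F \<longleftrightarrow> ffunctor (scat S) (scat C) F \<and> (\<forall>c\<in>cones S. map_cone F c \<in> cones C)"

definition sketch_iso ::
  "('u, 'o, 'a, 't) sketch \<Rightarrow> ('u, 'p, 'b, 's) sketch \<Rightarrow> bool" where
  "sketch_iso A B \<longleftrightarrow>
     (\<exists>F G. model A B F \<and> model B A G \<and>
            ffun_comp (scat A) G F = ffun_id (scat A) \<and>
            ffun_comp (scat B) F G = ffun_id (scat B))"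

section \<open>Transformations and modifications\<close>

(* w-cells in the square with top f, left g, right h, bottom k. *)
definition wcell ::
  "('o, 'a, 't) fcat \<Rightarrow> weakness \<Rightarrow> 'a \<Rightarrow> 'a \<Rightarrow> 'a \<Rightarrow> 'a \<Rightarrow> 't \<Rightarrow> bool" where
  "wcell C w f g h k \<alpha> \<longleftrightarrow>
     (case w of
        Strict \<Rightarrow> Cmp C h f = Cmp C k g \<and> \<alpha> = VId C (Cmp C h f)
      | Pseudo \<Rightarrow> \<alpha> \<in> Cell C \<and> Src C \<alpha> = Cmp C h f \<and> Tgt C \<alpha> = Cmp C k g \<and>
                  (\<exists>\<beta>. inverse_cells C \<alpha> \<beta>)
      | Lax \<Rightarrow> \<alpha> \<in> Cell C \<and> Src C \<alpha> = Cmp C h f \<and> Tgt C \<alpha> = Cmp C k g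
      | Colax \<Rightarrow> \<alpha> \<in> Cell C \<and> Src C \<alpha> = Cmp C k g \<and> Tgt C \<alpha> = Cmp C h f)"

(* The w-cell \<alpha> is a v-cell, its inverse being used when v = Pseudo and w = Colax. *)
definition wcell_at ::
  "('o, 'a, 't) fcat \<Rightarrow> weakness \<Rightarrow> weakness \<Rightarrow> 'a \<Rightarrow> 'a \<Rightarrow> 'a \<Rightarrow> 'a \<Rightarrow> 't \<Rightarrow> bool" where
  "wcell_at C v w f g h k \<alpha> \<longleftrightarrow>
     wcell C w f g h k \<alpha> \<and>
     (wcell C v f g h k \<alpha> \<or> (\<exists>\<beta>. inverse_cells C \<alpha> \<beta> \<and> wcell C v f g h k \<beta>))"

(* A w-cell in a square, as a (dual w)-cell in the square reflected in its diagonal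
   (top and left exchanged, right and bottom exchanged). *)
definition reflect :: "('o, 'a, 't) fcat \<Rightarrow> weakness \<Rightarrow> 't \<Rightarrow> 't" where
  "reflect C w \<alpha> = (if w = Pseudo then (THE \<beta>. inverse_cells C \<alpha> \<beta>) else \<alpha>)"

(* The vertical composite of two cells which, in the non-colax orientation, is "first \<alpha>, then \<beta>". *)
definition vseq :: "('o, 'a, 't) fcat \<Rightarrow> weakness \<Rightarrow> 't \<Rightarrow> 't \<Rightarrow> 't" where
  "vseq C w \<alpha> \<beta> = (if w = Colax then VCmp C \<alpha> \<beta> else VCmp C \<beta> \<alpha>)"

(* For w-cells p, q in squares with tops f, f', lefts g, g', rights h, h', bottoms k, k', and
   2-cells a : hf => h'f', b : kg => k'g', compatibility of p and q with a and b. *)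
definition compatible ::
  "('o, 'a, 't) fcat \<Rightarrow> weakness \<Rightarrow> 't \<Rightarrow> 't \<Rightarrow> 't \<Rightarrow> 't \<Rightarrow> bool" where
  "compatible C w p q a b \<longleftrightarrow>
     (if w = Colax then VCmp C a p = VCmp C q b else VCmp C q a = VCmp C b p)"

record ('o, 'a, 't, 'p, 'b, 's) wtrans =
  tsrc :: "('o, 'a, 't, 'p, 'b, 's) ffun"
  ttgt :: "('o, 'a, 't, 'p, 'b, 's) ffun"
  tob :: "'o \<Rightarrow> 'b"
  tcell :: "'a \<Rightarrow> 's"

definition wnatural :: "('o, 'a, 't) fcat \<Rightarrow> ('p, 'b, 's) fcat \<Rightarrow> weakness \<Rightarrow>
    ('o, 'a, 't, 'p, 'b, 's) wtrans \<Rightarrow> bool" where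
  "wnatural S C w \<phi> \<longleftrightarrow>
     (let M = tsrc \<phi>; N = ttgt \<phi> in
      ffunctor S C M \<and> ffunctor S C N \<and>
      tob \<phi> \<in> extensional (Obj S) \<and> tcell \<phi> \<in> extensional (Arr S) \<and>
      (\<forall>x\<in>Obj S. tob \<phi> x \<in> Arr C \<and> Dom C (tob \<phi> x) = F0 M x \<and> Cod C (tob \<phi> x) = F0 N x) \<and>
      (\<forall>s\<in>Arr S. wcell C w (tob \<phi> (Dom S s)) (F1 M s) (F1 N s) (tob \<phi> (Cod S s)) (tcell \<phi> s)) \<and>
      (\<forall>x\<in>Obj S. tcell \<phi> (Idn S x) = VId C (tob \<phi> x)) \<and>
      (\<forall>s\<in>Arr S. \<forall>t\<in>Arr S. Dom S t = Cod S s \<longrightarrow>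
         tcell \<phi> (Cmp S t s) =
         vseq C w (whisker_left C (F1 N t) (tcell \<phi> s)) (whisker_right C (tcell \<phi> t) (F1 M s))) \<and>
      (\<forall>\<alpha>\<in>Cell S. let s = Src S \<alpha>; s' = Tgt S \<alpha> in
         compatible C w (tcell \<phi> s) (tcell \<phi> s')
           (whisker_right C (F2 N \<alpha>) (tob \<phi> (Dom S s)))
           (whisker_left C (tob \<phi> (Cod S s)) (F2 M \<alpha>))))"

definition wcell_of :: "('o, 'a, 't) fcat \<Rightarrow> ('p, 'b, 's) fcat \<Rightarrow> weakness \<Rightarrow> weakness \<Rightarrow>
    ('o, 'a, 't, 'p, 'b, 's) wtrans \<Rightarrow> 'a \<Rightarrow> bool" where
  "wcell_of S C v w \<phi> s \<longleftrightarrow>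
     wcell_at C v w (tob \<phi> (Dom S s)) (F1 (tsrc \<phi>) s) (F1 (ttgt \<phi>) s) (tob \<phi> (Cod S s)) (tcell \<phi> s)"

definition loose_trans :: "('o, 'a, 't) fcat \<Rightarrow> ('p, 'b, 's) fcat \<Rightarrow> weakness \<Rightarrow> weakness \<Rightarrow>
    ('o, 'a, 't, 'p, 'b, 's) wtrans set" where
  "loose_trans S C v w = {\<phi>. wnatural S C w \<phi> \<and> (\<forall>s\<in>Tight S. wcell_of S C v w \<phi> s)}"

definition tight_trans :: "('o, 'a, 't) fcat \<Rightarrow> ('p, 'b, 's) fcat \<Rightarrow> weakness \<Rightarrow> weakness \<Rightarrow>
    ('o, 'a, 't, 'p, 'b, 's) wtrans set" where
  "tight_trans S C v w =
     {\<phi> \<in> loose_trans S C v w.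
        (\<forall>x\<in>Obj S. tob \<phi> x \<in> Tight C) \<and> (\<forall>s\<in>Arr S. wcell_of S C v w \<phi> s)}"

record ('o, 'a, 't, 'p, 'b, 's) modif =
  msrc :: "('o, 'a, 't, 'p, 'b, 's) wtrans"
  mtgt :: "('o, 'a, 't, 'p, 'b, 's) wtrans"
  mcmp :: "'o \<Rightarrow> 's"

definition modifications :: "('o, 'a, 't) fcat \<Rightarrow> ('p, 'b, 's) fcat \<Rightarrow> weakness \<Rightarrow> weakness \<Rightarrow>
    ('o, 'a, 't, 'p, 'b, 's) modif set" where
  "modifications S C v w = {\<mu>.
     let \<phi> = msrc \<mu>; \<psi> = mtgt \<mu>; M = tsrc \<phi>; N = ttgt \<phi> in
     \<phi> \<in> loose_trans S C v w \<and> \<psi> \<in> loose_trans S C v w \<and> tsrc \<psi> = M \<and> ttgt \<psi> = N \<and>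
     mcmp \<mu> \<in> extensional (Obj S) \<and>
     (\<forall>x\<in>Obj S. mcmp \<mu> x \<in> Cell C \<and> Src C (mcmp \<mu> x) = tob \<phi> x \<and> Tgt C (mcmp \<mu> x) = tob \<psi> x) \<and>
     (\<forall>s\<in>Arr S. compatible C w (tcell \<phi> s) (tcell \<psi> s)
        (whisker_left C (F1 N s) (mcmp \<mu> (Dom S s)))
        (whisker_right C (mcmp \<mu> (Cod S s)) (F1 M s)))}"

definition trans_id :: "('o, 'a, 't) fcat \<Rightarrow> ('p, 'b, 's) fcat \<Rightarrow>
    ('o, 'a, 't, 'p, 'b, 's) ffun \<Rightarrow> ('o, 'a, 't, 'p, 'b, 's) wtrans" where
  "trans_id S C M =
     \<lparr>tsrc = M, ttgt = M, tob = (\<lambda>x\<in>Obj S. Idn C (F0 M x)), tcell = (\<lambda>s\<in>Arr S. VId C (F1 M s))\<rparr>"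

definition trans_comp :: "('o, 'a, 't) fcat \<Rightarrow> ('p, 'b, 's) fcat \<Rightarrow> weakness \<Rightarrow>
    ('o, 'a, 't, 'p, 'b, 's) wtrans \<Rightarrow> ('o, 'a, 't, 'p, 'b, 's) wtrans \<Rightarrow>
    ('o, 'a, 't, 'p, 'b, 's) wtrans" where
  "trans_comp S C w \<psi> \<phi> =
     \<lparr>tsrc = tsrc \<phi>, ttgt = ttgt \<psi>,
      tob = (\<lambda>x\<in>Obj S. Cmp C (tob \<psi> x) (tob \<phi> x)),
      tcell = (\<lambda>s\<in>Arr S.
        vseq C w (whisker_right C (tcell \<psi> s) (tob \<phi> (Dom S s)))
                 (whisker_left C (tob \<psi> (Cod S s)) (tcell \<phi> s)))\<rparr>"

definition Fun_cat :: "weakness \<Rightarrow> weakness \<Rightarrow> ('o, 'a, 't) fcat \<Rightarrow> ('p, 'b, 's) fcat \<Rightarrow>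
    (('o, 'a, 't, 'p, 'b, 's) ffun, ('o, 'a, 't, 'p, 'b, 's) wtrans,
     ('o, 'a, 't, 'p, 'b, 's) modif) fcat" where
  "Fun_cat v w S C =
     \<lparr>Obj = {M. ffunctor S C M},
      Arr = loose_trans S C v w,
      Tight = tight_trans S C v w,
      Cell = modifications S C v w,
      Dom = tsrc,
      Cod = ttgt,
      Idn = trans_id S C,
      Cmp = trans_comp S C w,
      Src = msrc,
      Tgt = mtgt,
      VId = (\<lambda>\<phi>. \<lparr>msrc = \<phi>, mtgt = \<phi>, mcmp = (\<lambda>x\<in>Obj S. VId C (tob \<phi> x))\<rparr>),
      VCmp = (\<lambda>\<nu> \<mu>. \<lparr>msrc = msrc \<mu>, mtgt = mtgt \<nu>,
                 mcmp = (\<lambda>x\<in>Obj S. VCmp C (mcmp \<nu> x) (mcmp \<mu> x))\<rparr>),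
      HCmp = (\<lambda>\<nu> \<mu>. \<lparr>msrc = trans_comp S C w (msrc \<nu>) (msrc \<mu>),
                 mtgt = trans_comp S C w (mtgt \<nu>) (mtgt \<mu>),
                 mcmp = (\<lambda>x\<in>Obj S. HCmp C (mcmp \<nu> x) (mcmp \<mu> x))\<rparr>)\<rparr>"

definition Mod_cat :: "weakness \<Rightarrow> weakness \<Rightarrow> ('u, 'o, 'a, 't) sketch \<Rightarrow>
    ('u, 'p, 'b, 's) sketch \<Rightarrow>
    (('o, 'a, 't, 'p, 'b, 's) ffun, ('o, 'a, 't, 'p, 'b, 's) wtrans,
     ('o, 'a, 't, 'p, 'b, 's) modif) fcat" where
  "Mod_cat v w S C = full_sub (Fun_cat v w (scat S) (scat C)) {M. model S C M}"

definition evaluation ::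
  "(('o, 'a, 't, 'p, 'b, 's) ffun, ('o, 'a, 't, 'p, 'b, 's) wtrans,
    ('o, 'a, 't, 'p, 'b, 's) modif) fcat \<Rightarrow> 'o \<Rightarrow>
   (('o, 'a, 't, 'p, 'b, 's) ffun, ('o, 'a, 't, 'p, 'b, 's) wtrans,
    ('o, 'a, 't, 'p, 'b, 's) modif, 'p, 'b, 's) ffun" where
  "evaluation K x =
     \<lparr>F0 = (\<lambda>M\<in>Obj K. F0 M x), F1 = (\<lambda>\<phi>\<in>Arr K. tob \<phi> x), F2 = (\<lambda>\<mu>\<in>Cell K. mcmp \<mu> x)\<rparr>"

definition Mod_sketch :: "('u set \<Rightarrow> bool) \<Rightarrow> weakness \<Rightarrow> weakness \<Rightarrow>
    ('u, 'o, 'a, 't) sketch \<Rightarrow> ('u, 'p, 'b, 's) sketch \<Rightarrow>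
    ('u, ('o, 'a, 't, 'p, 'b, 's) ffun, ('o, 'a, 't, 'p, 'b, 's) wtrans,
     ('o, 'a, 't, 'p, 'b, 's) modif) sketch" where
  "Mod_sketch small v w S C =
     \<lparr>scat = Mod_cat v w S C,
      cones = {c. weighted_cone small (Mod_cat v w S C) c \<and>
                  (\<forall>x\<in>Obj (scat S). map_cone (evaluation (Mod_cat v w S C) x) c \<in> cones C)}\<rparr>"

section \<open>Multifunctors and multimodels\<close>

(* m1 M i xs s is M(.., s, ..) with s in position i (counted from 0) and the other arguments
   given by xs, where xs ! i must be the domain of s; similarly for m2.  mx M i j xs s t, for
   i < j, is the interchange cell M(s, t), where xs ! i and xs ! j are the domains of s and t.
   For an empty list of sources only m0 M [] is meaningful. *)
record ('o, 'a, 't, 'p, 'b, 's) mfun =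
  m0 :: "'o list \<Rightarrow> 'p"
  m1 :: "nat \<Rightarrow> 'o list \<Rightarrow> 'a \<Rightarrow> 'b"
  m2 :: "nat \<Rightarrow> 'o list \<Rightarrow> 't \<Rightarrow> 's"
  mx :: "nat \<Rightarrow> nat \<Rightarrow> 'o list \<Rightarrow> 'a \<Rightarrow> 'a \<Rightarrow> 's"

definition tuples :: "('o, 'a, 't) fcat list \<Rightarrow> 'o list set" where
  "tuples Ss = {xs. length xs = length Ss \<and> (\<forall>i<length Ss. xs ! i \<in> Obj (Ss ! i))}"

definition arr_at :: "('o, 'a, 't) fcat list \<Rightarrow> nat \<Rightarrow> 'o list \<Rightarrow> 'a \<Rightarrow> bool" where
  "arr_at Ss i xs s \<longleftrightarrow>
     i < length Ss \<and> xs \<in> tuples Ss \<and> s \<in> Arr (Ss ! i) \<and> Dom (Ss ! i) s = xs ! i"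

definition cell_at :: "('o, 'a, 't) fcat list \<Rightarrow> nat \<Rightarrow> 'o list \<Rightarrow> 't \<Rightarrow> bool" where
  "cell_at Ss i xs \<alpha> \<longleftrightarrow>
     i < length Ss \<and> xs \<in> tuples Ss \<and> \<alpha> \<in> Cell (Ss ! i) \<and> Dom (Ss ! i) (Src (Ss ! i) \<alpha>) = xs ! i"

definition mfun_restrict :: "('o, 'a, 't) fcat list \<Rightarrow> ('o, 'a, 't, 'p, 'b, 's) mfun \<Rightarrow>
    ('o, 'a, 't, 'p, 'b, 's) mfun" where
  "mfun_restrict Ss M =
     \<lparr>m0 = (\<lambda>xs. if xs \<in> tuples Ss then m0 M xs else undefined),
      m1 = (\<lambda>i xs s. if arr_at Ss i xs s then m1 M i xs s else undefined),
      m2 = (\<lambda>i xs \<alpha>. if cell_at Ss i xs \<alpha> then m2 M i xs \<alpha> else undefined),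
      mx = (\<lambda>i j xs s t. if i < j \<and> arr_at Ss i xs s \<and> arr_at Ss j xs t
                          then mx M i j xs s t else undefined)\<rparr>"

(* M(x_1, .., -_i, .., x_n); the entry xs ! i is irrelevant. *)
definition slice :: "('o, 'a, 't) fcat list \<Rightarrow> ('o, 'a, 't, 'p, 'b, 's) mfun \<Rightarrow> nat \<Rightarrow>
    'o list \<Rightarrow> ('o, 'a, 't, 'p, 'b, 's) ffun" where
  "slice Ss M i xs =
     \<lparr>F0 = (\<lambda>x\<in>Obj (Ss ! i). m0 M (xs[i := x])),
      F1 = (\<lambda>s\<in>Arr (Ss ! i). m1 M i (xs[i := Dom (Ss ! i) s]) s),
      F2 = (\<lambda>\<alpha>\<in>Cell (Ss ! i). m2 M i (xs[i := Dom (Ss ! i) (Src (Ss ! i) \<alpha>)]) \<alpha>)\<rparr>"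

(* M(s, -_j) for s in position i < j *)
definition slice_right :: "('o, 'a, 't) fcat list \<Rightarrow> ('o, 'a, 't, 'p, 'b, 's) mfun \<Rightarrow> nat \<Rightarrow> nat \<Rightarrow>
    'o list \<Rightarrow> 'a \<Rightarrow> ('o, 'a, 't, 'p, 'b, 's) wtrans" where
  "slice_right Ss M i j xs s =
     \<lparr>tsrc = slice Ss M j xs,
      ttgt = slice Ss M j (xs[i := Cod (Ss ! i) s]),
      tob = (\<lambda>y\<in>Obj (Ss ! j). m1 M i (xs[j := y]) s),
      tcell = (\<lambda>t\<in>Arr (Ss ! j). mx M i j (xs[j := Dom (Ss ! j) t]) s t)\<rparr>"

(* M(-_i, t) for t in position j > i *)
definition slice_left :: "('o, 'a, 't) fcat list \<Rightarrow> ('p, 'b, 's) fcat \<Rightarrow> weakness \<Rightarrow>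
    ('o, 'a, 't, 'p, 'b, 's) mfun \<Rightarrow> nat \<Rightarrow> nat \<Rightarrow> 'o list \<Rightarrow> 'a \<Rightarrow>
    ('o, 'a, 't, 'p, 'b, 's) wtrans" where
  "slice_left Ss C w M i j xs t =
     \<lparr>tsrc = slice Ss M i xs,
      ttgt = slice Ss M i (xs[j := Cod (Ss ! j) t]),
      tob = (\<lambda>x\<in>Obj (Ss ! i). m1 M j (xs[i := x]) t),
      tcell = (\<lambda>s\<in>Arr (Ss ! i). reflect C w (mx M i j (xs[i := Dom (Ss ! i) s]) s t))\<rparr>"

(* The two pastings of the six faces of the cube spanned by s, t, u in positions i < j < k,
   in the orientation "first s, then t, then u" => "first u, then t, then s"
   (reversed when w = Colax). *)
definition cubical :: "('o, 'a, 't) fcat list \<Rightarrow> ('p, 'b, 's) fcat \<Rightarrow> weakness \<Rightarrow>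
    ('o, 'a, 't, 'p, 'b, 's) mfun \<Rightarrow> nat \<Rightarrow> nat \<Rightarrow> nat \<Rightarrow> 'o list \<Rightarrow> 'a \<Rightarrow> 'a \<Rightarrow> 'a \<Rightarrow> bool" where
  "cubical Ss C w M i j k xs s t u \<longleftrightarrow>
     (let xi = xs[i := Cod (Ss ! i) s]; xj = xs[j := Cod (Ss ! j) t]; xk = xs[k := Cod (Ss ! k) u];
          xij = xi[j := Cod (Ss ! j) t]; xik = xi[k := Cod (Ss ! k) u];
          xjk = xj[k := Cod (Ss ! k) u]
      in vseq C w
           (whisker_left C (m1 M k xij u) (mx M i j xs s t))
           (vseq C w
             (whisker_right C (mx M i k xj s u) (m1 M j xs t))
             (whisker_left C (m1 M i xjk s) (mx M j k xs t u))) =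
         vseq C w
           (whisker_right C (mx M j k xi t u) (m1 M i xs s))
           (vseq C w
             (whisker_left C (m1 M j xik t) (mx M i k xs s u))
             (whisker_right C (mx M i j xk s t) (m1 M k xs u))))"

definition multifunctor :: "weakness \<Rightarrow> weakness \<Rightarrow> ('o, 'a, 't) fcat list \<Rightarrow>
    ('p, 'b, 's) fcat \<Rightarrow> ('o, 'a, 't, 'p, 'b, 's) mfun \<Rightarrow> bool" where
  "multifunctor v w Ss C M \<longleftrightarrow>
     mfun_restrict Ss M = M \<and>
     (\<forall>xs\<in>tuples Ss. m0 M xs \<in> Obj C) \<and>
     (\<forall>i<length Ss. \<forall>xs\<in>tuples Ss. ffunctor (Ss ! i) C (slice Ss M i xs)) \<and>
     (\<forall>i j xs s t. i < j \<and> arr_at Ss i xs s \<and> arr_at Ss j xs t \<longrightarrow>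
        (let f = m1 M i xs s; g = m1 M j xs t;
             h = m1 M j (xs[i := Cod (Ss ! i) s]) t; k = m1 M i (xs[j := Cod (Ss ! j) t]) s
         in wcell C w f g h k (mx M i j xs s t) \<and>
            (s \<in> Tight (Ss ! i) \<or> t \<in> Tight (Ss ! j) \<longrightarrow>
               wcell_at C v w f g h k (mx M i j xs s t)))) \<and>
     (\<forall>i j xs s. i < j \<and> j < length Ss \<and> arr_at Ss i xs s \<longrightarrow>
        wnatural (Ss ! j) C w (slice_right Ss M i j xs s)) \<and>
     (\<forall>i j xs t. i < j \<and> arr_at Ss j xs t \<longrightarrow>
        wnatural (Ss ! i) C (dual w) (slice_left Ss C w M i j xs t)) \<and>
     (\<forall>i j k xs s t u. i < j \<and> j < k \<and> arr_at Ss i xs s \<and> arr_at Ss j xs t \<and> arr_at Ss k xs u \<longrightarrow>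
        cubical Ss C w M i j k xs s t u)"

definition multimodel :: "weakness \<Rightarrow> weakness \<Rightarrow> ('u, 'o, 'a, 't) sketch list \<Rightarrow>
    ('u, 'p, 'b, 's) sketch \<Rightarrow> ('o, 'a, 't, 'p, 'b, 's) mfun \<Rightarrow> bool" where
  "multimodel v w Ss C M \<longleftrightarrow>
     multifunctor v w (map scat Ss) (scat C) M \<and>
     (\<forall>i<length Ss. \<forall>xs\<in>tuples (map scat Ss). model (Ss ! i) C (slice (map scat Ss) M i xs))"

definition mfun_id :: "('o, 'a, 't) fcat \<Rightarrow> ('o, 'a, 't, 'o, 'a, 't) mfun" where
  "mfun_id S = mfun_restrict [S]
     \<lparr>m0 = hd, m1 = (\<lambda>i xs s. s), m2 = (\<lambda>i xs \<alpha>. \<alpha>), mx = (\<lambda>i j xs s t. undefined)\<rparr>"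

(* blocks ns xs cuts xs into consecutive blocks of lengths ns; locate ns p = (k, i) when the
   p-th entry of xs is the i-th entry of the k-th block. *)
fun blocks :: "nat list \<Rightarrow> 'x list \<Rightarrow> 'x list list" where
  "blocks [] xs = []"
| "blocks (n # ns) xs = take n xs # blocks ns (drop n xs)"

fun locate :: "nat list \<Rightarrow> nat \<Rightarrow> nat \<times> nat" where
  "locate [] p = (0, p)"
| "locate (n # ns) p = (if p < n then (0, p) else apfst Suc (locate ns (p - n)))"

(* The substitution M(N_1, .., N_m), where N_k has sources Sss ! k.  The interchange cell of two
   arguments in the same block is the image under M of the one of N_k, and that of arguments in
   different blocks is the one of M. *)
definition mfun_subst :: "('o, 'a, 't) fcat list list \<Rightarrow>
    ('p, 'b, 's, 'q, 'c, 'r) mfun \<Rightarrow> ('o, 'a, 't, 'p, 'b, 's) mfun list \<Rightarrow>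
    ('o, 'a, 't, 'q, 'c, 'r) mfun" where
  "mfun_subst Sss M Ns =
     (let ns = map length Sss;
          B = blocks ns;
          ys = (\<lambda>xs. map2 m0 Ns (B xs));
          arr = (\<lambda>p xs s. let (k, i) = locate ns p in m1 (Ns ! k) i (B xs ! k) s)
      in mfun_restrict (concat Sss)
        \<lparr>m0 = (\<lambda>xs. m0 M (ys xs)),
         m1 = (\<lambda>p xs s. m1 M (fst (locate ns p)) (ys xs) (arr p xs s)),
         m2 = (\<lambda>p xs \<alpha>. let (k, i) = locate ns p in m2 M k (ys xs) (m2 (Ns ! k) i (B xs ! k) \<alpha>)),
         mx = (\<lambda>p q xs s t. let (k, i) = locate ns p; (l, j) = locate ns q in
                 if k = l then m2 M k (ys xs) (mx (Ns ! k) i j (B xs ! k) s t)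
                 else mx M k l (ys xs) (arr p xs s) (arr q xs t))\<rparr>)"

section \<open>Multicategories and closedness\<close>

(* mc_comp M Xss Ys Z g fs is the composite of g : Ys -> Z with fs ! k : Xss ! k -> Ys ! k. *)
record ('x, 'm) multicat =
  mc_ob :: "'x set"
  mc_hom :: "'x list \<Rightarrow> 'x \<Rightarrow> 'm set"
  mc_id :: "'x \<Rightarrow> 'm"
  mc_comp :: "'x list list \<Rightarrow> 'x list \<Rightarrow> 'x \<Rightarrow> 'm \<Rightarrow> 'm list \<Rightarrow> 'm"

definition FSK :: "('u set \<Rightarrow> bool) \<Rightarrow> weakness \<Rightarrow> weakness \<Rightarrow>
    ('u sk, ('u, 'u, 'u, 'u, 'u, 'u) mfun) multicat" where
  "FSK small v w =
     \<lparr>mc_ob = {S. small_sketch small S},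
      mc_hom = (\<lambda>Ss C. {M. multimodel v w Ss C M}),
      mc_id = (\<lambda>S. mfun_id (scat S)),
      mc_comp = (\<lambda>Sss Ts C M Ns. mfun_subst (map (map scat) Sss) M Ns)\<rparr>"

(* fs is a family of multimorphisms fs ! k : Vss ! k -> Ys ! k. *)
definition mc_family :: "('x, 'm) multicat \<Rightarrow> 'x list list \<Rightarrow> 'x list \<Rightarrow> 'm list \<Rightarrow> bool" where
  "mc_family M Vss Ys fs \<longleftrightarrow>
     length Vss = length Ys \<and> length fs = length Ys \<and>
     (\<forall>k<length Ys. set (Vss ! k) \<subseteq> mc_ob M \<and> fs ! k \<in> mc_hom M (Vss ! k) (Ys ! k))"

(* Left homs H X Z for the pairs (X, Z) in D: bijections
     \<theta> : M(X, Y_1, .., Y_n; Z) -> M(Y_1, .., Y_n; H X Z)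
   natural in the Y_i (along arbitrary multimorphisms), in X and in Z.  The action h of H on
   morphisms in X and in Z is determined by naturality, and so is only asserted to exist. *)
definition left_closed_on ::
  "('x, 'm) multicat \<Rightarrow> ('x \<times> 'x) set \<Rightarrow> ('x \<Rightarrow> 'x \<Rightarrow> 'x) \<Rightarrow> bool" where
  "left_closed_on M D H \<longleftrightarrow>
     (\<forall>(X, Z)\<in>D. X \<in> mc_ob M \<and> Z \<in> mc_ob M \<and> H X Z \<in> mc_ob M) \<and>
     (\<exists>\<theta>.
       (\<forall>(X, Z)\<in>D. \<forall>Ys. set Ys \<subseteq> mc_ob M \<longrightarrow>
          bij_betw (\<theta> X Z Ys) (mc_hom M (X # Ys) Z) (mc_hom M Ys (H X Z))) \<and>
       (\<forall>(X, Z)\<in>D. \<forall>Ys Vss fs. set Ys \<subseteq> mc_ob M \<and> mc_family M Vss Ys fs \<longrightarrow>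
          (\<forall>g\<in>mc_hom M (X # Ys) Z.
             \<theta> X Z (concat Vss) (mc_comp M ([X] # Vss) (X # Ys) Z g (mc_id M X # fs)) =
             mc_comp M Vss Ys (H X Z) (\<theta> X Z Ys g) fs)) \<and>
       (\<forall>X X' Z. (X, Z) \<in> D \<and> (X', Z) \<in> D \<longrightarrow>
          (\<forall>f\<in>mc_hom M [X'] X. \<exists>h\<in>mc_hom M [H X Z] (H X' Z).
             \<forall>Ys. set Ys \<subseteq> mc_ob M \<longrightarrow> (\<forall>g\<in>mc_hom M (X # Ys) Z.
               \<theta> X' Z Ys (mc_comp M ([X'] # map (\<lambda>Y. [Y]) Ys) (X # Ys) Z g
                             (f # map (mc_id M) Ys)) =
               mc_comp M [Ys] [H X Z] (H X' Z) h [\<theta> X Z Ys g]))) \<and>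
       (\<forall>X Z Z'. (X, Z) \<in> D \<and> (X, Z') \<in> D \<longrightarrow>
          (\<forall>f\<in>mc_hom M [Z] Z'. \<exists>h\<in>mc_hom M [H X Z] (H X Z').
             \<forall>Ys. set Ys \<subseteq> mc_ob M \<longrightarrow> (\<forall>g\<in>mc_hom M (X # Ys) Z.
               \<theta> X Z' Ys (mc_comp M [X # Ys] [Z] Z' f [g]) =
               mc_comp M [Ys] [H X Z] (H X Z') h [\<theta> X Z Ys g]))))"

definition right_closed_on ::
  "('x, 'm) multicat \<Rightarrow> ('x \<times> 'x) set \<Rightarrow> ('x \<Rightarrow> 'x \<Rightarrow> 'x) \<Rightarrow> bool" where
  "right_closed_on M D H \<longleftrightarrow>
     (\<forall>(Y, Z)\<in>D. Y \<in> mc_ob M \<and> Z \<in> mc_ob M \<and> H Y Z \<in> mc_ob M) \<and>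
     (\<exists>\<theta>.
       (\<forall>(Y, Z)\<in>D. \<forall>Xs. set Xs \<subseteq> mc_ob M \<longrightarrow>
          bij_betw (\<theta> Y Z Xs) (mc_hom M (Xs @ [Y]) Z) (mc_hom M Xs (H Y Z))) \<and>
       (\<forall>(Y, Z)\<in>D. \<forall>Xs Vss fs. set Xs \<subseteq> mc_ob M \<and> mc_family M Vss Xs fs \<longrightarrow>
          (\<forall>g\<in>mc_hom M (Xs @ [Y]) Z.
             \<theta> Y Z (concat Vss) (mc_comp M (Vss @ [[Y]]) (Xs @ [Y]) Z g (fs @ [mc_id M Y])) =
             mc_comp M Vss Xs (H Y Z) (\<theta> Y Z Xs g) fs)) \<and>
       (\<forall>Y Y' Z. (Y, Z) \<in> D \<and> (Y', Z) \<in> D \<longrightarrow>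
          (\<forall>f\<in>mc_hom M [Y'] Y. \<exists>h\<in>mc_hom M [H Y Z] (H Y' Z).
             \<forall>Xs. set Xs \<subseteq> mc_ob M \<longrightarrow> (\<forall>g\<in>mc_hom M (Xs @ [Y]) Z.
               \<theta> Y' Z Xs (mc_comp M (map (\<lambda>X. [X]) Xs @ [[Y']]) (Xs @ [Y]) Z g
                             (map (mc_id M) Xs @ [f])) =
               mc_comp M [Xs] [H Y Z] (H Y' Z) h [\<theta> Y Z Xs g]))) \<and>
       (\<forall>Y Z Z'. (Y, Z) \<in> D \<and> (Y, Z') \<in> D \<longrightarrow>
          (\<forall>f\<in>mc_hom M [Z] Z'. \<exists>h\<in>mc_hom M [H Y Z] (H Y Z').
             \<forall>Xs. set Xs \<subseteq> mc_ob M \<longrightarrow> (\<forall>g\<in>mc_hom M (Xs @ [Y]) Z.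
               \<theta> Y Z' Xs (mc_comp M [Xs @ [Y]] [Z] Z' f [g]) =
               mc_comp M [Xs] [H Y Z] (H Y Z') h [\<theta> Y Z Xs g]))))"

definition left_closed :: "('x, 'm) multicat \<Rightarrow> ('x \<Rightarrow> 'x \<Rightarrow> 'x) \<Rightarrow> bool" where
  "left_closed M H \<longleftrightarrow> left_closed_on M (mc_ob M \<times> mc_ob M) H"

definition right_closed :: "('x, 'm) multicat \<Rightarrow> ('x \<Rightarrow> 'x \<Rightarrow> 'x) \<Rightarrow> bool" where
  "right_closed M H \<longleftrightarrow> right_closed_on M (mc_ob M \<times> mc_ob M) H"

(* The cells of Mod_sketch small v w X Z are functors, transformations and modifications, whereas
   those of an object of FSK are elements of 'u: the homs of FSK are copies of the Mod sketches. *)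
definition Mod_homs :: "('u set \<Rightarrow> bool) \<Rightarrow> weakness \<Rightarrow> weakness \<Rightarrow> ('u sk \<times> 'u sk) set \<Rightarrow>
    ('u sk \<Rightarrow> 'u sk \<Rightarrow> 'u sk) \<Rightarrow> bool" where
  "Mod_homs small v w D H \<longleftrightarrow>
     (\<forall>(X, Z)\<in>D. small_sketch small X \<and> small_sketch small Z \<and> small_sketch small (H X Z) \<and>
                  sketch_iso (H X Z) (Mod_sketch small v w X Z))"

end

(* Right closedness is currying in the last variable: for xs fixed, M(xs, -) is a model of Y, the
   functoriality of M in the first variables together with the cells M(s, -) gives w-natural
   transformations, and the remaining cells M(s, t) are modifications, the modification axiom being
   the cubical condition.  Conversely, every multimodel in Mod(Y, Z) uncurries.  Naturality in Y and Z
   holds because currying turns substitution in the last variable and postcomposition into whiskering.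
   Left closedness follows by reversing the order of the variables, which exchanges (w', w) with the
   dual weaknesses; interchange cells are reflected, i.e. inverted when w is Pseudo. *)
theory Submission
  imports Defs
begin

section \<open>Whiskering, interchange and invertible 2-cells\<close>

section \<open>Calculus in a 2-category\<close>

text \<open>Two devices keep the case analysis small. Each weakness is brought to the lax direction
  by reversing 2-cells (\<open>ori\<close>); what is left of it is a condition on the cell alone
  (\<open>strong\<close>), so one set of equations covers all four. And a 2-cell of a functor
  F-category is determined by its end transformations and its components, so an equation for the
  curried multifunctor splits into a typing check (\<open>parallel\<close>) and the original
  equation at each object of the last source. Strengths are componentwise as well, because pointwise
  inverses of a modification form a modification. Specified cones of the hom sketch are those
  detected by evaluations, so being a model in an earlier variable passes through currying both
  ways. The homs are only isomorphic copies of the Mod sketches; the bijection is currying followed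
  by a chosen isomorphism. All naturality conditions come from one identity that substitutes in the
  first variables, restricts along a functor in the last and postcomposes with another functor. The
  universe bounds functors, transformations and modifications, so that small copies exist.\<close>

lemma categoryI:
	assumes "!!f. f : c_ar C ==> c_dom C f : c_ob C" "!!f. f : c_ar C ==> c_cod C f : c_ob C"
		and "!!x. x : c_ob C ==> c_id C x : c_ar C"
		and "!!x. x : c_ob C ==> c_dom C (c_id C x) = x" "!!x. x : c_ob C ==> c_cod C (c_id C x) = x"
		and "!!f g. [|f : c_ar C; g : c_ar C; c_dom C g = c_cod C f|] ==> c_comp C g f : c_ar C"
		and "!!f g. [|f : c_ar C; g : c_ar C; c_dom C g = c_cod C f|] ==> c_dom C (c_comp C g f) = c_dom C f"
		and "!!f g. [|f : c_ar C; g : c_ar C; c_dom C g = c_cod C f|] ==> c_cod C (c_comp C g f) = c_cod C g"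
		and "!!f. f : c_ar C ==> c_comp C f (c_id C (c_dom C f)) = f"
		and "!!f. f : c_ar C ==> c_comp C (c_id C (c_cod C f)) f = f"
		and "!!f g h. [|f : c_ar C; g : c_ar C; h : c_ar C; c_dom C g = c_cod C f; c_dom C h = c_cod C g|]
			==> c_comp C h (c_comp C g f) = c_comp C (c_comp C h g) f"
	shows "category C"
	unfolding category_def by (intro conjI ballI impI; (elim conjE)?; rule assms; assumption)

text \<open>Unpacked once, so that the arrow, vertical and horizontal categories of a 2-category all
  yield their rules by instantiation.\<close>

lemma
	assumes "category C"
	shows c_dom_ob: "f : c_ar C ==> c_dom C f : c_ob C"
		and c_cod_ob: "f : c_ar C ==> c_cod C f : c_ob C"
		and c_id_ar: "x : c_ob C ==> c_id C x : c_ar C"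
		and c_dom_id: "x : c_ob C ==> c_dom C (c_id C x) = x"
		and c_cod_id: "x : c_ob C ==> c_cod C (c_id C x) = x"
		and c_comp_ar: "f : c_ar C ==> g : c_ar C ==> c_dom C g = c_cod C f ==> c_comp C g f : c_ar C"
		and c_dom_comp: "f : c_ar C ==> g : c_ar C ==> c_dom C g = c_cod C f ==> c_dom C (c_comp C g f) = c_dom C f"
		and c_cod_comp: "f : c_ar C ==> g : c_ar C ==> c_dom C g = c_cod C f ==> c_cod C (c_comp C g f) = c_cod C g"
		and c_comp_id: "f : c_ar C ==> c_comp C f (c_id C (c_dom C f)) = f"
		and c_id_comp: "f : c_ar C ==> c_comp C (c_id C (c_cod C f)) f = f"
		and c_assoc: "f : c_ar C ==> g : c_ar C ==> h : c_ar C ==> c_dom C g = c_cod C f ==>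
			c_dom C h = c_cod C g ==> c_comp C (c_comp C h g) f = c_comp C h (c_comp C g f)"
	using assms unfolding category_def by (simp_all (no_asm_simp))

lemmas category_rules = c_dom_ob c_cod_ob c_id_ar c_dom_id c_cod_id c_comp_ar c_dom_comp c_cod_comp
	c_comp_id c_id_comp c_assoc

locale twocat =
	fixes C :: "('o, 'a, 't) fcat"
	assumes two_category: "two_category C"
begin

abbreviation wl where "wl \<equiv> whisker_left C"
abbreviation wr where "wr \<equiv> whisker_right C"

lemma
	shows Dom_ob [simp]: "f : Arr C ==> Dom C f : Obj C"
		and Cod_ob [simp]: "f : Arr C ==> Cod C f : Obj C"
		and Idn_arr [simp]: "x : Obj C ==> Idn C x : Arr C"
		and Dom_Idn [simp]: "x : Obj C ==> Dom C (Idn C x) = x"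
		and Cod_Idn [simp]: "x : Obj C ==> Cod C (Idn C x) = x"
		and Cmp_arr [simp]: "f : Arr C ==> g : Arr C ==> Dom C g = Cod C f ==> Cmp C g f : Arr C"
		and Dom_Cmp [simp]: "f : Arr C ==> g : Arr C ==> Dom C g = Cod C f ==> Dom C (Cmp C g f) = Dom C f"
		and Cod_Cmp [simp]: "f : Arr C ==> g : Arr C ==> Dom C g = Cod C f ==> Cod C (Cmp C g f) = Cod C g"
		and Cmp_Idn [simp]: "f : Arr C ==> Dom C f = x ==> Cmp C f (Idn C x) = f"
		and Idn_Cmp [simp]: "f : Arr C ==> Cod C f = x ==> Cmp C (Idn C x) f = f"
		and Cmp_assoc [simp]: "f : Arr C ==> g : Arr C ==> h : Arr C ==> Dom C g = Cod C f ==>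
			Dom C h = Cod C g ==> Cmp C (Cmp C h g) f = Cmp C h (Cmp C g f)"
	using category_rules[of "arrow_cat C"] two_category by (auto simp: two_category_def arrow_cat_def)

lemma
	shows Src_arr [simp]: "al : Cell C ==> Src C al : Arr C"
		and Tgt_arr [simp]: "al : Cell C ==> Tgt C al : Arr C"
		and VId_cell [simp]: "f : Arr C ==> VId C f : Cell C"
		and Src_VId [simp]: "f : Arr C ==> Src C (VId C f) = f"
		and Tgt_VId [simp]: "f : Arr C ==> Tgt C (VId C f) = f"
		and VCmp_cell [simp]: "al : Cell C ==> be : Cell C ==> Src C be = Tgt C al ==> VCmp C be al : Cell C"
		and Src_VCmp [simp]: "al : Cell C ==> be : Cell C ==> Src C be = Tgt C al ==> Src C (VCmp C be al) = Src C al"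
		and Tgt_VCmp [simp]: "al : Cell C ==> be : Cell C ==> Src C be = Tgt C al ==> Tgt C (VCmp C be al) = Tgt C be"
		and VCmp_VId [simp]: "al : Cell C ==> Src C al = f ==> VCmp C al (VId C f) = al"
		and VId_VCmp [simp]: "al : Cell C ==> Tgt C al = f ==> VCmp C (VId C f) al = al"
		and VCmp_assoc [simp]: "al : Cell C ==> be : Cell C ==> \<gamma> : Cell C ==> Src C be = Tgt C al ==>
			Src C \<gamma> = Tgt C be ==> VCmp C (VCmp C \<gamma> be) al = VCmp C \<gamma> (VCmp C be al)"
	using category_rules[of "vertical_cat C"] two_category by (auto simp: two_category_def vertical_cat_def)

lemma
	shows Dom_Tgt [simp]: "al : Cell C ==> Dom C (Tgt C al) = Dom C (Src C al)"
		and Cod_Tgt [simp]: "al : Cell C ==> Cod C (Tgt C al) = Cod C (Src C al)"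
		and HCmp_cell [simp]: "al : Cell C ==> be : Cell C ==> Dom C (Src C be) = Cod C (Src C al) ==>
			HCmp C be al : Cell C"
		and Src_HCmp [simp]: "al : Cell C ==> be : Cell C ==> Dom C (Src C be) = Cod C (Src C al) ==>
			Src C (HCmp C be al) = Cmp C (Src C be) (Src C al)"
		and Tgt_HCmp [simp]: "al : Cell C ==> be : Cell C ==> Dom C (Src C be) = Cod C (Src C al) ==>
			Tgt C (HCmp C be al) = Cmp C (Tgt C be) (Tgt C al)"
		and HCmp_Idn [simp]: "al : Cell C ==> Dom C (Src C al) = x ==> HCmp C al (VId C (Idn C x)) = al"
		and Idn_HCmp [simp]: "al : Cell C ==> Cod C (Src C al) = x ==> HCmp C (VId C (Idn C x)) al = al"
		and HCmp_VId: "f : Arr C ==> g : Arr C ==> Dom C g = Cod C f ==>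
			HCmp C (VId C g) (VId C f) = VId C (Cmp C g f)"
		and interchange: "al : Cell C ==> al' : Cell C ==> be : Cell C ==> be' : Cell C ==>
			Src C al' = Tgt C al ==> Src C be' = Tgt C be ==> Dom C (Src C be) = Cod C (Src C al) ==>
			HCmp C (VCmp C be' be) (VCmp C al' al) = VCmp C (HCmp C be' al') (HCmp C be al)"
	using category_rules[of "horizontal_cat C"] two_category by (simp_all add: two_category_def horizontal_cat_def, blast+)

lemma HCmp_assoc: "al : Cell C ==> be : Cell C ==> \<gamma> : Cell C ==>
			Dom C (Src C be) = Cod C (Src C al) ==> Dom C (Src C \<gamma>) = Cod C (Src C be) ==>
			HCmp C (HCmp C \<gamma> be) al = HCmp C \<gamma> (HCmp C be al)"
	using category_rules(11)[of "horizontal_cat C"] two_category by (simp add: two_category_def horizontal_cat_def)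

lemma
	assumes "al : Cell C" "g : Arr C" "Dom C g = Cod C (Src C al)"
	shows wl_cell [simp]: "wl g al : Cell C"
		and Src_wl [simp]: "Src C (wl g al) = Cmp C g (Src C al)"
		and Tgt_wl [simp]: "Tgt C (wl g al) = Cmp C g (Tgt C al)"
	using assms by (simp_all add: whisker_left_def)

lemma
	assumes "al : Cell C" "f : Arr C" "Dom C (Src C al) = Cod C f"
	shows wr_cell [simp]: "wr al f : Cell C"
		and Src_wr [simp]: "Src C (wr al f) = Cmp C (Src C al) f"
		and Tgt_wr [simp]: "Tgt C (wr al f) = Cmp C (Tgt C al) f"
	using assms by (simp_all add: whisker_right_def)

lemma
	assumes "f : Arr C" "g : Arr C" "Dom C g = Cod C f"
	shows wl_VId [simp]: "wl g (VId C f) = VId C (Cmp C g f)"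
		and wr_VId [simp]: "wr (VId C g) f = VId C (Cmp C g f)"
	using assms by (simp_all add: whisker_right_def whisker_left_def HCmp_VId)

lemma wl_Idn [simp]: "al : Cell C ==> Cod C (Src C al) = x ==> wl (Idn C x) al = al"
	by (simp add: whisker_left_def)

lemma wr_Idn [simp]: "al : Cell C ==> Dom C (Src C al) = x ==> wr al (Idn C x) = al"
	by (simp add: whisker_right_def)

text \<open>Interchange with the identity 2-cell of \<open>g\<close>, which is its own vertical
  composite with itself.\<close>

lemma wl_VCmp:
	assumes "al : Cell C" "be : Cell C" "g : Arr C" "Src C be = Tgt C al" "Dom C g = Cod C (Src C al)"
	shows "wl g (VCmp C be al) = VCmp C (wl g be) (wl g al)"
	using interchange[of al be "VId C g" "VId C g"] assms by (simp add: whisker_left_def)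

lemma wr_VCmp:
	assumes "al : Cell C" "be : Cell C" "f : Arr C" "Src C be = Tgt C al" "Dom C (Src C al) = Cod C f"
	shows "wr (VCmp C be al) f = VCmp C (wr be f) (wr al f)"
	using interchange[of "VId C f" "VId C f" al be] assms by (simp add: whisker_right_def)

lemma wl_Cmp:
	assumes "al : Cell C" "g : Arr C" "h : Arr C" "Dom C h = Cod C g" "Dom C g = Cod C (Src C al)"
	shows "wl (Cmp C h g) al = wl h (wl g al)"
	using assms by (simp add: whisker_left_def HCmp_assoc flip: HCmp_VId)

lemma wr_Cmp:
	assumes "al : Cell C" "g : Arr C" "h : Arr C" "Dom C h = Cod C g" "Cod C h = Dom C (Src C al)"
	shows "wr al (Cmp C h g) = wr (wr al h) g"
	using assms by (simp add: whisker_right_def HCmp_assoc flip: HCmp_VId)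

lemma wr_wl:
	assumes "al : Cell C" "f : Arr C" "g : Arr C" "Dom C g = Cod C (Src C al)" "Cod C f = Dom C (Src C al)"
	shows "wr (wl g al) f = wl g (wr al f)"
	using assms by (simp add: whisker_left_def whisker_right_def HCmp_assoc)

lemma HCmp_wl_wr:
	assumes "al : Cell C" "be : Cell C" "Dom C (Src C be) = Cod C (Src C al)"
	shows "HCmp C be al = VCmp C (wl (Tgt C be) al) (wr be (Src C al))"
	using interchange[of "VId C (Src C al)" al be "VId C (Tgt C be)"] assms
	by (simp add: whisker_left_def whisker_right_def)

lemma HCmp_wr_wl:
	assumes "al : Cell C" "be : Cell C" "Dom C (Src C be) = Cod C (Src C al)"
	shows "HCmp C be al = VCmp C (wr be (Tgt C al)) (wl (Src C be) al)"
	using interchange[of al "VId C (Tgt C al)" "VId C (Src C be)" be] assms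
	by (simp add: whisker_left_def whisker_right_def)

text \<open>Both sides are the horizontal composite of \<open>be\<close> and \<open>al\<close>,
  decomposed in two orders. The boundaries are separate variables because in applications they agree
  with sources and targets only after simplification.\<close>

lemma exchange:
	assumes "al : Cell C" "be : Cell C" "Dom C (Src C be) = Cod C (Src C al)"
		"Src C be = p" "Tgt C be = q" "Src C al = f" "Tgt C al = g"
	shows "VCmp C (wl q al) (wr be f) = VCmp C (wr be g) (wl p al)"
	using HCmp_wl_wr[OF assms(1-3)] HCmp_wr_wl[OF assms(1-3)] assms(4-) by simp

lemma inverse_unique:
	assumes "inverse_cells C al be" "inverse_cells C al \<gamma>"
	shows "be = \<gamma>"
proof -
	have "be = VCmp C be (VCmp C al \<gamma>)" using assms by (simp add: inverse_cells_def)
	also have "\<dots> = VCmp C (VCmp C be al) \<gamma>" using assms by (subst VCmp_assoc) (simp_all add: inverse_cells_def)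
	also have "\<dots> = \<gamma>" using assms by (simp add: inverse_cells_def)
	finally show ?thesis .
qed

lemma inverse_sym: "inverse_cells C al be ==> inverse_cells C be al"
	by (simp add: inverse_cells_def)

lemma the_inverse [simp]: "inverse_cells C al be ==> (THE \<gamma>. inverse_cells C al \<gamma>) = be"
	using inverse_unique by blast

lemma inverse_VId: "f : Arr C ==> inverse_cells C (VId C f) (VId C f)"
	by (simp add: inverse_cells_def)

lemma inverse_wl:
	assumes "inverse_cells C al be" "g : Arr C" "Dom C g = Cod C (Src C al)"
	shows "inverse_cells C (wl g al) (wl g be)"
proof -
	have "al : Cell C" "Cod C (Tgt C al) = Cod C (Src C al)" using assms by (simp_all add: inverse_cells_def)
	then show ?thesis using assms unfolding inverse_cells_def by (simp flip: wl_VCmp)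
qed

lemma inverse_wr:
	assumes "inverse_cells C al be" "f : Arr C" "Dom C (Src C al) = Cod C f"
	shows "inverse_cells C (wr al f) (wr be f)"
proof -
	have "al : Cell C" "Dom C (Tgt C al) = Dom C (Src C al)" using assms by (simp_all add: inverse_cells_def)
	then show ?thesis using assms unfolding inverse_cells_def by (simp flip: wr_VCmp)
qed

lemma inverse_VCmp:
	assumes "inverse_cells C al al'" "inverse_cells C be be'" "Src C be = Tgt C al"
	shows "inverse_cells C (VCmp C be al) (VCmp C al' be')"
proof -
	have "VCmp C be' (VCmp C be al) = VCmp C (VCmp C be' be) al"
		"VCmp C al (VCmp C al' be') = VCmp C (VCmp C al al') be'"
		using assms by (subst VCmp_assoc; simp add: inverse_cells_def)+
	then show ?thesis using assms by (simp add: inverse_cells_def)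
qed

end

subsection \<open>Strength of cells\<close>

text \<open>The share of the w-cell condition that mentions neither the square nor the direction of
  the cell. It is stable under whiskering and pasting and insensitive to inversion, so it can be
  carried along separately from the boundary.\<close>

definition strong :: "('o, 'a, 't) fcat => weakness => 't => bool" where
	"strong C w al \<longleftrightarrow> (w = Strict --> al : VId C ` Arr C) & (w = Pseudo --> (\<exists>be. inverse_cells C al be))"

context twocat begin

lemma strong_inverse: "al : Cell C ==> strong C w al ==> w = Strict \<or> w = Pseudo ==> \<exists>be. inverse_cells C al be"
	using inverse_VId by (auto simp: strong_def)

text \<open>Inverses are unique and an identity is its own inverse, so inverting never loses
  strength.\<close>

lemma strong_inverse_cells:
	assumes "strong C v al" "inverse_cells C al be"
	shows "strong C v be"
	unfolding strong_def
proof (intro conjI impI)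
	assume "v = Strict"
	then obtain f where f: "f : Arr C" "al = VId C f" using assms(1) by (auto simp: strong_def)
	then show "be : VId C ` Arr C" using inverse_unique[OF assms(2), of "VId C f"] inverse_VId[OF f(1)] by blast
qed (use inverse_sym[OF assms(2)] in blast)

lemma strong_VId [simp]: "f : Arr C ==> strong C w (VId C f)"
	using inverse_VId by (auto simp: strong_def)

lemma strong_wl [simp]:
	"al : Cell C ==> strong C w al ==> g : Arr C ==> Dom C g = Cod C (Src C al) ==> strong C w (wl g al)"
	using inverse_wl by (auto simp: strong_def)

lemma strong_wr [simp]:
	"al : Cell C ==> strong C w al ==> f : Arr C ==> Dom C (Src C al) = Cod C f ==> strong C w (wr al f)"
	using inverse_wr by (auto simp: strong_def)

lemma strong_VCmp [simp]:
	"al : Cell C ==> be : Cell C ==> Src C be = Tgt C al ==> strong C w al ==> strong C w be ==>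
		strong C w (VCmp C be al)"
	by (auto simp: strong_def dest: inverse_VCmp)

end

subsection \<open>Orientation\<close>

text \<open>Reversing the 2-cells of the target turns every weakness into one that points in the lax
	direction, so that the colax case needs no separate treatment.\<close>

definition ori :: "weakness => ('o, 'a, 't) fcat => ('o, 'a, 't) fcat" where
	"ori w C = (if w = Colax then C\<lparr>Src := Tgt C, Tgt := Src C, VCmp := (\<lambda>be al. VCmp C al be)\<rparr> else C)"

lemma ori_simps [simp]:
	"Obj (ori w C) = Obj C" "Arr (ori w C) = Arr C" "Tight (ori w C) = Tight C" "Cell (ori w C) = Cell C"
	"Dom (ori w C) = Dom C" "Cod (ori w C) = Cod C" "Idn (ori w C) = Idn C" "Cmp (ori w C) = Cmp C"
	"VId (ori w C) = VId C" "HCmp (ori w C) = HCmp C"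
	"whisker_left (ori w C) = whisker_left C" "whisker_right (ori w C) = whisker_right C"
	"arrow_cat (ori w C) = arrow_cat C" "ori w (ori w C) = C"
	by (auto simp: ori_def whisker_left_def whisker_right_def arrow_cat_def fun_eq_iff)

lemma ori_Colax:
	"Src (ori Colax C) = Tgt C" "Tgt (ori Colax C) = Src C" "VCmp (ori Colax C) = (\<lambda>be al. VCmp C al be)"
	by (simp_all add: ori_def)

lemma ori_other: "w ~= Colax ==> ori w C = C"
	by (simp add: ori_def)

lemma inverse_cells_ori [simp]: "inverse_cells (ori w C) al be = inverse_cells C al be"
	by (auto simp: inverse_cells_def ori_def)

lemma vseq_ori: "vseq C w al be = VCmp (ori w C) be al"
	by (simp add: vseq_def ori_def)

text \<open>Reversing vertical composition leaves horizontal composition alone, because source and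
  target of a 2-cell lie between the same objects.\<close>

lemma ori_two_category:
	assumes "two_category C" shows "two_category (ori w C)"
proof -
	interpret twocat C by unfold_locales (rule assms)
	have "two_category (ori Colax C)"
		unfolding two_category_def vertical_cat_def horizontal_cat_def ori_simps ori_Colax
	proof (intro conjI)
		show "category (arrow_cat C)" using assms by (simp add: two_category_def)
		show "category \<lparr>c_ob = Arr C, c_ar = Cell C, c_dom = Tgt C, c_cod = Src C, c_id = VId C,
				c_comp = (\<lambda>be al. VCmp C al be)\<rparr>"
			by (rule categoryI) simp_all
		show "category \<lparr>c_ob = Obj C, c_ar = Cell C, c_dom = (\<lambda>al. Dom C (Tgt C al)),
				c_cod = (\<lambda>al. Cod C (Tgt C al)), c_id = (\<lambda>x. VId C (Idn C x)), c_comp = HCmp C\<rparr>"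
			by (rule categoryI) (auto simp: HCmp_assoc)
		show "\<forall>al\<in>Cell C. \<forall>al'\<in>Cell C. \<forall>be\<in>Cell C. \<forall>be'\<in>Cell C.
				Tgt C al' = Src C al & Tgt C be' = Src C be & Dom C (Tgt C be) = Cod C (Tgt C al) -->
				HCmp C (VCmp C be be') (VCmp C al al') = VCmp C (HCmp C be al) (HCmp C be' al')"
		proof (intro ballI impI, elim conjE)
			fix al al' be be'
			assume c: "al : Cell C" "al' : Cell C" "be : Cell C" "be' : Cell C" "Tgt C al' = Src C al"
				"Tgt C be' = Src C be" "Dom C (Tgt C be) = Cod C (Tgt C al)"
			\<comment> \<open>The reversed hypotheses match the cells along their targets, while
			  \<open>interchange\<close> asks for the matching along sources.\<close>
			have "Dom C (Src C be') = Dom C (Src C be)" "Cod C (Src C al') = Cod C (Src C al)"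
				using Dom_Tgt[OF c(4)] Cod_Tgt[OF c(2)] unfolding c(5,6) by simp_all
			moreover have "Dom C (Src C be) = Cod C (Src C al)" using c(7) Dom_Tgt[OF c(3)] Cod_Tgt[OF c(1)] by simp
			ultimately show "HCmp C (VCmp C be be') (VCmp C al al') = VCmp C (HCmp C be al) (HCmp C be' al')"
				by (intro interchange) (simp_all only: c)
		qed
	qed (auto simp: HCmp_VId)
	then show ?thesis using assms by (cases "w = Colax") (simp_all only: ori_other not_False_eq_True)
qed

lemma strong_ori [simp]: "strong (ori u C) w al = strong C w al"
	by (simp add: strong_def)

text \<open>A w-cell is a cell with strength w in the orientation of w.\<close>

lemma wcell_iff:
	assumes "two_category C" "f : Arr C" "h : Arr C" "Dom C h = Cod C f"
	shows "wcell C w f g h k al \<longleftrightarrow> al : Cell C & Src (ori w C) al = Cmp C h f & Tgt (ori w C) al = Cmp C k g &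
		strong C w al"
proof -
	interpret twocat C by unfold_locales (rule assms)
	have a: "Cmp C h f : Arr C" using assms by simp
	show ?thesis
	proof (cases "w = Strict")
		case True
		show ?thesis unfolding True wcell_def strong_def ori_def using a by auto
	next
		case False
		then show ?thesis by (cases w) (auto simp: wcell_def strong_def ori_def)
	qed
qed

text \<open>If \<open>v\<close> and \<open>w\<close> point the same way, the v-cell is the given
  cell itself. Otherwise \<open>v \<preceq> w\<close> leaves only a strict or pseudo
  \<open>v\<close> against \<open>w = Colax\<close>, where the v-cell is the inverse of the given
  one; \<open>strong\<close> does not see the difference.\<close>

lemma wcell_at_iff:
	assumes "two_category C" "f : Arr C" "h : Arr C" "Dom C h = Cod C f" "v \<preceq> w"
	shows "wcell_at C v w f g h k al \<longleftrightarrow> al : Cell C & Src (ori w C) al = Cmp C h f &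
		Tgt (ori w C) al = Cmp C k g & strong C w al & strong C v al"
proof -
	interpret twocat C by unfold_locales (rule assms)
	note wc = wcell_iff[OF assms(1-4)]
	have "strong C v al" if "inverse_cells C al be" "wcell C v f g h k be" for be
		using strong_inverse_cells[OF _ inverse_sym[OF that(1)]] that(2) by (simp add: wcell_iff[OF assms(1-4)])
	moreover have "wcell C v f g h k al \<or> (\<exists>be. inverse_cells C al be & wcell C v f g h k be)"
		if w: "wcell C w f g h k al" and v: "strong C v al"
	proof (cases "ori v C = ori w C")
		case True
		then show ?thesis using w v by (simp add: wcell_iff[OF assms(1-4)])
	next
		case False
		then have *: "w = Colax" "v = Strict \<or> v = Pseudo"
			using assms(5) by (auto simp: weak_le_def ori_def split: if_splits)
		then obtain be where b: "inverse_cells C al be" using strong_inverse v w wc by blast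
		then have "wcell C v f g h k be"
			using w strong_inverse_cells[OF v b] * by (auto simp: wc ori_Colax ori_other inverse_cells_def)
		then show ?thesis using b by blast
	qed
	ultimately show ?thesis unfolding wcell_at_def wc by blast
qed

subsection \<open>2-functors\<close>

lemma ffunctorI:
	assumes "!!x. x : Obj A ==> F0 F x : Obj B" "F0 F : extensional (Obj A)"
		"!!f. f : Arr A ==> F1 F f : Arr B" "F1 F : extensional (Arr A)"
		"!!al. al : Cell A ==> F2 F al : Cell B" "F2 F : extensional (Cell A)"
		"!!f. f : Arr A ==> Dom B (F1 F f) = F0 F (Dom A f)"
		"!!f. f : Arr A ==> Cod B (F1 F f) = F0 F (Cod A f)"
		"!!x. x : Obj A ==> F1 F (Idn A x) = Idn B (F0 F x)"
		"!!f g. [|f : Arr A; g : Arr A; Dom A g = Cod A f|] ==> F1 F (Cmp A g f) = Cmp B (F1 F g) (F1 F f)"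
		"!!al. al : Cell A ==> Src B (F2 F al) = F1 F (Src A al)"
		"!!al. al : Cell A ==> Tgt B (F2 F al) = F1 F (Tgt A al)"
		"!!f. f : Arr A ==> F2 F (VId A f) = VId B (F1 F f)"
		"!!al be. [|al : Cell A; be : Cell A; Src A be = Tgt A al|] ==> F2 F (VCmp A be al) = VCmp B (F2 F be) (F2 F al)"
		"!!al be. [|al : Cell A; be : Cell A; Dom A (Src A be) = Cod A (Src A al)|] ==>
			 F2 F (HCmp A be al) = HCmp B (F2 F be) (F2 F al)"
		"!!f. f : Tight A ==> F1 F f : Tight B"
		and "two_category A"
	shows "ffunctor A B F"
proof -
	interpret A: twocat A by unfold_locales (rule assms)
	show ?thesis
		unfolding ffunctor_def is_functor_def arrow_cat_def vertical_cat_def horizontal_cat_def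
		using assms(1-16) by (simp add: PiE_iff)
qed

locale twofun = A: twocat A + B: twocat B for A :: "('o, 'a, 't) fcat" and B :: "('p, 'b, 's) fcat" +
	fixes F :: "('o, 'a, 't, 'p, 'b, 's) ffun"
	assumes ffunctor: "ffunctor A B F"
begin

lemma
	shows F0_ob [simp]: "x : Obj A ==> F0 F x : Obj B"
		and F1_arr [simp]: "f : Arr A ==> F1 F f : Arr B"
		and F2_cell [simp]: "al : Cell A ==> F2 F al : Cell B"
		and F0_ext: "F0 F : extensional (Obj A)"
		and F1_ext: "F1 F : extensional (Arr A)"
		and F2_ext: "F2 F : extensional (Cell A)"
		and Dom_F1 [simp]: "f : Arr A ==> Dom B (F1 F f) = F0 F (Dom A f)"
		and Cod_F1 [simp]: "f : Arr A ==> Cod B (F1 F f) = F0 F (Cod A f)"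
		and F1_Idn [simp]: "x : Obj A ==> F1 F (Idn A x) = Idn B (F0 F x)"
		and F1_Cmp [simp]: "f : Arr A ==> g : Arr A ==> Dom A g = Cod A f ==> F1 F (Cmp A g f) = Cmp B (F1 F g) (F1 F f)"
		and Src_F2 [simp]: "al : Cell A ==> Src B (F2 F al) = F1 F (Src A al)"
		and Tgt_F2 [simp]: "al : Cell A ==> Tgt B (F2 F al) = F1 F (Tgt A al)"
		and F2_VId [simp]: "f : Arr A ==> F2 F (VId A f) = VId B (F1 F f)"
		and F2_VCmp [simp]: "al : Cell A ==> be : Cell A ==> Src A be = Tgt A al ==> F2 F (VCmp A be al) = VCmp B (F2 F be) (F2 F al)"
		and F2_HCmp [simp]: "al : Cell A ==> be : Cell A ==> Dom A (Src A be) = Cod A (Src A al) ==>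
			 F2 F (HCmp A be al) = HCmp B (F2 F be) (F2 F al)"
		and F1_tight [simp]: "f : Tight A ==> F1 F f : Tight B"
	using ffunctor unfolding ffunctor_def is_functor_def arrow_cat_def vertical_cat_def horizontal_cat_def
	by (simp_all add: PiE_iff)

lemma F2_wl [simp]: "al : Cell A ==> g : Arr A ==> Dom A g = Cod A (Src A al) ==>
		F2 F (whisker_left A g al) = whisker_left B (F1 F g) (F2 F al)"
	by (simp add: whisker_left_def)

lemma F2_wr [simp]: "al : Cell A ==> f : Arr A ==> Dom A (Src A al) = Cod A f ==>
		F2 F (whisker_right A al f) = whisker_right B (F2 F al) (F1 F f)"
	by (simp add: whisker_right_def)

lemma F2_inverse: "inverse_cells A al be ==> inverse_cells B (F2 F al) (F2 F be)"
	unfolding inverse_cells_def by (simp flip: F2_VCmp)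

lemma F2_strong: "al : Cell A ==> strong A w al ==> strong B w (F2 F al)"
	using F2_inverse unfolding strong_def by auto

end

lemma ffunctor_ori:
	assumes "two_category A" "two_category B" "ffunctor A B F"
	shows "ffunctor (ori w A) (ori w B) F"
proof -
	interpret twofun A B F by unfold_locales (use assms in auto)
	have "ffunctor (ori Colax A) (ori Colax B) F"
	proof (rule ffunctorI, unfold ori_simps ori_Colax)
		fix al be assume c: "al : Cell A" "be : Cell A"
		show "F2 F (VCmp A al be) = VCmp B (F2 F al) (F2 F be)" if "Tgt A be = Src A al"
			by (rule F2_VCmp[OF c(2,1) that[symmetric]])
		show "F2 F (HCmp A be al) = HCmp B (F2 F be) (F2 F al)" if "Dom A (Tgt A be) = Cod A (Tgt A al)"
			using c that by (simp add: F2_HCmp)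
	qed (simp_all add: F0_ext F1_ext F2_ext ori_two_category assms)
	then show ?thesis using assms(3) by (cases "w = Colax") (simp_all add: ori_other)
qed

subsection \<open>Reflection of cells\<close>

lemma dual_dual [simp]: "dual (dual w) = w"
	by (cases w) auto

lemma dual_mono: "v \<preceq> w ==> dual v \<preceq> dual w"
	by (cases v; cases w) (auto simp: weak_le_def)

context twocat begin

lemma ori_twocat: "twocat (ori w C)"
	by unfold_locales (rule ori_two_category[OF two_category])

text \<open>On strict cells reflection is the identity, which is inversion there.\<close>

lemma reflect_inverse:
	assumes "al : Cell C" "strong C w al" "w = Strict \<or> w = Pseudo"
	shows "inverse_cells C al (reflect C w al)"
	using assms(3)
proof
	assume w: "w = Strict"
	then obtain f where "f : Arr C" "al = VId C f" using assms(2) by (auto simp: strong_def)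
	then show ?thesis using inverse_VId w by (simp add: reflect_def)
next
	assume w: "w = Pseudo"
	then obtain be where "inverse_cells C al be" using assms strong_inverse by blast
	then show ?thesis using w by (simp add: reflect_def)
qed

lemma reflect_eq:
	assumes "w = Strict \<or> w = Pseudo" "strong C w al" "inverse_cells C al be"
	shows "reflect C w al = be"
proof -
	have "al : Cell C" using assms(3) by (simp add: inverse_cells_def)
	from inverse_unique[OF reflect_inverse[OF this assms(2,1)] assms(3)] show ?thesis .
qed

lemma reflect_other: "\<not> (w = Strict \<or> w = Pseudo) ==> reflect C w al = al"
	by (simp add: reflect_def)

text \<open>A strict or pseudo cell is inverted while its orientation stays; a lax or colax cell
  stays while \<open>dual\<close> turns the orientation. Either way the oriented boundary is turned
  round.\<close>

lemma strong_reflect_aux: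
	assumes "al : Cell C" "strong C w al"
	shows "reflect C w al : Cell C & strong C (dual w) (reflect C w al) &
		Src (ori (dual w) C) (reflect C w al) = Tgt (ori w C) al &
		Tgt (ori (dual w) C) (reflect C w al) = Src (ori w C) al"
proof (cases "w = Strict \<or> w = Pseudo")
	case True
	note inv = reflect_inverse[OF assms True]
	then have "\<exists>be. inverse_cells C (reflect C w al) be" using inverse_sym by blast
	moreover have "w = Strict ==> reflect C w al = al" by (simp add: reflect_def)
	ultimately have "strong C w (reflect C w al)"
		using True assms(2) by (elim disjE) (simp_all add: strong_def)
	moreover have "dual w = w" "w ~= Colax" using True by auto
	ultimately show ?thesis using inv by (simp add: inverse_cells_def ori_other)
next
	case False
	then show ?thesis using assms(1) by (cases w) (simp_all add: reflect_def strong_def ori_Colax ori_other)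
qed

lemma
	assumes "al : Cell C" "strong C w al"
	shows reflect_cell [simp]: "reflect C w al : Cell C"
		and strong_dual_reflect [simp]: "strong C (dual w) (reflect C w al)"
		and Src_reflect [simp]: "Src (ori (dual w) C) (reflect C w al) = Tgt (ori w C) al"
		and Tgt_reflect [simp]: "Tgt (ori (dual w) C) (reflect C w al) = Src (ori w C) al"
	using strong_reflect_aux[OF assms] by auto

lemma Dom_Src_ori: "al : Cell C ==> Dom C (Src (ori w C) al) = Dom C (Src C al)"
	by (cases "w = Colax") (simp_all add: ori_Colax ori_other)

lemma Cod_Src_ori: "al : Cell C ==> Cod C (Src (ori w C) al) = Cod C (Src C al)"
	by (cases "w = Colax") (simp_all add: ori_Colax ori_other)

lemma
	assumes "al : Cell C" "strong C w al"
	shows Dom_Src_reflect: "Dom C (Src C (reflect C w al)) = Dom C (Src C al)"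
		and Cod_Src_reflect: "Cod C (Src C (reflect C w al)) = Cod C (Src C al)"
proof -
	interpret o: twocat "ori w C" by unfold_locales (rule ori_two_category[OF two_category])
	have "Dom C (Src C (reflect C w al)) = Dom C (Tgt (ori w C) al)"
		"Cod C (Src C (reflect C w al)) = Cod C (Tgt (ori w C) al)"
		using Dom_Src_ori[of "reflect C w al" "dual w"] Cod_Src_ori[of "reflect C w al" "dual w"]
		by (simp_all only: reflect_cell[OF assms] Src_reflect[OF assms] simp_thms)
	then show "Dom C (Src C (reflect C w al)) = Dom C (Src C al)" "Cod C (Src C (reflect C w al)) = Cod C (Src C al)"
		using o.Dom_Tgt[of al] o.Cod_Tgt[of al] assms(1) by (simp_all add: Dom_Src_ori Cod_Src_ori)
qed

lemma reflect_VId [simp]: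
	assumes "f : Arr C" shows "reflect C w (VId C f) = VId C f"
proof (cases "w = Strict \<or> w = Pseudo")
	case True
	then show ?thesis by (rule reflect_eq) (simp_all add: assms inverse_VId)
qed (simp add: reflect_other)

lemma reflect_reflect [simp]:
	assumes "al : Cell C" "strong C w al"
	shows "reflect C (dual w) (reflect C w al) = al"
proof (cases "w = Strict \<or> w = Pseudo")
	case True
	then have d: "dual w = w" by auto
	from reflect_eq[OF True strong_dual_reflect[OF assms, unfolded d] inverse_sym[OF reflect_inverse[OF assms True]]]
	show ?thesis unfolding d .
next
	case False
	then show ?thesis by (cases w) (auto simp: reflect_def)
qed

text \<open>When \<open>w\<close> is strict or pseudo, so is \<open>v\<close>, and both reflections
  are the unique inverse. Otherwise reflection does nothing and only the name of the weakness
  changes.\<close>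

lemma strong_strength_reflect:
	assumes "al : Cell C" "strong C w al" "strong C v al" "v \<preceq> w"
	shows "strong C (dual v) (reflect C w al)"
proof (cases "w = Strict \<or> w = Pseudo")
	case True
	have v: "v = Strict \<or> v = Pseudo" using assms(4) True by (auto simp: weak_le_def)
	have "reflect C w al = reflect C v al"
		using inverse_unique[OF reflect_inverse[OF assms(1,2) True] reflect_inverse[OF assms(1,3) v]] .
	then show ?thesis using assms by simp
next
	case False
	then show ?thesis using assms by (cases v) (auto simp: reflect_other strong_def)
qed

lemma reflect_wl:
	assumes "al : Cell C" "strong C w al" "g : Arr C" "Dom C g = Cod C (Src C al)"
	shows "reflect C w (wl g al) = wl g (reflect C w al)"
proof (cases "w = Strict \<or> w = Pseudo")
	case True
	from reflect_eq[OF True strong_wl[OF assms] inverse_wl[OF reflect_inverse[OF assms(1,2) True] assms(3,4)]]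
	show ?thesis .
qed (simp add: reflect_other)

lemma reflect_wr:
	assumes "al : Cell C" "strong C w al" "f : Arr C" "Dom C (Src C al) = Cod C f"
	shows "reflect C w (wr al f) = wr (reflect C w al) f"
proof (cases "w = Strict \<or> w = Pseudo")
	case True
	from reflect_eq[OF True strong_wr[OF assms] inverse_wr[OF reflect_inverse[OF assms(1,2) True] assms(3,4)]]
	show ?thesis .
qed (simp add: reflect_other)

text \<open>Inversion reverses the order of a composite; in the lax and colax cases the reversal is
  that of the orientation.\<close>

lemma reflect_VCmp:
	assumes "al : Cell C" "strong C w al" "be : Cell C" "strong C w be" "Src (ori w C) be = Tgt (ori w C) al"
	shows "reflect C w (VCmp (ori w C) be al) = VCmp (ori (dual w) C) (reflect C w al) (reflect C w be)"
proof (cases "w = Strict \<or> w = Pseudo")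
	case True
	then have o: "ori w C = C" "ori (dual w) C = C" by (auto simp: ori_def)
	have s: "Src C be = Tgt C al" using assms(5) o by simp
	from reflect_eq[OF True strong_VCmp[OF assms(1,3) s assms(2,4)]
		inverse_VCmp[OF reflect_inverse[OF assms(1,2) True] reflect_inverse[OF assms(3,4) True] s]]
	show ?thesis unfolding o .
next
	case False
	then show ?thesis by (cases w) (auto simp: reflect_other ori_Colax ori_other)
qed

text \<open>Cancels \<open>q\<close> on one side and \<open>p\<close> on the other. It serves to
  turn round both compatibility squares and modification squares.\<close>

lemma inverse_square:
	assumes "inverse_cells C p p'" "inverse_cells C q q'" "a : Cell C" "b : Cell C"
		"Src C a = Src C p" "Tgt C a = Src C q" "Src C b = Tgt C p" "Tgt C b = Tgt C q"
		and eq: "VCmp C q a = VCmp C b p"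
	shows "VCmp C q' b = VCmp C a p'"
proof -
	note i = assms(1,2)[unfolded inverse_cells_def]
	have "VCmp C q' b = VCmp C q' (VCmp C b (VCmp C p p'))" using i assms(3-8) by simp
	also have "\<dots> = VCmp C q' (VCmp C (VCmp C b p) p')" using i assms(3-8) by simp
	also have "\<dots> = VCmp C q' (VCmp C q (VCmp C a p'))" using i assms(3-8) by (simp add: eq[symmetric])
	also have "\<dots> = VCmp C (VCmp C q' q) (VCmp C a p')" using i assms(3-8) by (intro VCmp_assoc[symmetric]) simp_all
	also have "\<dots> = VCmp C a p'" using i assms(3-8) by simp
	finally show ?thesis .
qed

text \<open>For inverted cells this is \<open>inverse_square\<close> applied in both directions; for
  lax and colax cells \<open>dual\<close> exchanges the two branches of \<open>compatible\<close>,
  which is the same equation read from the other side.\<close>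

lemma compatible_reflect:
	assumes "p : Cell C" "q : Cell C" "strong C w p" "strong C w q" "a : Cell C" "b : Cell C"
		and "w ~= Colax ==> Src C a = Src C p & Tgt C a = Src C q & Src C b = Tgt C p & Tgt C b = Tgt C q"
	shows "compatible C (dual w) (reflect C w p) (reflect C w q) b a \<longleftrightarrow> compatible C w p q a b"
proof (cases "w = Strict \<or> w = Pseudo")
	case True
	then have d: "dual w = w" "w ~= Colax" by auto
	note i = reflect_inverse[OF assms(1,3) True] reflect_inverse[OF assms(2,4) True]
	have t: "Src C a = Src C p" "Tgt C a = Src C q" "Src C b = Tgt C p" "Tgt C b = Tgt C q" using assms(7) d by auto
	have t': "Src C b = Src C (reflect C w p)" "Tgt C b = Src C (reflect C w q)"
		"Src C a = Tgt C (reflect C w p)" "Tgt C a = Tgt C (reflect C w q)"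
		using t i by (simp_all add: inverse_cells_def)
	show ?thesis unfolding compatible_def d using d(2) inverse_square[OF i assms(5,6) t]
			inverse_square[OF i(1,2)[THEN inverse_sym] assms(6,5) t'] by auto
next
	case False
	then show ?thesis by (cases w) (auto simp: reflect_other compatible_def)
qed

lemma reflect_inj:
	assumes "al : Cell C" "strong C w al" "be : Cell C" "strong C w be"
	shows "reflect C w al = reflect C w be \<longleftrightarrow> al = be"
	using reflect_reflect assms by metis

end

text \<open>2-functors preserve inverses. This is what makes reversal compatible with substitution
  when an outer multifunctor is applied to an interchange cell of an inner one.\<close>

lemma (in twofun) F2_reflect:
	assumes "al : Cell A" "strong A w al"
	shows "F2 F (reflect A w al) = reflect B w (F2 F al)"
proof (cases "w = Strict \<or> w = Pseudo")
	case True
	from B.reflect_eq[OF True F2_strong[OF assms] F2_inverse[OF A.reflect_inverse[OF assms True]]]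
	show ?thesis by simp
qed (simp add: A.reflect_other B.reflect_other)

section \<open>Composition and inversion of lax transformations and modifications\<close>

section \<open>Transformations and modifications\<close>

lemma restrict_eqI: "f : extensional A ==> (!!x. x : A ==> g x = f x) ==> restrict g A = f"
	by (auto simp: fun_eq_iff restrict_def extensional_def)

text \<open>Lax naturality together with the strength \<open>w\<close> of the cells. Naturality of
  any weakness is this notion between the 2-categories reversed by \<open>ori w\<close>.\<close>

definition lnat :: "('o, 'a, 't) fcat => ('p, 'b, 's) fcat => weakness =>
		('o, 'a, 't, 'p, 'b, 's) wtrans => bool" where
	"lnat S C w ph \<longleftrightarrow>
		 ffunctor S C (tsrc ph) & ffunctor S C (ttgt ph) &
		 tob ph : extensional (Obj S) & tcell ph : extensional (Arr S) &
		 (\<forall>x\<in>Obj S. tob ph x : Arr C & Dom C (tob ph x) = F0 (tsrc ph) x & Cod C (tob ph x) = F0 (ttgt ph) x) &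
		 (\<forall>s\<in>Arr S. tcell ph s : Cell C & Src C (tcell ph s) = Cmp C (F1 (ttgt ph) s) (tob ph (Dom S s)) &
				Tgt C (tcell ph s) = Cmp C (tob ph (Cod S s)) (F1 (tsrc ph) s) & strong C w (tcell ph s)) &
		 (\<forall>x\<in>Obj S. tcell ph (Idn S x) = VId C (tob ph x)) &
		 (\<forall>s\<in>Arr S. \<forall>t\<in>Arr S. Dom S t = Cod S s -->
				tcell ph (Cmp S t s) =
				VCmp C (whisker_right C (tcell ph t) (F1 (tsrc ph) s)) (whisker_left C (F1 (ttgt ph) t) (tcell ph s))) &
		 (\<forall>al\<in>Cell S. VCmp C (tcell ph (Tgt S al)) (whisker_right C (F2 (ttgt ph) al) (tob ph (Dom S (Src S al)))) =
				VCmp C (whisker_left C (tob ph (Cod S (Src S al))) (F2 (tsrc ph) al)) (tcell ph (Src S al)))"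

lemma wnatural_iff_lnat:
	assumes "two_category S" "two_category C"
	shows "wnatural S C w ph \<longleftrightarrow> lnat (ori w S) (ori w C) w ph"
proof -
	interpret S: twocat S by unfold_locales (rule assms)
	have f: "ffunctor (ori w S) (ori w C) F \<longleftrightarrow> ffunctor S C F" for F
		using ffunctor_ori[OF assms, of F w]
			ffunctor_ori[OF ori_two_category[OF assms(1)] ori_two_category[OF assms(2)], of w w F w] by auto
	have wc: "(\<forall>s\<in>Arr S. wcell C w (tob ph (Dom S s)) (F1 (tsrc ph) s) (F1 (ttgt ph) s) (tob ph (Cod S s)) (tcell ph s)) \<longleftrightarrow>
		(\<forall>s\<in>Arr S. tcell ph s : Cell C & Src (ori w C) (tcell ph s) = Cmp C (F1 (ttgt ph) s) (tob ph (Dom S s)) &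
				Tgt (ori w C) (tcell ph s) = Cmp C (tob ph (Cod S s)) (F1 (tsrc ph) s) & strong C w (tcell ph s))"
		if M: "ffunctor S C (ttgt ph)"
			and t: "\<forall>x\<in>Obj S. tob ph x : Arr C & Dom C (tob ph x) = F0 (tsrc ph) x & Cod C (tob ph x) = F0 (ttgt ph) x"
	proof (intro ball_cong refl wcell_iff assms)
		interpret N: twofun S C "ttgt ph" by unfold_locales (use assms M in auto)
		fix s assume s: "s : Arr S"
		show "tob ph (Dom S s) : Arr C" "F1 (ttgt ph) s : Arr C" "Dom C (F1 (ttgt ph) s) = Cod C (tob ph (Dom S s))"
			using s t by simp_all
	qed
	\<comment> \<open>For \<open>w = Colax\<close> the source 2-category is reversed too, so
	  \<open>al\<close> exchanges its ends and the colax compatibility equation takes the lax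
	  shape.\<close>
	have c: "compatible C w (tcell ph (Src S al)) (tcell ph (Tgt S al)) a b \<longleftrightarrow>
		VCmp (ori w C) (tcell ph (Tgt (ori w S) al)) a = VCmp (ori w C) b (tcell ph (Src (ori w S) al))" for al a b
		by (cases "w = Colax") (auto simp: compatible_def ori_Colax ori_other)
	have ds: "Dom S (Src (ori w S) al) = Dom S (Src S al)" "Cod S (Src (ori w S) al) = Cod S (Src S al)"
		if "al : Cell S" for al
		using that by (simp_all add: S.Dom_Src_ori S.Cod_Src_ori)
	show ?thesis
		unfolding wnatural_def lnat_def Let_def vseq_ori c f ori_simps strong_ori
		using wc by (safe; simp add: ds)
qed

locale lnatural = S: twocat S + C: twocat C + M: twofun S C "tsrc ph" + N: twofun S C "ttgt ph"
	for S :: "('o, 'a, 't) fcat" and C :: "('p, 'b, 's) fcat" and ph +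
	fixes w assumes lnat: "lnat S C w ph"
begin

lemma
	shows tob_ext: "tob ph : extensional (Obj S)"
		and tcell_ext: "tcell ph : extensional (Arr S)"
		and tob_arr [simp]: "x : Obj S ==> tob ph x : Arr C"
		and Dom_tob [simp]: "x : Obj S ==> Dom C (tob ph x) = F0 (tsrc ph) x"
		and Cod_tob [simp]: "x : Obj S ==> Cod C (tob ph x) = F0 (ttgt ph) x"
		and tcell_cell [simp]: "s : Arr S ==> tcell ph s : Cell C"
		and Src_tcell [simp]: "s : Arr S ==> Src C (tcell ph s) = Cmp C (F1 (ttgt ph) s) (tob ph (Dom S s))"
		and Tgt_tcell [simp]: "s : Arr S ==> Tgt C (tcell ph s) = Cmp C (tob ph (Cod S s)) (F1 (tsrc ph) s)"
		and strong_tcell [simp]: "s : Arr S ==> strong C w (tcell ph s)"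
		and tcell_Idn: "x : Obj S ==> tcell ph (Idn S x) = VId C (tob ph x)"
		and tcell_Cmp: "s : Arr S ==> t : Arr S ==> Dom S t = Cod S s ==> tcell ph (Cmp S t s) =
				VCmp C (whisker_right C (tcell ph t) (F1 (tsrc ph) s)) (whisker_left C (F1 (ttgt ph) t) (tcell ph s))"
		and tcell_nat: "al : Cell S ==>
				VCmp C (tcell ph (Tgt S al)) (whisker_right C (F2 (ttgt ph) al) (tob ph (Dom S (Src S al)))) =
				VCmp C (whisker_left C (tob ph (Cod S (Src S al))) (F2 (tsrc ph) al)) (tcell ph (Src S al))"
	using lnat unfolding lnat_def by simp_all

end

lemma lnaturalI:
	assumes "two_category S" "two_category C" "lnat S C w ph"
	shows "lnatural S C ph w"
	using assms by unfold_locales (simp_all add: lnat_def)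

text \<open>Allows every fact about composites to be proved for lax composition only.\<close>

lemma trans_comp_ori: "trans_comp S C w ps ph = trans_comp (ori w S) (ori w C) Lax ps ph"
	by (simp add: trans_comp_def vseq_ori ori_other)

lemma trans_id_ori: "trans_id S C M = trans_id (ori w S) (ori w C) M"
	by (simp add: trans_id_def)

lemma trans_comp_sel [simp]:
	"tsrc (trans_comp S C w ps ph) = tsrc ph" "ttgt (trans_comp S C w ps ph) = ttgt ps"
	"x : Obj S ==> tob (trans_comp S C w ps ph) x = Cmp C (tob ps x) (tob ph x)"
	"s : Arr S ==> tcell (trans_comp S C w ps ph) s = VCmp (ori w C) (whisker_left C (tob ps (Cod S s)) (tcell ph s))
		 (whisker_right C (tcell ps s) (tob ph (Dom S s)))"
	by (simp_all add: trans_comp_def vseq_ori)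

lemma trans_id_sel [simp]:
	"tsrc (trans_id S C M) = M" "ttgt (trans_id S C M) = M"
	"x : Obj S ==> tob (trans_id S C M) x = Idn C (F0 M x)"
	"s : Arr S ==> tcell (trans_id S C M) s = VId C (F1 M s)"
	by (simp_all add: trans_id_def)

lemma ori_Lax [simp]: "ori Lax C = C"
	by (simp add: ori_def)

lemma lnat_id:
	assumes "two_category S" "two_category C" "ffunctor S C M"
	shows "lnat S C w (trans_id S C M)"
proof -
	interpret M: twofun S C M by unfold_locales (use assms in auto)
	show ?thesis
		unfolding lnat_def trans_id_sel(1,2)
		using assms(3) by (auto simp: trans_id_def)
qed

locale lnatural_pair = P: lnatural S C ph w + Q: lnatural S C ps w
	for S :: "('o, 'a, 't) fcat" and C :: "('p, 'b, 's) fcat" and ph ps w +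
	assumes match [simp]: "tsrc ps = ttgt ph"
begin

abbreviation wl where "wl \<equiv> whisker_left C"
abbreviation wr where "wr \<equiv> whisker_right C"
abbreviation V where "V \<equiv> VCmp C"

text \<open>After expansion the two sides differ in the order of the cell of \<open>ps\<close> at
  \<open>t\<close> and the cell of \<open>ph\<close> at \<open>s\<close>. These act on different
  factors of the path, so \<open>exchange\<close> swaps them.\<close>

lemma comp_tcell_Cmp:
	assumes st: "s : Arr S" "t : Arr S" "Dom S t = Cod S s"
	shows "V (wl (tob ps (Cod S t)) (tcell ph (Cmp S t s))) (wr (tcell ps (Cmp S t s)) (tob ph (Dom S s))) =
		V (wr (V (wl (tob ps (Cod S t)) (tcell ph t)) (wr (tcell ps t) (tob ph (Dom S t)))) (F1 (tsrc ph) s))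
			(wl (F1 (ttgt ps) t) (V (wl (tob ps (Cod S s)) (tcell ph s)) (wr (tcell ps s) (tob ph (Dom S s)))))"
proof -
	let ?x = "Dom S s" and ?y = "Cod S s" and ?z = "Cod S t"
	let ?M = "tsrc ph" and ?N = "ttgt ph" and ?P = "ttgt ps"
	note simps = P.C.wl_VCmp P.C.wr_VCmp P.C.wl_Cmp P.C.wr_Cmp P.C.wr_wl
	have ex: "V (wl (Cmp C (tob ps ?z) (F1 ?N t)) (tcell ph s)) (wr (tcell ps t) (Cmp C (F1 ?N s) (tob ph ?x))) =
		 V (wr (tcell ps t) (Cmp C (tob ph ?y) (F1 ?M s))) (wl (Cmp C (F1 ?P t) (tob ps ?y)) (tcell ph s))"
		by (rule P.C.exchange) (use st in simp_all)
	let ?A = "wl (tob ps ?z) (wr (tcell ph t) (F1 ?M s))" and ?B = "wl (tob ps ?z) (wl (F1 ?N t) (tcell ph s))"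
	let ?C = "wr (wr (tcell ps t) (F1 ?N s)) (tob ph ?x)" and ?D = "wl (F1 ?P t) (wr (tcell ps s) (tob ph ?x))"
	let ?E = "wr (wr (tcell ps t) (tob ph ?y)) (F1 ?M s)" and ?F = "wl (F1 ?P t) (wl (tob ps ?y) (tcell ph s))"
	have 1: "V ?B ?C = V ?E ?F" using ex st by (simp add: simps)
	have "V (wl (tob ps ?z) (tcell ph (Cmp S t s))) (wr (tcell ps (Cmp S t s)) (tob ph ?x)) = V ?A (V ?B (V ?C ?D))"
		using st by (simp add: simps P.tcell_Cmp Q.tcell_Cmp)
	also have "\<dots> = V ?A (V (V ?B ?C) ?D)" using st by simp
	also have "\<dots> = V ?A (V (V ?E ?F) ?D)" unfolding 1 ..
	also have "\<dots> = V (wr (V (wl (tob ps ?z) (tcell ph t)) (wr (tcell ps t) (tob ph ?y))) (F1 ?M s))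
			(wl (F1 ?P t) (V (wl (tob ps ?y) (tcell ph s)) (wr (tcell ps s) (tob ph ?x))))"
		using st by (simp add: simps)
	finally show ?thesis using st by simp
qed

text \<open>The 2-cell is pushed past \<open>ps\<close> and then past \<open>ph\<close>, each time
  by one naturality square.\<close>

lemma comp_tcell_nat:
	assumes a: "al : Cell S"
	defines "x \<equiv> Dom S (Src S al)" and "y \<equiv> Cod S (Src S al)"
	shows "V (V (wl (tob ps y) (tcell ph (Tgt S al))) (wr (tcell ps (Tgt S al)) (tob ph x)))
			(wr (F2 (ttgt ps) al) (Cmp C (tob ps x) (tob ph x))) =
		V (wl (Cmp C (tob ps y) (tob ph y)) (F2 (tsrc ph) al))
			(V (wl (tob ps y) (tcell ph (Src S al))) (wr (tcell ps (Src S al)) (tob ph x)))"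
proof -
	note simps = P.C.wl_VCmp P.C.wr_VCmp P.C.wl_Cmp P.C.wr_Cmp P.C.wr_wl x_def y_def a
	note p = P.tcell_nat[OF a, folded x_def y_def] and q = Q.tcell_nat[OF a, folded x_def y_def]
	have "V (V (wl (tob ps y) (tcell ph (Tgt S al))) (wr (tcell ps (Tgt S al)) (tob ph x)))
			(wr (F2 (ttgt ps) al) (Cmp C (tob ps x) (tob ph x))) =
		V (wl (tob ps y) (tcell ph (Tgt S al))) (wr (V (tcell ps (Tgt S al)) (wr (F2 (ttgt ps) al) (tob ps x))) (tob ph x))"
		by (simp add: simps)
	also have "\<dots> = V (wl (tob ps y) (tcell ph (Tgt S al)))
			(wr (V (wl (tob ps y) (F2 (ttgt ph) al)) (tcell ps (Src S al))) (tob ph x))"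
		using q by simp
	also have "\<dots> = V (wl (tob ps y) (V (tcell ph (Tgt S al)) (wr (F2 (ttgt ph) al) (tob ph x))))
			(wr (tcell ps (Src S al)) (tob ph x))"
		by (simp add: simps)
	also have "\<dots> = V (wl (tob ps y) (V (wl (tob ph y) (F2 (tsrc ph) al)) (tcell ph (Src S al))))
			(wr (tcell ps (Src S al)) (tob ph x))"
		using p by simp
	also have "\<dots> = V (wl (Cmp C (tob ps y) (tob ph y)) (F2 (tsrc ph) al))
			(V (wl (tob ps y) (tcell ph (Src S al))) (wr (tcell ps (Src S al)) (tob ph x)))"
		by (simp add: simps)
	finally show ?thesis .
qed

lemma lnat_comp: "lnat S C w (trans_comp S C Lax ps ph)"
proof -
	note cc = comp_tcell_Cmp and cn = comp_tcell_nat
	show ?thesis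
		unfolding lnat_def trans_comp_sel(1,2)
	proof (intro conjI ballI impI)
		fix s t assume "s : Arr S" "t : Arr S" "Dom S t = Cod S s"
		then show "tcell (trans_comp S C Lax ps ph) (Cmp S t s) = V (wr (tcell (trans_comp S C Lax ps ph) t) (F1 (tsrc ph) s))
			(wl (F1 (ttgt ps) t) (tcell (trans_comp S C Lax ps ph) s))"
			using cc[of s t] by simp
	next
		fix al assume a: "al : Cell S"
		then show "V (tcell (trans_comp S C Lax ps ph) (Tgt S al))
			 (wr (F2 (ttgt ps) al) (tob (trans_comp S C Lax ps ph) (Dom S (Src S al)))) =
			V (wl (tob (trans_comp S C Lax ps ph) (Cod S (Src S al))) (F2 (tsrc ph) al))
			 (tcell (trans_comp S C Lax ps ph) (Src S al))"
			using cn[OF a] by (simp del: P.C.VCmp_assoc)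
	qed (simp_all add: P.M.ffunctor Q.N.ffunctor P.tcell_Idn Q.tcell_Idn, simp_all add: trans_comp_def)
qed

end

text \<open>Modifications, with \<open>m\<close> running from \<open>ph\<close> to \<open>ps\<close> in the lax orientation.\<close>

definition lmodif :: "('o, 'a, 't) fcat => ('p, 'b, 's) fcat =>
		('o, 'a, 't, 'p, 'b, 's) wtrans => ('o, 'a, 't, 'p, 'b, 's) wtrans => ('o => 's) => bool" where
	"lmodif S C ph ps m \<longleftrightarrow> tsrc ps = tsrc ph & ttgt ps = ttgt ph &
		 (\<forall>x\<in>Obj S. m x : Cell C & Src C (m x) = tob ph x & Tgt C (m x) = tob ps x) &
		 (\<forall>s\<in>Arr S. VCmp C (tcell ps s) (whisker_left C (F1 (ttgt ph) s) (m (Dom S s))) =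
									VCmp C (whisker_right C (m (Cod S s)) (F1 (tsrc ph) s)) (tcell ph s))"

context
	fixes S :: "('o, 'a, 't) fcat" and C :: "('p, 'b, 's) fcat" and w :: weakness
	assumes S: "two_category S" and C: "two_category C"
begin

interpretation S: twocat S by unfold_locales (rule S)
interpretation C: twocat C by unfold_locales (rule C)

lemma lmodif_id:
	assumes "lnat S C w ph"
	shows "lmodif S C ph ph (\<lambda>x\<in>Obj S. VId C (tob ph x))"
proof -
	interpret lnatural S C ph w by (rule lnaturalI[OF S C assms])
	show ?thesis by (simp add: lmodif_def)
qed

lemma lmodif_VCmp:
	assumes "lnat S C w ph" "lnat S C w ps" "lnat S C w \<chi>" "lmodif S C ph ps m" "lmodif S C ps \<chi> n"
	shows "lmodif S C ph \<chi> (\<lambda>x\<in>Obj S. VCmp C (n x) (m x))"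
proof -
	interpret P: lnatural S C ph w by (rule lnaturalI[OF S C assms(1)])
	interpret Q: lnatural S C ps w by (rule lnaturalI[OF S C assms(2)])
	interpret R: lnatural S C \<chi> w by (rule lnaturalI[OF S C assms(3)])
	note l = assms(4,5)[unfolded lmodif_def]
	have ends: "tsrc ps = tsrc ph" "ttgt ps = ttgt ph" "tsrc \<chi> = tsrc ph" "ttgt \<chi> = ttgt ph"
		using l by auto
	have mc: "m x : Cell C" "Src C (m x) = tob ph x" "Tgt C (m x) = tob ps x"
		and nc: "n x : Cell C" "Src C (n x) = tob ps x" "Tgt C (n x) = tob \<chi> x" if "x : Obj S" for x
		using l that by auto
	show ?thesis unfolding lmodif_def
	proof (intro conjI ballI)
		fix s assume s: "s : Arr S"
		have m: "VCmp C (tcell ps s) (whisker_left C (F1 (ttgt ph) s) (m (Dom S s))) =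
									VCmp C (whisker_right C (m (Cod S s)) (F1 (tsrc ph) s)) (tcell ph s)"
			and n: "VCmp C (tcell \<chi> s) (whisker_left C (F1 (ttgt ph) s) (n (Dom S s))) =
									VCmp C (whisker_right C (n (Cod S s)) (F1 (tsrc ph) s)) (tcell ps s)"
			using l s by auto
		have "VCmp C (tcell \<chi> s) (whisker_left C (F1 (ttgt ph) s) (VCmp C (n (Dom S s)) (m (Dom S s)))) =
			VCmp C (VCmp C (tcell \<chi> s) (whisker_left C (F1 (ttgt ph) s) (n (Dom S s)))) (whisker_left C (F1 (ttgt ph) s) (m (Dom S s)))"
			using s by (simp add: ends mc nc C.wl_VCmp)
		also have "\<dots> = VCmp C (whisker_right C (n (Cod S s)) (F1 (tsrc ph) s))
			 (VCmp C (tcell ps s) (whisker_left C (F1 (ttgt ph) s) (m (Dom S s))))"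
			unfolding n using s l by simp
		also have "\<dots> = VCmp C (whisker_right C (VCmp C (n (Cod S s)) (m (Cod S s))) (F1 (tsrc ph) s)) (tcell ph s)"
			unfolding m using s by (simp add: ends mc nc C.wr_VCmp)
		finally show "VCmp C (tcell \<chi> s) (whisker_left C (F1 (ttgt ph) s) ((\<lambda>x\<in>Obj S. VCmp C (n x) (m x)) (Dom S s))) =
			 VCmp C (whisker_right C ((\<lambda>x\<in>Obj S. VCmp C (n x) (m x)) (Cod S s)) (F1 (tsrc ph) s)) (tcell ph s)"
			using s by simp
	qed (simp_all add: ends mc nc)
qed

text \<open>Whiskerings are written as \<open>HCmp\<close> with identity 2-cells, so that
  \<open>interchange\<close> can merge each modification square with the neighbouring cell.\<close>

lemma lmodif_HCmp:
	assumes "lnat S C w ph" "lnat S C w ph'" "lnat S C w ps" "lnat S C w ps'" "tsrc ps = ttgt ph"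
		and "lmodif S C ph ph' m" "lmodif S C ps ps' n"
	shows "lmodif S C (trans_comp S C Lax ps ph) (trans_comp S C Lax ps' ph') (\<lambda>x\<in>Obj S. HCmp C (n x) (m x))"
proof -
	interpret P: lnatural S C ph w by (rule lnaturalI[OF S C assms(1)])
	interpret P': lnatural S C ph' w by (rule lnaturalI[OF S C assms(2)])
	interpret Q: lnatural S C ps w by (rule lnaturalI[OF S C assms(3)])
	interpret Q': lnatural S C ps' w by (rule lnaturalI[OF S C assms(4)])
	note l = assms(5-7)[unfolded lmodif_def]
	have ends: "tsrc ps' = ttgt ph" "tsrc ph' = tsrc ph" "ttgt ph' = ttgt ph" "ttgt ps' = ttgt ps" "tsrc ps = ttgt ph"
		using l by auto
	have mc: "m x : Cell C" "Src C (m x) = tob ph x" "Tgt C (m x) = tob ph' x"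
		and nc: "n x : Cell C" "Src C (n x) = tob ps x" "Tgt C (n x) = tob ps' x" if "x : Obj S" for x
		using l that by auto
	show ?thesis unfolding lmodif_def
	proof (intro conjI ballI)
		fix s assume s: "s : Arr S"
		let ?x = "Dom S s" and ?y = "Cod S s" and ?M = "F1 (tsrc ph) s" and ?N = "F1 (ttgt ph) s" and ?P = "F1 (ttgt ps) s"
		let ?H = "HCmp C" and ?V = "VCmp C" and ?i = "VId C"
		have m: "?V (tcell ph' s) (?H (?i ?N) (m ?x)) = ?V (?H (m ?y) (?i ?M)) (tcell ph s)"
			and n: "?V (tcell ps' s) (?H (?i ?P) (n ?x)) = ?V (?H (n ?y) (?i ?N)) (tcell ps s)"
			using l s by (auto simp: whisker_left_def whisker_right_def)
		note t = s mc nc ends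
		have "?V (?V (?H (?i (tob ps' ?y)) (tcell ph' s)) (?H (tcell ps' s) (?i (tob ph' ?x)))) (?H (?i ?P) (?H (n ?x) (m ?x)))
			 = ?V (?H (?i (tob ps' ?y)) (tcell ph' s)) (?V (?H (tcell ps' s) (?i (tob ph' ?x))) (?H (?H (?i ?P) (n ?x)) (m ?x)))"
			by (simp add: t C.HCmp_assoc)
		also have "\<dots> = ?V (?H (?i (tob ps' ?y)) (tcell ph' s)) (?H (?V (tcell ps' s) (?H (?i ?P) (n ?x))) (?V (?i (tob ph' ?x)) (m ?x)))"
			by (subst C.interchange[symmetric]) (simp_all add: t)
		also have "\<dots> = ?V (?H (?i (tob ps' ?y)) (tcell ph' s)) (?H (?V (?H (n ?y) (?i ?N)) (tcell ps s)) (?V (m ?x) (?i (tob ph ?x))))"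
			unfolding n by (simp add: t)
		also have "\<dots> = ?V (?H (?i (tob ps' ?y)) (tcell ph' s)) (?V (?H (?H (n ?y) (?i ?N)) (m ?x)) (?H (tcell ps s) (?i (tob ph ?x))))"
			by (subst C.interchange) (simp_all add: t)
		also have "\<dots> = ?V (?V (?H (?i (tob ps' ?y)) (tcell ph' s)) (?H (n ?y) (?H (?i ?N) (m ?x)))) (?H (tcell ps s) (?i (tob ph ?x)))"
			by (simp add: t C.HCmp_assoc)
		also have "?V (?H (?i (tob ps' ?y)) (tcell ph' s)) (?H (n ?y) (?H (?i ?N) (m ?x))) =
			?H (?V (?i (tob ps' ?y)) (n ?y)) (?V (tcell ph' s) (?H (?i ?N) (m ?x)))"
			by (subst C.interchange[symmetric]) (simp_all add: t)
		also have "\<dots> = ?H (?V (n ?y) (?i (tob ps ?y))) (?V (?H (m ?y) (?i ?M)) (tcell ph s))"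
			unfolding m by (simp add: t)
		also have "\<dots> = ?V (?H (n ?y) (?H (m ?y) (?i ?M))) (?H (?i (tob ps ?y)) (tcell ph s))"
			by (subst C.interchange) (simp_all add: t)
		finally have "?V (?V (?H (?i (tob ps' ?y)) (tcell ph' s)) (?H (tcell ps' s) (?i (tob ph' ?x)))) (?H (?i ?P) (?H (n ?x) (m ?x))) =
			?V (?H (?H (n ?y) (m ?y)) (?i ?M)) (?V (?H (?i (tob ps ?y)) (tcell ph s)) (?H (tcell ps s) (?i (tob ph ?x))))"
			by (simp add: t C.HCmp_assoc)
		then show "?V (tcell (trans_comp S C Lax ps' ph') s) (whisker_left C (F1 (ttgt (trans_comp S C Lax ps ph)) s)
				 ((\<lambda>x\<in>Obj S. ?H (n x) (m x)) ?x)) =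
			 ?V (whisker_right C ((\<lambda>x\<in>Obj S. ?H (n x) (m x)) ?y) (F1 (tsrc (trans_comp S C Lax ps ph)) s))
				 (tcell (trans_comp S C Lax ps ph) s)"
			using s by (simp add: whisker_left_def whisker_right_def del: C.VCmp_assoc)
	qed (simp_all add: mc nc ends)
qed

lemma lnat_assoc:
	assumes "lnat S C w ph" "lnat S C w ps" "lnat S C w \<chi>" "tsrc ps = ttgt ph" "tsrc \<chi> = ttgt ps"
	shows "trans_comp S C Lax \<chi> (trans_comp S C Lax ps ph) = trans_comp S C Lax (trans_comp S C Lax \<chi> ps) ph"
proof -
	interpret P: lnatural S C ph w by (rule lnaturalI[OF S C assms(1)])
	interpret Q: lnatural S C ps w by (rule lnaturalI[OF S C assms(2)])
	interpret R: lnatural S C \<chi> w by (rule lnaturalI[OF S C assms(3)])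
	show ?thesis
		by (intro wtrans.equality ext)
			(simp_all add: trans_comp_def vseq_def restrict_def assms(4,5) C.wl_VCmp C.wr_VCmp C.wl_Cmp C.wr_Cmp C.wr_wl)
qed

lemma
	assumes "lnat S C w ph"
	shows lnat_comp_id: "trans_comp S C Lax ph (trans_id S C (tsrc ph)) = ph"
		and lnat_id_comp: "trans_comp S C Lax (trans_id S C (ttgt ph)) ph = ph"
proof -
	interpret P: lnatural S C ph w by (rule lnaturalI[OF S C assms])
	show "trans_comp S C Lax ph (trans_id S C (tsrc ph)) = ph"
		unfolding trans_comp_def
		by (intro wtrans.equality) (auto intro!: restrict_eqI P.tob_ext P.tcell_ext simp: vseq_def)
	show "trans_comp S C Lax (trans_id S C (ttgt ph)) ph = ph"
		unfolding trans_comp_def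
		by (intro wtrans.equality) (auto intro!: restrict_eqI P.tob_ext P.tcell_ext simp: vseq_def)
qed

text \<open>Each modification square can be turned round by \<open>inverse_square\<close>. Hence
  invertibility of a modification is a condition on its components.\<close>

lemma lmodif_inverse:
	assumes "lnat S C w ph" "lnat S C w ps" "lmodif S C ph ps m" "!!x. x : Obj S ==> inverse_cells C (m x) (n x)"
	shows "lmodif S C ps ph n"
proof -
	interpret P: lnatural S C ph w by (rule lnaturalI[OF S C assms(1)])
	interpret Q: lnatural S C ps w by (rule lnaturalI[OF S C assms(2)])
	note l = assms(3)[unfolded lmodif_def]
	have ends: "tsrc ps = tsrc ph" "ttgt ps = ttgt ph"
		using l by auto
	have mc: "m x : Cell C" "Src C (m x) = tob ph x" "Tgt C (m x) = tob ps x" if "x : Obj S" for x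
		using l that by auto
	have nc: "n x : Cell C" "Src C (n x) = tob ps x" "Tgt C (n x) = tob ph x" if "x : Obj S" for x
		using assms(4)[OF that] mc[OF that] by (simp_all add: inverse_cells_def)
	show ?thesis unfolding lmodif_def
	proof (intro conjI ballI)
		fix s assume s: "s : Arr S"
		let ?N = "F1 (ttgt ph) s" and ?M = "F1 (tsrc ph) s"
		have eq: "VCmp C (tcell ps s) (whisker_left C ?N (m (Dom S s))) =
				VCmp C (whisker_right C (m (Cod S s)) ?M) (tcell ph s)" using l s by blast
		have "inverse_cells C (whisker_left C ?N (m (Dom S s))) (whisker_left C ?N (n (Dom S s)))"
			by (rule C.inverse_wl[OF assms(4)]) (use s in \<open>simp_all add: mc\<close>)
		moreover have "inverse_cells C (whisker_right C (m (Cod S s)) ?M) (whisker_right C (n (Cod S s)) ?M)"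
			by (rule C.inverse_wr[OF assms(4)]) (use s in \<open>simp_all add: mc\<close>)
		ultimately have "VCmp C (whisker_right C (n (Cod S s)) ?M) (tcell ps s) =
			VCmp C (tcell ph s) (whisker_left C ?N (n (Dom S s)))"
			by (rule C.inverse_square) (use s eq in \<open>simp_all add: mc nc ends\<close>)
		then show "VCmp C (tcell ph s) (whisker_left C (F1 (ttgt ps) s) (n (Dom S s))) =
			VCmp C (whisker_right C (n (Cod S s)) (F1 (tsrc ps) s)) (tcell ps s)"
			by (simp add: ends)
	qed (simp_all add: ends nc)
qed

text \<open>With identity components the modification square degenerates to equality of the cells of
  \<open>ph\<close> and \<open>ps\<close>. This makes being an identity modification a componentwise
  condition.\<close>

lemma lmodif_eq:
	assumes "lnat S C w ph" "lnat S C w ps" "lmodif S C ph ps m" "!!x. x : Obj S ==> m x : VId C ` Arr C"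
	shows "ps = ph" "!!x. x : Obj S ==> m x = VId C (tob ph x)"
proof -
	interpret P: lnatural S C ph w by (rule lnaturalI[OF S C assms(1)])
	interpret Q: lnatural S C ps w by (rule lnaturalI[OF S C assms(2)])
	note l = assms(3)[unfolded lmodif_def]
	have m: "m x = VId C (tob ph x) & tob ps x = tob ph x" if x: "x : Obj S" for x
	proof -
		obtain f where "f : Arr C" "m x = VId C f" using assms(4)[OF x] by blast
		moreover have "Src C (m x) = tob ph x" "Tgt C (m x) = tob ps x" using l x by auto
		ultimately show ?thesis by simp
	qed
	then show "!!x. x : Obj S ==> m x = VId C (tob ph x)" by blast
	have ends: "tsrc ps = tsrc ph" "ttgt ps = ttgt ph"
		using l by auto
	have t: "tcell ps s = tcell ph s" if s: "s : Arr S" for s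
	proof -
		have "VCmp C (tcell ps s) (whisker_left C (F1 (ttgt ph) s) (m (Dom S s))) =
									VCmp C (whisker_right C (m (Cod S s)) (F1 (tsrc ph) s)) (tcell ph s)" using l s by blast
		moreover have "m (Dom S s) = VId C (tob ph (Dom S s))" "m (Cod S s) = VId C (tob ph (Cod S s))"
			using m s by simp_all
		ultimately show ?thesis using s m by (simp add: ends)
	qed
	show "ps = ph"
		by (intro wtrans.equality extensionalityI[OF Q.tob_ext P.tob_ext]
				extensionalityI[OF Q.tcell_ext P.tcell_ext]) (simp_all add: m t ends)
qed

end

section \<open>The F-category of transformations and modifications of given weaknesses\<close>

section \<open>The functor and model categories\<close>

lemma
	assumes "fcategory C"
	shows fcategory_two_category: "two_category C"
		and Tight_arr: "f : Tight C ==> f : Arr C"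
		and Idn_tight: "x : Obj C ==> Idn C x : Tight C"
		and Cmp_tight: "f : Tight C ==> g : Tight C ==> Dom C g = Cod C f ==> Cmp C g f : Tight C"
	using assms by (auto simp: fcategory_def)

lemma full_sub_simps [simp]:
	"Dom (full_sub C P) = Dom C" "Cod (full_sub C P) = Cod C" "Idn (full_sub C P) = Idn C"
	"Cmp (full_sub C P) = Cmp C" "Src (full_sub C P) = Src C" "Tgt (full_sub C P) = Tgt C"
	"VId (full_sub C P) = VId C" "VCmp (full_sub C P) = VCmp C" "HCmp (full_sub C P) = HCmp C"
	"whisker_left (full_sub C P) = whisker_left C" "whisker_right (full_sub C P) = whisker_right C"
	by (simp_all add: full_sub_def whisker_left_def whisker_right_def fun_eq_iff)

lemma full_sub_sets:
	"Obj (full_sub C P) = Obj C \<inter> P" "Arr (full_sub C P) = {f \<in> Arr C. Dom C f : P & Cod C f : P}"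
	"Tight (full_sub C P) = {f \<in> Tight C. Dom C f : P & Cod C f : P}"
	"Cell (full_sub C P) = {al \<in> Cell C. Dom C (Src C al) : P & Cod C (Src C al) : P}"
	by (simp_all add: full_sub_def)

lemma fcategory_full_sub:
	assumes "fcategory C"
	shows "fcategory (full_sub C P)"
proof -
	interpret twocat C by unfold_locales (rule fcategory_two_category[OF assms])
	have "two_category (full_sub C P)"
		unfolding two_category_def
	proof (intro conjI)
		show "category (arrow_cat (full_sub C P))"
			by (rule categoryI) (simp_all add: arrow_cat_def full_sub_sets)
		show "category (vertical_cat (full_sub C P))"
			by (rule categoryI) (simp_all add: vertical_cat_def full_sub_sets)
		show "category (horizontal_cat (full_sub C P))"
			by (rule categoryI) (simp_all add: horizontal_cat_def full_sub_sets HCmp_assoc)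
	qed (simp_all add: full_sub_sets HCmp_VId interchange)
	moreover note t = Tight_arr[OF assms]
	ultimately show ?thesis
		using Idn_tight[OF assms] Cmp_tight[OF assms] by (simp add: fcategory_def full_sub_sets Collect_mono_iff t)
qed

text \<open>A full subcategory contains every inverse of its 2-cells and every 1-cell whose identity
  it contains.\<close>

lemma strong_full_sub:
	assumes "two_category C" "al : Cell (full_sub C P)"
	shows "strong (full_sub C P) w al \<longleftrightarrow> strong C w al"
proof -
	interpret twocat C by unfold_locales (rule assms)
	have "inverse_cells (full_sub C P) al be \<longleftrightarrow> inverse_cells C al be" for be
		using assms(2) by (auto simp: inverse_cells_def full_sub_sets)
	moreover have "al : VId C ` Arr (full_sub C P) \<longleftrightarrow> al : VId C ` Arr C"
		using assms(2) by (auto simp: full_sub_sets image_iff)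
	ultimately show ?thesis by (simp add: strong_def)
qed

text \<open>The oriented ends of a modification: what \<open>Src\<close> and \<open>Tgt\<close> of
  the functor 2-category become after \<open>ori w\<close>.\<close>

definition osrc :: "weakness => ('o, 'a, 't, 'p, 'b, 's) modif => ('o, 'a, 't, 'p, 'b, 's) wtrans" where
	"osrc w mu = (if w = Colax then mtgt mu else msrc mu)"

definition otgt :: "weakness => ('o, 'a, 't, 'p, 'b, 's) modif => ('o, 'a, 't, 'p, 'b, 's) wtrans" where
	"otgt w mu = (if w = Colax then msrc mu else mtgt mu)"

locale funcat =
	fixes S :: "('o, 'a, 't) fcat" and C :: "('p, 'b, 's) fcat" and v w :: weakness
	assumes S: "fcategory S" and C: "fcategory C" and vw: "v \<preceq> w"
begin

sublocale S: twocat S by unfold_locales (rule fcategory_two_category[OF S])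
sublocale C: twocat C by unfold_locales (rule fcategory_two_category[OF C])

abbreviation K where "K \<equiv> Fun_cat v w S C"

lemmas S' = ori_two_category[OF S.two_category, of w]
lemmas C' = ori_two_category[OF C.two_category, of w]

text \<open>The condition on tight arrows becomes the strength \<open>v\<close> of the same cell,
  whichever way \<open>v\<close> and \<open>w\<close> point, so no inverse has to be chosen when
  transformations are manipulated.\<close>

lemma loose_iff: "ph : loose_trans S C v w \<longleftrightarrow>
		lnat (ori w S) (ori w C) w ph & (\<forall>s\<in>Tight S. strong C v (tcell ph s))"
proof -
	have "wcell_of S C v w ph s \<longleftrightarrow> strong C v (tcell ph s)"
		if s: "s : Arr S" and l: "lnat (ori w S) (ori w C) w ph" for s
	proof -
		interpret l: lnatural "ori w S" "ori w C" ph w by (rule lnaturalI[OF S' C' l])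
		note t = l.tob_arr l.Dom_tob l.Cod_tob l.tcell_cell l.Src_tcell l.Tgt_tcell l.strong_tcell l.N.F1_arr l.N.Dom_F1
		show ?thesis
			unfolding wcell_of_def
			using t[unfolded ori_simps strong_ori] s by (subst wcell_at_iff[OF C.two_category _ _ _ vw]) simp_all
	qed
	then show ?thesis
		using Tight_arr[OF S] by (auto simp: loose_trans_def wnatural_iff_lnat[OF S.two_category C.two_category])
qed

lemma wcell_of_iff:
	assumes "s : Arr S" and "ph : loose_trans S C v w"
	shows "wcell_of S C v w ph s \<longleftrightarrow> strong C v (tcell ph s)"
proof -
	interpret l: lnatural "ori w S" "ori w C" ph w by (rule lnaturalI[OF S' C']) (use assms loose_iff in blast)
	note t = l.tob_arr l.Dom_tob l.Cod_tob l.tcell_cell l.Src_tcell l.Tgt_tcell l.strong_tcell l.N.F1_arr l.N.Dom_F1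
	show ?thesis
		unfolding wcell_of_def
		using t[unfolded ori_simps strong_ori] assms(1) by (subst wcell_at_iff[OF C.two_category _ _ _ vw]) simp_all
qed

lemma tight_iff: "ph : tight_trans S C v w \<longleftrightarrow> ph : loose_trans S C v w &
		(\<forall>x\<in>Obj S. tob ph x : Tight C) & (\<forall>s\<in>Arr S. strong C v (tcell ph s))"
	using wcell_of_iff by (auto simp: tight_trans_def)

lemma ffunctor_ori_iff: "ffunctor (ori w S) (ori w C) M \<longleftrightarrow> ffunctor S C M"
	using ffunctor_ori[OF S.two_category C.two_category, of M w] ffunctor_ori[OF S' C', of M w] by auto

lemma
	assumes "ph : loose_trans S C v w"
	shows loose_lnat: "lnat (ori w S) (ori w C) w ph"
		and loose_src: "ffunctor S C (tsrc ph)" (is ?G1)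
		and loose_tgt: "ffunctor S C (ttgt ph)" (is ?G2)
		and loose_tob: "x : Obj S ==> tob ph x : Arr C" (is "PROP ?G3")
		and loose_Dom: "x : Obj S ==> Dom C (tob ph x) = F0 (tsrc ph) x" (is "PROP ?G4")
		and loose_Cod: "x : Obj S ==> Cod C (tob ph x) = F0 (ttgt ph) x" (is "PROP ?G5")
		and loose_tob_ext: "tob ph : extensional (Obj S)" (is ?G6)
		and loose_tcell_ext: "tcell ph : extensional (Arr S)" (is ?G7)
		and loose_cell: "s : Arr S ==> tcell ph s : Cell C" (is "PROP ?G8")
		and loose_strong: "s : Arr S ==> strong C w (tcell ph s)" (is "PROP ?G9")
proof -
	show l: "lnat (ori w S) (ori w C) w ph" using assms loose_iff by blast
	interpret l: lnatural "ori w S" "ori w C" ph w by (rule lnaturalI[OF S' C' l])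
	show ?G1 ?G2 using l.M.ffunctor l.N.ffunctor by (simp_all only: ffunctor_ori_iff)
	show "PROP ?G3" "PROP ?G4" "PROP ?G5" ?G6 ?G7 "PROP ?G8" "PROP ?G9"
		using l.tob_arr l.Dom_tob l.Cod_tob l.tob_ext l.tcell_ext l.tcell_cell l.strong_tcell by simp_all
qed

lemma modif_iff: "mu : modifications S C v w \<longleftrightarrow>
		msrc mu : loose_trans S C v w & mtgt mu : loose_trans S C v w & mcmp mu : extensional (Obj S) &
		lmodif (ori w S) (ori w C) (osrc w mu) (otgt w mu) (mcmp mu)"
proof (cases "w = Colax")
	case True
	show ?thesis unfolding True modifications_def lmodif_def osrc_def otgt_def compatible_def Let_def ori_simps ori_Colax
		by (auto; metis)
next
	case False
	then show ?thesis unfolding modifications_def lmodif_def osrc_def otgt_def compatible_def Let_def ori_simps ori_other[OF False]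
		by auto
qed

lemma
	assumes "mu : modifications S C v w"
	shows modif_src: "msrc mu : loose_trans S C v w"
		and modif_tgt: "mtgt mu : loose_trans S C v w"
		and modif_ends: "tsrc (mtgt mu) = tsrc (msrc mu)" "ttgt (mtgt mu) = ttgt (msrc mu)"
		and modif_ext: "mcmp mu : extensional (Obj S)"
		and modif_cell: "x : Obj S ==> mcmp mu x : Cell C"
		and modif_Src: "x : Obj S ==> Src C (mcmp mu x) = tob (msrc mu) x"
		and modif_Tgt: "x : Obj S ==> Tgt C (mcmp mu x) = tob (mtgt mu) x"
	using assms by (simp_all add: modifications_def Let_def)

lemma modif_lmodif: "mu : modifications S C v w ==> lmodif (ori w S) (ori w C) (osrc w mu) (otgt w mu) (mcmp mu)"
	using modif_iff by blast

lemma modif_osrc: "mu : modifications S C v w ==> osrc w mu : loose_trans S C v w"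
	and modif_otgt: "mu : modifications S C v w ==> otgt w mu : loose_trans S C v w"
	by (simp_all only: osrc_def otgt_def modif_src modif_tgt split: if_split) blast+

lemma modif_oends: "mu : modifications S C v w ==> tsrc (osrc w mu) = tsrc (msrc mu) & ttgt (osrc w mu) = ttgt (msrc mu)"
	by (auto simp: osrc_def modif_ends)

text \<open>The second conclusion is for tight transformations, whose cells are
  \<open>v\<close>-strong at every arrow.\<close>

lemma loose_comp:
	assumes "ph : loose_trans S C v w" "ps : loose_trans S C v w" "tsrc ps = ttgt ph"
	shows "trans_comp S C w ps ph : loose_trans S C v w"
		and "(!!s. s : Arr S ==> strong C v (tcell ph s)) ==> (!!s. s : Arr S ==> strong C v (tcell ps s)) ==>
			s : Arr S ==> strong C v (tcell (trans_comp S C w ps ph) s)"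
proof -
	interpret P: lnatural "ori w S" "ori w C" ph w by (rule lnaturalI[OF S' C' loose_lnat[OF assms(1)]])
	interpret Q: lnatural "ori w S" "ori w C" ps w by (rule lnaturalI[OF S' C' loose_lnat[OF assms(2)]])
	interpret PQ: lnatural_pair "ori w S" "ori w C" ph ps w by unfold_locales (rule assms)
	have s: "strong (ori w C) v (tcell (trans_comp (ori w S) (ori w C) Lax ps ph) s)"
		if "s : Arr (ori w S)" "strong (ori w C) v (tcell ph s)" "strong (ori w C) v (tcell ps s)" for s
	proof -
		have t: "tcell (trans_comp (ori w S) (ori w C) Lax ps ph) s = VCmp (ori w C)
			(whisker_left (ori w C) (tob ps (Cod (ori w S) s)) (tcell ph s))
			(whisker_right (ori w C) (tcell ps s) (tob ph (Dom (ori w S) s)))"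
			using that(1) by (subst trans_comp_sel(4)) simp_all
		show ?thesis unfolding t
			by (intro P.C.strong_VCmp P.C.strong_wl P.C.strong_wr P.C.wl_cell P.C.wr_cell P.tcell_cell Q.tcell_cell
				that P.tob_arr Q.tob_arr P.S.Dom_ob P.S.Cod_ob)
				(simp_all only: that P.C.Src_wl P.C.Tgt_wr P.tcell_cell Q.tcell_cell Q.tob_arr P.tob_arr P.S.Dom_ob P.S.Cod_ob
					P.Src_tcell P.Tgt_tcell Q.Src_tcell Q.Tgt_tcell PQ.match Q.Dom_tob P.Cod_tob P.M.F1_arr P.N.F1_arr Q.N.F1_arr
					P.C.Dom_Cmp P.C.Cod_Cmp P.N.Dom_F1 P.N.Cod_F1 Q.N.Dom_F1 Q.N.Cod_F1 P.M.Dom_F1 P.M.Cod_F1 Q.Cod_tob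
					P.C.Cmp_assoc)
	qed
	note s' = s[unfolded strong_ori ori_simps trans_comp_ori[symmetric]]
	show "trans_comp S C w ps ph : loose_trans S C v w"
		unfolding loose_iff
	proof (intro conjI ballI)
		show "lnat (ori w S) (ori w C) w (trans_comp S C w ps ph)"
			unfolding trans_comp_ori[of S] by (rule PQ.lnat_comp)
		fix s assume "s : Tight S"
		then show "strong C v (tcell (trans_comp S C w ps ph) s)"
			using assms(1,2) unfolding loose_iff by (intro s' Tight_arr[OF S]) auto
	qed
	show "strong C v (tcell (trans_comp S C w ps ph) s)"
		if "!!s. s : Arr S ==> strong C v (tcell ph s)" "!!s. s : Arr S ==> strong C v (tcell ps s)" "s : Arr S"
		by (rule s') (use that in auto)
qed

lemma loose_id:
	assumes "ffunctor S C M"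
	shows "trans_id S C M : loose_trans S C v w" "s : Arr S ==> strong C v (tcell (trans_id S C M) s)"
proof -
	interpret M: twofun S C M by unfold_locales (rule assms)
	show s: "strong C v (tcell (trans_id S C M) s)" if "s : Arr S" for s
		using that by simp
	have "lnat (ori w S) (ori w C) w (trans_id S C M)"
		unfolding trans_id_ori[of S C M w] by (rule lnat_id[OF S' C']) (simp add: ffunctor_ori_iff assms)
	then show "trans_id S C M : loose_trans S C v w"
		unfolding loose_iff using s Tight_arr[OF S] by blast
qed

lemma modif_VId:
	assumes "ph : loose_trans S C v w"
	shows "\<lparr>msrc = ph, mtgt = ph, mcmp = (\<lambda>x\<in>Obj S. VId C (tob ph x))\<rparr> : modifications S C v w"
	unfolding modif_iff osrc_def otgt_def using assms lmodif_id[OF S' C' loose_lnat[OF assms]] by (cases "w = Colax") simp_all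

lemma modif_VCmp:
	assumes "mu : modifications S C v w" "nu : modifications S C v w" "msrc nu = mtgt mu"
	shows "\<lparr>msrc = msrc mu, mtgt = mtgt nu, mcmp = (\<lambda>x\<in>Obj S. VCmp C (mcmp nu x) (mcmp mu x))\<rparr> : modifications S C v w"
proof -
	note l = modif_src[OF assms(1)] modif_tgt[OF assms(1)] modif_tgt[OF assms(2)]
	note n = l[THEN loose_lnat]
	note m = modif_lmodif[OF assms(1)] modif_lmodif[OF assms(2)]
	have "lmodif (ori w S) (ori w C) (if w = Colax then mtgt nu else msrc mu) (if w = Colax then msrc mu else mtgt nu)
		(\<lambda>x\<in>Obj S. VCmp C (mcmp nu x) (mcmp mu x))"
	proof (cases "w = Colax")
		case True
		show ?thesis
			using lmodif_VCmp[OF S' C' n(3,2,1)] m assms(3) by (simp add: osrc_def otgt_def True ori_Colax)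
	next
		case False
		then show ?thesis
			using lmodif_VCmp[OF S' C' n] m assms(3) by (simp add: osrc_def otgt_def ori_other)
	qed
	then show ?thesis unfolding modif_iff osrc_def otgt_def using l by (cases "w = Colax") simp_all
qed

lemma modif_HCmp:
	assumes "mu : modifications S C v w" "nu : modifications S C v w" "tsrc (msrc nu) = ttgt (msrc mu)"
	shows "\<lparr>msrc = trans_comp S C w (msrc nu) (msrc mu), mtgt = trans_comp S C w (mtgt nu) (mtgt mu),
		mcmp = (\<lambda>x\<in>Obj S. HCmp C (mcmp nu x) (mcmp mu x))\<rparr> : modifications S C v w"
proof -
	note n = modif_osrc[OF assms(1), THEN loose_lnat] modif_otgt[OF assms(1), THEN loose_lnat]
		modif_osrc[OF assms(2), THEN loose_lnat] modif_otgt[OF assms(2), THEN loose_lnat]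
	have "tsrc (osrc w nu) = ttgt (osrc w mu)" using modif_oends assms by metis
	from lmodif_HCmp[OF S' C' n this modif_lmodif[OF assms(1)] modif_lmodif[OF assms(2)]]
	have "lmodif (ori w S) (ori w C) (trans_comp S C w (osrc w nu) (osrc w mu)) (trans_comp S C w (otgt w nu) (otgt w mu))
		(\<lambda>x\<in>Obj S. HCmp C (mcmp nu x) (mcmp mu x))"
		by (simp flip: trans_comp_ori)
	moreover have "trans_comp S C w (msrc nu) (msrc mu) : loose_trans S C v w"
		"trans_comp S C w (mtgt nu) (mtgt mu) : loose_trans S C v w"
		using assms modif_src modif_tgt modif_ends by (intro loose_comp(1); simp)+
	ultimately show ?thesis unfolding modif_iff osrc_def otgt_def by (cases "w = Colax") simp_all
qed

lemma Fun_sel [simp]: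
	"Obj K = {M. ffunctor S C M}" "Arr K = loose_trans S C v w" "Tight K = tight_trans S C v w"
	"Cell K = modifications S C v w" "Dom K = tsrc" "Cod K = ttgt" "Idn K = trans_id S C"
	"Cmp K = trans_comp S C w" "Src K = msrc" "Tgt K = mtgt"
	"VId K = (\<lambda>ph. \<lparr>msrc = ph, mtgt = ph, mcmp = (\<lambda>x\<in>Obj S. VId C (tob ph x))\<rparr>)"
	"VCmp K = (\<lambda>nu mu. \<lparr>msrc = msrc mu, mtgt = mtgt nu, mcmp = (\<lambda>x\<in>Obj S. VCmp C (mcmp nu x) (mcmp mu x))\<rparr>)"
	"HCmp K = (\<lambda>nu mu. \<lparr>msrc = trans_comp S C w (msrc nu) (msrc mu), mtgt = trans_comp S C w (mtgt nu) (mtgt mu),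
		 mcmp = (\<lambda>x\<in>Obj S. HCmp C (mcmp nu x) (mcmp mu x))\<rparr>)"
	by (simp_all add: Fun_cat_def)

lemma modif_eqI:
	fixes mu nu :: "('o, 'a, 't, 'p, 'b, 's) modif"
	assumes "mcmp mu : extensional (Obj S)" "mcmp nu : extensional (Obj S)" "msrc mu = msrc nu" "mtgt mu = mtgt nu"
		"!!x. x : Obj S ==> mcmp mu x = mcmp nu x"
	shows "mu = nu"
	using assms by (intro modif.equality extensionalityI[of "mcmp mu" "Obj S"]) simp_all

lemma loose_assoc:
	assumes "ph : loose_trans S C v w" "ps : loose_trans S C v w" "\<chi> : loose_trans S C v w"
		"tsrc ps = ttgt ph" "tsrc \<chi> = ttgt ps"
	shows "trans_comp S C w \<chi> (trans_comp S C w ps ph) = trans_comp S C w (trans_comp S C w \<chi> ps) ph"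
	unfolding trans_comp_ori[of S] by (rule lnat_assoc[OF S' C' assms(1-3)[THEN loose_lnat] assms(4,5)])

lemma
	assumes "ph : loose_trans S C v w"
	shows loose_comp_id: "trans_comp S C w ph (trans_id S C (tsrc ph)) = ph"
		and loose_id_comp: "trans_comp S C w (trans_id S C (ttgt ph)) ph = ph"
	unfolding trans_comp_ori[of S] trans_id_ori[of S C _ w]
	by (rule lnat_comp_id[OF S' C' loose_lnat[OF assms]] lnat_id_comp[OF S' C' loose_lnat[OF assms]])+

lemma fcategory_Fun: "fcategory K"
proof -
	note lf = loose_tob loose_Dom loose_Cod and mf = modif_cell modif_Src modif_Tgt modif_src modif_tgt modif_ends
	have hc: "Dom C (Src C (mcmp nu x)) = Cod C (Src C (mcmp mu x))"
		if "mu : modifications S C v w" "nu : modifications S C v w" "tsrc (msrc nu) = ttgt (msrc mu)" "x : Obj S" for mu nu x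
		using that by (simp add: mf lf)
	have "category (arrow_cat K)"
		by (rule categoryI) (simp_all add: arrow_cat_def loose_src loose_tgt loose_id loose_comp loose_comp_id loose_id_comp loose_assoc)
	moreover have "category (vertical_cat K)"
		by (rule categoryI)
			(simp_all add: vertical_cat_def modif_src modif_tgt modif_VId modif_VCmp,
				((rule modif_eqI | rule restrict_ext); simp add: modif_ext mf lf)+)
	moreover have "category (horizontal_cat K)"
	proof (rule categoryI)
		fix mu assume "mu : c_ar (horizontal_cat K)"
		then have m: "mu : modifications S C v w" by (simp add: horizontal_cat_def)
		note f = m modif_ext[OF m] mf[OF m] modif_src[OF m, THEN loose_comp_id] modif_tgt[OF m, THEN loose_comp_id]
			modif_src[OF m, THEN loose_id_comp] modif_tgt[OF m, THEN loose_id_comp] lf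
		have t: "tob (trans_id S C M) x = Idn C (F0 M x)" if "x : Obj S" for M x using that by simp
		show "c_comp (horizontal_cat K) mu (c_id (horizontal_cat K) (c_dom (horizontal_cat K) mu)) = mu"
			"c_comp (horizontal_cat K) (c_id (horizontal_cat K) (c_cod (horizontal_cat K) mu)) mu = mu"
			using f by (auto simp: horizontal_cat_def intro!: modif_eqI)
	next
		fix mu nu \<rho> assume "mu : c_ar (horizontal_cat K)" "nu : c_ar (horizontal_cat K)" "\<rho> : c_ar (horizontal_cat K)"
			"c_dom (horizontal_cat K) nu = c_cod (horizontal_cat K) mu" "c_dom (horizontal_cat K) \<rho> = c_cod (horizontal_cat K) nu"
		then have m: "mu : modifications S C v w" "nu : modifications S C v w" "\<rho> : modifications S C v w"
			and e: "tsrc (msrc nu) = ttgt (msrc mu)" "tsrc (msrc \<rho>) = ttgt (msrc nu)"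
			by (simp_all add: horizontal_cat_def)
		\<comment> \<open>The two ends of a modification run between the same functors, so the targets are
		  composable as well.\<close>
		have e': "tsrc (mtgt nu) = ttgt (mtgt mu)" "tsrc (mtgt \<rho>) = ttgt (mtgt nu)" using e m by (simp_all add: modif_ends)
		show "c_comp (horizontal_cat K) \<rho> (c_comp (horizontal_cat K) nu mu) = c_comp (horizontal_cat K) (c_comp (horizontal_cat K) \<rho> nu) mu"
			using loose_assoc[OF m[THEN modif_src] e] loose_assoc[OF m[THEN modif_tgt] e']
			by (auto simp: horizontal_cat_def C.HCmp_assoc m modif_cell hc e intro!: modif_eqI)
	qed (simp_all add: horizontal_cat_def modif_src modif_tgt loose_id modif_VId modif_HCmp loose_src loose_tgt)
	moreover have "HCmp K (VId K g) (VId K f) = VId K (Cmp K g f)" if "f : Arr K" "g : Arr K" "Dom K g = Cod K f" for f g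
		using that by (auto intro!: modif_eqI simp: C.HCmp_VId lf)
	moreover have "HCmp K (VCmp K be' be) (VCmp K al' al) = VCmp K (HCmp K be' al') (HCmp K be al)"
		if "al : Cell K" "al' : Cell K" "be : Cell K" "be' : Cell K"
			"Src K al' = Tgt K al" "Src K be' = Tgt K be" "Dom K (Src K be) = Cod K (Src K al)" for al al' be be'
		using that by (simp, intro restrict_ext) (simp add: mf lf C.interchange)
	ultimately have "two_category K"
		unfolding two_category_def by (simp add: modif_ends)
	moreover have "Tight K \<subseteq> Arr K" by (auto simp: tight_iff)
	moreover have "Idn K M : Tight K" if "M : Obj K" for M
	proof -
		interpret M: twofun S C M by unfold_locales (use that in simp)
		show ?thesis using that loose_id[of M] by (auto simp: tight_iff Idn_tight[OF C])
	qed
	moreover have "Cmp K g f : Tight K" if "f : Tight K" "g : Tight K" "Dom K g = Cod K f" for f g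
	proof -
		have fg: "f : loose_trans S C v w" "g : loose_trans S C v w" "tsrc g = ttgt f" using that by (auto simp: tight_iff)
		have "strong C v (tcell (trans_comp S C w g f) s)" if s: "s : Arr S" for s
			by (rule loose_comp(2)[OF fg _ _ s]) (use that \<open>f : Tight K\<close> \<open>g : Tight K\<close> in \<open>auto simp: tight_iff\<close>)
		then show ?thesis using that loose_comp(1)[OF fg] fg
			by (auto simp: tight_iff lf intro!: Cmp_tight[OF C] simp del: trans_comp_sel(4))
	qed
	ultimately show ?thesis by (simp add: fcategory_def)
qed

text \<open>Identities and inverses of modifications are found pointwise, by
  \<open>lmodif_eq\<close> and \<open>lmodif_inverse\<close>. Through this the strength of an
  interchange cell of a curried multifunctor is compared with the strengths of the original
  cells.\<close>

lemma strong_Fun: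
	assumes m: "mu : modifications S C v w"
	shows "strong K u mu \<longleftrightarrow> (\<forall>x\<in>Obj S. strong C u (mcmp mu x))"
proof -
	interpret K: twocat K by unfold_locales (rule fcategory_two_category[OF fcategory_Fun])
	have "mu : VId K ` Arr K \<longleftrightarrow> (\<forall>x\<in>Obj S. mcmp mu x : VId C ` Arr C)"
	proof
		assume r: "\<forall>x\<in>Obj S. mcmp mu x : VId C ` Arr C"
		have "mcmp mu x : VId (ori w C) ` Arr (ori w C)" if "x : Obj (ori w S)" for x using r that by simp
		note e = lmodif_eq[OF S' C' loose_lnat[OF modif_osrc[OF m]] loose_lnat[OF modif_otgt[OF m]] modif_lmodif[OF m] this]
		have mm: "mtgt mu = msrc mu" "!!x. x : Obj S ==> mcmp mu x = VId C (tob (msrc mu) x)"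
			using e by (cases "w = Colax"; simp add: osrc_def otgt_def)+
		have "mu = VId K (msrc mu)"
			using mm modif_ext[OF m] by (intro modif_eqI) simp_all
		then show "mu : VId K ` Arr K" using modif_src[OF m] by (metis Fun_sel(2) imageI)
	qed (auto simp: loose_tob)
	moreover have "(\<exists>nu. inverse_cells K mu nu) \<longleftrightarrow> (\<forall>x\<in>Obj S. \<exists>be. inverse_cells C (mcmp mu x) be)"
	proof
		assume "\<exists>nu. inverse_cells K mu nu"
		then obtain nu where i: "inverse_cells K mu nu" by blast
		then have n: "nu : modifications S C v w" "msrc nu = mtgt mu" "mtgt nu = msrc mu" by (simp_all add: inverse_cells_def)
		have "inverse_cells C (mcmp mu x) (mcmp nu x)" if x: "x : Obj S" for x
		proof -
			have "mcmp (VCmp K nu mu) x = mcmp (VId K (Src K mu)) x" "mcmp (VCmp K mu nu) x = mcmp (VId K (Tgt K mu)) x"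
				using i by (simp_all only: inverse_cells_def)
			then show ?thesis using x m n by (simp add: inverse_cells_def modif_cell modif_Src modif_Tgt)
		qed
		then show "\<forall>x\<in>Obj S. \<exists>be. inverse_cells C (mcmp mu x) be" by blast
	next
		assume "\<forall>x\<in>Obj S. \<exists>be. inverse_cells C (mcmp mu x) be"
		then obtain n where n: "!!x. x : Obj S ==> inverse_cells C (mcmp mu x) (n x)" by metis
		let ?nu = "\<lparr>msrc = mtgt mu, mtgt = msrc mu, mcmp = restrict n (Obj S)\<rparr>"
		have "lmodif (ori w S) (ori w C) (otgt w mu) (osrc w mu) (restrict n (Obj S))"
			by (rule lmodif_inverse[OF S' C' loose_lnat[OF modif_osrc[OF m]] loose_lnat[OF modif_otgt[OF m]] modif_lmodif[OF m]])
				(use n in simp)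
		then have "?nu : modifications S C v w"
			using modif_src[OF m] modif_tgt[OF m] by (auto simp: modif_iff osrc_def otgt_def)
		moreover have "n x : Cell C & Src C (n x) = Tgt C (mcmp mu x) & Tgt C (n x) = Src C (mcmp mu x) &
			VCmp C (n x) (mcmp mu x) = VId C (Src C (mcmp mu x)) & VCmp C (mcmp mu x) (n x) = VId C (Tgt C (mcmp mu x))"
			if "x : Obj S" for x using n[OF that] by (simp add: inverse_cells_def)
		ultimately have "inverse_cells K mu ?nu"
			using m by (auto simp: inverse_cells_def modif_Src modif_Tgt intro!: modif_eqI)
		then show "\<exists>nu. inverse_cells K mu nu" by blast
	qed
	ultimately show ?thesis by (auto simp: strong_def simp del: Fun_sel)
qed

end

section \<open>The multifunctor axioms as equations between oriented cells\<close>

section \<open>Multifunctors by equations\<close>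

text \<open>Condition (c) of a multifunctor speaks of reflected cells in the dual weakness. Undoing
  the reflection turns it into equations in the same orientation as condition (b).\<close>

lemma wnatural_dual_iff:
	fixes c tb
	assumes S: "two_category S" and C: "two_category C" and M: "ffunctor S C M" and N: "ffunctor S C N"
		and tb: "!!x. x : Obj S ==> tb x : Arr C" "!!x. x : Obj S ==> Dom C (tb x) = F0 M x"
			"!!x. x : Obj S ==> Cod C (tb x) = F0 N x"
		and c: "!!s. s : Arr S ==> c s : Cell C"
			"!!s. s : Arr S ==> Src (ori w C) (c s) = Cmp C (tb (Cod S s)) (F1 M s)"
			"!!s. s : Arr S ==> Tgt (ori w C) (c s) = Cmp C (F1 N s) (tb (Dom S s))"
			"!!s. s : Arr S ==> strong C w (c s)"
	shows "wnatural S C (dual w) \<lparr>tsrc = M, ttgt = N, tob = restrict tb (Obj S), tcell = (\<lambda>s\<in>Arr S. reflect C w (c s))\<rparr> \<longleftrightarrow>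
		(\<forall>x\<in>Obj S. c (Idn S x) = VId C (tb x)) &
		(\<forall>s\<in>Arr S. \<forall>t\<in>Arr S. Dom S t = Cod S s --> c (Cmp S t s) =
			 VCmp (ori w C) (whisker_left C (F1 N t) (c s)) (whisker_right C (c t) (F1 M s))) &
		(\<forall>al\<in>Cell S. VCmp (ori w C) (c (Tgt (ori w S) al)) (whisker_left C (tb (Cod S (Src S al))) (F2 M al)) =
			 VCmp (ori w C) (whisker_right C (F2 N al) (tb (Dom S (Src S al)))) (c (Src (ori w S) al)))"
proof -
	interpret M: twofun S C M by unfold_locales (use assms in auto)
	interpret N: twofun S C N by unfold_locales (use assms in auto)
	have cs: "Dom C (Src C (c s)) = F0 M (Dom S s)" "Cod C (Src C (c s)) = F0 N (Cod S s)" if "s : Arr S" for s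
		using M.B.Dom_Src_ori[OF c(1)[OF that], of w] M.B.Cod_Src_ori[OF c(1)[OF that], of w] that
		by (simp_all add: c tb)
	have wc: "wcell C (dual w) (tb (Dom S s)) (F1 M s) (F1 N s) (tb (Cod S s)) (reflect C w (c s))" if s: "s : Arr S" for s
		by (subst wcell_iff[OF C]) (use s in \<open>simp_all add: c tb\<close>)
	have u: "reflect C w (c (Idn S x)) = VId C (tb x) \<longleftrightarrow> c (Idn S x) = VId C (tb x)" if "x : Obj S" for x
	proof -
		have "reflect C w (c (Idn S x)) = reflect C w (VId C (tb x)) \<longleftrightarrow> c (Idn S x) = VId C (tb x)"
			by (rule M.B.reflect_inj) (use that in \<open>simp_all add: c tb\<close>)
		then show ?thesis using that by (simp add: tb)
	qed
	\<comment> \<open>Reflection reverses composites and is injective on strong cells, so the whole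
	  equation can be reflected at once.\<close>
	have m: "reflect C w (c (Cmp S t s)) = vseq C (dual w) (whisker_left C (F1 N t) (reflect C w (c s)))
			(whisker_right C (reflect C w (c t)) (F1 M s)) \<longleftrightarrow>
		c (Cmp S t s) = VCmp (ori w C) (whisker_left C (F1 N t) (c s)) (whisker_right C (c t) (F1 M s))"
		if st: "s : Arr S" "t : Arr S" "Dom S t = Cod S s" for s t
	proof -
		interpret O: twocat "ori w C" by unfold_locales (rule ori_two_category[OF C])
		note o = O.Src_wl O.Tgt_wr O.wl_cell O.wr_cell O.VCmp_cell O.strong_VCmp O.Src_wr O.Tgt_wl
		note o' = o[unfolded ori_simps strong_ori]
		have oc: "Dom C (Src (ori w C) (c s)) = F0 M (Dom S s)" "Cod C (Src (ori w C) (c s)) = F0 N (Cod S s)"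
			if "s : Arr S" for s
			by (simp_all only: M.B.Dom_Src_ori[OF c(1)[OF that]] M.B.Cod_Src_ori[OF c(1)[OF that]] cs[OF that])
		have wl: "whisker_left C (F1 N t) (reflect C w (c s)) = reflect C w (whisker_left C (F1 N t) (c s))"
			by (rule M.B.reflect_wl[symmetric]) (use st in \<open>simp_all add: c cs\<close>)
		have wr: "whisker_right C (reflect C w (c t)) (F1 M s) = reflect C w (whisker_right C (c t) (F1 M s))"
			by (rule M.B.reflect_wr[symmetric]) (use st in \<open>simp_all add: c cs\<close>)
		have k: "whisker_left C (F1 N t) (c s) : Cell C" "strong C w (whisker_left C (F1 N t) (c s))"
			"whisker_right C (c t) (F1 M s) : Cell C" "strong C w (whisker_right C (c t) (F1 M s))"
			using st by (simp_all add: c cs)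
		have e: "Src (ori w C) (whisker_left C (F1 N t) (c s)) = Tgt (ori w C) (whisker_right C (c t) (F1 M s))"
			using st by (subst o'(1); simp add: c oc tb) (subst o'(2); simp add: c oc tb)
		show ?thesis
			unfolding vseq_ori wl wr M.B.reflect_VCmp[OF k(3,4,1,2) e, symmetric]
			by (rule M.B.reflect_inj) (use st k e in \<open>simp_all add: c o'\<close>)
	qed
	have cell: "compatible C (dual w) (reflect C w (c (Src S al))) (reflect C w (c (Tgt S al)))
			(whisker_right C (F2 N al) (tb (Dom S (Src S al)))) (whisker_left C (tb (Cod S (Src S al))) (F2 M al)) \<longleftrightarrow>
		VCmp (ori w C) (c (Tgt (ori w S) al)) (whisker_left C (tb (Cod S (Src S al))) (F2 M al)) =
			 VCmp (ori w C) (whisker_right C (F2 N al) (tb (Dom S (Src S al)))) (c (Src (ori w S) al))"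
		if a: "al : Cell S" for al
	proof -
		have "compatible C (dual w) (reflect C w (c (Src S al))) (reflect C w (c (Tgt S al)))
			(whisker_right C (F2 N al) (tb (Dom S (Src S al)))) (whisker_left C (tb (Cod S (Src S al))) (F2 M al)) \<longleftrightarrow>
			compatible C w (c (Src S al)) (c (Tgt S al)) (whisker_left C (tb (Cod S (Src S al))) (F2 M al))
				(whisker_right C (F2 N al) (tb (Dom S (Src S al))))"
			by (rule M.B.compatible_reflect)
				(use a c(2,3)[of "Src S al"] c(2,3)[of "Tgt S al"] in \<open>simp_all add: c(1,4) tb ori_other\<close>)
		also have "\<dots> \<longleftrightarrow> VCmp (ori w C) (c (Tgt (ori w S) al)) (whisker_left C (tb (Cod S (Src S al))) (F2 M al)) =
			 VCmp (ori w C) (whisker_right C (F2 N al) (tb (Dom S (Src S al)))) (c (Src (ori w S) al))"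
			by (cases "w = Colax") (auto simp: compatible_def ori_Colax ori_other)
		finally show ?thesis .
	qed
	show ?thesis
		unfolding wnatural_def Let_def wtrans.simps
		using M N by (simp add: tb wc u m cell cong: conj_cong)
qed

definition mf_fun :: "('o, 'a, 't) fcat list => ('p, 'b, 's) fcat => ('o, 'a, 't, 'p, 'b, 's) mfun => nat => bool" where
	"mf_fun Ss C M i \<longleftrightarrow> (\<forall>xs\<in>tuples Ss. ffunctor (Ss ! i) C (slice Ss M i xs))"

definition mf_cells :: "weakness => weakness => ('o, 'a, 't) fcat list => ('p, 'b, 's) fcat =>
		('o, 'a, 't, 'p, 'b, 's) mfun => nat => nat => bool" where
	"mf_cells v w Ss C M i j \<longleftrightarrow> (\<forall>xs s t. arr_at Ss i xs s & arr_at Ss j xs t -->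
		 mx M i j xs s t : Cell C &
		 Src (ori w C) (mx M i j xs s t) = Cmp C (m1 M j (xs[i := Cod (Ss ! i) s]) t) (m1 M i xs s) &
		 Tgt (ori w C) (mx M i j xs s t) = Cmp C (m1 M i (xs[j := Cod (Ss ! j) t]) s) (m1 M j xs t) &
		 strong C w (mx M i j xs s t) &
		 (s : Tight (Ss ! i) \<or> t : Tight (Ss ! j) --> strong C v (mx M i j xs s t)))"

text \<open>Condition (b) of a multifunctor, for a fixed arrow in position \<open>i\<close>: its
  unit, composition and 2-cell equations in position \<open>j\<close>.\<close>

definition mf_right :: "weakness => ('o, 'a, 't) fcat list => ('p, 'b, 's) fcat =>
		('o, 'a, 't, 'p, 'b, 's) mfun => nat => nat => bool" where
	"mf_right w Ss C M i j \<longleftrightarrow>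
		 (\<forall>xs s. arr_at Ss i xs s --> mx M i j xs s (Idn (Ss ! j) (xs ! j)) = VId C (m1 M i xs s)) &
		 (\<forall>xs s t t'. arr_at Ss i xs s & arr_at Ss j xs t & t' : Arr (Ss ! j) & Dom (Ss ! j) t' = Cod (Ss ! j) t -->
				mx M i j xs s (Cmp (Ss ! j) t' t) =
				VCmp (ori w C) (whisker_right C (mx M i j (xs[j := Cod (Ss ! j) t]) s t') (m1 M j xs t))
					(whisker_left C (m1 M j (xs[i := Cod (Ss ! i) s, j := Cod (Ss ! j) t]) t') (mx M i j xs s t))) &
		 (\<forall>xs s be. arr_at Ss i xs s & cell_at Ss j xs be -->
				VCmp (ori w C) (mx M i j xs s (Tgt (ori w (Ss ! j)) be))
					(whisker_right C (m2 M j (xs[i := Cod (Ss ! i) s]) be) (m1 M i xs s)) =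
				VCmp (ori w C) (whisker_left C (m1 M i (xs[j := Cod (Ss ! j) (Src (Ss ! j) be)]) s) (m2 M j xs be))
					(mx M i j xs s (Src (ori w (Ss ! j)) be)))"

text \<open>Condition (c) with the reflection removed, hence stated in orientation \<open>w\<close>
  like \<open>mf_right\<close>.\<close>

definition mf_left :: "weakness => ('o, 'a, 't) fcat list => ('p, 'b, 's) fcat =>
		('o, 'a, 't, 'p, 'b, 's) mfun => nat => nat => bool" where
	"mf_left w Ss C M i j \<longleftrightarrow>
		 (\<forall>xs t. arr_at Ss j xs t --> mx M i j xs (Idn (Ss ! i) (xs ! i)) t = VId C (m1 M j xs t)) &
		 (\<forall>xs s s' t. arr_at Ss i xs s & arr_at Ss j xs t & s' : Arr (Ss ! i) & Dom (Ss ! i) s' = Cod (Ss ! i) s -->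
				mx M i j xs (Cmp (Ss ! i) s' s) t =
				VCmp (ori w C) (whisker_left C (m1 M i (xs[j := Cod (Ss ! j) t, i := Cod (Ss ! i) s]) s') (mx M i j xs s t))
					(whisker_right C (mx M i j (xs[i := Cod (Ss ! i) s]) s' t) (m1 M i xs s))) &
		 (\<forall>xs t al. arr_at Ss j xs t & cell_at Ss i xs al -->
				VCmp (ori w C) (mx M i j xs (Tgt (ori w (Ss ! i)) al) t)
					(whisker_left C (m1 M j (xs[i := Cod (Ss ! i) (Src (Ss ! i) al)]) t) (m2 M i xs al)) =
				VCmp (ori w C) (whisker_right C (m2 M i (xs[j := Cod (Ss ! j) t]) al) (m1 M j xs t))
					(mx M i j xs (Src (ori w (Ss ! i)) al) t))"

lemma tuples_nth: "xs : tuples Ss ==> i < length Ss ==> xs ! i : Obj (Ss ! i)"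
	by (simp add: tuples_def)

lemma tuples_length: "xs : tuples Ss ==> length xs = length Ss"
	by (simp add: tuples_def)

lemma tuples_update: "xs : tuples Ss ==> x : Obj (Ss ! i) ==> xs[i := x] : tuples Ss"
	by (cases "i < length xs") (auto simp: tuples_def nth_list_update)

lemma arr_at_tuples: "arr_at Ss i xs s ==> xs : tuples Ss"
	and arr_at_less: "arr_at Ss i xs s ==> i < length Ss"
	and arr_at_arr: "arr_at Ss i xs s ==> s : Arr (Ss ! i)"
	and arr_at_Dom: "arr_at Ss i xs s ==> Dom (Ss ! i) s = xs ! i"
	by (simp_all add: arr_at_def)

lemma arr_at_update: "arr_at Ss i xs s ==> i ~= j ==> x : Obj (Ss ! j) ==> arr_at Ss i (xs[j := x]) s"
	by (simp add: arr_at_def tuples_update)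

locale fcats =
	fixes Ss :: "('o, 'a, 't) fcat list"
	assumes fcat: "i < length Ss ==> fcategory (Ss ! i)"
begin

lemma S_twocat: "i < length Ss ==> twocat (Ss ! i)"
	by unfold_locales (rule fcategory_two_category[OF fcat])

lemma Cod_at: "arr_at Ss i xs s ==> Cod (Ss ! i) s : Obj (Ss ! i)"
	using twocat.Cod_ob[OF S_twocat] arr_at_less arr_at_arr by metis

lemma update_Cod: "arr_at Ss i xs s ==> xs[i := Cod (Ss ! i) s] : tuples Ss"
	using Cod_at arr_at_tuples tuples_update by metis

lemma arr_at_next: "arr_at Ss i xs s ==> s' : Arr (Ss ! i) ==> Dom (Ss ! i) s' = Cod (Ss ! i) s ==>
		arr_at Ss i (xs[i := Cod (Ss ! i) s]) s'"
	using update_Cod[of i xs s] tuples_length[of xs Ss] unfolding arr_at_def by simp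

lemma arr_at_cross: "arr_at Ss i xs s ==> arr_at Ss j xs t ==> i ~= j ==> arr_at Ss i (xs[j := Cod (Ss ! j) t]) s"
	using arr_at_update Cod_at by metis

lemma arr_at_Cmp: "arr_at Ss i xs s ==> s' : Arr (Ss ! i) ==> Dom (Ss ! i) s' = Cod (Ss ! i) s ==>
		arr_at Ss i xs (Cmp (Ss ! i) s' s)"
	using twocat.Cmp_arr[OF S_twocat] twocat.Dom_Cmp[OF S_twocat] by (simp add: arr_at_def)

lemma arr_at_Idn: "xs : tuples Ss ==> i < length Ss ==> arr_at Ss i xs (Idn (Ss ! i) (xs ! i))"
	unfolding arr_at_def using twocat.Idn_arr[OF S_twocat] twocat.Dom_Idn[OF S_twocat] tuples_nth by blast

lemma arr_at_Src: "cell_at Ss i xs al ==> arr_at Ss i xs (Src (Ss ! i) al)"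
	and arr_at_Tgt: "cell_at Ss i xs al ==> arr_at Ss i xs (Tgt (Ss ! i) al)"
	using twocat.Src_arr[OF S_twocat] twocat.Tgt_arr[OF S_twocat] twocat.Dom_Tgt[OF S_twocat]
	by (simp_all add: arr_at_def cell_at_def)

lemma arr_at_oSrc: "cell_at Ss i xs al ==> arr_at Ss i xs (Src (ori w (Ss ! i)) al)"
	and arr_at_oTgt: "cell_at Ss i xs al ==> arr_at Ss i xs (Tgt (ori w (Ss ! i)) al)"
	using arr_at_Src arr_at_Tgt by (cases "w = Colax"; simp add: ori_Colax ori_other)+

lemma Cod_oTgt: "cell_at Ss i xs al ==> Cod (Ss ! i) (Tgt (ori w (Ss ! i)) al) = Cod (Ss ! i) (Src (Ss ! i) al)"
	and Cod_oSrc: "cell_at Ss i xs al ==> Cod (Ss ! i) (Src (ori w (Ss ! i)) al) = Cod (Ss ! i) (Src (Ss ! i) al)"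
	using twocat.Cod_Tgt[OF S_twocat] by (cases "w = Colax"; simp add: ori_Colax ori_other cell_at_def)+

end

locale mf_setup = fcats Ss for Ss :: "('o, 'a, 't) fcat list" +
	fixes C :: "('p, 'b, 's) fcat" and M :: "('o, 'a, 't, 'p, 'b, 's) mfun"
	assumes C: "fcategory C"
begin

sublocale C: twocat C by unfold_locales (rule fcategory_two_category[OF C])

lemma slice_twofun:
	assumes "mf_fun Ss C M i" "xs : tuples Ss" "i < length Ss"
	shows "twofun (Ss ! i) C (slice Ss M i xs)"
	using assms fcat C by unfold_locales (simp_all add: mf_fun_def fcategory_two_category)

lemma
	assumes f: "mf_fun Ss C M i" and a: "arr_at Ss i xs s"
	shows m1_arr: "m1 M i xs s : Arr C" and m1_Dom: "Dom C (m1 M i xs s) = m0 M xs"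
		and m1_Cod: "Cod C (m1 M i xs s) = m0 M (xs[i := Cod (Ss ! i) s])"
		and m1_tight: "s : Tight (Ss ! i) ==> m1 M i xs s : Tight C"
		and m1_Cmp: "s' : Arr (Ss ! i) ==> Dom (Ss ! i) s' = Cod (Ss ! i) s ==>
			m1 M i xs (Cmp (Ss ! i) s' s) = Cmp C (m1 M i (xs[i := Cod (Ss ! i) s]) s') (m1 M i xs s)"
proof -
	note t = arr_at_tuples[OF a] arr_at_less[OF a] arr_at_arr[OF a] arr_at_Dom[OF a]
	interpret F: twofun "Ss ! i" C "slice Ss M i xs" by (rule slice_twofun[OF f t(1,2)])
	have e: "F1 (slice Ss M i xs) s = m1 M i xs s" "F0 (slice Ss M i xs) (xs ! i) = m0 M xs"
		"F0 (slice Ss M i xs) (Cod (Ss ! i) s) = m0 M (xs[i := Cod (Ss ! i) s])"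
		using t by (simp_all add: slice_def tuples_nth)
	show "m1 M i xs s : Arr C" "Dom C (m1 M i xs s) = m0 M xs" "Cod C (m1 M i xs s) = m0 M (xs[i := Cod (Ss ! i) s])"
		"s : Tight (Ss ! i) ==> m1 M i xs s : Tight C"
		using F.F1_arr[of s] F.Dom_F1[of s] F.Cod_F1[of s] F.F1_tight[of s] t(3,4) e by simp_all
	show "m1 M i xs (Cmp (Ss ! i) s' s) = Cmp C (m1 M i (xs[i := Cod (Ss ! i) s]) s') (m1 M i xs s)"
		if "s' : Arr (Ss ! i)" "Dom (Ss ! i) s' = Cod (Ss ! i) s"
		using F.F1_Cmp[of s s'] that t(3,4) by (simp add: slice_def)
qed

lemma m1_Idn: "mf_fun Ss C M i ==> xs : tuples Ss ==> i < length Ss ==> m1 M i xs (Idn (Ss ! i) (xs ! i)) = Idn C (m0 M xs)"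
proof -
	assume a: "mf_fun Ss C M i" "xs : tuples Ss" "i < length Ss"
	interpret F: twofun "Ss ! i" C "slice Ss M i xs" by (rule slice_twofun[OF a])
	show ?thesis using F.F1_Idn[of "xs ! i"] tuples_nth[OF a(2,3)] by (simp add: slice_def)
qed

lemma
	assumes f: "mf_fun Ss C M i" and a: "cell_at Ss i xs al"
	shows m2_cell: "m2 M i xs al : Cell C" and m2_Src: "Src C (m2 M i xs al) = m1 M i xs (Src (Ss ! i) al)"
		and m2_Tgt: "Tgt C (m2 M i xs al) = m1 M i xs (Tgt (Ss ! i) al)"
		and m2_VCmp: "be : Cell (Ss ! i) ==> Src (Ss ! i) be = Tgt (Ss ! i) al ==>
			m2 M i xs (VCmp (Ss ! i) be al) = VCmp C (m2 M i xs be) (m2 M i xs al)"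
		and m2_HCmp: "be : Cell (Ss ! i) ==> Dom (Ss ! i) (Src (Ss ! i) be) = Cod (Ss ! i) (Src (Ss ! i) al) ==>
			m2 M i xs (HCmp (Ss ! i) be al) = HCmp C (m2 M i (xs[i := Cod (Ss ! i) (Src (Ss ! i) al)]) be) (m2 M i xs al)"
proof -
	have t: "xs : tuples Ss" "i < length Ss" "al : Cell (Ss ! i)" "Dom (Ss ! i) (Src (Ss ! i) al) = xs ! i"
		using a by (simp_all add: cell_at_def)
	interpret F: twofun "Ss ! i" C "slice Ss M i xs" by (rule slice_twofun[OF f t(1,2)])
	show "m2 M i xs al : Cell C" "Src C (m2 M i xs al) = m1 M i xs (Src (Ss ! i) al)"
		"Tgt C (m2 M i xs al) = m1 M i xs (Tgt (Ss ! i) al)"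
		using F.F2_cell[of al] F.Src_F2[of al] F.Tgt_F2[of al] t(3,4) by (simp_all add: slice_def)
	show "m2 M i xs (VCmp (Ss ! i) be al) = VCmp C (m2 M i xs be) (m2 M i xs al)"
		if b: "be : Cell (Ss ! i)" "Src (Ss ! i) be = Tgt (Ss ! i) al"
		using F.F2_VCmp[of al be] t(3,4) b by (simp add: slice_def)
	show "m2 M i xs (HCmp (Ss ! i) be al) = HCmp C (m2 M i (xs[i := Cod (Ss ! i) (Src (Ss ! i) al)]) be) (m2 M i xs al)"
		if b: "be : Cell (Ss ! i)" "Dom (Ss ! i) (Src (Ss ! i) be) = Cod (Ss ! i) (Src (Ss ! i) al)"
		using F.F2_HCmp[of al be] t(3,4) b by (simp add: slice_def)
qed

lemma m2_VId: "mf_fun Ss C M i ==> arr_at Ss i xs s ==> m2 M i xs (VId (Ss ! i) s) = VId C (m1 M i xs s)"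
proof -
	assume f: "mf_fun Ss C M i" and a: "arr_at Ss i xs s"
	note t = arr_at_tuples[OF a] arr_at_less[OF a] arr_at_arr[OF a] arr_at_Dom[OF a]
	interpret F: twofun "Ss ! i" C "slice Ss M i xs" by (rule slice_twofun[OF f t(1,2)])
	show ?thesis using F.F2_VId[of s] t(3,4) by (simp add: slice_def)
qed

lemma mf_funI:
	assumes i: "i < length Ss"
		and "!!xs. xs : tuples Ss ==> m0 M xs : Obj C"
		and "!!xs s. arr_at Ss i xs s ==> m1 M i xs s : Arr C"
			"!!xs s. arr_at Ss i xs s ==> Dom C (m1 M i xs s) = m0 M xs"
			"!!xs s. arr_at Ss i xs s ==> Cod C (m1 M i xs s) = m0 M (xs[i := Cod (Ss ! i) s])"
			"!!xs s. arr_at Ss i xs s ==> s : Tight (Ss ! i) ==> m1 M i xs s : Tight C"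
			"!!xs. xs : tuples Ss ==> m1 M i xs (Idn (Ss ! i) (xs ! i)) = Idn C (m0 M xs)"
			"!!xs s s'. arr_at Ss i xs s ==> s' : Arr (Ss ! i) ==> Dom (Ss ! i) s' = Cod (Ss ! i) s ==>
				m1 M i xs (Cmp (Ss ! i) s' s) = Cmp C (m1 M i (xs[i := Cod (Ss ! i) s]) s') (m1 M i xs s)"
			"!!xs al. cell_at Ss i xs al ==> m2 M i xs al : Cell C"
			"!!xs al. cell_at Ss i xs al ==> Src C (m2 M i xs al) = m1 M i xs (Src (Ss ! i) al)"
			"!!xs al. cell_at Ss i xs al ==> Tgt C (m2 M i xs al) = m1 M i xs (Tgt (Ss ! i) al)"
			"!!xs s. arr_at Ss i xs s ==> m2 M i xs (VId (Ss ! i) s) = VId C (m1 M i xs s)"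
			"!!xs al be. cell_at Ss i xs al ==> be : Cell (Ss ! i) ==> Src (Ss ! i) be = Tgt (Ss ! i) al ==>
				m2 M i xs (VCmp (Ss ! i) be al) = VCmp C (m2 M i xs be) (m2 M i xs al)"
			"!!xs al be. cell_at Ss i xs al ==> be : Cell (Ss ! i) ==>
				Dom (Ss ! i) (Src (Ss ! i) be) = Cod (Ss ! i) (Src (Ss ! i) al) ==>
				m2 M i xs (HCmp (Ss ! i) be al) = HCmp C (m2 M i (xs[i := Cod (Ss ! i) (Src (Ss ! i) al)]) be) (m2 M i xs al)"
	shows "mf_fun Ss C M i"
	unfolding mf_fun_def
proof
	fix xs assume xs: "xs : tuples Ss"
	interpret S: twocat "Ss ! i" by (rule S_twocat[OF i])
	have l: "length xs = length Ss" using xs by (rule tuples_length)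
	have a: "arr_at Ss i (xs[i := Dom (Ss ! i) s]) s" if "s : Arr (Ss ! i)" for s
		using that xs i l by (simp add: arr_at_def tuples_update)
	have c: "cell_at Ss i (xs[i := Dom (Ss ! i) (Src (Ss ! i) al)]) al" if "al : Cell (Ss ! i)" for al
		using that xs i l by (simp add: cell_at_def tuples_update)
	show "ffunctor (Ss ! i) C (slice Ss M i xs)"
	\<comment> \<open>Cases 9, 10, 14, 15 and 16 are identities, composites, vertical composites,
	  horizontal composites and tightness.\<close>
	proof (rule ffunctorI, goal_cases)
		case (9 x)
		then show ?case using assms(7)[of "xs[i := x]"] xs i l by (simp add: slice_def tuples_update)
	next
		case (10 f g)
		then show ?case using assms(8)[OF a[of f], of g] by (simp add: slice_def)
	next
		case (14 al be)
		then show ?case using assms(13)[OF c[of al], of be] by (simp add: slice_def)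
	next
		case (15 al be)
		then show ?case using assms(14)[OF c[of al], of be] by (simp add: slice_def)
	next
		case (16 f)
		then show ?case using assms(6)[OF a] Tight_arr[OF fcat[OF i]] by (simp add: slice_def)
	qed (simp_all add: slice_def assms(2) assms(3-5,12)[OF a] assms(9-11)[OF c] xs tuples_update S.two_category l i)
qed

text \<open>Normal form of a multifunctor: typing, strengths and equations, all in the single
  orientation \<open>w\<close>. Everything after \<open>multifunctor_iff_nmf\<close> can work with
  it in place of natural transformations of four kinds.\<close>

definition nmf :: "weakness => weakness => bool" where
	"nmf v w \<longleftrightarrow> mfun_restrict Ss M = M & (\<forall>xs\<in>tuples Ss. m0 M xs : Obj C) &
		 (\<forall>i<length Ss. mf_fun Ss C M i) &
		 (\<forall>i j. i < j & j < length Ss --> mf_cells v w Ss C M i j & mf_right w Ss C M i j & mf_left w Ss C M i j) &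
		 (\<forall>i j k xs s t u. i < j & j < k & arr_at Ss i xs s & arr_at Ss j xs t & arr_at Ss k xs u -->
				cubical Ss C w M i j k xs s t u)"

lemma mf_cells_iff:
	assumes f: "mf_fun Ss C M i" "mf_fun Ss C M j" and ij: "i ~= j" and vw: "v \<preceq> w"
	shows "(\<forall>xs s t. arr_at Ss i xs s & arr_at Ss j xs t -->
				(let f = m1 M i xs s; g = m1 M j xs t;
						 h = m1 M j (xs[i := Cod (Ss ! i) s]) t; k = m1 M i (xs[j := Cod (Ss ! j) t]) s
				 in wcell C w f g h k (mx M i j xs s t) &
						(s : Tight (Ss ! i) \<or> t : Tight (Ss ! j) -->
							 wcell_at C v w f g h k (mx M i j xs s t)))) \<longleftrightarrow> mf_cells v w Ss C M i j"
	unfolding mf_cells_def Let_def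
proof (intro all_cong1 imp_cong refl)
	fix xs s t assume a: "arr_at Ss i xs s & arr_at Ss j xs t"
	then have b: "arr_at Ss i xs s" "arr_at Ss j (xs[i := Cod (Ss ! i) s]) t"
		using arr_at_cross[of j xs t i s] ij by auto
	have c: "Dom C (m1 M j (xs[i := Cod (Ss ! i) s]) t) = Cod C (m1 M i xs s)"
		by (simp only: m1_Dom[OF f(2) b(2)] m1_Cod[OF f(1) b(1)])
	note w = wcell_iff[OF C.two_category m1_arr[OF f(1) b(1)] m1_arr[OF f(2) b(2)] c]
	note wa = wcell_at_iff[OF C.two_category m1_arr[OF f(1) b(1)] m1_arr[OF f(2) b(2)] c vw]
	let ?g = "m1 M j xs t" and ?k = "m1 M i (xs[j := Cod (Ss ! j) t]) s"
	show "(wcell C w (m1 M i xs s) ?g (m1 M j (xs[i := Cod (Ss ! i) s]) t) ?k (mx M i j xs s t) &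
			(s : Tight (Ss ! i) \<or> t : Tight (Ss ! j) -->
				wcell_at C v w (m1 M i xs s) ?g (m1 M j (xs[i := Cod (Ss ! i) s]) t) ?k (mx M i j xs s t))) =
		(mx M i j xs s t : Cell C &
		 Src (ori w C) (mx M i j xs s t) = Cmp C (m1 M j (xs[i := Cod (Ss ! i) s]) t) (m1 M i xs s) &
		 Tgt (ori w C) (mx M i j xs s t) = Cmp C ?k ?g &
		 strong C w (mx M i j xs s t) &
		 (s : Tight (Ss ! i) \<or> t : Tight (Ss ! j) --> strong C v (mx M i j xs s t)))"
		unfolding w wa by blast
qed

lemma
	assumes "mf_cells v w Ss C M i j" "arr_at Ss i xs s" "arr_at Ss j xs t"
	shows mx_cell: "mx M i j xs s t : Cell C"
		and mx_Src: "Src (ori w C) (mx M i j xs s t) = Cmp C (m1 M j (xs[i := Cod (Ss ! i) s]) t) (m1 M i xs s)"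
		and mx_Tgt: "Tgt (ori w C) (mx M i j xs s t) = Cmp C (m1 M i (xs[j := Cod (Ss ! j) t]) s) (m1 M j xs t)"
		and mx_strong: "strong C w (mx M i j xs s t)"
		and mx_tight: "s : Tight (Ss ! i) \<or> t : Tight (Ss ! j) ==> strong C v (mx M i j xs s t)"
	using assms unfolding mf_cells_def by blast+

text \<open>\<open>wnatural\<close> fixes \<open>xs\<close> and lets the entry at \<open>j\<close>
  run, whereas \<open>mf_right\<close> requires that entry to be the domain of the arrow. Updating
  the entry at \<open>j\<close> translates between the two quantifications.\<close>

lemma mf_right_iff:
	assumes f: "mf_fun Ss C M i" "mf_fun Ss C M j" and c: "mf_cells v w Ss C M i j"
		and ij: "i ~= j" "i < length Ss" "j < length Ss"
	shows "(\<forall>xs s. arr_at Ss i xs s --> wnatural (Ss ! j) C w (slice_right Ss M i j xs s)) \<longleftrightarrow> mf_right w Ss C M i j"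
proof -
	interpret S: twocat "Ss ! j" by (rule S_twocat[OF ij(3)])
	have at: "arr_at Ss i (xs[j := y]) s" if "arr_at Ss i xs s" "y : Obj (Ss ! j)" for xs s y
		using that ij by (intro arr_at_update)
	have at2: "arr_at Ss j (xs[j := Dom (Ss ! j) t]) t" if "arr_at Ss i xs s" "t : Arr (Ss ! j)" for xs s t
		using that tuples_update[of xs Ss "Dom (Ss ! j) t" j] ij(3) tuples_length[of xs Ss] by (simp add: arr_at_def)
	have at3: "cell_at Ss j (xs[j := Dom (Ss ! j) (Src (Ss ! j) be)]) be" if "arr_at Ss i xs s" "be : Cell (Ss ! j)" for xs s be
		using that tuples_update[of xs Ss "Dom (Ss ! j) (Src (Ss ! j) be)" j] ij(3) tuples_length[of xs Ss]
		by (simp add: arr_at_def cell_at_def)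
	have sl: "ffunctor (Ss ! j) C (slice Ss M j xs)" if "xs : tuples Ss" for xs
		using f(2) that by (simp add: mf_fun_def)
	have sl': "ffunctor (ori w (Ss ! j)) (ori w C) (slice Ss M j xs)" if "xs : tuples Ss" for xs
		by (rule ffunctor_ori[OF S.two_category C.two_category sl[OF that]])
	have ds: "Dom (Ss ! j) (Tgt (ori w (Ss ! j)) be) = Dom (Ss ! j) (Src (Ss ! j) be)"
		"Dom (Ss ! j) (Src (ori w (Ss ! j)) be) = Dom (Ss ! j) (Src (Ss ! j) be)"
		"Cod (Ss ! j) (Src (ori w (Ss ! j)) be) = Cod (Ss ! j) (Src (Ss ! j) be)"
		"Tgt (ori w (Ss ! j)) be : Arr (Ss ! j)" "Src (ori w (Ss ! j)) be : Arr (Ss ! j)" if "be : Cell (Ss ! j)" for be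
		using that by (cases "w = Colax"; simp add: ori_Colax ori_other)+
	have upd: "xs[i := a, j := b] = xs[j := b, i := a]" for xs :: "'o list" and a b
		using ij(1) by (simp add: list_update_swap)
	have iff: "wnatural (Ss ! j) C w (slice_right Ss M i j xs s) \<longleftrightarrow>
		 (\<forall>y\<in>Obj (Ss ! j). mx M i j (xs[j := y]) s (Idn (Ss ! j) y) = VId C (m1 M i (xs[j := y]) s)) &
		 (\<forall>t\<in>Arr (Ss ! j). \<forall>t'\<in>Arr (Ss ! j). Dom (Ss ! j) t' = Cod (Ss ! j) t -->
				mx M i j (xs[j := Dom (Ss ! j) t]) s (Cmp (Ss ! j) t' t) =
				VCmp (ori w C) (whisker_right C (mx M i j (xs[j := Cod (Ss ! j) t]) s t') (m1 M j (xs[j := Dom (Ss ! j) t]) t))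
					(whisker_left C (m1 M j (xs[i := Cod (Ss ! i) s, j := Cod (Ss ! j) t]) t') (mx M i j (xs[j := Dom (Ss ! j) t]) s t))) &
		 (\<forall>be\<in>Cell (Ss ! j).
				VCmp (ori w C) (mx M i j (xs[j := Dom (Ss ! j) (Src (Ss ! j) be)]) s (Tgt (ori w (Ss ! j)) be))
					(whisker_right C (m2 M j (xs[i := Cod (Ss ! i) s, j := Dom (Ss ! j) (Src (Ss ! j) be)]) be)
						(m1 M i (xs[j := Dom (Ss ! j) (Src (Ss ! j) be)]) s)) =
				VCmp (ori w C) (whisker_left C (m1 M i (xs[j := Cod (Ss ! j) (Src (Ss ! j) be)]) s) (m2 M j (xs[j := Dom (Ss ! j) (Src (Ss ! j) be)]) be))
					(mx M i j (xs[j := Dom (Ss ! j) (Src (Ss ! j) be)]) s (Src (ori w (Ss ! j)) be)))"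
		if a: "arr_at Ss i xs s" for xs s
	proof -
		have xs: "xs : tuples Ss" "xs[i := Cod (Ss ! i) s] : tuples Ss" "length xs = length Ss"
			using update_Cod[OF a] arr_at_tuples[OF a] tuples_length[OF arr_at_tuples[OF a]] by simp_all
		have tob: "m1 M i (xs[j := y]) s : Arr C" "Dom C (m1 M i (xs[j := y]) s) = m0 M (xs[j := y])"
			"Cod C (m1 M i (xs[j := y]) s) = m0 M (xs[i := Cod (Ss ! i) s, j := y])" if "y : Obj (Ss ! j)" for y
			using m1_arr[OF f(1) at[OF a that]] m1_Dom[OF f(1) at[OF a that]] m1_Cod[OF f(1) at[OF a that]] by (simp_all only: upd)
		have cell: "mx M i j (xs[j := Dom (Ss ! j) t]) s t : Cell C"
			"Src (ori w C) (mx M i j (xs[j := Dom (Ss ! j) t]) s t) =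
				 Cmp C (m1 M j (xs[i := Cod (Ss ! i) s, j := Dom (Ss ! j) t]) t) (m1 M i (xs[j := Dom (Ss ! j) t]) s)"
			"Tgt (ori w C) (mx M i j (xs[j := Dom (Ss ! j) t]) s t) =
				 Cmp C (m1 M i (xs[j := Cod (Ss ! j) t]) s) (m1 M j (xs[j := Dom (Ss ! j) t]) t)"
			"strong C w (mx M i j (xs[j := Dom (Ss ! j) t]) s t)" if t: "t : Arr (Ss ! j)" for t
			using mx_cell[OF c at[OF a S.Dom_ob[OF t]] at2[OF a t]] mx_Src[OF c at[OF a S.Dom_ob[OF t]] at2[OF a t]]
				mx_Tgt[OF c at[OF a S.Dom_ob[OF t]] at2[OF a t]] mx_strong[OF c at[OF a S.Dom_ob[OF t]] at2[OF a t]]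
			by (simp_all add: upd)
		show ?thesis
			unfolding wnatural_iff_lnat[OF S.two_category C.two_category] lnat_def slice_right_def wtrans.simps
				ori_simps strong_ori
			using sl'[OF xs(1)] sl'[OF xs(2)] by (simp add: tob cell ds slice_def cong: conj_cong)
	qed
	show ?thesis
		unfolding mf_right_def
	proof (intro iffI conjI allI impI, goal_cases)
		case (1 xs s)
		have y: "xs ! j : Obj (Ss ! j)" by (rule tuples_nth[OF arr_at_tuples[OF 1(2)] ij(3)])
		have "wnatural (Ss ! j) C w (slice_right Ss M i j xs s)" using 1 by blast
		then show ?case using y unfolding iff[OF 1(2)] by (metis list_update_id)
	next
		case (2 xs s t t')
		then have a: "arr_at Ss i xs s" and b: "arr_at Ss j xs t" "t' : Arr (Ss ! j)" "Dom (Ss ! j) t' = Cod (Ss ! j) t" by blast+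
		note n = 2(1)[rule_format, OF a, unfolded iff[OF a], THEN conjunct2, THEN conjunct1, rule_format, OF arr_at_arr[OF b(1)] b(2,3)]
		show ?case using n by (simp add: arr_at_Dom[OF b(1)])
	next
		case (3 xs s be)
		then have a: "arr_at Ss i xs s" and b: "cell_at Ss j xs be" by blast+
		then have d: "Dom (Ss ! j) (Src (Ss ! j) be) = xs ! j" "be : Cell (Ss ! j)" by (simp_all add: cell_at_def)
		have e: "xs[i := Cod (Ss ! i) s, j := xs ! j] = xs[i := Cod (Ss ! i) s]"
			using ij(1) by (metis list_update_id nth_list_update_neq)
		note n = 3(1)[rule_format, OF a, unfolded iff[OF a], THEN conjunct2, THEN conjunct2, rule_format, OF d(2)]
		show ?case using n by (simp add: d(1) e)
	next
		case (4 xs s)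
		have l: "length xs = length Ss" by (rule tuples_length[OF arr_at_tuples[OF 4(2)]])
		note r = 4(1)[THEN conjunct1, rule_format] 4(1)[THEN conjunct2, THEN conjunct1, rule_format, OF conjI, OF _ conjI, OF _ _ conjI]
			4(1)[THEN conjunct2, THEN conjunct2, rule_format, OF conjI]
		show ?case unfolding iff[OF 4(2)]
		proof (intro conjI ballI impI, goal_cases)
			case (1 y)
			note y = 1
			from y show ?case using r(1)[OF at[OF 4(2) y]] l ij(3) by simp
		next
			case (2 t t')
			note t = 2
			show ?case using r(2)[OF at[OF 4(2) S.Dom_ob[OF t(1)]] at2[OF 4(2) t(1)] t(2,3)] by (simp add: upd)
		next
			case (3 be)
			note b = 3
			let ?y = "Dom (Ss ! j) (Src (Ss ! j) be)"
			show ?case using r(3)[OF at[OF 4(2), of ?y] at3[OF 4(2) b]] b by (simp add: upd)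
		qed
	qed
qed

lemma mf_left_iff:
	assumes f: "mf_fun Ss C M i" "mf_fun Ss C M j" and c: "mf_cells v w Ss C M i j"
		and ij: "i ~= j" "i < length Ss" "j < length Ss"
	shows "(\<forall>xs t. arr_at Ss j xs t --> wnatural (Ss ! i) C (dual w) (slice_left Ss C w M i j xs t)) \<longleftrightarrow> mf_left w Ss C M i j"
proof -
	interpret S: twocat "Ss ! i" by (rule S_twocat[OF ij(2)])
	have at: "arr_at Ss j (xs[i := y]) t" if "arr_at Ss j xs t" "y : Obj (Ss ! i)" for xs t y
		using that ij(1) by (intro arr_at_update) auto
	have at2: "arr_at Ss i (xs[i := Dom (Ss ! i) s]) s" if "arr_at Ss j xs t" "s : Arr (Ss ! i)" for xs s t
		using that tuples_update[of xs Ss "Dom (Ss ! i) s" i] ij(2) tuples_length[of xs Ss] by (simp add: arr_at_def)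
	have at3: "cell_at Ss i (xs[i := Dom (Ss ! i) (Src (Ss ! i) be)]) be" if "arr_at Ss j xs t" "be : Cell (Ss ! i)" for xs t be
		using that tuples_update[of xs Ss "Dom (Ss ! i) (Src (Ss ! i) be)" i] ij(2) tuples_length[of xs Ss]
		by (simp add: arr_at_def cell_at_def)
	have sl: "ffunctor (Ss ! i) C (slice Ss M i xs)" if "xs : tuples Ss" for xs
		using f(1) that by (simp add: mf_fun_def)
	have ds: "Dom (Ss ! i) (Tgt (ori w (Ss ! i)) be) = Dom (Ss ! i) (Src (Ss ! i) be)"
		"Dom (Ss ! i) (Src (ori w (Ss ! i)) be) = Dom (Ss ! i) (Src (Ss ! i) be)"
		"Tgt (ori w (Ss ! i)) be : Arr (Ss ! i)" "Src (ori w (Ss ! i)) be : Arr (Ss ! i)" if "be : Cell (Ss ! i)" for be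
		using that by (cases "w = Colax"; simp add: ori_Colax ori_other)+
	have upd: "xs[j := a, i := b] = xs[i := b, j := a]" for xs :: "'o list" and a b
		using ij(1) by (simp add: list_update_swap)
	have iff: "wnatural (Ss ! i) C (dual w) (slice_left Ss C w M i j xs t) \<longleftrightarrow>
		 (\<forall>y\<in>Obj (Ss ! i). mx M i j (xs[i := y]) (Idn (Ss ! i) y) t = VId C (m1 M j (xs[i := y]) t)) &
		 (\<forall>s\<in>Arr (Ss ! i). \<forall>s'\<in>Arr (Ss ! i). Dom (Ss ! i) s' = Cod (Ss ! i) s -->
				mx M i j (xs[i := Dom (Ss ! i) s]) (Cmp (Ss ! i) s' s) t =
				VCmp (ori w C) (whisker_left C (m1 M i (xs[j := Cod (Ss ! j) t, i := Cod (Ss ! i) s]) s') (mx M i j (xs[i := Dom (Ss ! i) s]) s t))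
					(whisker_right C (mx M i j (xs[i := Cod (Ss ! i) s]) s' t) (m1 M i (xs[i := Dom (Ss ! i) s]) s))) &
		 (\<forall>al\<in>Cell (Ss ! i).
				VCmp (ori w C) (mx M i j (xs[i := Dom (Ss ! i) (Src (Ss ! i) al)]) (Tgt (ori w (Ss ! i)) al) t)
					(whisker_left C (m1 M j (xs[i := Cod (Ss ! i) (Src (Ss ! i) al)]) t) (m2 M i (xs[i := Dom (Ss ! i) (Src (Ss ! i) al)]) al)) =
				VCmp (ori w C) (whisker_right C (m2 M i (xs[j := Cod (Ss ! j) t, i := Dom (Ss ! i) (Src (Ss ! i) al)]) al)
						(m1 M j (xs[i := Dom (Ss ! i) (Src (Ss ! i) al)]) t))
					(mx M i j (xs[i := Dom (Ss ! i) (Src (Ss ! i) al)]) (Src (ori w (Ss ! i)) al) t))"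
		if a: "arr_at Ss j xs t" for xs t
	proof -
		have xs: "xs : tuples Ss" "xs[j := Cod (Ss ! j) t] : tuples Ss" "length xs = length Ss"
			using update_Cod[OF a] arr_at_tuples[OF a] tuples_length[OF arr_at_tuples[OF a]] by simp_all
		have tob: "m1 M j (xs[i := y]) t : Arr C" "Dom C (m1 M j (xs[i := y]) t) = m0 M (xs[i := y])"
			"Cod C (m1 M j (xs[i := y]) t) = m0 M (xs[j := Cod (Ss ! j) t, i := y])" if "y : Obj (Ss ! i)" for y
			using m1_arr[OF f(2) at[OF a that]] m1_Dom[OF f(2) at[OF a that]] m1_Cod[OF f(2) at[OF a that]] by (simp_all only: upd)
		have cell: "mx M i j (xs[i := Dom (Ss ! i) s]) s t : Cell C"
			"Src (ori w C) (mx M i j (xs[i := Dom (Ss ! i) s]) s t) =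
				 Cmp C (m1 M j (xs[i := Cod (Ss ! i) s]) t) (m1 M i (xs[i := Dom (Ss ! i) s]) s)"
			"Tgt (ori w C) (mx M i j (xs[i := Dom (Ss ! i) s]) s t) =
				 Cmp C (m1 M i (xs[j := Cod (Ss ! j) t, i := Dom (Ss ! i) s]) s) (m1 M j (xs[i := Dom (Ss ! i) s]) t)"
			"strong C w (mx M i j (xs[i := Dom (Ss ! i) s]) s t)" if s: "s : Arr (Ss ! i)" for s
			using mx_cell[OF c at2[OF a s] at[OF a S.Dom_ob[OF s]]] mx_Src[OF c at2[OF a s] at[OF a S.Dom_ob[OF s]]]
				mx_Tgt[OF c at2[OF a s] at[OF a S.Dom_ob[OF s]]] mx_strong[OF c at2[OF a s] at[OF a S.Dom_ob[OF s]]]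
			by (simp_all add: upd)
		have F: "F1 (slice Ss M i xs) s = m1 M i (xs[i := Dom (Ss ! i) s]) s"
			"F1 (slice Ss M i (xs[j := Cod (Ss ! j) t])) s = m1 M i (xs[j := Cod (Ss ! j) t, i := Dom (Ss ! i) s]) s"
			if "s : Arr (Ss ! i)" for s
			using that by (simp_all add: slice_def)
		have F0: "F0 (slice Ss M i xs) y = m0 M (xs[i := y])"
			"F0 (slice Ss M i (xs[j := Cod (Ss ! j) t])) y = m0 M (xs[j := Cod (Ss ! j) t, i := y])" if "y : Obj (Ss ! i)" for y
			using that by (simp_all add: slice_def)
		have F2: "F2 (slice Ss M i xs) al = m2 M i (xs[i := Dom (Ss ! i) (Src (Ss ! i) al)]) al"
			"F2 (slice Ss M i (xs[j := Cod (Ss ! j) t])) al = m2 M i (xs[j := Cod (Ss ! j) t, i := Dom (Ss ! i) (Src (Ss ! i) al)]) al"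
			if "al : Cell (Ss ! i)" for al
			using that by (simp_all add: slice_def)
		note w = wnatural_dual_iff[OF S.two_category C.two_category sl[OF xs(1)] sl[OF xs(2)],
				of "\<lambda>x. m1 M j (xs[i := x]) t" "\<lambda>s. mx M i j (xs[i := Dom (Ss ! i) s]) s t" w]
		show ?thesis
			unfolding slice_left_def
			by (subst w) (simp_all add: tob cell F F0 F2 ds cong: conj_cong)
	qed
	show ?thesis
		unfolding mf_left_def
	proof (intro iffI conjI allI impI, goal_cases)
		case (1 xs t)
		have y: "xs ! i : Obj (Ss ! i)" by (rule tuples_nth[OF arr_at_tuples[OF 1(2)] ij(2)])
		have "wnatural (Ss ! i) C (dual w) (slice_left Ss C w M i j xs t)" using 1 by blast
		then show ?case using y unfolding iff[OF 1(2)] by (metis list_update_id)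
	next
		case (2 xs s s' t)
		then have a: "arr_at Ss j xs t" and b: "arr_at Ss i xs s" "s' : Arr (Ss ! i)" "Dom (Ss ! i) s' = Cod (Ss ! i) s" by blast+
		note n = 2(1)[rule_format, OF a, unfolded iff[OF a], THEN conjunct2, THEN conjunct1, rule_format, OF arr_at_arr[OF b(1)] b(2,3)]
		show ?case using n by (simp add: arr_at_Dom[OF b(1)])
	next
		case (3 xs t al)
		then have a: "arr_at Ss j xs t" and b: "cell_at Ss i xs al" by blast+
		then have d: "Dom (Ss ! i) (Src (Ss ! i) al) = xs ! i" "al : Cell (Ss ! i)" by (simp_all add: cell_at_def)
		have e: "xs[j := Cod (Ss ! j) t, i := xs ! i] = xs[j := Cod (Ss ! j) t]"
			using ij(1) by (metis list_update_id nth_list_update_neq)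
		note n = 3(1)[rule_format, OF a, unfolded iff[OF a], THEN conjunct2, THEN conjunct2, rule_format, OF d(2)]
		show ?case using n by (simp add: d(1) e)
	next
		case (4 xs t)
		have l: "length xs = length Ss" by (rule tuples_length[OF arr_at_tuples[OF 4(2)]])
		note r = 4(1)[THEN conjunct1, rule_format] 4(1)[THEN conjunct2, THEN conjunct1, rule_format, OF conjI, OF _ conjI, OF _ _ conjI]
			4(1)[THEN conjunct2, THEN conjunct2, rule_format, OF conjI]
		show ?case unfolding iff[OF 4(2)]
		proof (intro conjI ballI impI, goal_cases)
			case (1 y)
			note y = 1
			from y show ?case using r(1)[OF at[OF 4(2) y]] l ij(2) by simp
		next
			case (2 s s')
			note s = 2
			show ?case using r(2)[OF at2[OF 4(2) s(1)] at[OF 4(2) S.Dom_ob[OF s(1)]] s(2,3)] by (simp add: upd)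
		next
			case (3 al)
			note b = 3
			let ?y = "Dom (Ss ! i) (Src (Ss ! i) al)"
			show ?case using r(3)[OF at[OF 4(2), of ?y] at3[OF 4(2) b]] b by (simp add: upd)
		qed
	qed
qed

lemma multifunctor_iff_nmf:
	assumes vw: "v \<preceq> w"
	shows "multifunctor v w Ss C M \<longleftrightarrow> nmf v w"
proof -
	have j: "arr_at Ss j xs t ==> j < length Ss" for j xs t by (rule arr_at_less)
	have 1: "(\<forall>i j xs s t. i < j & arr_at Ss i xs s & arr_at Ss j xs t --> P i j xs s t) \<longleftrightarrow>
		(\<forall>i j. i < j & j < length Ss --> (\<forall>xs s t. arr_at Ss i xs s & arr_at Ss j xs t --> P i j xs s t))" for P
		using j by blast
	have 2: "(\<forall>i j xs s. i < j & j < length Ss & arr_at Ss i xs s --> P i j xs s) \<longleftrightarrow>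
		(\<forall>i j. i < j & j < length Ss --> (\<forall>xs s. arr_at Ss i xs s --> P i j xs s))" for P
		by blast
	have 3: "(\<forall>i j xs t. i < j & arr_at Ss j xs t --> P i j xs t) \<longleftrightarrow>
		(\<forall>i j. i < j & j < length Ss --> (\<forall>xs t. arr_at Ss j xs t --> P i j xs t))" for P
		using j by blast
	show ?thesis
	\<comment> \<open>If some slice is not a 2-functor, both sides are false. Otherwise the boundaries
	  of all 1-cells are known and the clauses can be compared one by one.\<close>
	proof (cases "\<forall>i<length Ss. mf_fun Ss C M i")
		case f: True
		have c: "(\<forall>xs s t. arr_at Ss i xs s & arr_at Ss j xs t -->
				(let f = m1 M i xs s; g = m1 M j xs t;
						 h = m1 M j (xs[i := Cod (Ss ! i) s]) t; k = m1 M i (xs[j := Cod (Ss ! j) t]) s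
				 in wcell C w f g h k (mx M i j xs s t) &
						(s : Tight (Ss ! i) \<or> t : Tight (Ss ! j) -->
							 wcell_at C v w f g h k (mx M i j xs s t)))) \<longleftrightarrow> mf_cells v w Ss C M i j" if "i < j" "j < length Ss" for i j
			using that f by (intro mf_cells_iff vw) auto
		have r: "(\<forall>xs s. arr_at Ss i xs s --> wnatural (Ss ! j) C w (slice_right Ss M i j xs s)) \<longleftrightarrow> mf_right w Ss C M i j"
			"(\<forall>xs t. arr_at Ss j xs t --> wnatural (Ss ! i) C (dual w) (slice_left Ss C w M i j xs t)) \<longleftrightarrow> mf_left w Ss C M i j"
			if "i < j" "j < length Ss" "mf_cells v w Ss C M i j" for i j
			using that f by (intro mf_right_iff mf_left_iff; auto)+
		\<comment> \<open>The naturality clauses can be rewritten only once the cell clause supplies the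
		  boundaries of the interchange cells, hence the conditional equivalences.\<close>
		have q: "(\<forall>i j. Q i j --> W1 i j) & (\<forall>i j. Q i j --> W2 i j) & (\<forall>i j. Q i j --> W3 i j) & R \<longleftrightarrow>
				(\<forall>i j. Q i j --> A i j & B i j & D i j) & R"
			if "!!i j. Q i j ==> W1 i j \<longleftrightarrow> A i j" "!!i j. Q i j ==> A i j ==> W2 i j \<longleftrightarrow> B i j"
				"!!i j. Q i j ==> A i j ==> W3 i j \<longleftrightarrow> D i j" for Q W1 W2 W3 A B D :: "nat => nat => bool" and R
			using that by blast
		show ?thesis
			unfolding multifunctor_def nmf_def mf_fun_def[symmetric] 1 2 3
			by (rule conj_cong[OF refl], rule conj_cong[OF refl], rule conj_cong[OF refl], rule q;
					(elim conjE)?, (rule c | rule r); assumption)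
	next
		case False
		then show ?thesis unfolding multifunctor_def nmf_def mf_fun_def by blast
	qed
qed

end

section \<open>Boundaries of the two sides of each multifunctor equation\<close>

section \<open>Parallel cells in the multifunctor axioms\<close>

context twocat begin
lemmas typing = wl_cell Src_wl Tgt_wl wr_cell Src_wr Tgt_wr VCmp_cell Src_VCmp Tgt_VCmp
end

text \<open>The typing part of an equation between 2-cells. Modifications that are parallel and
  agree on components are equal, so this is what has to accompany a componentwise equation.\<close>

definition parallel :: "('o, 'a, 't) fcat => weakness => 't => 't => bool" where
	"parallel C w al be \<longleftrightarrow> al : Cell C & be : Cell C & Src (ori w C) al = Src (ori w C) be & Tgt (ori w C) al = Tgt (ori w C) be"

text \<open>Functoriality and the typing of interchange cells, without the equations between them:
  boundaries can thus be computed while the equations are still to be proved.\<close>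

locale mf_typed = mf_setup Ss C M
	for Ss :: "('o, 'a, 't) fcat list" and C :: "('p, 'b, 's) fcat" and M +
	fixes v w :: weakness
	assumes typed_fun [simp]: "i < length Ss ==> mf_fun Ss C M i"
		and typed_cells: "i < j ==> j < length Ss ==> mf_cells v w Ss C M i j"
begin

lemma
	assumes "arr_at Ss i xs s"
	shows t1_arr [simp]: "m1 M i xs s : Arr C" and t1_Dom [simp]: "Dom C (m1 M i xs s) = m0 M xs"
		and t1_Cod [simp]: "Cod C (m1 M i xs s) = m0 M (xs[i := Cod (Ss ! i) s])"
	using m1_arr m1_Dom m1_Cod assms arr_at_less[OF assms] by simp_all

lemma
	assumes "i < j" "arr_at Ss i xs s" "arr_at Ss j xs t"
	shows tx_cell [simp]: "mx M i j xs s t : Cell C"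
		and tx_Src [simp]: "Src (ori w C) (mx M i j xs s t) = Cmp C (m1 M j (xs[i := Cod (Ss ! i) s]) t) (m1 M i xs s)"
		and tx_Tgt [simp]: "Tgt (ori w C) (mx M i j xs s t) = Cmp C (m1 M i (xs[j := Cod (Ss ! j) t]) s) (m1 M j xs t)"
		and tx_strong: "strong C w (mx M i j xs s t)"
		and tx_tight: "s : Tight (Ss ! i) \<or> t : Tight (Ss ! j) ==> strong C v (mx M i j xs s t)"
	using mx_cell[of v w i j xs s t] mx_Src[of v w i j xs s t] mx_Tgt[of v w i j xs s t] mx_strong[of v w i j xs s t]
		mx_tight[of v w i j xs s t] assms typed_cells[OF assms(1) arr_at_less[OF assms(3)]] by blast+

lemma t2_ori:
	assumes "cell_at Ss i xs al"
	shows "m2 M i xs al : Cell C & Src (ori w C) (m2 M i xs al) = m1 M i xs (Src (ori w (Ss ! i)) al) &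
		Tgt (ori w C) (m2 M i xs al) = m1 M i xs (Tgt (ori w (Ss ! i)) al)"
proof -
	have i: "i < length Ss" using assms by (simp add: cell_at_def)
	show ?thesis
		using m2_cell[OF typed_fun[OF i] assms] m2_Src[OF typed_fun[OF i] assms] m2_Tgt[OF typed_fun[OF i] assms]
		by (cases "w = Colax") (simp_all add: ori_Colax ori_other)
qed

lemma
	assumes "cell_at Ss i xs al"
	shows t2_cell [simp]: "m2 M i xs al : Cell C"
		and t2_Src [simp]: "Src (ori w C) (m2 M i xs al) = m1 M i xs (Src (ori w (Ss ! i)) al)"
		and t2_Tgt [simp]: "Tgt (ori w C) (m2 M i xs al) = m1 M i xs (Tgt (ori w (Ss ! i)) al)"
	using t2_ori[OF assms] by auto

lemma cell_at_cross: "cell_at Ss i xs al ==> arr_at Ss j xs t ==> i ~= j ==> cell_at Ss i (xs[j := Cod (Ss ! j) t]) al"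
	using update_Cod[of j xs t] by (simp add: cell_at_def)

context
	notes [simp] = arr_at_cross arr_at_next arr_at_Cmp cell_at_cross arr_at_oSrc arr_at_oTgt Cod_oSrc Cod_oTgt
begin

text \<open>This lemma and its companions for the other clauses only compute boundaries. They are
  applied to the curried multifunctor, where the components are compared separately.\<close>

lemma right_comp_parallel:
	assumes "i < j" and a: "arr_at Ss i xs s" "arr_at Ss j xs t" "t' : Arr (Ss ! j)" "Dom (Ss ! j) t' = Cod (Ss ! j) t"
	shows "parallel C w (mx M i j xs s (Cmp (Ss ! j) t' t))
		(VCmp (ori w C) (whisker_right C (mx M i j (xs[j := Cod (Ss ! j) t]) s t') (m1 M j xs t))
					(whisker_left C (m1 M j (xs[i := Cod (Ss ! i) s, j := Cod (Ss ! j) t]) t') (mx M i j xs s t)))"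
proof -
	interpret O: twocat "ori w C" by (rule C.ori_twocat)
	interpret S: twocat "Ss ! j" by (rule S_twocat[OF arr_at_less[OF a(2)]])
	have ij: "i ~= j" "j ~= i" using assms(1) by auto
	have sw: "xs[i := Cod (Ss ! i) s, j := Cod (Ss ! j) t] = xs[j := Cod (Ss ! j) t, i := Cod (Ss ! i) s]" for t
		using ij by (simp add: list_update_swap)
	have j: "j < length Ss" by (rule arr_at_less[OF a(2)])
	have at: "arr_at Ss j (xs[j := Cod (Ss ! j) t, i := Cod (Ss ! i) s]) t'"
		using arr_at_cross[OF arr_at_next[OF a(2-4)] arr_at_cross[OF a(1,2) ij(1)] ij(2)] .
	have at2: "arr_at Ss i (xs[j := Cod (Ss ! j) t']) s"
		by (rule arr_at_update[OF a(1) ij(1) Cod_at[OF arr_at_next[OF a(2-4)]]])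
	have c: "m1 M j (xs[i := Cod (Ss ! i) s]) (Cmp (Ss ! j) t' t) =
			Cmp C (m1 M j (xs[i := Cod (Ss ! i) s, j := Cod (Ss ! j) t]) t') (m1 M j (xs[i := Cod (Ss ! i) s]) t)"
		"m1 M j xs (Cmp (Ss ! j) t' t) = Cmp C (m1 M j (xs[j := Cod (Ss ! j) t]) t') (m1 M j xs t)"
		using m1_Cmp[OF typed_fun[OF j] arr_at_cross[OF a(2,1) ij(2)] a(3,4)] m1_Cmp[OF typed_fun[OF j] a(2-4)] by simp_all
	note [simp] = O.typing[unfolded ori_simps]
	show ?thesis unfolding parallel_def
		using assms ij at at2 by (simp add: c arr_at_arr sw)
qed

lemma left_comp_parallel:
	assumes "i < j" and a: "arr_at Ss i xs s" "arr_at Ss j xs t" "s' : Arr (Ss ! i)" "Dom (Ss ! i) s' = Cod (Ss ! i) s"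
	shows "parallel C w (mx M i j xs (Cmp (Ss ! i) s' s) t)
				(VCmp (ori w C) (whisker_left C (m1 M i (xs[j := Cod (Ss ! j) t, i := Cod (Ss ! i) s]) s') (mx M i j xs s t))
					(whisker_right C (mx M i j (xs[i := Cod (Ss ! i) s]) s' t) (m1 M i xs s)))"
proof -
	interpret O: twocat "ori w C" by (rule C.ori_twocat)
	interpret S: twocat "Ss ! i" by (rule S_twocat[OF arr_at_less[OF a(1)]])
	have ij: "i ~= j" "j ~= i" using assms(1) by auto
	have sw: "xs[j := Cod (Ss ! j) t, i := Cod (Ss ! i) s] = xs[i := Cod (Ss ! i) s, j := Cod (Ss ! j) t]" for s
		using ij by (simp add: list_update_swap)
	have i: "i < length Ss" by (rule arr_at_less[OF a(1)])
	have at: "arr_at Ss i (xs[i := Cod (Ss ! i) s, j := Cod (Ss ! j) t]) s'"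
		using arr_at_cross[OF arr_at_next[OF a(1,3,4)] arr_at_cross[OF a(2,1) ij(2)] ij(1)] .
	have at2: "arr_at Ss j (xs[i := Cod (Ss ! i) s']) t"
		by (rule arr_at_update[OF a(2) ij(2) Cod_at[OF arr_at_next[OF a(1,3,4)]]])
	have c: "m1 M i (xs[j := Cod (Ss ! j) t]) (Cmp (Ss ! i) s' s) =
			Cmp C (m1 M i (xs[j := Cod (Ss ! j) t, i := Cod (Ss ! i) s]) s') (m1 M i (xs[j := Cod (Ss ! j) t]) s)"
		"m1 M i xs (Cmp (Ss ! i) s' s) = Cmp C (m1 M i (xs[i := Cod (Ss ! i) s]) s') (m1 M i xs s)"
		using m1_Cmp[OF typed_fun[OF i] arr_at_cross[OF a(1,2) ij(1)] a(3,4)] m1_Cmp[OF typed_fun[OF i] a(1,3,4)] by simp_all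
	note [simp] = O.typing[unfolded ori_simps]
	show ?thesis unfolding parallel_def
		using assms ij at at2 by (simp add: c arr_at_arr sw)
qed

lemma right_cell_parallel:
	assumes "i < j" and a: "arr_at Ss i xs s" "cell_at Ss j xs be"
	shows "parallel C w (VCmp (ori w C) (mx M i j xs s (Tgt (ori w (Ss ! j)) be))
					(whisker_right C (m2 M j (xs[i := Cod (Ss ! i) s]) be) (m1 M i xs s)))
				(VCmp (ori w C) (whisker_left C (m1 M i (xs[j := Cod (Ss ! j) (Src (Ss ! j) be)]) s) (m2 M j xs be))
					(mx M i j xs s (Src (ori w (Ss ! j)) be)))"
proof -
	interpret O: twocat "ori w C" by (rule C.ori_twocat)
	have ij: "i ~= j" "j ~= i" using assms(1) by auto
	have at: "arr_at Ss j xs (Src (Ss ! j) be)" by (rule arr_at_Src[OF a(2)])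
	have sw: "xs[i := Cod (Ss ! i) s, j := Cod (Ss ! j) t] = xs[j := Cod (Ss ! j) t, i := Cod (Ss ! i) s]" for t
		using ij by (simp add: list_update_swap)
	note [simp] = O.typing[unfolded ori_simps]
	show ?thesis unfolding parallel_def
		using assms ij at by (simp add: sw)
qed

lemma left_cell_parallel:
	assumes "i < j" and a: "arr_at Ss j xs t" "cell_at Ss i xs al"
	shows "parallel C w (VCmp (ori w C) (mx M i j xs (Tgt (ori w (Ss ! i)) al) t)
					(whisker_left C (m1 M j (xs[i := Cod (Ss ! i) (Src (Ss ! i) al)]) t) (m2 M i xs al)))
				(VCmp (ori w C) (whisker_right C (m2 M i (xs[j := Cod (Ss ! j) t]) al) (m1 M j xs t))
					(mx M i j xs (Src (ori w (Ss ! i)) al) t))"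
proof -
	interpret O: twocat "ori w C" by (rule C.ori_twocat)
	have ij: "i ~= j" "j ~= i" using assms(1) by auto
	have at: "arr_at Ss i xs (Src (Ss ! i) al)" by (rule arr_at_Src[OF a(2)])
	have sw: "xs[j := Cod (Ss ! j) t, i := Cod (Ss ! i) s] = xs[i := Cod (Ss ! i) s, j := Cod (Ss ! j) t]" for s
		using ij by (simp add: list_update_swap)
	note [simp] = O.typing[unfolded ori_simps]
	show ?thesis unfolding parallel_def
		using assms ij at by (simp add: sw)
qed

lemma right_Idn_parallel:
	assumes "i < j" "j < length Ss" and a: "arr_at Ss i xs s"
	shows "parallel C w (mx M i j xs s (Idn (Ss ! j) (xs ! j))) (VId C (m1 M i xs s))"
proof -
	interpret O: twocat "ori w C" by (rule C.ori_twocat)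
	interpret S: twocat "Ss ! j" by (rule S_twocat[OF assms(2)])
	have xs: "xs : tuples Ss" "xs ! j : Obj (Ss ! j)" using arr_at_tuples[OF a] tuples_nth assms(2) by blast+
	have j: "arr_at Ss j xs (Idn (Ss ! j) (xs ! j))" by (rule arr_at_Idn[OF xs(1) assms(2)])
	have e: "xs[i := Cod (Ss ! i) s] ! j = xs ! j" using assms(1) by simp
	have u: "m1 M j xs (Idn (Ss ! j) (xs ! j)) = Idn C (m0 M xs)"
		"m1 M j (xs[i := Cod (Ss ! i) s]) (Idn (Ss ! j) (xs ! j)) = Idn C (m0 M (xs[i := Cod (Ss ! i) s]))"
		using m1_Idn[OF typed_fun[OF assms(2)] xs(1) assms(2)]
			m1_Idn[OF typed_fun[OF assms(2)] update_Cod[OF a] assms(2)] by (simp_all add: e)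
	note [simp] = O.Src_VId[unfolded ori_simps] O.Tgt_VId[unfolded ori_simps]
	show ?thesis unfolding parallel_def using assms(1) a j xs by (simp add: u)
qed

lemma left_Idn_parallel:
	assumes "i < j" and a: "arr_at Ss j xs t"
	shows "parallel C w (mx M i j xs (Idn (Ss ! i) (xs ! i)) t) (VId C (m1 M j xs t))"
proof -
	interpret O: twocat "ori w C" by (rule C.ori_twocat)
	have i: "i < length Ss" using assms(1) arr_at_less[OF a] by simp
	interpret S: twocat "Ss ! i" by (rule S_twocat[OF i])
	have xs: "xs : tuples Ss" "xs ! i : Obj (Ss ! i)" using arr_at_tuples[OF a] tuples_nth i by blast+
	have j: "arr_at Ss i xs (Idn (Ss ! i) (xs ! i))" by (rule arr_at_Idn[OF xs(1) i])
	have e: "xs[j := Cod (Ss ! j) t] ! i = xs ! i" using assms(1) by simp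
	have u: "m1 M i xs (Idn (Ss ! i) (xs ! i)) = Idn C (m0 M xs)"
		"m1 M i (xs[j := Cod (Ss ! j) t]) (Idn (Ss ! i) (xs ! i)) = Idn C (m0 M (xs[j := Cod (Ss ! j) t]))"
		using m1_Idn[OF typed_fun[OF i] xs(1) i]
			m1_Idn[OF typed_fun[OF i] update_Cod[OF a] i] by (simp_all add: e)
	note [simp] = O.Src_VId[unfolded ori_simps] O.Tgt_VId[unfolded ori_simps]
	show ?thesis unfolding parallel_def using assms(1) a j xs by (simp add: u)
qed

lemma cubical_parallel:
	assumes "i < j" "j < k" and a: "arr_at Ss i xs s" "arr_at Ss j xs t" "arr_at Ss k xs u"
	defines "xi \<equiv> xs[i := Cod (Ss ! i) s]" and "xj \<equiv> xs[j := Cod (Ss ! j) t]" and "xk \<equiv> xs[k := Cod (Ss ! k) u]"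
	shows "parallel C w
		 (VCmp (ori w C) (VCmp (ori w C) (whisker_left C (m1 M i (xj[k := Cod (Ss ! k) u]) s) (mx M j k xs t u))
					(whisker_right C (mx M i k xj s u) (m1 M j xs t)))
				(whisker_left C (m1 M k (xi[j := Cod (Ss ! j) t]) u) (mx M i j xs s t)))
		 (VCmp (ori w C) (VCmp (ori w C) (whisker_right C (mx M i j xk s t) (m1 M k xs u))
					(whisker_left C (m1 M j (xi[k := Cod (Ss ! k) u]) t) (mx M i k xs s u)))
				(whisker_right C (mx M j k xi t u) (m1 M i xs s)))"
proof -
	interpret O: twocat "ori w C" by (rule C.ori_twocat)
	have ij: "i ~= j" "j ~= i" "i ~= k" "k ~= i" "j ~= k" "k ~= j" "i < k" using assms(1,2) by auto
	have sw: "ys[j := a, i := b] = ys[i := b, j := a]" "ys[k := a, i := b] = ys[i := b, k := a]"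
		 "ys[k := a, j := b] = ys[j := b, k := a]" for ys :: "'o list" and a b
		using ij by (simp_all add: list_update_swap)
	note [simp] = O.typing[unfolded ori_simps]
	show ?thesis unfolding parallel_def xi_def xj_def xk_def
		using assms(1,2) a ij by (simp add: sw)
qed

text \<open>Rebracketing makes the two factors that involve \<open>u\<close> into the cell at
  \<open>u\<close> of a composite transformation. The cube then has the shape of a modification
  square in the third variable.\<close>

lemma cubical_assoc:
	assumes "i < j" "j < k" and a: "arr_at Ss i xs s" "arr_at Ss j xs t" "arr_at Ss k xs u"
	defines "xi \<equiv> xs[i := Cod (Ss ! i) s]" and "xk \<equiv> xs[k := Cod (Ss ! k) u]"
	shows "VCmp (ori w C) (VCmp (ori w C) (whisker_right C (mx M i j xk s t) (m1 M k xs u))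
					(whisker_left C (m1 M j (xi[k := Cod (Ss ! k) u]) t) (mx M i k xs s u)))
				(whisker_right C (mx M j k xi t u) (m1 M i xs s)) =
		 VCmp (ori w C) (whisker_right C (mx M i j xk s t) (m1 M k xs u))
			 (VCmp (ori w C) (whisker_left C (m1 M j (xi[k := Cod (Ss ! k) u]) t) (mx M i k xs s u))
				(whisker_right C (mx M j k xi t u) (m1 M i xs s)))"
proof -
	interpret O: twocat "ori w C" by (rule C.ori_twocat)
	have ij: "i ~= j" "j ~= i" "i ~= k" "k ~= i" "j ~= k" "k ~= j" "i < k" using assms(1,2) by auto
	have sw: "ys[j := a, i := b] = ys[i := b, j := a]" "ys[k := a, i := b] = ys[i := b, k := a]"
		 "ys[k := a, j := b] = ys[j := b, k := a]" for ys :: "'o list" and a b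
		using ij by (simp_all add: list_update_swap)
	note [simp] = O.typing[unfolded ori_simps]
	show ?thesis unfolding xi_def xk_def
		by (rule O.VCmp_assoc[unfolded ori_simps]) (use assms(1,2) a ij in \<open>simp_all add: sw\<close>)
qed

end

end

lemma cubical_ori:
	"cubical Ss C w M i j k xs s t u \<longleftrightarrow>
		 (let xi = xs[i := Cod (Ss ! i) s]; xj = xs[j := Cod (Ss ! j) t]; xk = xs[k := Cod (Ss ! k) u]
			in VCmp (ori w C) (VCmp (ori w C) (whisker_left C (m1 M i (xj[k := Cod (Ss ! k) u]) s) (mx M j k xs t u))
					(whisker_right C (mx M i k xj s u) (m1 M j xs t)))
				(whisker_left C (m1 M k (xi[j := Cod (Ss ! j) t]) u) (mx M i j xs s t)) =
		 VCmp (ori w C) (VCmp (ori w C) (whisker_right C (mx M i j xk s t) (m1 M k xs u))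
					(whisker_left C (m1 M j (xi[k := Cod (Ss ! k) u]) t) (mx M i k xs s u)))
				(whisker_right C (mx M j k xi t u) (m1 M i xs s)))"
	by (simp add: cubical_def vseq_ori Let_def)

section \<open>Currying in the last variable and its inverse\<close>

section \<open>Currying\<close>

lemma ori_if:
	"Src (ori w C) al = (if w = Colax then Tgt C al else Src C al)"
	"Tgt (ori w C) al = (if w = Colax then Src C al else Tgt C al)"
	"VCmp (ori w C) be al = (if w = Colax then VCmp C al be else VCmp C be al)"
	by (simp_all add: ori_def)

definition cur_fun where
	"cur_fun Ss Y M xs =
		 \<lparr>F0 = (\<lambda>y\<in>Obj Y. m0 M (xs @ [y])),
			F1 = (\<lambda>t\<in>Arr Y. m1 M (length Ss) (xs @ [Dom Y t]) t),
			F2 = (\<lambda>be\<in>Cell Y. m2 M (length Ss) (xs @ [Dom Y (Src Y be)]) be)\<rparr>"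

definition cur_trans where
	"cur_trans Ss Y M i xs s =
		 \<lparr>tsrc = cur_fun Ss Y M xs, ttgt = cur_fun Ss Y M (xs[i := Cod (Ss ! i) s]),
			tob = (\<lambda>y\<in>Obj Y. m1 M i (xs @ [y]) s),
			tcell = (\<lambda>t\<in>Arr Y. mx M i (length Ss) (xs @ [Dom Y t]) s t)\<rparr>"

definition cur_modif where
	"cur_modif Ss Y M i xs al =
		 \<lparr>msrc = cur_trans Ss Y M i xs (Src (Ss ! i) al), mtgt = cur_trans Ss Y M i xs (Tgt (Ss ! i) al),
			mcmp = (\<lambda>y\<in>Obj Y. m2 M i (xs @ [y]) al)\<rparr>"

text \<open>The ends are the two composites round the square of \<open>s\<close> and
  \<open>t\<close>. They are exchanged for \<open>Colax\<close> because \<open>msrc\<close> and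
  \<open>mtgt\<close> ignore the orientation.\<close>

definition cur_cell where
	"cur_cell w Ss Y C M i j xs s t =
		 (let a = trans_comp Y C w (cur_trans Ss Y M j (xs[i := Cod (Ss ! i) s]) t) (cur_trans Ss Y M i xs s);
					b = trans_comp Y C w (cur_trans Ss Y M i (xs[j := Cod (Ss ! j) t]) s) (cur_trans Ss Y M j xs t)
			in \<lparr>msrc = if w = Colax then b else a, mtgt = if w = Colax then a else b,
					mcmp = (\<lambda>y\<in>Obj Y. mx M i j (xs @ [y]) s t)\<rparr>)"

definition cur where
	"cur w Ss Y C M = mfun_restrict Ss
		 \<lparr>m0 = cur_fun Ss Y M, m1 = cur_trans Ss Y M, m2 = cur_modif Ss Y M, mx = cur_cell w Ss Y C M\<rparr>"

text \<open>The index \<open>length Ss\<close> is the last variable. Interchange with it is read off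
  the cells of the transformation \<open>m1 N i\<close>, interchange of two earlier variables off
  the components of a modification.\<close>

definition uncur where
	"uncur Ss Y N = mfun_restrict (Ss @ [Y])
		 \<lparr>m0 = (\<lambda>zs. F0 (m0 N (butlast zs)) (last zs)),
			m1 = (\<lambda>i zs s. if i < length Ss then tob (m1 N i (butlast zs) s) (last zs) else F1 (m0 N (butlast zs)) s),
			m2 = (\<lambda>i zs al. if i < length Ss then mcmp (m2 N i (butlast zs) al) (last zs) else F2 (m0 N (butlast zs)) al),
			mx = (\<lambda>i j zs s t. if j < length Ss then mcmp (mx N i j (butlast zs) s t) (last zs)
													else tcell (m1 N i (butlast zs) s) t)\<rparr>"

lemma cur_fun_sel [simp]:
	"y : Obj Y ==> F0 (cur_fun Ss Y M xs) y = m0 M (xs @ [y])"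
	"t : Arr Y ==> F1 (cur_fun Ss Y M xs) t = m1 M (length Ss) (xs @ [Dom Y t]) t"
	"be : Cell Y ==> F2 (cur_fun Ss Y M xs) be = m2 M (length Ss) (xs @ [Dom Y (Src Y be)]) be"
	by (simp_all add: cur_fun_def)

lemma cur_trans_sel [simp]:
	"tsrc (cur_trans Ss Y M i xs s) = cur_fun Ss Y M xs"
	"ttgt (cur_trans Ss Y M i xs s) = cur_fun Ss Y M (xs[i := Cod (Ss ! i) s])"
	"y : Obj Y ==> tob (cur_trans Ss Y M i xs s) y = m1 M i (xs @ [y]) s"
	"t : Arr Y ==> tcell (cur_trans Ss Y M i xs s) t = mx M i (length Ss) (xs @ [Dom Y t]) s t"
	by (simp_all add: cur_trans_def)

lemma cur_modif_sel [simp]: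
	"msrc (cur_modif Ss Y M i xs al) = cur_trans Ss Y M i xs (Src (Ss ! i) al)"
	"mtgt (cur_modif Ss Y M i xs al) = cur_trans Ss Y M i xs (Tgt (Ss ! i) al)"
	"y : Obj Y ==> mcmp (cur_modif Ss Y M i xs al) y = m2 M i (xs @ [y]) al"
	"mcmp (cur_modif Ss Y M i xs al) : extensional (Obj Y)"
	by (simp_all add: cur_modif_def)

lemma cur_cell_sel:
	"osrc w (cur_cell w Ss Y C M i j xs s t) =
		 trans_comp Y C w (cur_trans Ss Y M j (xs[i := Cod (Ss ! i) s]) t) (cur_trans Ss Y M i xs s)"
	"otgt w (cur_cell w Ss Y C M i j xs s t) =
		 trans_comp Y C w (cur_trans Ss Y M i (xs[j := Cod (Ss ! j) t]) s) (cur_trans Ss Y M j xs t)"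
	"y : Obj Y ==> mcmp (cur_cell w Ss Y C M i j xs s t) y = mx M i j (xs @ [y]) s t"
	"mcmp (cur_cell w Ss Y C M i j xs s t) : extensional (Obj Y)"
	by (simp_all add: cur_cell_def Let_def osrc_def otgt_def)

lemma tuples_snoc:
	"xs @ [y] : tuples (Ss @ [Y]) \<longleftrightarrow> xs : tuples Ss & y : Obj Y"
	by (auto simp: tuples_def nth_append less_Suc_eq)

lemma tuples_snocE:
	assumes "zs : tuples (Ss @ [Y])"
	obtains xs y where "zs = xs @ [y]" "xs : tuples Ss" "y : Obj Y"
	using assms by (cases zs rule: rev_cases) (auto simp: tuples_snoc, simp add: tuples_def)

lemma arr_at_snoc: "i < length Ss ==> arr_at (Ss @ [Y]) i (xs @ [y]) s \<longleftrightarrow> arr_at Ss i xs s & y : Obj Y"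
	by (auto simp: arr_at_def tuples_snoc nth_append dest: tuples_length)

lemma cell_at_snoc: "i < length Ss ==> cell_at (Ss @ [Y]) i (xs @ [y]) al \<longleftrightarrow> cell_at Ss i xs al & y : Obj Y"
	by (auto simp: cell_at_def tuples_snoc nth_append dest: tuples_length)

lemma arr_at_last: "arr_at (Ss @ [Y]) (length Ss) (xs @ [y]) t \<longleftrightarrow>
		xs : tuples Ss & y : Obj Y & t : Arr Y & Dom Y t = y"
	by (auto simp: arr_at_def tuples_snoc nth_append dest: tuples_length)

lemma cell_at_last: "cell_at (Ss @ [Y]) (length Ss) (xs @ [y]) be \<longleftrightarrow>
		xs : tuples Ss & y : Obj Y & be : Cell Y & Dom Y (Src Y be) = y"
	by (auto simp: cell_at_def tuples_snoc nth_append dest: tuples_length)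

lemma snoc_update: "i < length Ss ==> xs : tuples Ss ==> (xs @ [y])[i := x] = xs[i := x] @ [y]"
	"xs : tuples Ss ==> (xs @ [y])[length Ss := x] = xs @ [x]"
	by (simp_all add: tuples_def list_update_append)

lemma snoc_nth: "i < length Ss ==> (Ss @ [Y]) ! i = Ss ! i" "(Ss @ [Y]) ! length Ss = Y"
	"i < length Ss ==> xs : tuples Ss ==> (xs @ [y]) ! i = xs ! i" "xs : tuples Ss ==> (xs @ [y]) ! length Ss = y"
	by (simp_all add: nth_append tuples_def)

lemmas snoc_simps = tuples_snoc arr_at_snoc cell_at_snoc arr_at_last cell_at_last snoc_update snoc_nth

text \<open>A relation between \<open>M\<close> and \<open>N\<close> rather than a construction: it
  is used with \<open>N\<close> the currying of \<open>M\<close>, and again with \<open>M\<close>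
  the uncurrying of \<open>N\<close>. The set \<open>P\<close> will be that of models.\<close>

locale curried = fcats Ss + F: funcat Y C v w
	for Ss :: "('o, 'a, 't) fcat list" and Y :: "('o, 'a, 't) fcat" and C :: "('p, 'b, 's) fcat" and v w +
	fixes P :: "('o, 'a, 't, 'p, 'b, 's) ffun set"
		and M :: "('o, 'a, 't, 'p, 'b, 's) mfun"
		and N :: "('o, 'a, 't, ('o, 'a, 't, 'p, 'b, 's) ffun, ('o, 'a, 't, 'p, 'b, 's) wtrans, ('o, 'a, 't, 'p, 'b, 's) modif) mfun"
	assumes R0: "xs : tuples Ss ==> m0 N xs = cur_fun Ss Y M xs"
		and R1: "arr_at Ss i xs s ==> m1 N i xs s = cur_trans Ss Y M i xs s"
		and R2: "cell_at Ss i xs al ==> m2 N i xs al = cur_modif Ss Y M i xs al"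
		and R3: "i < j ==> arr_at Ss i xs s ==> arr_at Ss j xs t ==> mx N i j xs s t = cur_cell w Ss Y C M i j xs s t"
begin

abbreviation T where "T \<equiv> Ss @ [Y]"
abbreviation n where "n \<equiv> length Ss"
abbreviation Q where "Q \<equiv> full_sub F.K P"

sublocale T: fcats T
proof
	fix i assume "i < length T"
	then show "fcategory (T ! i)" using fcat[of i] F.S by (cases "i < n") (auto simp: nth_append less_Suc_eq)
qed

sublocale Mm: mf_setup T C M by unfold_locales (rule F.C)
sublocale Nn: mf_setup Ss Q N by unfold_locales (rule fcategory_full_sub[OF F.fcategory_Fun])

lemma mcmp_VCmp: "y : Obj Y ==> mcmp (VCmp (ori u Q) nu mu) y = VCmp (ori u C) (mcmp nu y) (mcmp mu y)"
	by (cases "u = Colax") (simp_all add: ori_if)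

text \<open>Taking the component at \<open>y\<close> respects all operations, in any orientation. An
  equation of modifications therefore turns into one in \<open>C\<close> by simplification.\<close>

lemma mcmp_simps:
	"y : Obj Y ==> mcmp (VCmp (ori w Q) nu mu) y = VCmp (ori w C) (mcmp nu y) (mcmp mu y)"
	"y : Obj Y ==> mcmp (whisker_left Q f mu) y = whisker_left C (tob f y) (mcmp mu y)"
	"y : Obj Y ==> mcmp (whisker_right Q mu f) y = whisker_right C (mcmp mu y) (tob f y)"
	"y : Obj Y ==> mcmp (VId Q f) y = VId C (tob f y)"
	by (simp_all add: whisker_left_def whisker_right_def mcmp_VCmp)

lemma ori_ends: "Src (ori u Q) mu = Src (ori u Q) nu ==> Tgt (ori u Q) mu = Tgt (ori u Q) nu ==>
		msrc mu = msrc nu & mtgt mu = mtgt nu"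
	by (cases "u = Colax") (simp_all add: ori_if)

lemma ori_osrc: "Src (ori u Q) mu = osrc u mu" "Tgt (ori u Q) mu = otgt u mu"
	by (cases "u = Colax"; simp add: ori_if osrc_def otgt_def)+

lemma osrc_mem: "osrc u mu : A ==> otgt u mu : A ==> msrc mu : A & mtgt mu : A"
	by (cases "u = Colax") (simp_all add: osrc_def otgt_def)

text \<open>Reduces an equation in the functor category to its values at \<open>y\<close>, that is,
  to the corresponding equation for \<open>M\<close> at \<open>xs @ [y]\<close>.\<close>

lemma parallel_eqI:
	assumes "parallel Q w mu nu" "!!y. y : Obj Y ==> mcmp mu y = mcmp nu y"
	shows "mu = nu"
proof -
	have m: "mu : modifications Y C v w" "nu : modifications Y C v w"
		using assms(1) by (simp_all add: parallel_def full_sub_sets)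
	have e: "msrc mu = msrc nu" "mtgt mu = mtgt nu"
		using assms(1) ori_ends[of w mu nu] by (simp_all only: parallel_def simp_thms)
	show ?thesis by (rule F.modif_eqI[OF F.modif_ext[OF m(1)] F.modif_ext[OF m(2)] e assms(2)])
qed

lemma Y_Cod_oSrc: "be : Cell Y ==> Dom Y (Tgt (ori w Y) be) = Dom Y (Src Y be)"
	"be : Cell Y ==> Dom Y (Src (ori w Y) be) = Dom Y (Src Y be)"
	"be : Cell Y ==> Cod Y (Src (ori w Y) be) = Cod Y (Src Y be)"
	"be : Cell Y ==> Tgt (ori w Y) be : Arr Y" "be : Cell Y ==> Src (ori w Y) be : Arr Y"
	by (simp_all add: ori_if)

subsection \<open>From multifunctors to curried multifunctors\<close>

lemma N_tob: "arr_at Ss i xs s ==> y : Obj Y ==> tob (m1 N i xs s) y = m1 M i (xs @ [y]) s"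
	by (simp add: R1)

lemma N_mcmp: "cell_at Ss i xs al ==> y : Obj Y ==> mcmp (m2 N i xs al) y = m2 M i (xs @ [y]) al"
	by (simp add: R2)

lemma N_mx: "i < j ==> arr_at Ss i xs s ==> arr_at Ss j xs t ==> y : Obj Y ==>
		mcmp (mx N i j xs s t) y = mx M i j (xs @ [y]) s t"
	by (simp add: R3 cur_cell_sel)

end

locale curried_forward = curried +
	assumes nm: "Mm.nmf v w" and mP: "!!xs. xs : tuples Ss ==> m0 N xs : P"
begin

sublocale Tm: mf_typed T C M v w
	by unfold_locales (use nm in \<open>auto simp: Mm.nmf_def\<close>)

lemma right_n: "i < n ==> mf_right w T C M i n" and left_n: "i < n ==> mf_left w T C M i n"
	using nm by (auto simp: Mm.nmf_def)

lemma f_m0: "xs : tuples Ss ==> y : Obj Y ==> m0 M (xs @ [y]) : Obj C"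
	using nm unfolding Mm.nmf_def by (simp add: tuples_snoc)

text \<open>From here to \<open>fx_left_Idn\<close> the axioms of \<open>M\<close> are specialised
  to tuples \<open>xs @ [y]\<close>: names in \<open>fn\<close> concern the last variable, names in
  \<open>fi\<close> an earlier one, names in \<open>fx\<close> the interchange of both.\<close>

lemma
	assumes xs: "xs : tuples Ss" and t: "t : Arr Y"
	shows fn_arr: "m1 M n (xs @ [Dom Y t]) t : Arr C" (is ?G0) and fn_Dom: "Dom C (m1 M n (xs @ [Dom Y t]) t) = m0 M (xs @ [Dom Y t])" (is ?G1)
		and fn_Cod: "Cod C (m1 M n (xs @ [Dom Y t]) t) = m0 M (xs @ [Cod Y t])" (is ?G2)
		and fn_tight: "t : Tight Y ==> m1 M n (xs @ [Dom Y t]) t : Tight C" (is "PROP ?G3")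
		and fn_VId: "m2 M n (xs @ [Dom Y t]) (VId Y t) = VId C (m1 M n (xs @ [Dom Y t]) t)" (is ?G4)
		and fn_Cmp: "t' : Arr Y ==> Dom Y t' = Cod Y t ==>
			m1 M n (xs @ [Dom Y t]) (Cmp Y t' t) = Cmp C (m1 M n (xs @ [Cod Y t]) t') (m1 M n (xs @ [Dom Y t]) t)" (is "PROP ?G5")
proof -
	have a: "arr_at T n (xs @ [Dom Y t]) t" using assms by (simp add: snoc_simps)
	have f: "mf_fun T C M n" by (rule Tm.typed_fun) simp
	show ?G0 ?G1 ?G2 "PROP ?G3" ?G4
		using Tm.t1_arr[OF a] Tm.t1_Dom[OF a] Tm.t1_Cod[OF a] Mm.m1_tight[OF f a] Mm.m2_VId[OF f a] xs by (simp_all add: snoc_simps)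
	show "PROP ?G5"
		using Mm.m1_Cmp[OF f a, of t'] xs by (simp add: snoc_simps)
qed

lemma fn_Idn: "xs : tuples Ss ==> y : Obj Y ==> m1 M n (xs @ [y]) (Idn Y y) = Idn C (m0 M (xs @ [y]))"
	using Mm.m1_Idn[OF Tm.typed_fun, of n "xs @ [y]"] by (simp add: snoc_simps)

lemma
	assumes xs: "xs : tuples Ss" and b: "be : Cell Y"
	shows fn_cell: "m2 M n (xs @ [Dom Y (Src Y be)]) be : Cell C" (is ?G0)
		and fn_Src: "Src C (m2 M n (xs @ [Dom Y (Src Y be)]) be) = m1 M n (xs @ [Dom Y (Src Y be)]) (Src Y be)" (is ?G1)
		and fn_Tgt: "Tgt C (m2 M n (xs @ [Dom Y (Src Y be)]) be) = m1 M n (xs @ [Dom Y (Src Y be)]) (Tgt Y be)" (is ?G2)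
		and fn_VCmp: "be' : Cell Y ==> Src Y be' = Tgt Y be ==> m2 M n (xs @ [Dom Y (Src Y be)]) (VCmp Y be' be) =
			VCmp C (m2 M n (xs @ [Dom Y (Src Y be)]) be') (m2 M n (xs @ [Dom Y (Src Y be)]) be)" (is "PROP ?G3")
		and fn_HCmp: "be' : Cell Y ==> Dom Y (Src Y be') = Cod Y (Src Y be) ==> m2 M n (xs @ [Dom Y (Src Y be)]) (HCmp Y be' be) =
			HCmp C (m2 M n (xs @ [Cod Y (Src Y be)]) be') (m2 M n (xs @ [Dom Y (Src Y be)]) be)" (is "PROP ?G4")
proof -
	have a: "cell_at T n (xs @ [Dom Y (Src Y be)]) be" using assms by (simp add: snoc_simps)
	have f: "mf_fun T C M n" by (rule Tm.typed_fun) simp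
	show ?G0 ?G1 ?G2
		using Mm.m2_cell[OF f a] Mm.m2_Src[OF f a] Mm.m2_Tgt[OF f a] by (simp_all add: snoc_simps)
	show "PROP ?G3" "PROP ?G4"
		using Mm.m2_VCmp[OF f a, of be'] Mm.m2_HCmp[OF f a, of be'] xs by (simp_all add: snoc_simps)
qed

lemma cur_fun_ffunctor:
	assumes "xs : tuples Ss" shows "ffunctor Y C (cur_fun Ss Y M xs)"
	by (rule ffunctorI)
		(simp_all add: f_m0 fn_arr fn_Dom fn_Cod fn_tight fn_VId fn_Idn fn_cell fn_Src fn_Tgt assms F.S.two_category Tight_arr[OF F.S],
		 simp_all add: cur_fun_def fn_Cmp fn_VCmp fn_HCmp assms)

lemma
	assumes a: "arr_at Ss i xs s" and y: "y : Obj Y"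
	shows fi_arr: "m1 M i (xs @ [y]) s : Arr C" (is ?G0) and fi_Dom: "Dom C (m1 M i (xs @ [y]) s) = m0 M (xs @ [y])" (is ?G1)
		and fi_Cod: "Cod C (m1 M i (xs @ [y]) s) = m0 M (xs[i := Cod (Ss ! i) s] @ [y])" (is ?G2)
		and fi_tight: "s : Tight (Ss ! i) ==> m1 M i (xs @ [y]) s : Tight C" (is "PROP ?G3")
		and fi_VId: "m2 M i (xs @ [y]) (VId (Ss ! i) s) = VId C (m1 M i (xs @ [y]) s)" (is ?G4)
		and fi_Cmp: "s' : Arr (Ss ! i) ==> Dom (Ss ! i) s' = Cod (Ss ! i) s ==> m1 M i (xs @ [y]) (Cmp (Ss ! i) s' s) =
			Cmp C (m1 M i (xs[i := Cod (Ss ! i) s] @ [y]) s') (m1 M i (xs @ [y]) s)" (is "PROP ?G5")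
		and fi_right_Idn: "mx M i n (xs @ [y]) s (Idn Y y) = VId C (m1 M i (xs @ [y]) s)" (is ?G6)
proof -
	have i: "i < n" and xs: "xs : tuples Ss" using arr_at_less[OF a] arr_at_tuples[OF a] by simp_all
	have b: "arr_at T i (xs @ [y]) s" using a i y by (simp add: snoc_simps)
	have f: "mf_fun T C M i" using i by simp
	show ?G0 ?G1 ?G2 "PROP ?G3" ?G4 "PROP ?G5"
		using Tm.t1_arr[OF b] Tm.t1_Dom[OF b] Tm.t1_Cod[OF b] Mm.m1_tight[OF f b] Mm.m2_VId[OF f b] Mm.m1_Cmp[OF f b, of s'] i xs
		by (simp_all add: snoc_simps)
	show ?G6
		using right_n[OF i, unfolded mf_right_def, THEN conjunct1, rule_format, OF b] xs by (simp add: snoc_simps)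
qed

lemma
	assumes a: "arr_at Ss i xs s" and t: "t : Arr Y"
	shows fx_cell: "mx M i n (xs @ [Dom Y t]) s t : Cell C" (is ?G0)
		and fx_Src: "Src (ori w C) (mx M i n (xs @ [Dom Y t]) s t) =
			Cmp C (m1 M n (xs[i := Cod (Ss ! i) s] @ [Dom Y t]) t) (m1 M i (xs @ [Dom Y t]) s)" (is ?G1)
		and fx_Tgt: "Tgt (ori w C) (mx M i n (xs @ [Dom Y t]) s t) =
			Cmp C (m1 M i (xs @ [Cod Y t]) s) (m1 M n (xs @ [Dom Y t]) t)" (is ?G2)
		and fx_strong: "strong C w (mx M i n (xs @ [Dom Y t]) s t)" (is ?G3)
		and fx_tight: "s : Tight (Ss ! i) \<or> t : Tight Y ==> strong C v (mx M i n (xs @ [Dom Y t]) s t)" (is "PROP ?G4")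
		and fx_right_Cmp: "t' : Arr Y ==> Dom Y t' = Cod Y t ==> mx M i n (xs @ [Dom Y t]) s (Cmp Y t' t) =
			VCmp (ori w C) (whisker_right C (mx M i n (xs @ [Cod Y t]) s t') (m1 M n (xs @ [Dom Y t]) t))
				(whisker_left C (m1 M n (xs[i := Cod (Ss ! i) s] @ [Cod Y t]) t') (mx M i n (xs @ [Dom Y t]) s t))" (is "PROP ?G5")
		and fx_left_Cmp: "s' : Arr (Ss ! i) ==> Dom (Ss ! i) s' = Cod (Ss ! i) s ==>
			mx M i n (xs @ [Dom Y t]) (Cmp (Ss ! i) s' s) t =
			VCmp (ori w C) (whisker_left C (m1 M i (xs[i := Cod (Ss ! i) s] @ [Cod Y t]) s') (mx M i n (xs @ [Dom Y t]) s t))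
				(whisker_right C (mx M i n (xs[i := Cod (Ss ! i) s] @ [Dom Y t]) s' t) (m1 M i (xs @ [Dom Y t]) s))" (is "PROP ?G6")
proof -
	have i: "i < n" and xs: "xs : tuples Ss" "xs[i := Cod (Ss ! i) s] : tuples Ss"
		using arr_at_less[OF a] arr_at_tuples[OF a] update_Cod[OF a] by auto
	have b: "arr_at T i (xs @ [Dom Y t]) s" "arr_at T n (xs @ [Dom Y t]) t"
		using a i t xs by (simp_all add: snoc_simps)
	show ?G0 ?G1 ?G2 ?G3 "PROP ?G4"
		using Tm.tx_cell[OF i b] Tm.tx_Src[OF i b] Tm.tx_Tgt[OF i b] Tm.tx_strong[OF i b] Tm.tx_tight[OF i b] i xs
		by (simp_all add: snoc_simps)
	show "PROP ?G5"
		using right_n[OF i, unfolded mf_right_def, THEN conjunct2, THEN conjunct1, rule_format, of "xs @ [Dom Y t]" s t t'] b i xs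
		by (simp add: snoc_simps)
	show "PROP ?G6"
		using left_n[OF i, unfolded mf_left_def, THEN conjunct2, THEN conjunct1, rule_format, of "xs @ [Dom Y t]" s t s'] b i xs
		by (simp add: snoc_simps)
qed

lemma fx_right_nat:
	assumes a: "arr_at Ss i xs s" and b: "be : Cell Y"
	shows "VCmp (ori w C) (mx M i n (xs @ [Dom Y (Src Y be)]) s (Tgt (ori w Y) be))
			(whisker_right C (m2 M n (xs[i := Cod (Ss ! i) s] @ [Dom Y (Src Y be)]) be) (m1 M i (xs @ [Dom Y (Src Y be)]) s)) =
		VCmp (ori w C) (whisker_left C (m1 M i (xs @ [Cod Y (Src Y be)]) s) (m2 M n (xs @ [Dom Y (Src Y be)]) be))
			(mx M i n (xs @ [Dom Y (Src Y be)]) s (Src (ori w Y) be))"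
proof -
	have i: "i < n" and xs: "xs : tuples Ss" "xs[i := Cod (Ss ! i) s] : tuples Ss"
		using arr_at_less[OF a] arr_at_tuples[OF a] update_Cod[OF a] by auto
	show ?thesis
		using right_n[OF i, unfolded mf_right_def, THEN conjunct2, THEN conjunct2, rule_format, of "xs @ [Dom Y (Src Y be)]" s be]
			a b i xs by (simp add: snoc_simps)
qed

lemma fx_left_nat:
	assumes a: "cell_at Ss i xs al" and t: "t : Arr Y"
	shows "VCmp (ori w C) (mx M i n (xs @ [Dom Y t]) (Tgt (ori w (Ss ! i)) al) t)
			(whisker_left C (m1 M n (xs[i := Cod (Ss ! i) (Src (Ss ! i) al)] @ [Dom Y t]) t) (m2 M i (xs @ [Dom Y t]) al)) =
		VCmp (ori w C) (whisker_right C (m2 M i (xs @ [Cod Y t]) al) (m1 M n (xs @ [Dom Y t]) t))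
			(mx M i n (xs @ [Dom Y t]) (Src (ori w (Ss ! i)) al) t)"
proof -
	have i: "i < n" and xs: "xs : tuples Ss" using a by (auto simp: cell_at_def)
	show ?thesis
		using left_n[OF i, unfolded mf_left_def, THEN conjunct2, THEN conjunct2, rule_format, of "xs @ [Dom Y t]" t al]
			a t i xs by (simp add: snoc_simps)
qed

lemma fi_Idn: "xs : tuples Ss ==> i < n ==> y : Obj Y ==> m1 M i (xs @ [y]) (Idn (Ss ! i) (xs ! i)) = Idn C (m0 M (xs @ [y]))"
	using Mm.m1_Idn[OF Tm.typed_fun, of i "xs @ [y]"] by (simp add: snoc_simps)

lemma fx_left_Idn: "xs : tuples Ss ==> i < n ==> t : Arr Y ==>
		mx M i n (xs @ [Dom Y t]) (Idn (Ss ! i) (xs ! i)) t = VId C (m1 M n (xs @ [Dom Y t]) t)"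
	using left_n[unfolded mf_left_def, THEN conjunct1, rule_format, of i "xs @ [Dom Y t]" t] by (simp add: snoc_simps)

text \<open>The \<open>mf_right\<close> clauses of \<open>M\<close> for the positions
  \<open>i\<close> and \<open>n\<close> are the axioms of a transformation in the last
  variable.\<close>

lemma cur_trans_loose:
	assumes a: "arr_at Ss i xs s"
	shows "cur_trans Ss Y M i xs s : loose_trans Y C v w"
proof -
	have xs: "xs : tuples Ss" "xs[i := Cod (Ss ! i) s] : tuples Ss"
		using arr_at_tuples[OF a] update_Cod[OF a] by auto
	have "lnat (ori w Y) (ori w C) w (cur_trans Ss Y M i xs s)"
		unfolding lnat_def ori_simps strong_ori cur_trans_sel(1,2) F.ffunctor_ori_iff
	proof (intro conjI ballI impI)
		fix t t' assume t: "t : Arr Y" "t' : Arr Y" "Dom Y t' = Cod Y t"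
		then show "tcell (cur_trans Ss Y M i xs s) (Cmp Y t' t) =
			VCmp (ori w C) (whisker_right C (tcell (cur_trans Ss Y M i xs s) t') (F1 (cur_fun Ss Y M xs) t))
			 (whisker_left C (F1 (cur_fun Ss Y M (xs[i := Cod (Ss ! i) s])) t') (tcell (cur_trans Ss Y M i xs s) t))"
			using fx_right_Cmp[OF a t] by simp
	next
		fix be assume b: "be : Cell Y"
		then show "VCmp (ori w C) (tcell (cur_trans Ss Y M i xs s) (Tgt (ori w Y) be))
				(whisker_right C (F2 (cur_fun Ss Y M (xs[i := Cod (Ss ! i) s])) be)
					(tob (cur_trans Ss Y M i xs s) (Dom Y (Src (ori w Y) be)))) =
			 VCmp (ori w C) (whisker_left C (tob (cur_trans Ss Y M i xs s) (Cod Y (Src (ori w Y) be))) (F2 (cur_fun Ss Y M xs) be))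
				(tcell (cur_trans Ss Y M i xs s) (Src (ori w Y) be))"
			using fx_right_nat[OF a b] by (simp add: Y_Cod_oSrc)
	qed (simp_all add: xs cur_fun_ffunctor fi_arr[OF a] fi_Dom[OF a] fi_Cod[OF a] fi_right_Idn[OF a] fx_cell[OF a]
			fx_Src[OF a] fx_Tgt[OF a] fx_strong[OF a], simp_all add: cur_trans_def)
	then show ?thesis
		unfolding F.loose_iff using fx_tight[OF a] Tight_arr[OF F.S] by simp
qed

text \<open>Here the \<open>mf_left\<close> clauses enter: for the last position they express that
  \<open>s \<mapsto> M(s, -)\<close> is functorial.\<close>

lemma cur_trans_Cmp:
	assumes a: "arr_at Ss i xs s" "s' : Arr (Ss ! i)" "Dom (Ss ! i) s' = Cod (Ss ! i) s"
	shows "cur_trans Ss Y M i xs (Cmp (Ss ! i) s' s) =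
		trans_comp Y C w (cur_trans Ss Y M i (xs[i := Cod (Ss ! i) s]) s') (cur_trans Ss Y M i xs s)"
proof -
	interpret S: twocat "Ss ! i" by (rule S_twocat[OF arr_at_less[OF a(1)]])
	show ?thesis
		unfolding cur_trans_def trans_comp_def vseq_ori
		using a arr_at_arr[OF a(1)] by (auto intro!: restrict_ext simp: fi_Cmp fx_left_Cmp)
qed

lemma cur_Cmp_loose:
	assumes "arr_at Ss i xs s" "arr_at Ss j (xs[i := Cod (Ss ! i) s]) t"
	shows "trans_comp Y C w (cur_trans Ss Y M j (xs[i := Cod (Ss ! i) s]) t) (cur_trans Ss Y M i xs s) : loose_trans Y C v w"
	by (rule F.loose_comp(1)) (simp_all add: cur_trans_loose assms)

text \<open>The modification square is the 2-cell clause of \<open>mf_left\<close> in the last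
  position.\<close>

lemma cur_modif_modif:
	assumes a: "cell_at Ss i xs al"
	shows "cur_modif Ss Y M i xs al : modifications Y C v w"
proof -
	have i: "i < n" and xs: "xs : tuples Ss" using a by (auto simp: cell_at_def)
	have o: "osrc w (cur_modif Ss Y M i xs al) = cur_trans Ss Y M i xs (Src (ori w (Ss ! i)) al)"
		"otgt w (cur_modif Ss Y M i xs al) = cur_trans Ss Y M i xs (Tgt (ori w (Ss ! i)) al)"
		by (simp_all add: osrc_def otgt_def ori_if)
	have c: "m2 M i (xs @ [y]) al : Cell C"
		 "Src (ori w C) (m2 M i (xs @ [y]) al) = m1 M i (xs @ [y]) (Src (ori w (Ss ! i)) al)"
		 "Tgt (ori w C) (m2 M i (xs @ [y]) al) = m1 M i (xs @ [y]) (Tgt (ori w (Ss ! i)) al)" if "y : Obj Y" for y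
		using Tm.t2_ori[of i "xs @ [y]" al] a i xs that by (simp_all add: snoc_simps)
	have "lmodif (ori w Y) (ori w C) (cur_trans Ss Y M i xs (Src (ori w (Ss ! i)) al))
			(cur_trans Ss Y M i xs (Tgt (ori w (Ss ! i)) al)) (mcmp (cur_modif Ss Y M i xs al))"
		unfolding lmodif_def ori_simps
		using fx_left_nat[OF a] by (simp add: c Cod_oSrc[OF a] Cod_oTgt[OF a])
	then show ?thesis
		unfolding F.modif_iff o using cur_trans_loose[OF arr_at_Src[OF a]] cur_trans_loose[OF arr_at_Tgt[OF a]] by simp
qed

lemma N_typed_fun: assumes i: "i < n" shows "mf_fun Ss Q N i"
proof (rule Nn.mf_funI[OF i])
	interpret S: twocat "Ss ! i" by (rule S_twocat[OF i])
	have P: "cur_fun Ss Y M xs : P" if "xs : tuples Ss" for xs using mP[OF that] R0[OF that] by simp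
	show "m0 N xs : Obj Q" if "xs : tuples Ss" for xs
		using that by (simp add: R0 full_sub_sets cur_fun_ffunctor P)
	fix xs s assume a: "arr_at Ss i xs s"
	note xs = arr_at_tuples[OF a] update_Cod[OF a]
	show "m1 N i xs s : Arr Q"
		using a xs by (simp add: R1 full_sub_sets P cur_trans_loose)
	show "Dom Q (m1 N i xs s) = m0 N xs" "Cod Q (m1 N i xs s) = m0 N (xs[i := Cod (Ss ! i) s])"
		using a xs by (simp_all add: R1 R0)
	show "m1 N i xs s : Tight Q" if "s : Tight (Ss ! i)"
		using a xs that by (simp add: R1 full_sub_sets P F.tight_iff cur_trans_loose fi_tight fx_tight)
	show "m1 N i xs (Cmp (Ss ! i) s' s) = Cmp Q (m1 N i (xs[i := Cod (Ss ! i) s]) s') (m1 N i xs s)"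
		if "s' : Arr (Ss ! i)" "Dom (Ss ! i) s' = Cod (Ss ! i) s" for s'
		using a that by (simp add: R1 arr_at_Cmp arr_at_next cur_trans_Cmp)
	have v: "cell_at Ss i xs (VId (Ss ! i) s)" using a by (simp add: arr_at_def cell_at_def)
	have e: "cur_modif Ss Y M i xs (VId (Ss ! i) s) = VId F.K (cur_trans Ss Y M i xs s)"
		by (rule F.modif_eqI) (use arr_at_arr[OF a] in \<open>simp_all add: fi_VId[OF a]\<close>)
	show "m2 N i xs (VId (Ss ! i) s) = VId Q (m1 N i xs s)"
		using R2[OF v] R1[OF a] e by simp
next
	interpret S: twocat "Ss ! i" by (rule S_twocat[OF i])
	fix xs assume xs: "xs : tuples Ss"
	have I: "arr_at Ss i xs (Idn (Ss ! i) (xs ! i))" by (rule arr_at_Idn[OF xs i])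
	have "cur_trans Ss Y M i xs (Idn (Ss ! i) (xs ! i)) = trans_id Y C (cur_fun Ss Y M xs)"
		unfolding cur_trans_def trans_id_def
		using xs i by (auto intro!: restrict_ext simp: fi_Idn fx_left_Idn tuples_nth)
	then show "m1 N i xs (Idn (Ss ! i) (xs ! i)) = Idn Q (m0 N xs)"
		using R1[OF I] R0[OF xs] by simp
next
	interpret S: twocat "Ss ! i" by (rule S_twocat[OF i])
	have P: "cur_fun Ss Y M xs : P" if "xs : tuples Ss" for xs using mP[OF that] R0[OF that] by simp
	fix xs al assume a: "cell_at Ss i xs al"
	then have xs: "xs : tuples Ss" and al: "al : Cell (Ss ! i)" "Dom (Ss ! i) (Src (Ss ! i) al) = xs ! i" by (simp_all add: cell_at_def)
	note u = update_Cod[OF arr_at_Src[OF a]]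
	show "m2 N i xs al : Cell Q"
		using a xs u by (simp add: R2 full_sub_sets cur_modif_modif P)
	show "Src Q (m2 N i xs al) = m1 N i xs (Src (Ss ! i) al)" "Tgt Q (m2 N i xs al) = m1 N i xs (Tgt (Ss ! i) al)"
		using a by (simp_all add: R2 R1 arr_at_Src arr_at_Tgt)
	have f: "mf_fun T C M i" using i by simp
	fix be assume b: "be : Cell (Ss ! i)"
	have aT: "cell_at T i (xs @ [y]) al" if "y : Obj Y" for y using a i that by (simp add: snoc_simps)
	show "m2 N i xs (VCmp (Ss ! i) be al) = VCmp Q (m2 N i xs be) (m2 N i xs al)" if m: "Src (Ss ! i) be = Tgt (Ss ! i) al"
	proof -
		have c: "cell_at Ss i xs (VCmp (Ss ! i) be al)" "cell_at Ss i xs be"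
			using a b m by (simp_all add: cell_at_def)
		have "cur_modif Ss Y M i xs (VCmp (Ss ! i) be al) = VCmp F.K (cur_modif Ss Y M i xs be) (cur_modif Ss Y M i xs al)"
			using Mm.m2_VCmp[OF f aT, of _ be] al b m i by (intro F.modif_eqI) (simp_all add: snoc_simps)
		then show ?thesis by (simp add: R2[OF c(1)] R2[OF c(2)] R2[OF a])
	qed
	show "m2 N i xs (HCmp (Ss ! i) be al) = HCmp Q (m2 N i (xs[i := Cod (Ss ! i) (Src (Ss ! i) al)]) be) (m2 N i xs al)"
		if m: "Dom (Ss ! i) (Src (Ss ! i) be) = Cod (Ss ! i) (Src (Ss ! i) al)"
	proof -
		have c: "cell_at Ss i xs (HCmp (Ss ! i) be al)" "cell_at Ss i (xs[i := Cod (Ss ! i) (Src (Ss ! i) al)]) be"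
			using a b m u tuples_length[OF xs] by (simp_all add: cell_at_def)
		have e: "Cod (Ss ! i) (Tgt (Ss ! i) al) = Cod (Ss ! i) (Src (Ss ! i) al)" using al by simp
		have t: "cur_trans Ss Y M i xs (Cmp (Ss ! i) (Src (Ss ! i) be) (Src (Ss ! i) al)) =
				trans_comp Y C w (cur_trans Ss Y M i (xs[i := Cod (Ss ! i) (Src (Ss ! i) al)]) (Src (Ss ! i) be)) (cur_trans Ss Y M i xs (Src (Ss ! i) al))"
			"cur_trans Ss Y M i xs (Cmp (Ss ! i) (Tgt (Ss ! i) be) (Tgt (Ss ! i) al)) =
				trans_comp Y C w (cur_trans Ss Y M i (xs[i := Cod (Ss ! i) (Src (Ss ! i) al)]) (Tgt (Ss ! i) be)) (cur_trans Ss Y M i xs (Tgt (Ss ! i) al))"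
			using cur_trans_Cmp[OF arr_at_Src[OF a], of "Src (Ss ! i) be"] cur_trans_Cmp[OF arr_at_Tgt[OF a], of "Tgt (Ss ! i) be"] b m e al
			by simp_all
		have "cur_modif Ss Y M i xs (HCmp (Ss ! i) be al) =
			HCmp F.K (cur_modif Ss Y M i (xs[i := Cod (Ss ! i) (Src (Ss ! i) al)]) be) (cur_modif Ss Y M i xs al)"
			using Mm.m2_HCmp[OF f aT, of _ be] al b m i xs by (intro F.modif_eqI) (simp_all add: snoc_simps t)
		then show ?thesis by (simp add: R2[OF c(1)] R2[OF c(2)] R2[OF a])
	qed
qed

lemma N_cells:
	assumes ij: "i < j" "j < n"
	shows "mf_cells v w Ss Q N i j"
	unfolding mf_cells_def
proof (intro allI impI, elim conjE)
	fix xs s t assume a: "arr_at Ss i xs s" "arr_at Ss j xs t"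
	have ij': "i ~= j" "j ~= i" using ij by auto
	have i: "i < n" using ij by simp
	note xs = arr_at_tuples[OF a(1)]
	have P: "cur_fun Ss Y M xs : P" if "xs : tuples Ss" for xs using mP[OF that] R0[OF that] by simp
	let ?m = "cur_cell w Ss Y C M i j xs s t"
	let ?si = "Cod (Ss ! i) s" and ?tj = "Cod (Ss ! j) t"
	note b = arr_at_cross[OF a(2,1) ij'(2)] arr_at_cross[OF a ij'(1)]
	have sw: "xs[j := ?tj, i := ?si] = xs[i := ?si, j := ?tj]" using ij' by (simp add: list_update_swap)
	have l: "osrc w ?m : loose_trans Y C v w" "otgt w ?m : loose_trans Y C v w"
		unfolding cur_cell_sel by (intro cur_Cmp_loose a b)+
	have TT: "arr_at T i (xs @ [y]) s" "arr_at T j (xs @ [y]) t" if "y : Obj Y" for y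
		using a ij that by (simp_all add: snoc_simps)
	have c: "mx M i j (xs @ [y]) s t : Cell C"
		"Src (ori w C) (mx M i j (xs @ [y]) s t) = Cmp C (m1 M j (xs[i := ?si] @ [y]) t) (m1 M i (xs @ [y]) s)"
		"Tgt (ori w C) (mx M i j (xs @ [y]) s t) = Cmp C (m1 M i (xs[j := ?tj] @ [y]) s) (m1 M j (xs @ [y]) t)"
		"strong C w (mx M i j (xs @ [y]) s t)"
		"s : Tight (Ss ! i) \<or> t : Tight (Ss ! j) ==> strong C v (mx M i j (xs @ [y]) s t)" if "y : Obj Y" for y
		using Tm.tx_cell[OF ij(1) TT[OF that]] Tm.tx_Src[OF ij(1) TT[OF that]] Tm.tx_Tgt[OF ij(1) TT[OF that]]
			Tm.tx_strong[OF ij(1) TT[OF that]] Tm.tx_tight[OF ij(1) TT[OF that]] ij i xs by (simp_all add: snoc_simps)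
	have "lmodif (ori w Y) (ori w C) (osrc w ?m) (otgt w ?m) (mcmp ?m)"
		unfolding lmodif_def ori_simps
	proof (intro conjI ballI)
		fix u assume u: "u : Arr Y"
		\<comment> \<open>Of the cubes of \<open>M\<close>, those whose third position is \<open>n\<close>
		  are consumed here; the remaining ones become the cubes of \<open>N\<close>.\<close>
		have "cubical T C w M i j n (xs @ [Dom Y u]) s t u"
			using nm[unfolded Mm.nmf_def] ij(1) ij(2) TT[of "Dom Y u"] u xs by (auto simp: snoc_simps)
		then show "VCmp (ori w C) (tcell (otgt w ?m) u) (whisker_left C (F1 (ttgt (osrc w ?m)) u) (mcmp ?m (Dom Y u))) =
			VCmp (ori w C) (whisker_right C (mcmp ?m (Cod Y u)) (F1 (tsrc (osrc w ?m)) u)) (tcell (osrc w ?m) u)"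
			using Tm.cubical_assoc[OF ij TT[of "Dom Y u"], of u] u ij i xs update_Cod[OF a(1)] update_Cod[OF a(2)]
			by (simp add: cubical_ori Let_def cur_cell_sel snoc_simps sw)
	qed (use ij' xs in \<open>simp_all add: cur_cell_sel c sw\<close>)
	then have m: "?m : modifications Y C v w"
		unfolding F.modif_iff using osrc_mem[OF l] by (simp add: cur_cell_sel(4))
	have mQ: "?m : Cell Q"
	proof -
		have "tsrc (msrc ?m) = cur_fun Ss Y M xs" "ttgt (msrc ?m) = cur_fun Ss Y M (xs[i := ?si, j := ?tj])"
			by (simp_all add: cur_cell_def Let_def sw)
		then show ?thesis using m P[OF xs] P[OF update_Cod[OF b(1)]] by (simp add: full_sub_sets)
	qed
	\<comment> \<open>Strength in the full subcategory is strength in the functor category, which is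
	  componentwise.\<close>
	have st: "strong Q u ?m \<longleftrightarrow> (\<forall>y\<in>Obj Y. strong C u (mx M i j (xs @ [y]) s t))" for u
		using strong_full_sub[OF fcategory_two_category[OF F.fcategory_Fun] mQ] F.strong_Fun[OF m]
		by (simp add: cur_cell_sel)
	have o: "Src (ori w Q) ?m = osrc w ?m" "Tgt (ori w Q) ?m = otgt w ?m"
		by (rule ori_osrc)+
	show "mx N i j xs s t : Cell Q &
		 Src (ori w Q) (mx N i j xs s t) = Cmp Q (m1 N j (xs[i := Cod (Ss ! i) s]) t) (m1 N i xs s) &
		 Tgt (ori w Q) (mx N i j xs s t) = Cmp Q (m1 N i (xs[j := Cod (Ss ! j) t]) s) (m1 N j xs t) &
		 strong Q w (mx N i j xs s t) &
		 (s : Tight (Ss ! i) \<or> t : Tight (Ss ! j) --> strong Q v (mx N i j xs s t))"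
		unfolding R3[OF ij(1) a] st o using mQ c by (simp add: cur_cell_sel R1 a b)
qed

end

lemma arr_at_lastE:
	assumes "arr_at (Ss @ [Y]) (length Ss) zs t"
	obtains xs where "zs = xs @ [Dom Y t]" "xs : tuples Ss" "t : Arr Y" "Dom Y t : Obj Y"
	using tuples_snocE[OF arr_at_tuples[OF assms]] assms by (metis arr_at_last)

lemma cell_at_lastE:
	assumes "cell_at (Ss @ [Y]) (length Ss) zs be"
	obtains xs where "zs = xs @ [Dom Y (Src Y be)]" "xs : tuples Ss" "be : Cell Y" "Dom Y (Src Y be) : Obj Y"
proof -
	have "zs : tuples (Ss @ [Y])" using assms by (simp add: cell_at_def)
	then show ?thesis using tuples_snocE assms that by (metis cell_at_last)
qed

lemma arr_at_snocE:
	assumes "arr_at (Ss @ [Y]) i zs s" "i < length Ss"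
	obtains xs y where "zs = xs @ [y]" "arr_at Ss i xs s" "y : Obj Y" "xs : tuples Ss"
	using tuples_snocE[OF arr_at_tuples[OF assms(1)]] assms by (metis arr_at_snoc)

lemma cell_at_snocE:
	assumes "cell_at (Ss @ [Y]) i zs al" "i < length Ss"
	obtains xs y where "zs = xs @ [y]" "cell_at Ss i xs al" "y : Obj Y" "xs : tuples Ss"
proof -
	have "zs : tuples (Ss @ [Y])" using assms by (simp add: cell_at_def)
	then show ?thesis using tuples_snocE assms that by (metis cell_at_snoc)
qed

context curried_forward
begin

sublocale Nt: mf_typed Ss Q N v w
	by unfold_locales (simp_all add: N_typed_fun N_cells)

context
	notes [simp] = arr_at_cross arr_at_next arr_at_Cmp Nt.cell_at_cross arr_at_oSrc arr_at_oTgt Cod_oSrc Cod_oTgt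
begin

text \<open>Each equation is first typed by the lemma on parallel cells and then checked at
  \<open>y\<close>, where it is the same clause of \<open>M\<close> at
  \<open>xs @ [y]\<close>.\<close>

lemma N_right:
	assumes ij: "i < j" "j < n"
	shows "mf_right w Ss Q N i j"
proof -
	have ne: "i ~= j" "j ~= i" "i < n" using ij by auto
	have "mf_right w T C M i j" using nm ij by (auto simp: Mm.nmf_def)
	note r = this[unfolded mf_right_def, THEN conjunct1, rule_format]
		this[unfolded mf_right_def, THEN conjunct2, THEN conjunct1, rule_format, OF conjI, OF _ conjI, OF _ _ conjI]
		this[unfolded mf_right_def, THEN conjunct2, THEN conjunct2, rule_format, OF conjI]
	show ?thesis
		unfolding mf_right_def
	proof ((intro conjI allI impI; (elim conjE)?; rule parallel_eqI), goal_cases)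
		case (1 xs s)
		show ?case by (rule Nt.right_Idn_parallel[OF ij 1])
	next
		case (2 xs s y)
		note a = 2(1) and y = 2(2)
		show ?case
			using r(1)[of "xs @ [y]" s] a y ij ne arr_at_tuples[OF a] arr_at_Idn[OF arr_at_tuples[OF a] ij(2)]
			by (simp add: mcmp_simps N_mx N_tob snoc_simps del: full_sub_simps)
	next
		case (3 xs s t t')
		show ?case by (rule Nt.right_comp_parallel[OF ij(1) 3])
	next
		case (4 xs s t t' y)
		note a = 4(1-4) and y = 4(5)
		show ?case
			using r(2)[of "xs @ [y]" s t t'] a y ij ne arr_at_tuples[OF a(1)] update_Cod[OF a(1)]
			by (simp add: mcmp_simps N_mx N_tob snoc_simps del: full_sub_simps)
	next
		case (5 xs s be)
		show ?case by (rule Nt.right_cell_parallel[OF ij(1) 5])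
	next
		case (6 xs s be y)
		note a = 6(1-2) and y = 6(3)
		show ?case
			using r(3)[of "xs @ [y]" s be] a y ij ne arr_at_tuples[OF a(1)] arr_at_Src[OF a(2)]
			by (simp add: mcmp_simps N_mx N_tob N_mcmp snoc_simps del: full_sub_simps)
	qed
qed

lemma N_left:
	assumes ij: "i < j" "j < n"
	shows "mf_left w Ss Q N i j"
proof -
	have ne: "i ~= j" "j ~= i" "i < n" using ij by auto
	have "mf_left w T C M i j" using nm ij by (auto simp: Mm.nmf_def)
	note r = this[unfolded mf_left_def, THEN conjunct1, rule_format]
		this[unfolded mf_left_def, THEN conjunct2, THEN conjunct1, rule_format, OF conjI, OF _ conjI, OF _ _ conjI]
		this[unfolded mf_left_def, THEN conjunct2, THEN conjunct2, rule_format, OF conjI]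
	show ?thesis
		unfolding mf_left_def
	proof ((intro conjI allI impI; (elim conjE)?; rule parallel_eqI), goal_cases)
		case (1 xs t)
		show ?case by (rule Nt.left_Idn_parallel[OF ij(1) 1])
	next
		case (2 xs t y)
		note a = 2(1) and y = 2(2)
		show ?case
			using r(1)[of "xs @ [y]" t] a y ij ne arr_at_tuples[OF a] arr_at_Idn[OF arr_at_tuples[OF a] ne(3)]
			by (simp add: mcmp_simps N_mx N_tob snoc_simps del: full_sub_simps)
	next
		case (3 xs s s' t)
		show ?case by (rule Nt.left_comp_parallel[OF ij(1) 3])
	next
		case (4 xs s s' t y)
		note a = 4(1-4) and y = 4(5)
		show ?case
			using r(2)[of "xs @ [y]" s t s'] a y ij ne arr_at_tuples[OF a(1)] update_Cod[OF a(2)]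
			by (simp add: mcmp_simps N_mx N_tob snoc_simps del: full_sub_simps)
	next
		case (5 xs t al)
		show ?case by (rule Nt.left_cell_parallel[OF ij(1) 5])
	next
		case (6 xs t al y)
		note a = 6(1-2) and y = 6(3)
		show ?case
			using r(3)[of "xs @ [y]" t al] a y ij ne arr_at_tuples[OF a(1)] arr_at_Src[OF a(2)]
			by (simp add: mcmp_simps N_mx N_tob N_mcmp snoc_simps del: full_sub_simps)
	qed
qed

lemma N_cubical:
	assumes ijk: "i < j" "j < k" and a: "arr_at Ss i xs s" "arr_at Ss j xs t" "arr_at Ss k xs u"
	shows "cubical Ss Q w N i j k xs s t u"
	unfolding cubical_ori Let_def
proof (rule parallel_eqI[OF Nt.cubical_parallel[OF ijk a]])
	have k: "k < n" by (rule arr_at_less[OF a(3)])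
	then have ne: "i ~= j" "j ~= i" "i ~= k" "k ~= i" "j ~= k" "k ~= j" "i < k" "i < n" "j < n" using ijk by auto
	note xs = arr_at_tuples[OF a(1)]
	fix y assume y: "y : Obj Y"
	then have "arr_at T i (xs @ [y]) s" "arr_at T j (xs @ [y]) t" "arr_at T k (xs @ [y]) u"
		using a ne k by (simp_all add: snoc_simps)
	then have "cubical T C w M i j k (xs @ [y]) s t u"
		using nm ijk unfolding Mm.nmf_def by blast
	then show "mcmp (VCmp (ori w Q) (VCmp (ori w Q)
				(whisker_left Q (m1 N i (xs[j := Cod (Ss ! j) t, k := Cod (Ss ! k) u]) s) (mx N j k xs t u))
				(whisker_right Q (mx N i k (xs[j := Cod (Ss ! j) t]) s u) (m1 N j xs t)))
			 (whisker_left Q (m1 N k (xs[i := Cod (Ss ! i) s, j := Cod (Ss ! j) t]) u) (mx N i j xs s t))) y =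
		mcmp (VCmp (ori w Q) (VCmp (ori w Q) (whisker_right Q (mx N i j (xs[k := Cod (Ss ! k) u]) s t) (m1 N k xs u))
				(whisker_left Q (m1 N j (xs[i := Cod (Ss ! i) s, k := Cod (Ss ! k) u]) t) (mx N i k xs s u)))
			 (whisker_right Q (mx N j k (xs[i := Cod (Ss ! i) s]) t u) (m1 N i xs s))) y"
		using y a ijk ne k xs update_Cod[OF a(1)] update_Cod[OF a(2)] update_Cod[OF a(3)]
		by (simp add: cubical_ori Let_def mcmp_simps N_mx N_tob snoc_simps del: full_sub_simps)
qed

end

lemma N_nmf:
	assumes "mfun_restrict Ss N = N" shows "Nn.nmf v w"
proof -
	show ?thesis
		unfolding Nn.nmf_def
	proof (intro conjI ballI allI impI; (elim conjE)?)
		show "mfun_restrict Ss N = N" by (rule assms)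
		show "m0 N xs : Obj Q" if "xs : tuples Ss" for xs
			using cur_fun_ffunctor[OF that] mP[OF that] that by (simp add: R0 full_sub_sets)
		show "mf_fun Ss Q N i" if "i < n" for i using that by (rule N_typed_fun)
		show "mf_cells v w Ss Q N i j" "mf_right w Ss Q N i j" "mf_left w Ss Q N i j" if "i < j" "j < n" for i j
			by (rule N_cells[OF that] N_right[OF that] N_left[OF that])+
		show "cubical Ss Q w N i j k xs s t u"
			if "i < j" "j < k" "arr_at Ss i xs s" "arr_at Ss j xs t" "arr_at Ss k xs u" for i j k xs s t u
			by (rule N_cubical[OF that])
	qed
qed

end

subsection \<open>From curried multifunctors to multifunctors\<close>

locale curried_backward = curried +
	assumes nn: "Nn.nmf v w"
begin

sublocale Nt: mf_typed Ss Q N v w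
	by unfold_locales (use nn in \<open>auto simp: Nn.nmf_def\<close>)

lemma b_fun: "xs : tuples Ss ==> ffunctor Y C (cur_fun Ss Y M xs)"
	using nn R0[of xs] unfolding Nn.nmf_def by (auto simp: full_sub_sets)

lemma b_twofun: "xs : tuples Ss ==> twofun Y C (cur_fun Ss Y M xs)"
	using b_fun by unfold_locales

lemma b_loose: "arr_at Ss i xs s ==> cur_trans Ss Y M i xs s : loose_trans Y C v w"
	using Nt.t1_arr[of i xs s] R1[of i xs s] by (simp add: full_sub_sets)

lemma b_lnat: "arr_at Ss i xs s ==> lnatural (ori w Y) (ori w C) (cur_trans Ss Y M i xs s) w"
	by (rule lnaturalI[OF F.S' F.C' F.loose_lnat[OF b_loose]])

lemma b_modif: "cell_at Ss i xs al ==> cur_modif Ss Y M i xs al : modifications Y C v w"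
	using Nt.t2_cell[of i xs al] R2[of i xs al] by (simp add: full_sub_sets)

lemma b_cell:
	assumes "i < j" "arr_at Ss i xs s" "arr_at Ss j xs t"
	shows "cur_cell w Ss Y C M i j xs s t : modifications Y C v w"
		and "cur_cell w Ss Y C M i j xs s t : Cell Q"
	using Nt.tx_cell[OF assms] R3[OF assms] by (simp_all add: full_sub_sets)

lemma M_fun_last: "mf_fun T C M n"
proof (rule Mm.mf_funI)
	show "n < length T" by simp
	show "m0 M zs : Obj C" if zs: "zs : tuples T" for zs
	proof -
		obtain xs y where z: "zs = xs @ [y]" "xs : tuples Ss" "y : Obj Y" using zs by (rule tuples_snocE)
		interpret G: twofun Y C "cur_fun Ss Y M xs" by (rule b_twofun[OF z(2)])
		show ?thesis using G.F0_ob[OF z(3)] z by simp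
	qed
	fix zs t assume "arr_at T n zs t"
	then obtain xs where z: "zs = xs @ [Dom Y t]" "xs : tuples Ss" "t : Arr Y" "Dom Y t : Obj Y" by (rule arr_at_lastE)
	interpret G: twofun Y C "cur_fun Ss Y M xs" by (rule b_twofun[OF z(2)])
	show "m1 M n zs t : Arr C" "Dom C (m1 M n zs t) = m0 M zs" "Cod C (m1 M n zs t) = m0 M (zs[n := Cod (T ! n) t])"
		"m2 M n zs (VId (T ! n) t) = VId C (m1 M n zs t)"
		using G.F1_arr[OF z(3)] G.Dom_F1[OF z(3)] G.Cod_F1[OF z(3)] G.F2_VId[OF z(3)] z by (simp_all add: snoc_simps)
	show "m1 M n zs t : Tight C" if "t : Tight (T ! n)"
		using G.F1_tight[of t] that z by (simp add: snoc_simps)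
	show "m1 M n zs (Cmp (T ! n) t' t) = Cmp C (m1 M n (zs[n := Cod (T ! n) t]) t') (m1 M n zs t)"
		if "t' : Arr (T ! n)" "Dom (T ! n) t' = Cod (T ! n) t" for t'
		using G.F1_Cmp[of t t'] that z by (simp add: snoc_simps)
next
	fix zs assume "zs : tuples T"
	then obtain xs y where z: "zs = xs @ [y]" "xs : tuples Ss" "y : Obj Y" by (rule tuples_snocE)
	interpret G: twofun Y C "cur_fun Ss Y M xs" by (rule b_twofun[OF z(2)])
	show "m1 M n zs (Idn (T ! n) (zs ! n)) = Idn C (m0 M zs)"
		using G.F1_Idn[OF z(3)] z by (simp add: snoc_simps)
next
	fix zs be assume "cell_at T n zs be"
	then obtain xs where z: "zs = xs @ [Dom Y (Src Y be)]" "xs : tuples Ss" "be : Cell Y" "Dom Y (Src Y be) : Obj Y"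
		by (rule cell_at_lastE)
	interpret G: twofun Y C "cur_fun Ss Y M xs" by (rule b_twofun[OF z(2)])
	show "m2 M n zs be : Cell C" "Src C (m2 M n zs be) = m1 M n zs (Src (T ! n) be)" "Tgt C (m2 M n zs be) = m1 M n zs (Tgt (T ! n) be)"
		using G.F2_cell[OF z(3)] G.Src_F2[OF z(3)] G.Tgt_F2[OF z(3)] z by (simp_all add: snoc_simps)
	fix be' assume b: "be' : Cell (T ! n)"
	show "m2 M n zs (VCmp (T ! n) be' be) = VCmp C (m2 M n zs be') (m2 M n zs be)" if "Src (T ! n) be' = Tgt (T ! n) be"
		using G.F2_VCmp[of be be'] b that z by (simp add: snoc_simps)
	show "m2 M n zs (HCmp (T ! n) be' be) = HCmp C (m2 M n (zs[n := Cod (T ! n) (Src (T ! n) be)]) be') (m2 M n zs be)"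
		if "Dom (T ! n) (Src (T ! n) be') = Cod (T ! n) (Src (T ! n) be)"
		using G.F2_HCmp[of be be'] b that z by (simp add: snoc_simps)
qed

text \<open>Functoriality in an earlier variable is the functoriality of \<open>N\<close> evaluated
  at \<open>y\<close>.\<close>

lemma M_fun:
	assumes i: "i < n" shows "mf_fun T C M i"
proof (rule Mm.mf_funI)
	have f: "mf_fun Ss Q N i" using i by simp
	interpret S: twocat "Ss ! i" by (rule S_twocat[OF i])
	show "i < length T" using i by simp
	show "m0 M zs : Obj C" if zs: "zs : tuples T" for zs
	proof -
		obtain xs y where z: "zs = xs @ [y]" "xs : tuples Ss" "y : Obj Y" using zs by (rule tuples_snocE)
		interpret G: twofun Y C "cur_fun Ss Y M xs" by (rule b_twofun[OF z(2)])
		show ?thesis using G.F0_ob[OF z(3)] z by simp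
	qed
	fix zs s assume "arr_at T i zs s"
	then obtain xs y where z: "zs = xs @ [y]" "arr_at Ss i xs s" "y : Obj Y" "xs : tuples Ss" using i by (rule arr_at_snocE)
	note l = b_loose[OF z(2)]
	show "m1 M i zs s : Arr C" "Dom C (m1 M i zs s) = m0 M zs" "Cod C (m1 M i zs s) = m0 M (zs[i := Cod (T ! i) s])"
		using F.loose_tob[OF l z(3)] F.loose_Dom[OF l z(3)] F.loose_Cod[OF l z(3)] z i by (simp_all add: snoc_simps)
	show "m1 M i zs s : Tight C" if "s : Tight (T ! i)"
		using Nn.m1_tight[OF f z(2)] that z i by (simp add: snoc_simps R1 full_sub_sets F.tight_iff)
	show "m1 M i zs (Cmp (T ! i) s' s) = Cmp C (m1 M i (zs[i := Cod (T ! i) s]) s') (m1 M i zs s)"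
		if s': "s' : Arr (T ! i)" "Dom (T ! i) s' = Cod (T ! i) s" for s'
	proof -
		have b: "s' : Arr (Ss ! i)" "Dom (Ss ! i) s' = Cod (Ss ! i) s" using s' i by (simp_all add: snoc_simps)
		have "tob (m1 N i xs (Cmp (Ss ! i) s' s)) y = tob (Cmp Q (m1 N i (xs[i := Cod (Ss ! i) s]) s') (m1 N i xs s)) y"
			using Nn.m1_Cmp[OF f z(2) b] by simp
		then show ?thesis
			using z i by (simp add: snoc_simps N_tob arr_at_Cmp[OF z(2) b] arr_at_next[OF z(2) b])
	qed
	show "m2 M i zs (VId (T ! i) s) = VId C (m1 M i zs s)"
	proof -
		have c: "cell_at Ss i xs (VId (Ss ! i) s)" using z(2) by (simp add: arr_at_def cell_at_def)
		have "mcmp (m2 N i xs (VId (Ss ! i) s)) y = mcmp (VId Q (m1 N i xs s)) y"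
			using Nn.m2_VId[OF f z(2)] by simp
		then show ?thesis using z i by (simp add: snoc_simps N_mcmp[OF c] N_tob mcmp_simps(4) del: full_sub_simps)
	qed
next
	fix zs assume "zs : tuples T"
	then obtain xs y where z: "zs = xs @ [y]" "xs : tuples Ss" "y : Obj Y" by (rule tuples_snocE)
	have f: "mf_fun Ss Q N i" using i by simp
	have "tob (m1 N i xs (Idn (Ss ! i) (xs ! i))) y = tob (Idn Q (m0 N xs)) y"
		using Nn.m1_Idn[OF f z(2) i] by simp
	then show "m1 M i zs (Idn (T ! i) (zs ! i)) = Idn C (m0 M zs)"
		using z i by (simp add: snoc_simps N_tob arr_at_Idn[OF z(2) i] R0)
next
	fix zs al assume "cell_at T i zs al"
	then obtain xs y where z: "zs = xs @ [y]" "cell_at Ss i xs al" "y : Obj Y" "xs : tuples Ss" using i by (rule cell_at_snocE)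
	have f: "mf_fun Ss Q N i" using i by simp
	interpret S: twocat "Ss ! i" by (rule S_twocat[OF i])
	note m = b_modif[OF z(2)]
	have al: "al : Cell (Ss ! i)" "Dom (Ss ! i) (Src (Ss ! i) al) = xs ! i" using z(2) by (simp_all add: cell_at_def)
	show "m2 M i zs al : Cell C" "Src C (m2 M i zs al) = m1 M i zs (Src (T ! i) al)" "Tgt C (m2 M i zs al) = m1 M i zs (Tgt (T ! i) al)"
		using F.modif_cell[OF m z(3)] F.modif_Src[OF m z(3)] F.modif_Tgt[OF m z(3)] z i by (simp_all add: snoc_simps)
	fix be assume b: "be : Cell (T ! i)"
	show "m2 M i zs (VCmp (T ! i) be al) = VCmp C (m2 M i zs be) (m2 M i zs al)" if e: "Src (T ! i) be = Tgt (T ! i) al"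
	proof -
		have b': "be : Cell (Ss ! i)" "Src (Ss ! i) be = Tgt (Ss ! i) al" using b e i by (simp_all add: snoc_simps)
		have c: "cell_at Ss i xs (VCmp (Ss ! i) be al)" "cell_at Ss i xs be" using z(2) b' by (simp_all add: cell_at_def)
		have "mcmp (m2 N i xs (VCmp (Ss ! i) be al)) y = mcmp (VCmp Q (m2 N i xs be) (m2 N i xs al)) y"
			using Nn.m2_VCmp[OF f z(2) b'] by simp
		then show ?thesis using z i by (simp add: snoc_simps N_mcmp[OF c(1)] N_mcmp[OF c(2)] N_mcmp)
	qed
	show "m2 M i zs (HCmp (T ! i) be al) = HCmp C (m2 M i (zs[i := Cod (T ! i) (Src (T ! i) al)]) be) (m2 M i zs al)"
		if e: "Dom (T ! i) (Src (T ! i) be) = Cod (T ! i) (Src (T ! i) al)"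
	proof -
		have b': "be : Cell (Ss ! i)" "Dom (Ss ! i) (Src (Ss ! i) be) = Cod (Ss ! i) (Src (Ss ! i) al)"
			using b e i by (simp_all add: snoc_simps)
		have c: "cell_at Ss i xs (HCmp (Ss ! i) be al)" "cell_at Ss i (xs[i := Cod (Ss ! i) (Src (Ss ! i) al)]) be"
			using z(2) b' update_Cod[OF arr_at_Src[OF z(2)]] tuples_length[OF z(4)] by (simp_all add: cell_at_def)
		have "mcmp (m2 N i xs (HCmp (Ss ! i) be al)) y =
				mcmp (HCmp Q (m2 N i (xs[i := Cod (Ss ! i) (Src (Ss ! i) al)]) be) (m2 N i xs al)) y"
			using Nn.m2_HCmp[OF f z(2) b'] by simp
		then show ?thesis using z i by (simp add: snoc_simps N_mcmp[OF c(1)] N_mcmp[OF c(2)] N_mcmp)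
	qed
qed

lemma M_cells_last:
	assumes i: "i < n" shows "mf_cells v w T C M i n"
	unfolding mf_cells_def
proof (intro allI impI, elim conjE)
	fix zs s t assume a: "arr_at T i zs s" "arr_at T n zs t"
	obtain xs where z: "zs = xs @ [Dom Y t]" "xs : tuples Ss" "t : Arr Y" "Dom Y t : Obj Y" using a(2) by (rule arr_at_lastE)
	have s: "arr_at Ss i xs s" using a(1) z i by (simp add: snoc_simps)
	interpret l: lnatural "ori w Y" "ori w C" "cur_trans Ss Y M i xs s" w by (rule b_lnat[OF s])
	\<comment> \<open>There are two sources of strength: a tight \<open>s\<close> yields a tight
	  transformation, all of whose cells are strong, and a tight \<open>t\<close> is covered by the
	  definition of a loose transformation.\<close>
	have "strong C v (mx M i n zs s t)" if "s : Tight (Ss ! i) \<or> t : Tight Y"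
		using that
	proof
		assume "s : Tight (Ss ! i)"
		then have "m1 N i xs s : Tight Q" using Nn.m1_tight[OF Nt.typed_fun[OF i] s] by blast
		then show ?thesis using z s by (auto simp: R1 full_sub_sets F.tight_iff)
	next
		assume "t : Tight Y"
		then show ?thesis using b_loose[OF s] z unfolding F.loose_iff by auto
	qed
	then show "mx M i n zs s t : Cell C &
		 Src (ori w C) (mx M i n zs s t) = Cmp C (m1 M n (zs[i := Cod (T ! i) s]) t) (m1 M i zs s) &
		 Tgt (ori w C) (mx M i n zs s t) = Cmp C (m1 M i (zs[n := Cod (T ! n) t]) s) (m1 M n zs t) &
		 strong C w (mx M i n zs s t) &
		 (s : Tight (T ! i) \<or> t : Tight (T ! n) --> strong C v (mx M i n zs s t))"
		using l.tcell_cell[of t] l.Src_tcell[of t] l.Tgt_tcell[of t] l.strong_tcell[of t] z i update_Cod[OF s]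
		by (simp add: snoc_simps)
qed

lemma M_cells:
	assumes ij: "i < j" "j < n" shows "mf_cells v w T C M i j"
	unfolding mf_cells_def
proof (intro allI impI, elim conjE)
	have i: "i < n" using ij by simp
	fix zs s t assume a: "arr_at T i zs s" "arr_at T j zs t"
	obtain xs y where z: "zs = xs @ [y]" "arr_at Ss i xs s" "y : Obj Y" "xs : tuples Ss" using a(1) i by (rule arr_at_snocE)
	have t: "arr_at Ss j xs t" using a(2) z ij by (simp add: snoc_simps)
	note m = b_cell[OF ij(1) z(2) t]
	note l = F.modif_lmodif[OF m(1), unfolded lmodif_def, THEN conjunct2, THEN conjunct2, THEN conjunct1, rule_format, of y]
	have st: "strong Q u (mx N i j xs s t) \<longleftrightarrow> (\<forall>y\<in>Obj Y. strong C u (mx M i j (xs @ [y]) s t))" for u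
		using strong_full_sub[OF fcategory_two_category[OF F.fcategory_Fun] m(2)] F.strong_Fun[OF m(1)]
		by (simp add: cur_cell_sel R3[OF ij(1) z(2) t])
	show "mx M i j zs s t : Cell C &
		 Src (ori w C) (mx M i j zs s t) = Cmp C (m1 M j (zs[i := Cod (T ! i) s]) t) (m1 M i zs s) &
		 Tgt (ori w C) (mx M i j zs s t) = Cmp C (m1 M i (zs[j := Cod (T ! j) t]) s) (m1 M j zs t) &
		 strong C w (mx M i j zs s t) &
		 (s : Tight (T ! i) \<or> t : Tight (T ! j) --> strong C v (mx M i j zs s t))"
		using l Nt.tx_strong[OF ij(1) z(2) t] Nt.tx_tight[OF ij(1) z(2) t] z ij i
		by (simp add: cur_cell_sel snoc_simps st snoc_update(1)[OF i z(4)])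
qed

sublocale Tm: mf_typed T C M v w
proof unfold_locales
	show "mf_fun T C M i" if "i < length T" for i
		using that M_fun M_fun_last by (cases "i = n") auto
	show "mf_cells v w T C M i j" if "i < j" "j < length T" for i j
		using that M_cells M_cells_last by (cases "j = n") auto
qed

lemma M_right_last:
	assumes i: "i < n" shows "mf_right w T C M i n"
	unfolding mf_right_def
proof (intro conjI allI impI, goal_cases)
	case (1 zs s)
	obtain xs y where z: "zs = xs @ [y]" "arr_at Ss i xs s" "y : Obj Y" "xs : tuples Ss" using 1 i by (rule arr_at_snocE)
	interpret l: lnatural "ori w Y" "ori w C" "cur_trans Ss Y M i xs s" w by (rule b_lnat[OF z(2)])
	show ?case using l.tcell_Idn[of y] z i by (simp add: snoc_simps)
next
	case (2 zs s t t')
	then obtain xs where z: "zs = xs @ [Dom Y t]" "xs : tuples Ss" "t : Arr Y" "Dom Y t : Obj Y" using arr_at_lastE by metis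
	have s: "arr_at Ss i xs s" using 2 z i by (simp add: snoc_simps)
	interpret l: lnatural "ori w Y" "ori w C" "cur_trans Ss Y M i xs s" w by (rule b_lnat[OF s])
	show ?case using l.tcell_Cmp[of t t'] 2 z i update_Cod[OF s] by (simp add: snoc_simps)
next
	case (3 zs s be)
	then obtain xs where z: "zs = xs @ [Dom Y (Src Y be)]" "xs : tuples Ss" "be : Cell Y" "Dom Y (Src Y be) : Obj Y"
		using cell_at_lastE by metis
	have s: "arr_at Ss i xs s" using 3 z i by (simp add: snoc_simps)
	interpret l: lnatural "ori w Y" "ori w C" "cur_trans Ss Y M i xs s" w by (rule b_lnat[OF s])
	show ?case using l.tcell_nat[of be] 3 z i update_Cod[OF s] by (simp add: snoc_simps Y_Cod_oSrc)
qed

text \<open>Read off from functoriality of \<open>N\<close>: equal transformations have equal cells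
  at \<open>t\<close>. The 2-cell clause is the modification square of the value of \<open>N\<close>
  at a 2-cell.\<close>

lemma M_left_last:
	assumes i: "i < n" shows "mf_left w T C M i n"
	unfolding mf_left_def
proof (intro conjI allI impI, goal_cases)
	case (1 zs t)
	obtain xs where z: "zs = xs @ [Dom Y t]" "xs : tuples Ss" "t : Arr Y" "Dom Y t : Obj Y" using 1 by (rule arr_at_lastE)
	have "tcell (m1 N i xs (Idn (Ss ! i) (xs ! i))) t = tcell (Idn Q (m0 N xs)) t"
		using Nn.m1_Idn[OF Nt.typed_fun[OF i] z(2) i] by simp
	then show ?case using z i by (simp add: snoc_simps R1[OF arr_at_Idn[OF z(2) i]] R0)
next
	case (2 zs s s' t)
	then have b: "arr_at T n zs t" "arr_at T i zs s" "s' : Arr (Ss ! i)" "Dom (Ss ! i) s' = Cod (Ss ! i) s"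
		using i by (simp_all add: snoc_simps)
	obtain xs where z: "zs = xs @ [Dom Y t]" "xs : tuples Ss" "t : Arr Y" "Dom Y t : Obj Y" using b(1) by (rule arr_at_lastE)
	have s: "arr_at Ss i xs s" using b(2) z i by (simp add: snoc_simps)
	have "tcell (m1 N i xs (Cmp (Ss ! i) s' s)) t = tcell (Cmp Q (m1 N i (xs[i := Cod (Ss ! i) s]) s') (m1 N i xs s)) t"
		using Nn.m1_Cmp[OF Nt.typed_fun[OF i] s b(3,4)] by simp
	then show ?case
		using z i by (simp add: snoc_simps R1[OF arr_at_Cmp[OF s b(3,4)]] R1[OF arr_at_next[OF s b(3,4)]] R1[OF s])
next
	case (3 zs t al)
	then have b: "arr_at T n zs t" "cell_at T i zs al" by simp_all
	obtain xs where z: "zs = xs @ [Dom Y t]" "xs : tuples Ss" "t : Arr Y" "Dom Y t : Obj Y" using b(1) by (rule arr_at_lastE)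
	have a: "cell_at Ss i xs al" using b(2) z i by (simp add: snoc_simps)
	have o: "osrc w (cur_modif Ss Y M i xs al) = cur_trans Ss Y M i xs (Src (ori w (Ss ! i)) al)"
		"otgt w (cur_modif Ss Y M i xs al) = cur_trans Ss Y M i xs (Tgt (ori w (Ss ! i)) al)"
		by (simp_all add: osrc_def otgt_def ori_if)
	note l = F.modif_lmodif[OF b_modif[OF a], unfolded o lmodif_def, THEN conjunct2, THEN conjunct2, THEN conjunct2, rule_format, of t]
	show ?case using l z i a by (simp add: snoc_simps Cod_oSrc[OF a] Cod_oTgt[OF a])
qed

end

context curried_backward
begin

context
	notes [simp] = arr_at_cross arr_at_next arr_at_Cmp Nt.cell_at_cross arr_at_oSrc arr_at_oTgt Cod_oSrc Cod_oTgt
begin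

lemma M_right:
	assumes ij: "i < j" "j < n" shows "mf_right w T C M i j"
proof -
	have ne: "i ~= j" "j ~= i" "i < n" using ij by auto
	have "mf_right w Ss Q N i j" using nn ij by (auto simp: Nn.nmf_def)
	note r = this[unfolded mf_right_def, THEN conjunct1, rule_format]
		this[unfolded mf_right_def, THEN conjunct2, THEN conjunct1, rule_format, OF conjI, OF _ conjI, OF _ _ conjI]
		this[unfolded mf_right_def, THEN conjunct2, THEN conjunct2, rule_format, OF conjI]
	show ?thesis
		unfolding mf_right_def
	proof ((intro conjI allI impI; (elim conjE)?), goal_cases)
		case (1 zs s)
		note a = 1
		obtain xs y where z: "zs = xs @ [y]" "arr_at Ss i xs s" "y : Obj Y" "xs : tuples Ss" using a ne(3) by (rule arr_at_snocE)
		have "mcmp (mx N i j xs s (Idn (Ss ! j) (xs ! j))) y = mcmp (VId Q (m1 N i xs s)) y"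
			using r(1)[OF z(2)] by simp
		then show ?case using z ij ne arr_at_Idn[OF z(4) ij(2)]
			by (simp add: mcmp_simps N_mx N_tob snoc_simps del: full_sub_simps)
	next
		case (2 zs s t t')
		note a = 2
		obtain xs y where z: "zs = xs @ [y]" "arr_at Ss i xs s" "y : Obj Y" "xs : tuples Ss" using a(1) ne(3) by (rule arr_at_snocE)
		have b: "arr_at Ss j xs t" "t' : Arr (Ss ! j)" "Dom (Ss ! j) t' = Cod (Ss ! j) t" using a z ij by (simp_all add: snoc_simps)
		have "mcmp (mx N i j xs s (Cmp (Ss ! j) t' t)) y =
			mcmp (VCmp (ori w Q) (whisker_right Q (mx N i j (xs[j := Cod (Ss ! j) t]) s t') (m1 N j xs t))
					(whisker_left Q (m1 N j (xs[i := Cod (Ss ! i) s, j := Cod (Ss ! j) t]) t') (mx N i j xs s t))) y"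
			using r(2)[OF z(2) b] by simp
		then show ?case using z b ij ne update_Cod[OF z(2)] snoc_update(1)[OF ne(3) z(4)]
			by (simp add: mcmp_simps N_mx N_tob snoc_simps del: full_sub_simps)
	next
		case (3 zs s be)
		note a = 3
		obtain xs y where z: "zs = xs @ [y]" "arr_at Ss i xs s" "y : Obj Y" "xs : tuples Ss" using a(1) ne(3) by (rule arr_at_snocE)
		have b: "cell_at Ss j xs be" using a z ij by (simp add: snoc_simps)
		have "mcmp (VCmp (ori w Q) (mx N i j xs s (Tgt (ori w (Ss ! j)) be))
					(whisker_right Q (m2 N j (xs[i := Cod (Ss ! i) s]) be) (m1 N i xs s))) y =
				mcmp (VCmp (ori w Q) (whisker_left Q (m1 N i (xs[j := Cod (Ss ! j) (Src (Ss ! j) be)]) s) (m2 N j xs be))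
					(mx N i j xs s (Src (ori w (Ss ! j)) be))) y"
			using r(3)[OF z(2) b] by simp
		then show ?case using z b ij ne arr_at_Src[OF b] snoc_update(1)[OF ne(3) z(4)]
				arr_at_cross[OF z(2) arr_at_Src[OF b] ne(1)]
			by (simp add: mcmp_simps N_mx N_tob N_mcmp snoc_simps del: full_sub_simps)
	qed
qed

lemma M_left:
	assumes ij: "i < j" "j < n" shows "mf_left w T C M i j"
proof -
	have ne: "i ~= j" "j ~= i" "i < n" using ij by auto
	have "mf_left w Ss Q N i j" using nn ij by (auto simp: Nn.nmf_def)
	note r = this[unfolded mf_left_def, THEN conjunct1, rule_format]
		this[unfolded mf_left_def, THEN conjunct2, THEN conjunct1, rule_format, OF conjI, OF _ conjI, OF _ _ conjI]
		this[unfolded mf_left_def, THEN conjunct2, THEN conjunct2, rule_format, OF conjI]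
	show ?thesis
		unfolding mf_left_def
	proof ((intro conjI allI impI; (elim conjE)?), goal_cases)
		case (1 zs t)
		note a = 1
		obtain xs y where z: "zs = xs @ [y]" "arr_at Ss j xs t" "y : Obj Y" "xs : tuples Ss" using a ij(2) by (rule arr_at_snocE)
		have "mcmp (mx N i j xs (Idn (Ss ! i) (xs ! i)) t) y = mcmp (VId Q (m1 N j xs t)) y"
			using r(1)[OF z(2)] by simp
		then show ?case using z ij ne arr_at_Idn[OF z(4) ne(3)] snoc_nth(3)[OF ne(3) z(4)] snoc_nth(1)[OF ne(3)]
			by (simp add: mcmp_simps N_mx N_tob snoc_simps del: full_sub_simps)
	next
		case (2 zs s s' t)
		note a = 2
		obtain xs y where z: "zs = xs @ [y]" "arr_at Ss i xs s" "y : Obj Y" "xs : tuples Ss" using a(1) ne(3) by (rule arr_at_snocE)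
		have b: "arr_at Ss j xs t" "s' : Arr (Ss ! i)" "Dom (Ss ! i) s' = Cod (Ss ! i) s"
			using a z ij snoc_nth(1)[OF ne(3)] by (simp_all add: snoc_simps)
		have "mcmp (mx N i j xs (Cmp (Ss ! i) s' s) t) y =
			mcmp (VCmp (ori w Q) (whisker_left Q (m1 N i (xs[j := Cod (Ss ! j) t, i := Cod (Ss ! i) s]) s') (mx N i j xs s t))
					(whisker_right Q (mx N i j (xs[i := Cod (Ss ! i) s]) s' t) (m1 N i xs s))) y"
			using r(2)[OF z(2) b] by simp
		then show ?case using z b ij ne update_Cod[OF b(1)] snoc_update(1)[OF ne(3) z(4)] snoc_update(1)[OF ne(3) update_Cod[OF b(1)]]
				snoc_nth(1)[OF ne(3)]
			by (simp add: mcmp_simps N_mx N_tob snoc_simps del: full_sub_simps)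
	next
		case (3 zs t al)
		note a = 3
		obtain xs y where z: "zs = xs @ [y]" "arr_at Ss j xs t" "y : Obj Y" "xs : tuples Ss" using a(1) ij(2) by (rule arr_at_snocE)
		have b: "cell_at Ss i xs al" using a z ne(3) cell_at_snoc[OF ne(3)] by simp
		have "mcmp (VCmp (ori w Q) (mx N i j xs (Tgt (ori w (Ss ! i)) al) t)
					(whisker_left Q (m1 N j (xs[i := Cod (Ss ! i) (Src (Ss ! i) al)]) t) (m2 N i xs al))) y =
				mcmp (VCmp (ori w Q) (whisker_right Q (m2 N i (xs[j := Cod (Ss ! j) t]) al) (m1 N j xs t))
					(mx N i j xs (Src (ori w (Ss ! i)) al) t)) y"
			using r(3)[OF z(2) b] by simp
		then show ?case using z b ij ne arr_at_Src[OF b] snoc_update(1)[OF ne(3) z(4)] snoc_nth(1)[OF ne(3)]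
				arr_at_cross[OF z(2) arr_at_Src[OF b] ne(2)]
			by (simp add: mcmp_simps N_mx N_tob N_mcmp snoc_simps del: full_sub_simps)
	qed
qed

lemma M_cubical:
	assumes ijk: "i < j" "j < k" "k < n" and a: "arr_at T i zs s" "arr_at T j zs t" "arr_at T k zs u"
	shows "cubical T C w M i j k zs s t u"
proof -
	have ne: "i ~= j" "j ~= i" "i ~= k" "k ~= i" "j ~= k" "k ~= j" "i < k" "i < n" "j < n" using ijk by auto
	obtain xs y where z: "zs = xs @ [y]" "arr_at Ss i xs s" "y : Obj Y" "xs : tuples Ss" using a(1) ne(8) by (rule arr_at_snocE)
	have b: "arr_at Ss j xs t" "arr_at Ss k xs u" using a z ne ijk arr_at_snoc[OF ne(9)] arr_at_snoc[OF ijk(3)] by simp_all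
	have "cubical Ss Q w N i j k xs s t u"
		using nn ijk z(2) b unfolding Nn.nmf_def by blast
	note c = this[unfolded cubical_ori Let_def, THEN arg_cong[of _ _ "\<lambda>mu. mcmp mu y"]]
	show ?thesis
		using c z b ijk ne update_Cod[OF z(2)] update_Cod[OF b(1)] update_Cod[OF b(2)]
			snoc_update(1)[OF ne(8)] snoc_update(1)[OF ne(9)] snoc_update(1)[OF ijk(3)]
			snoc_nth(1)[OF ne(8)] snoc_nth(1)[OF ne(9)] snoc_nth(1)[OF ijk(3)]
		by (simp add: cubical_ori Let_def mcmp_simps N_mx N_tob del: full_sub_simps)
qed

text \<open>The modification square at \<open>u\<close> of an interchange cell of \<open>N\<close>,
  rebracketed by \<open>cubical_assoc\<close>.\<close>

lemma M_cubical_last: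
	assumes ij: "i < j" "j < n" and a: "arr_at T i zs s" "arr_at T j zs t" "arr_at T n zs u"
	shows "cubical T C w M i j n zs s t u"
proof -
	have ne: "i ~= j" "j ~= i" "i < n" using ij by auto
	obtain xs where z: "zs = xs @ [Dom Y u]" "xs : tuples Ss" "u : Arr Y" "Dom Y u : Obj Y" using a(3) by (rule arr_at_lastE)
	have b: "arr_at Ss i xs s" "arr_at Ss j xs t" using a z ne ij arr_at_snoc[OF ne(3)] arr_at_snoc[OF ij(2)] by simp_all
	have sw: "xs[j := x, i := y] = xs[i := y, j := x]" for x y using ne by (simp add: list_update_swap)
	note l = F.modif_lmodif[OF b_cell(1)[OF ij(1) b], unfolded lmodif_def, THEN conjunct2, THEN conjunct2, THEN conjunct2, rule_format, of u]
	show ?thesis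
		using l Tm.cubical_assoc[OF ij a] z b ij ne update_Cod[OF b(1)] update_Cod[OF b(2)]
			snoc_update(1)[OF ne(3)] snoc_update(1)[OF ij(2)]
			snoc_nth(1)[OF ne(3)] snoc_nth(1)[OF ij(2)]
		by (simp add: cubical_ori Let_def cur_cell_sel sw snoc_update(2) snoc_nth(2))
qed

end

lemma M_nmf:
	assumes "mfun_restrict T M = M" shows "Mm.nmf v w"
	unfolding Mm.nmf_def
proof (intro conjI ballI allI impI; (elim conjE)?)
	show "mfun_restrict T M = M" by (rule assms)
	show "m0 M zs : Obj C" if zs: "zs : tuples T" for zs
	proof -
		obtain xs y where z: "zs = xs @ [y]" "xs : tuples Ss" "y : Obj Y" using zs by (rule tuples_snocE)
		interpret G: twofun Y C "cur_fun Ss Y M xs" by (rule b_twofun[OF z(2)])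
		show ?thesis using G.F0_ob[OF z(3)] z by simp
	qed
	show "mf_fun T C M i" if "i < length T" for i using that by (rule Tm.typed_fun)
	show "mf_cells v w T C M i j" if "i < j" "j < length T" for i j using that by (rule Tm.typed_cells)
	show "mf_right w T C M i j" "mf_left w T C M i j" if "i < j" "j < length T" for i j
		using that M_right[of i j] M_right_last[of i] M_left[of i j] M_left_last[of i] by (cases "j = n"; simp)+
	show "cubical T C w M i j k xs s t u"
		if "i < j" "j < k" "arr_at T i xs s" "arr_at T j xs t" "arr_at T k xs u" for i j k xs s t u
		using that M_cubical[OF that(1,2) _ that(3-5)] M_cubical_last[of i j xs s t u] arr_at_less[OF that(5)]
		by (cases "k = n") simp_all
qed

end

lemma mfun_restrict_idem [simp]: "mfun_restrict Ss (mfun_restrict Ss M) = mfun_restrict Ss M"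
	by (auto simp: mfun_restrict_def fun_eq_iff)

lemma mfun_restrict_sel:
	"xs : tuples Ss ==> m0 (mfun_restrict Ss M) xs = m0 M xs"
	"arr_at Ss i xs s ==> m1 (mfun_restrict Ss M) i xs s = m1 M i xs s"
	"cell_at Ss i xs al ==> m2 (mfun_restrict Ss M) i xs al = m2 M i xs al"
	"i < j ==> arr_at Ss i xs s ==> arr_at Ss j xs t ==> mx (mfun_restrict Ss M) i j xs s t = mx M i j xs s t"
	by (simp_all add: mfun_restrict_def)

lemma mfun_restrict_cong:
	assumes "!!xs. xs : tuples Ss ==> m0 M xs = m0 N xs"
		and "!!i xs s. arr_at Ss i xs s ==> m1 M i xs s = m1 N i xs s"
		and "!!i xs al. cell_at Ss i xs al ==> m2 M i xs al = m2 N i xs al"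
		and "!!i j xs s t. i < j ==> arr_at Ss i xs s ==> arr_at Ss j xs t ==> mx M i j xs s t = mx N i j xs s t"
	shows "mfun_restrict Ss M = mfun_restrict Ss N"
	using assms by (auto simp: mfun_restrict_def fun_eq_iff)

lemma mfun_eqI:
	assumes "mfun_restrict Ss M = M" "mfun_restrict Ss N = N"
		and "!!xs. xs : tuples Ss ==> m0 M xs = m0 N xs"
		and "!!i xs s. arr_at Ss i xs s ==> m1 M i xs s = m1 N i xs s"
		and "!!i xs al. cell_at Ss i xs al ==> m2 M i xs al = m2 N i xs al"
		and "!!i j xs s t. i < j ==> arr_at Ss i xs s ==> arr_at Ss j xs t ==> mx M i j xs s t = mx N i j xs s t"
	shows "M = N"
	by (rule box_equals[OF mfun_restrict_cong[OF assms(3-6)] assms(1,2)])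

lemma mfun_restrict_cur [simp]: "mfun_restrict Ss (cur w Ss Y C M) = cur w Ss Y C M"
	and mfun_restrict_uncur [simp]: "mfun_restrict (Ss @ [Y]) (uncur Ss Y N) = uncur Ss Y N"
	by (simp_all add: cur_def uncur_def)

lemma cur_sel:
	"xs : tuples Ss ==> m0 (cur w Ss Y C M) xs = cur_fun Ss Y M xs"
	"arr_at Ss i xs s ==> m1 (cur w Ss Y C M) i xs s = cur_trans Ss Y M i xs s"
	"cell_at Ss i xs al ==> m2 (cur w Ss Y C M) i xs al = cur_modif Ss Y M i xs al"
	"i < j ==> arr_at Ss i xs s ==> arr_at Ss j xs t ==> mx (cur w Ss Y C M) i j xs s t = cur_cell w Ss Y C M i j xs s t"
	by (simp_all add: cur_def mfun_restrict_sel)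

lemma cell_at_less: "cell_at Ss i xs al ==> i < length Ss"
	by (simp add: cell_at_def)

lemma uncur_sel:
	"xs : tuples Ss ==> y : Obj Y ==> m0 (uncur Ss Y N) (xs @ [y]) = F0 (m0 N xs) y"
	"arr_at Ss i xs s ==> y : Obj Y ==> m1 (uncur Ss Y N) i (xs @ [y]) s = tob (m1 N i xs s) y"
	"xs : tuples Ss ==> t : Arr Y ==> Dom Y t : Obj Y ==> m1 (uncur Ss Y N) (length Ss) (xs @ [Dom Y t]) t = F1 (m0 N xs) t"
	"cell_at Ss i xs al ==> y : Obj Y ==> m2 (uncur Ss Y N) i (xs @ [y]) al = mcmp (m2 N i xs al) y"
	"xs : tuples Ss ==> be : Cell Y ==> Dom Y (Src Y be) : Obj Y ==>
		 m2 (uncur Ss Y N) (length Ss) (xs @ [Dom Y (Src Y be)]) be = F2 (m0 N xs) be"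
	"i < j ==> arr_at Ss i xs s ==> arr_at Ss j xs t ==> y : Obj Y ==>
		 mx (uncur Ss Y N) i j (xs @ [y]) s t = mcmp (mx N i j xs s t) y"
	"arr_at Ss i xs s ==> t : Arr Y ==> Dom Y t : Obj Y ==>
		 mx (uncur Ss Y N) i (length Ss) (xs @ [Dom Y t]) s t = tcell (m1 N i xs s) t"
	by (simp_all add: uncur_def mfun_restrict_def arr_at_snoc tuples_snoc cell_at_snoc arr_at_last cell_at_last
			arr_at_less arr_at_tuples cell_at_less)

locale cur_setup = fcats Ss + F: funcat Y C v w
	for Ss :: "('o, 'a, 't) fcat list" and Y :: "('o, 'a, 't) fcat" and C :: "('p, 'b, 's) fcat" and v w +
	fixes P :: "('o, 'a, 't, 'p, 'b, 's) ffun set"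
begin

abbreviation Q where "Q \<equiv> full_sub F.K P"

lemma cur_multifunctor:
	assumes M: "multifunctor v w (Ss @ [Y]) C M" and P: "!!xs. xs : tuples Ss ==> cur_fun Ss Y M xs : P"
	shows "multifunctor v w Ss Q (cur w Ss Y C M)"
proof -
	interpret c: curried Ss Y C v w P M "cur w Ss Y C M" by unfold_locales (simp_all add: cur_sel)
	interpret f: curried_forward Ss Y C v w P M "cur w Ss Y C M"
		by unfold_locales (use M c.Mm.multifunctor_iff_nmf[OF F.vw] P in \<open>simp_all add: cur_sel\<close>)
	show ?thesis using c.Nn.multifunctor_iff_nmf[OF F.vw] f.N_nmf by simp
qed

lemma uncur_cur:
	assumes M: "mfun_restrict (Ss @ [Y]) M = M"
	shows "uncur Ss Y (cur w Ss Y C M) = M"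
proof (rule mfun_eqI[OF mfun_restrict_uncur M])
	let ?N = "uncur Ss Y (cur w Ss Y C M)"
	show "m0 ?N zs = m0 M zs" if "zs : tuples (Ss @ [Y])" for zs
		using tuples_snocE[OF that] by (metis uncur_sel(1) cur_sel(1) cur_fun_sel(1))
	show "m1 ?N i zs s = m1 M i zs s" if a: "arr_at (Ss @ [Y]) i zs s" for i zs s
	proof (cases "i < length Ss")
		case True
		obtain xs y where "zs = xs @ [y]" "arr_at Ss i xs s" "y : Obj Y" "xs : tuples Ss" using a True by (rule arr_at_snocE)
		then show ?thesis by (simp add: uncur_sel cur_sel)
	next
		case False
		then have i: "i = length Ss" using arr_at_less[OF a] by simp
		obtain xs where "zs = xs @ [Dom Y s]" "xs : tuples Ss" "s : Arr Y" "Dom Y s : Obj Y" using a[unfolded i] by (rule arr_at_lastE)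
		then show ?thesis by (simp add: uncur_sel cur_sel i)
	qed
	show "m2 ?N i zs al = m2 M i zs al" if a: "cell_at (Ss @ [Y]) i zs al" for i zs al
	proof (cases "i < length Ss")
		case True
		obtain xs y where "zs = xs @ [y]" "cell_at Ss i xs al" "y : Obj Y" "xs : tuples Ss" using a True by (rule cell_at_snocE)
		then show ?thesis by (simp add: uncur_sel cur_sel)
	next
		case False
		then have i: "i = length Ss" using a by (simp add: cell_at_def)
		obtain xs where "zs = xs @ [Dom Y (Src Y al)]" "xs : tuples Ss" "al : Cell Y" "Dom Y (Src Y al) : Obj Y"
			using a[unfolded i] by (rule cell_at_lastE)
		then show ?thesis by (simp add: uncur_sel cur_sel i)
	qed
	show "mx ?N i j zs s t = mx M i j zs s t"
		if ij: "i < j" and a: "arr_at (Ss @ [Y]) i zs s" "arr_at (Ss @ [Y]) j zs t" for i j zs s t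
	proof (cases "j < length Ss")
		case True
		then have i: "i < length Ss" using ij by simp
		obtain xs y where z: "zs = xs @ [y]" "arr_at Ss i xs s" "y : Obj Y" "xs : tuples Ss" using a(1) i by (rule arr_at_snocE)
		have "arr_at Ss j xs t" using a(2) z True by (simp add: arr_at_snoc)
		then show ?thesis using z ij by (simp add: uncur_sel cur_sel cur_cell_sel)
	next
		case False
		then have j: "j = length Ss" using arr_at_less[OF a(2)] by simp
		obtain xs where z: "zs = xs @ [Dom Y t]" "xs : tuples Ss" "t : Arr Y" "Dom Y t : Obj Y"
			using a(2)[unfolded j] by (rule arr_at_lastE)
		have "arr_at Ss i xs s" using a(1) z ij j by (simp add: arr_at_snoc)
		then show ?thesis using z by (simp add: uncur_sel cur_sel j)
	qed
qed

text \<open>Functors, transformations and modifications are extensional, so the components collected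
  in \<open>uncur\<close> determine the values of \<open>N\<close>. Hence \<open>N\<close> is
  related to its uncurrying by \<open>curried\<close>, and the backward direction applies to this
  pair.\<close>

lemma
	assumes N: "multifunctor v w Ss Q N"
	shows uncur_curried: "curried Ss Y C v w (uncur Ss Y N) N"
		and uncur_multifunctor: "multifunctor v w (Ss @ [Y]) C (uncur Ss Y N)"
		and cur_uncur: "cur w Ss Y C (uncur Ss Y N) = N"
proof -
	interpret N: mf_setup Ss Q N by unfold_locales (rule fcategory_full_sub[OF F.fcategory_Fun])
	have n: "N.nmf v w" using N N.multifunctor_iff_nmf[OF F.vw] by simp
	interpret Nt: mf_typed Ss Q N v w by unfold_locales (use n in \<open>auto simp: N.nmf_def\<close>)
	have M0: "m0 N xs = cur_fun Ss Y (uncur Ss Y N) xs" if xs: "xs : tuples Ss" for xs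
	proof -
		have "ffunctor Y C (m0 N xs)" using n xs unfolding N.nmf_def by (auto simp: full_sub_sets)
		then interpret G: twofun Y C "m0 N xs" by unfold_locales
		show ?thesis
			unfolding cur_fun_def
			by (rule ffun.equality) (auto intro!: restrict_eqI[symmetric] G.F0_ext G.F1_ext G.F2_ext simp: uncur_sel xs)
	qed
	have M1: "m1 N i xs s = cur_trans Ss Y (uncur Ss Y N) i xs s" if a: "arr_at Ss i xs s" for i xs s
	proof -
		have l: "m1 N i xs s : loose_trans Y C v w" using Nt.t1_arr[OF a] by (simp add: full_sub_sets)
		show ?thesis
			unfolding cur_trans_def M0[OF arr_at_tuples[OF a], symmetric] M0[OF update_Cod[OF a], symmetric]
			by (rule wtrans.equality) (use Nt.t1_Dom[OF a] Nt.t1_Cod[OF a] in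
				\<open>auto intro!: restrict_eqI[symmetric] F.loose_tob_ext[OF l] F.loose_tcell_ext[OF l] simp: uncur_sel a\<close>)
	qed
	have M2: "m2 N i xs al = cur_modif Ss Y (uncur Ss Y N) i xs al" if a: "cell_at Ss i xs al" for i xs al
	proof -
		have m: "m2 N i xs al : modifications Y C v w" using Nt.t2_cell[OF a] by (simp add: full_sub_sets)
		have i: "i < length Ss" using a by (simp add: cell_at_def)
		show ?thesis
			unfolding cur_modif_def M1[OF arr_at_Src[OF a], symmetric] M1[OF arr_at_Tgt[OF a], symmetric]
			by (rule modif.equality) (use N.m2_Src[OF Nt.typed_fun[OF i] a] N.m2_Tgt[OF Nt.typed_fun[OF i] a] in
				\<open>auto intro!: restrict_eqI[symmetric] F.modif_ext[OF m] simp: uncur_sel a\<close>)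
	qed
	\<comment> \<open>Recovers the actual ends of a modification from its oriented ends.\<close>
	have oe: "msrc mu = (if u = Colax then b else a) & mtgt mu = (if u = Colax then a else b)"
		if "Src (ori u Q) mu = a" "Tgt (ori u Q) mu = b" for u mu a b
		using that by (cases "u = Colax") (simp_all add: ori_if)
	have M3: "mx N i j xs s t = cur_cell w Ss Y C (uncur Ss Y N) i j xs s t"
		if ij: "i < j" and a: "arr_at Ss i xs s" "arr_at Ss j xs t" for i j xs s t
	proof -
		have m: "mx N i j xs s t : modifications Y C v w" using Nt.tx_cell[OF ij a] by (simp add: full_sub_sets)
		have c: "arr_at Ss i (xs[j := Cod (Ss ! j) t]) s" "arr_at Ss j (xs[i := Cod (Ss ! i) s]) t"
			using arr_at_cross a ij by simp_all
		have "Src (ori w Q) (mx N i j xs s t) = trans_comp Y C w (m1 N j (xs[i := Cod (Ss ! i) s]) t) (m1 N i xs s)"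
			"Tgt (ori w Q) (mx N i j xs s t) = trans_comp Y C w (m1 N i (xs[j := Cod (Ss ! j) t]) s) (m1 N j xs t)"
			using Nt.tx_Src[OF ij a] Nt.tx_Tgt[OF ij a] by simp_all
		note e = oe[OF this]
		show ?thesis
			unfolding cur_cell_def Let_def M1[OF a(1), symmetric] M1[OF a(2), symmetric] M1[OF c(1), symmetric] M1[OF c(2), symmetric]
			by (rule modif.equality) (use e in
				\<open>auto intro!: restrict_eqI[symmetric] F.modif_ext[OF m] simp: uncur_sel a ij\<close>)
	qed
	show "curried Ss Y C v w (uncur Ss Y N) N"
		by unfold_locales (simp_all add: M0 M1 M2 M3)
	then interpret c: curried Ss Y C v w P "uncur Ss Y N" N .
	interpret b: curried_backward Ss Y C v w P "uncur Ss Y N" N by unfold_locales (rule n)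
	show "multifunctor v w (Ss @ [Y]) C (uncur Ss Y N)"
		using c.Mm.multifunctor_iff_nmf[OF F.vw] b.M_nmf by simp
	have r: "mfun_restrict Ss N = N" using n by (simp add: N.nmf_def)
	show "cur w Ss Y C (uncur Ss Y N) = N"
		by (rule mfun_eqI[OF mfun_restrict_cur r]) (simp_all add: cur_sel flip: M0 M1 M2 M3)
qed

end

section \<open>The action of 2-functors on weighted cones, models and multifunctors\<close>

section \<open>Models and post-composition\<close>

lemma ffun_comp_sel [simp]:
	"x : Obj A ==> F0 (ffun_comp A G F) x = F0 G (F0 F x)"
	"f : Arr A ==> F1 (ffun_comp A G F) f = F1 G (F1 F f)"
	"al : Cell A ==> F2 (ffun_comp A G F) al = F2 G (F2 F al)"
	by (simp_all add: ffun_comp_def)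

lemma ffunctor_comp:
	assumes "two_category A" "!!f. f : Tight A ==> f : Arr A" "two_category B" "two_category C" "ffunctor A B F" "ffunctor B C G"
	shows "ffunctor A C (ffun_comp A G F)"
proof -
	interpret F: twofun A B F by unfold_locales (use assms in auto)
	interpret G: twofun B C G by unfold_locales (use assms in auto)
	show ?thesis
		by (rule ffunctorI) (simp_all add: assms(1,2), simp_all add: ffun_comp_def)
qed

locale cone =
	fixes small :: "'u set => bool" and S :: "('o, 'a, 't) fcat" and c
	assumes S: "fcategory S" and cone: "weighted_cone small S c"
begin

abbreviation J where "J \<equiv> shape c"
abbreviation W where "W \<equiv> weight c"
abbreviation D where "D \<equiv> diag c"
abbreviation X where "X \<equiv> apex c"

lemma
	shows J_small: "small_fcat small J" and W: "ffunctor J (FF small) W" and D: "ffunctor J S D" and X [simp]: "X : Obj S"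
		and leg_ext: "leg c : extensional (Obj J)"
		and leg: "j : Obj J ==> is_functor (lam (F0 W j)) (hom_cat S X (F0 D j)) (leg c j)"
		and leg_restricts: "j : Obj J ==> restricts (F0 W j) (hom_fobj S X (F0 D j)) (leg c j)"
		and leg_nat: "f : Arr J ==> cfun_comp (lam (F0 W (Dom J f))) (leg c (Cod J f)) (fa_fun (F1 W f)) =
				 cfun_comp (lam (F0 W (Dom J f))) (postcomp S X (F1 D f)) (leg c (Dom J f))"
		and leg_nat2: "al : Cell J ==> x : c_ob (lam (F0 W (Dom J (Src J al)))) ==>
					 f_ar (leg c (Cod J (Src J al))) (fn_cmp (F2 W al) x) =
					 whisker_right S (F2 D al) (f_ob (leg c (Dom J (Src J al))) x)"
	using cone unfolding weighted_cone_def Let_def by blast+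

lemma J: "fcategory J"
	using J_small by (simp add: small_fcat_def)

sublocale D: twofun J S D
	by unfold_locales (use J S D in \<open>auto simp: fcategory_two_category\<close>)

lemma W_ob: "j : Obj J ==> F0 W j : FF_ob small"
	using W unfolding ffunctor_def is_functor_def arrow_cat_def FF_def by (auto simp: PiE_iff)

lemma W_cat:
	assumes "j : Obj J"
	shows "category (lam (F0 W j))" "category (tau (F0 W j))" "is_functor (tau (F0 W j)) (lam (F0 W j)) (emb (F0 W j))"
	using W_ob[OF assms] by (simp_all add: FF_ob_def full_embedding_def)

lemma W_ar:
	assumes "f : Arr J"
	shows "fa_dom (F1 W f) = F0 W (Dom J f)" "fa_cod (F1 W f) = F0 W (Cod J f)"
		and "is_functor (lam (F0 W (Dom J f))) (lam (F0 W (Cod J f))) (fa_fun (F1 W f))"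
proof -
	have 1: "F1 W f : FF_ar small" "fa_dom (F1 W f) = F0 W (Dom J f)" "fa_cod (F1 W f) = F0 W (Cod J f)"
		using W assms unfolding ffunctor_def is_functor_def arrow_cat_def FF_def by (auto simp: PiE_iff)
	then show "fa_dom (F1 W f) = F0 W (Dom J f)" "fa_cod (F1 W f) = F0 W (Cod J f)"
		"is_functor (lam (F0 W (Dom J f))) (lam (F0 W (Cod J f))) (fa_fun (F1 W f))"
		by (auto simp: FF_ar_def)
qed

lemma W_cell:
	assumes "al : Cell J" "x : c_ob (lam (F0 W (Dom J (Src J al))))"
	shows "fn_cmp (F2 W al) x : c_ar (lam (F0 W (Cod J (Src J al))))"
proof -
	have "F2 W al : FF_cell small" "fn_src (F2 W al) = F1 W (Src J al)"
		using W assms unfolding ffunctor_def is_functor_def vertical_cat_def FF_def by (auto simp: PiE_iff)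
	then have "x : c_ob (lam (fa_dom (F1 W (Src J al)))) ==> fn_cmp (F2 W al) x : c_ar (lam (fa_cod (F1 W (Src J al))))"
		by (auto simp: FF_cell_def Let_def c_hom_def)
	then show ?thesis using W_ar(1,2)[of "Src J al"] assms by simp
qed

lemma
	assumes "j : Obj J"
	shows leg_ob: "x : c_ob (lam (F0 W j)) ==> f_ob (leg c j) x : Arr S"
			"x : c_ob (lam (F0 W j)) ==> Dom S (f_ob (leg c j) x) = X"
			"x : c_ob (lam (F0 W j)) ==> Cod S (f_ob (leg c j) x) = F0 D j"
		and leg_ar: "a : c_ar (lam (F0 W j)) ==> f_ar (leg c j) a : Cell S"
			"a : c_ar (lam (F0 W j)) ==> Dom S (Src S (f_ar (leg c j) a)) = X"
			"a : c_ar (lam (F0 W j)) ==> Cod S (Src S (f_ar (leg c j) a)) = F0 D j"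
	using leg[OF assms] unfolding is_functor_def hom_cat_def by (auto simp: PiE_iff)

end

lemma is_functorI:
	assumes "f_ob F : extensional (c_ob A)" "f_ar F : extensional (c_ar A)"
		"!!x. x : c_ob A ==> f_ob F x : c_ob B" "!!f. f : c_ar A ==> f_ar F f : c_ar B"
		"!!f. f : c_ar A ==> c_dom B (f_ar F f) = f_ob F (c_dom A f)"
		"!!f. f : c_ar A ==> c_cod B (f_ar F f) = f_ob F (c_cod A f)"
		"!!x. x : c_ob A ==> f_ar F (c_id A x) = c_id B (f_ob F x)"
		"!!f g. f : c_ar A ==> g : c_ar A ==> c_dom A g = c_cod A f ==> f_ar F (c_comp A g f) = c_comp B (f_ar F g) (f_ar F f)"
	shows "is_functor A B F"
	using assms by (simp add: is_functor_def PiE_iff)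

lemma
	assumes "is_functor A B F"
	shows is_functor_ob: "x : c_ob A ==> f_ob F x : c_ob B" and is_functor_ar: "f : c_ar A ==> f_ar F f : c_ar B"
		and is_functor_dom: "f : c_ar A ==> c_dom B (f_ar F f) = f_ob F (c_dom A f)"
		and is_functor_cod: "f : c_ar A ==> c_cod B (f_ar F f) = f_ob F (c_cod A f)"
		and is_functor_id: "x : c_ob A ==> f_ar F (c_id A x) = c_id B (f_ob F x)"
		and is_functor_comp: "f : c_ar A ==> g : c_ar A ==> c_dom A g = c_cod A f ==>
			f_ar F (c_comp A g f) = c_comp B (f_ar F g) (f_ar F f)"
	using assms by (simp_all add: is_functor_def PiE_iff)

text \<open>Composition of functors when the second one is not extensional on its domain.\<close>

lemma is_functor_cfun_comp:
	assumes A: "category A" and L: "is_functor A B L"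
		and "!!x. x : c_ob B ==> f_ob K x : c_ob C" "!!f. f : c_ar B ==> f_ar K f : c_ar C"
		"!!f. f : c_ar B ==> c_dom C (f_ar K f) = f_ob K (c_dom B f)"
		"!!f. f : c_ar B ==> c_cod C (f_ar K f) = f_ob K (c_cod B f)"
		"!!x. x : c_ob B ==> f_ar K (c_id B x) = c_id C (f_ob K x)"
		"!!f g. f : c_ar B ==> g : c_ar B ==> c_dom B g = c_cod B f ==> f_ar K (c_comp B g f) = c_comp C (f_ar K g) (f_ar K f)"
	shows "is_functor A C (cfun_comp A K L)"
proof (rule is_functorI)
	show "f_ob (cfun_comp A K L) : extensional (c_ob A)" "f_ar (cfun_comp A K L) : extensional (c_ar A)"
		by (simp_all add: cfun_comp_def)
	note L' = is_functor_ob[OF L] is_functor_ar[OF L] is_functor_dom[OF L] is_functor_cod[OF L] is_functor_id[OF L]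
		is_functor_comp[OF L]
	show "f_ob (cfun_comp A K L) x : c_ob C" if "x : c_ob A" for x
		using that by (simp add: cfun_comp_def L' assms(3-))
	show "f_ar (cfun_comp A K L) f : c_ar C" "c_dom C (f_ar (cfun_comp A K L) f) = f_ob (cfun_comp A K L) (c_dom A f)"
		"c_cod C (f_ar (cfun_comp A K L) f) = f_ob (cfun_comp A K L) (c_cod A f)" if "f : c_ar A" for f
		using that by (simp_all add: cfun_comp_def L' assms(3-) c_dom_ob[OF A] c_cod_ob[OF A])
	show "f_ar (cfun_comp A K L) (c_id A x) = c_id C (f_ob (cfun_comp A K L) x)" if "x : c_ob A" for x
		using that by (simp add: cfun_comp_def L' assms(3-) c_id_ar[OF A])
	show "f_ar (cfun_comp A K L) (c_comp A g f) = c_comp C (f_ar (cfun_comp A K L) g) (f_ar (cfun_comp A K L) f)"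
		if "f : c_ar A" "g : c_ar A" "c_dom A g = c_cod A f" for f g
		using that by (simp add: cfun_comp_def L' assms(3-) c_comp_ar[OF A])
qed

locale cone_map = cone small S c + F: twofun S C F
	for small :: "'u set => bool" and S :: "('o, 'a, 't) fcat" and c and C :: "('p, 'b, 's) fcat" and F
begin

lemma map_leg:
	assumes j: "j : Obj J"
	shows "is_functor (lam (F0 W j)) (hom_cat C (F0 F X) (F0 F (F0 D j)))
			(cfun_comp (lam (F0 W j)) \<lparr>f_ob = F1 F, f_ar = F2 F\<rparr> (leg c j))"
	by (rule is_functor_cfun_comp[OF W_cat(1)[OF j] leg[OF j]]) (auto simp: hom_cat_def)

lemma map_leg_restricts:
	assumes j: "j : Obj J"
	shows "restricts (F0 W j) (hom_fobj C (F0 F X) (F0 F (F0 D j)))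
			(cfun_comp (lam (F0 W j)) \<lparr>f_ob = F1 F, f_ar = F2 F\<rparr> (leg c j))"
proof -
	let ?A = "F0 W j" and ?K = "\<lparr>f_ob = F1 F, f_ar = F2 F\<rparr>"
	let ?B = "tight_hom_cat S X (F0 D j)" and ?B' = "tight_hom_cat C (F0 F X) (F0 F (F0 D j))"
	obtain G where G: "is_functor (tau ?A) ?B G"
		and eq: "cfun_comp (tau ?A) (cfun_id ?B) G = cfun_comp (tau ?A) (leg c j) (emb ?A)"
		using leg_restricts[OF j] by (auto simp: restricts_def hom_fobj_def)
	note E = W_cat(3)[OF j]
	\<comment> \<open>The witness for tightness of the image leg is the tight part \<open>G\<close> of
	  the original leg followed by \<open>F\<close>, which preserves tight 1-cells.\<close>
	have G': "is_functor (tau ?A) ?B' (cfun_comp (tau ?A) ?K G)"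
		by (rule is_functor_cfun_comp[OF W_cat(2)[OF j] G]) (auto simp: tight_hom_cat_def Tight_arr[OF S])
	\<comment> \<open>The embedding of a hom object is an inclusion, so \<open>G\<close> is the leg
	  restricted along the embedding of the weight.\<close>
	have o: "f_ob G x = f_ob (leg c j) (f_ob (emb ?A) x)" if "x : c_ob (tau ?A)" for x
		using arg_cong[OF eq, of "\<lambda>H. f_ob H x"] that is_functor_ob[OF G that] by (simp add: cfun_comp_def cfun_id_def)
	have a: "f_ar G x = f_ar (leg c j) (f_ar (emb ?A) x)" if "x : c_ar (tau ?A)" for x
		using arg_cong[OF eq, of "\<lambda>H. f_ar H x"] that is_functor_ar[OF G that] by (simp add: cfun_comp_def cfun_id_def)
	have "cfun_comp (tau ?A) (cfun_id ?B') (cfun_comp (tau ?A) ?K G) =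
			cfun_comp (tau ?A) (cfun_comp (lam ?A) ?K (leg c j)) (emb ?A)"
		using is_functor_ob[OF G'] is_functor_ar[OF G'] is_functor_ob[OF E] is_functor_ar[OF E]
		by (auto simp: cfun_comp_def cfun_id_def o a intro!: restrict_ext)
	then show ?thesis using G' by (auto simp: restricts_def hom_fobj_def)
qed

lemma weighted_cone_map: "weighted_cone small C (map_cone F c)"
	unfolding weighted_cone_def Let_def map_cone_def wcone.simps
proof (intro conjI ballI)
	note JJ = J_small W
	show "small_fcat small J" "ffunctor J (FF small) W" by (rule J_small W)+
	show "ffunctor J C (ffun_comp J F D)"
		by (rule ffunctor_comp[OF D.A.two_category Tight_arr[OF J] fcategory_two_category[OF S] F.B.two_category D F.ffunctor])
	show "F0 F X : Obj C" by simp
	show "(\<lambda>j\<in>Obj J. cfun_comp (lam (F0 W j)) \<lparr>f_ob = F1 F, f_ar = F2 F\<rparr> (leg c j)) : extensional (Obj J)" by simp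
	fix j assume j: "j : Obj J"
	show "is_functor (lam (F0 W j)) (hom_cat C (F0 F X) (F0 (ffun_comp J F D) j))
			((\<lambda>j\<in>Obj J. cfun_comp (lam (F0 W j)) \<lparr>f_ob = F1 F, f_ar = F2 F\<rparr> (leg c j)) j)"
		"restricts (F0 W j) (hom_fobj C (F0 F X) (F0 (ffun_comp J F D) j))
			((\<lambda>j\<in>Obj J. cfun_comp (lam (F0 W j)) \<lparr>f_ob = F1 F, f_ar = F2 F\<rparr> (leg c j)) j)"
		using map_leg[OF j] map_leg_restricts[OF j] j by simp_all
next
	fix f assume f: "f : Arr J"
	note n = leg_nat[OF f] and w = W_ar(3)[OF f]
	have o: "f_ob (leg c (Cod J f)) (f_ob (fa_fun (F1 W f)) x) = Cmp S (F1 D f) (f_ob (leg c (Dom J f)) x)"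
		if "x : c_ob (lam (F0 W (Dom J f)))" for x
		using arg_cong[OF n, of "\<lambda>H. f_ob H x"] that f leg_ob[of "Dom J f" x]
		by (simp add: cfun_comp_def postcomp_def hom_cat_def)
	have a: "f_ar (leg c (Cod J f)) (f_ar (fa_fun (F1 W f)) x) = whisker_left S (F1 D f) (f_ar (leg c (Dom J f)) x)"
		if "x : c_ar (lam (F0 W (Dom J f)))" for x
		using arg_cong[OF n, of "\<lambda>H. f_ar H x"] that f leg_ar[of "Dom J f" x]
		by (simp add: cfun_comp_def postcomp_def hom_cat_def)
	show "cfun_comp (lam (F0 W (Dom J f)))
				((\<lambda>j\<in>Obj J. cfun_comp (lam (F0 W j)) \<lparr>f_ob = F1 F, f_ar = F2 F\<rparr> (leg c j)) (Cod J f)) (fa_fun (F1 W f)) =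
			cfun_comp (lam (F0 W (Dom J f))) (postcomp C (F0 F X) (F1 (ffun_comp J F D) f))
				((\<lambda>j\<in>Obj J. cfun_comp (lam (F0 W j)) \<lparr>f_ob = F1 F, f_ar = F2 F\<rparr> (leg c j)) (Dom J f))"
		using f is_functor_ob[OF w] is_functor_ar[OF w] leg_ob[of "Dom J f"] leg_ar[of "Dom J f"]
		by (auto simp: cfun_comp_def postcomp_def hom_cat_def o a intro!: restrict_ext)
next
	fix al x assume al: "al : Cell J" and x: "x : c_ob (lam (F0 W (Dom J (Src J al))))"
	show "f_ar ((\<lambda>j\<in>Obj J. cfun_comp (lam (F0 W j)) \<lparr>f_ob = F1 F, f_ar = F2 F\<rparr> (leg c j)) (Cod J (Src J al)))
				(fn_cmp (F2 W al) x) =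
			whisker_right C (F2 (ffun_comp J F D) al)
				(f_ob ((\<lambda>j\<in>Obj J. cfun_comp (lam (F0 W j)) \<lparr>f_ob = F1 F, f_ar = F2 F\<rparr> (leg c j)) (Dom J (Src J al))) x)"
		using al x W_cell[OF al x] leg_ob[of "Dom J (Src J al)" x] leg_nat2[OF al x] by (simp add: cfun_comp_def)
qed

end

context cone begin

text \<open>The diagram and the legs take their values in \<open>S\<close>, so restricting the
  composite functor to the carriers of \<open>S\<close> changes nothing.\<close>

lemma map_cone_comp: "ffunctor S B F ==> map_cone G (map_cone F c) = map_cone (ffun_comp S G F) c"
	unfolding map_cone_def wcone.simps ffun_comp_def ffun.simps
	using leg_ob leg_ar by (auto simp: cfun_comp_def intro!: restrict_ext)

lemma map_cone_cong:
	assumes "!!x. x : Obj S ==> F0 F x = F0 G x" "!!x. x : Arr S ==> F1 F x = F1 G x" "!!x. x : Cell S ==> F2 F x = F2 G x"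
	shows "map_cone F c = map_cone G c"
	unfolding map_cone_def ffun_comp_def
	using leg_ob leg_ar by (auto simp: cfun_comp_def assms intro!: restrict_ext)

end

text \<open>Stated for sketches over arbitrary carrier types, since \<open>Mod_sketch\<close> does
  not have its carriers in \<open>'u\<close> and so is no instance of
  \<open>small_sketch\<close>.\<close>

lemma model_compose:
	assumes A: "fcategory (scat A)" "!!c. c : cones A ==> weighted_cone small (scat A) c"
		and B: "two_category (scat B)" and C: "two_category (scat C)" and F: "model A B F" and G: "model B C G"
	shows "model A C (ffun_comp (scat A) G F)"
proof -
	have "map_cone (ffun_comp (scat A) G F) c : cones C" if c: "c : cones A" for c
	proof -
		interpret cone small "scat A" c by unfold_locales (use A c in auto)
		have "map_cone G (map_cone F c) : cones C" using F G c by (auto simp: model_def)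
		then show ?thesis using map_cone_comp[of "scat B" F G] F by (simp add: model_def)
	qed
	then show ?thesis
		using ffunctor_comp[OF fcategory_two_category[OF A(1)] Tight_arr[OF A(1)] B C] F G by (simp add: model_def)
qed

lemma model_comp:
	assumes "small_sketch small A" "two_category (scat B)" "two_category (scat C)" "model A B F" "model B C G"
	shows "model A C (ffun_comp (scat A) G F)"
	using assms(1) by (intro model_compose[OF _ _ assms(2-5), of small]) (auto simp: small_sketch_def small_fcat_def)

text \<open>Composition with the unary multimorphism given by \<open>G\<close>, without the index
  arithmetic of substitution; \<open>subst_unary\<close> identifies the two.\<close>

definition post where
	"post Ss G N = mfun_restrict Ss
		 \<lparr>m0 = (\<lambda>xs. F0 G (m0 N xs)), m1 = (\<lambda>i xs s. F1 G (m1 N i xs s)),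
			m2 = (\<lambda>i xs al. F2 G (m2 N i xs al)), mx = (\<lambda>i j xs s t. F2 G (mx N i j xs s t))\<rparr>"

lemma post_sel:
	"xs : tuples Ss ==> m0 (post Ss G N) xs = F0 G (m0 N xs)"
	"arr_at Ss i xs s ==> m1 (post Ss G N) i xs s = F1 G (m1 N i xs s)"
	"cell_at Ss i xs al ==> m2 (post Ss G N) i xs al = F2 G (m2 N i xs al)"
	"i < j ==> arr_at Ss i xs s ==> arr_at Ss j xs t ==> mx (post Ss G N) i j xs s t = F2 G (mx N i j xs s t)"
	by (simp_all add: post_def mfun_restrict_sel)

lemma mfun_restrict_post [simp]: "mfun_restrict Ss (post Ss G N) = post Ss G N"
	by (simp add: post_def)

lemma (in fcats) slice_post:
	assumes "xs : tuples Ss" "i < length Ss"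
	shows "slice Ss (post Ss G N) i xs = ffun_comp (Ss ! i) G (slice Ss N i xs)"
proof -
	interpret S: twocat "Ss ! i" by (rule S_twocat[OF assms(2)])
	have "arr_at Ss i (xs[i := Dom (Ss ! i) s]) s" if "s : Arr (Ss ! i)" for s
		using that assms tuples_length[OF assms(1)] by (simp add: arr_at_def tuples_update)
	moreover have "cell_at Ss i (xs[i := Dom (Ss ! i) (Src (Ss ! i) s)]) s" if "s : Cell (Ss ! i)" for s
		using that assms tuples_length[OF assms(1)] by (simp add: cell_at_def tuples_update)
	ultimately show ?thesis
		using assms by (auto simp: slice_def ffun_comp_def post_sel tuples_update intro!: restrict_ext)
qed

locale post_setup = mf_typed Ss B N v w + G: twofun B A G
	for Ss :: "('o, 'a, 't) fcat list" and B :: "('p, 'b, 's) fcat" and N v w and A :: "('q, 'c, 'r) fcat" and G +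
	assumes A: "fcategory A" and vw: "v \<preceq> w" and nn: "nmf v w"
begin

sublocale A: mf_setup Ss A "post Ss G N" by unfold_locales (rule A)

context
	notes [simp] = arr_at_cross arr_at_next arr_at_Cmp cell_at_cross arr_at_oSrc arr_at_oTgt Cod_oSrc Cod_oTgt
begin

text \<open>Each clause for \<open>N\<close> is a boundary condition or an equation, and applying
  \<open>G\<close> yields the clause for the composite. Strengths survive because 2-functors
  preserve identities and inverses.\<close>

lemma post_multifunctor: "multifunctor v w Ss A (post Ss G N)"
	unfolding A.multifunctor_iff_nmf[OF vw] A.nmf_def
proof (intro conjI ballI allI impI; (elim conjE)?)
	interpret O: twocat "ori w B" by (rule C.ori_twocat)
	interpret G': twofun "ori w B" "ori w A" G
		by unfold_locales (use ffunctor_ori[OF C.two_category G.B.two_category G.ffunctor] ori_two_category C.two_category G.B.two_category in blast)+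
	note ty [simp] = O.typing[unfolded ori_simps]
	note g = G'.F2_VCmp[unfolded ori_simps] G'.F2_wl[unfolded ori_simps] G'.F2_wr[unfolded ori_simps]
	show "mfun_restrict Ss (post Ss G N) = post Ss G N" by simp
	show "m0 (post Ss G N) xs : Obj A" if "xs : tuples Ss" for xs
		using that nn by (simp add: post_sel nmf_def)
	show "mf_fun Ss A (post Ss G N) i" if i: "i < length Ss" for i
		unfolding mf_fun_def
	proof
		fix xs assume xs: "xs : tuples Ss"
		interpret F: twofun "Ss ! i" B "slice Ss N i xs" by (rule slice_twofun[OF typed_fun[OF i] xs i])
		show "ffunctor (Ss ! i) A (slice Ss (post Ss G N) i xs)"
			unfolding slice_post[OF xs i]
			by (rule ffunctor_comp[OF F.A.two_category Tight_arr[OF fcat[OF i]] C.two_category G.B.two_category F.ffunctor G.ffunctor])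
	qed
	fix i j :: nat assume ij: "i < j" "j < length Ss"
	then have ne: "i ~= j" "j ~= i" "i < length Ss" by auto
	show "mf_cells v w Ss A (post Ss G N) i j"
		unfolding mf_cells_def
	proof (intro allI impI, elim conjE)
		fix xs s t assume a: "arr_at Ss i xs s" "arr_at Ss j xs t"
		show "mx (post Ss G N) i j xs s t : Cell A &
			 Src (ori w A) (mx (post Ss G N) i j xs s t) = Cmp A (m1 (post Ss G N) j (xs[i := Cod (Ss ! i) s]) t) (m1 (post Ss G N) i xs s) &
			 Tgt (ori w A) (mx (post Ss G N) i j xs s t) = Cmp A (m1 (post Ss G N) i (xs[j := Cod (Ss ! j) t]) s) (m1 (post Ss G N) j xs t) &
			 strong A w (mx (post Ss G N) i j xs s t) &
			 (s : Tight (Ss ! i) \<or> t : Tight (Ss ! j) --> strong A v (mx (post Ss G N) i j xs s t))"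
			using a ij ne G'.Src_F2[unfolded ori_simps] G'.Tgt_F2[unfolded ori_simps] G.F2_strong[OF _ tx_strong[OF ij(1) a]]
				G.F2_strong[OF _ tx_tight[OF ij(1) a]]
			by (simp add: post_sel)
	qed
	show "mf_right w Ss A (post Ss G N) i j"
	proof -
		have "mf_right w Ss B N i j" using nn ij by (auto simp: nmf_def)
		note r = this[unfolded mf_right_def, THEN conjunct1, rule_format]
			this[unfolded mf_right_def, THEN conjunct2, THEN conjunct1, rule_format, OF conjI, OF _ conjI, OF _ _ conjI]
			this[unfolded mf_right_def, THEN conjunct2, THEN conjunct2, rule_format, OF conjI]
		have sw: "xs[i := a, j := b] = xs[j := b, i := a]" for xs :: "'o list" and a b
			using ne by (simp add: list_update_swap)
		show ?thesis
			unfolding mf_right_def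
		proof ((intro conjI allI impI; (elim conjE)?), goal_cases)
			case (1 xs s)
			note a = 1
			show ?case using arg_cong[OF r(1)[OF a], of "F2 G"] a ij arr_at_Idn[OF arr_at_tuples[OF a] ij(2)] by (simp add: post_sel)
		next
			case (2 xs s t t')
			note a = 2
			have at: "arr_at Ss j (xs[j := Cod (Ss ! j) t, i := Cod (Ss ! i) s]) t'"
				using arr_at_cross[OF arr_at_next[OF a(2-4)] arr_at_cross[OF a(1,2) ne(1)] ne(2)] .
			have at2: "arr_at Ss i (xs[j := Cod (Ss ! j) t']) s"
				by (rule arr_at_update[OF a(1) ne(1) Cod_at[OF arr_at_next[OF a(2-4)]]])
			show ?case using arg_cong[OF r(2)[OF a], of "F2 G"] a ij ne at at2 by (simp add: post_sel g sw)
		next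
			case (3 xs s be)
			note a = 3
			show ?case using arg_cong[OF r(3)[OF a], of "F2 G"] a ij ne arr_at_Src[OF a(2)]
					arr_at_cross[OF a(1) arr_at_Src[OF a(2)] ne(1)] by (simp add: post_sel g sw)
		qed
	qed
	show "mf_left w Ss A (post Ss G N) i j"
	proof -
		have "mf_left w Ss B N i j" using nn ij by (auto simp: nmf_def)
		note r = this[unfolded mf_left_def, THEN conjunct1, rule_format]
			this[unfolded mf_left_def, THEN conjunct2, THEN conjunct1, rule_format, OF conjI, OF _ conjI, OF _ _ conjI]
			this[unfolded mf_left_def, THEN conjunct2, THEN conjunct2, rule_format, OF conjI]
		have sw: "xs[j := a, i := b] = xs[i := b, j := a]" for xs :: "'o list" and a b
			using ne by (simp add: list_update_swap)
		show ?thesis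
			unfolding mf_left_def
		proof ((intro conjI allI impI; (elim conjE)?), goal_cases)
			case (1 xs t)
			note a = 1
			show ?case using arg_cong[OF r(1)[OF a], of "F2 G"] a ij arr_at_Idn[OF arr_at_tuples[OF a] ne(3)] by (simp add: post_sel)
		next
			case (2 xs s s' t)
			note a = 2
			have at: "arr_at Ss i (xs[i := Cod (Ss ! i) s, j := Cod (Ss ! j) t]) s'"
				using arr_at_cross[OF arr_at_next[OF a(1,3,4)] arr_at_cross[OF a(2,1) ne(2)] ne(1)] .
			have at2: "arr_at Ss j (xs[i := Cod (Ss ! i) s']) t"
				by (rule arr_at_update[OF a(2) ne(2) Cod_at[OF arr_at_next[OF a(1,3,4)]]])
			show ?case using arg_cong[OF r(2)[OF a], of "F2 G"] a ij ne at at2 by (simp add: post_sel g sw)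
		next
			case (3 xs t al)
			note a = 3
			show ?case using arg_cong[OF r(3)[OF a], of "F2 G"] a ij ne arr_at_Src[OF a(2)]
					arr_at_cross[OF a(1) arr_at_Src[OF a(2)] ne(2)] by (simp add: post_sel g sw)
		qed
	qed
next
	interpret O: twocat "ori w B" by (rule C.ori_twocat)
	interpret G': twofun "ori w B" "ori w A" G
		by unfold_locales (use ffunctor_ori[OF C.two_category G.B.two_category G.ffunctor] ori_two_category C.two_category G.B.two_category in blast)+
	note ty [simp] = O.typing[unfolded ori_simps]
	note g = G'.F2_VCmp[unfolded ori_simps] G'.F2_wl[unfolded ori_simps] G'.F2_wr[unfolded ori_simps]
	fix i j k xs s t u assume ijk: "i < j" "j < k" and a: "arr_at Ss i xs s" "arr_at Ss j xs t" "arr_at Ss k xs u"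
	have ne: "i ~= j" "j ~= i" "i ~= k" "k ~= i" "j ~= k" "k ~= j" "i < k" using ijk by auto
	have sw: "ys[j := a, i := b] = ys[i := b, j := a]" "ys[k := a, i := b] = ys[i := b, k := a]"
		 "ys[k := a, j := b] = ys[j := b, k := a]" for ys :: "'o list" and a b
		using ne by (simp_all add: list_update_swap)
	have "cubical Ss B w N i j k xs s t u" using nn ijk a unfolding nmf_def by blast
	note c = this[unfolded cubical_ori Let_def, THEN arg_cong[of _ _ "F2 G"]]
	show "cubical Ss A w (post Ss G N) i j k xs s t u"
		using c a ijk ne by (simp add: cubical_ori Let_def post_sel g sw del: O.VCmp_assoc G'.B.VCmp_assoc)
qed

end

end

section \<open>Functoriality of the hom sketch in both arguments\<close>

section \<open>Whiskering with functors\<close>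

text \<open>Restriction along \<open>F\<close> and postcomposition with \<open>G\<close> are
  performed together, so that naturality in \<open>Y\<close> and in \<open>Z\<close> become two
  cases of one construction.\<close>

definition wh_fun where
	"wh_fun Y' G F M = \<lparr>F0 = (\<lambda>y\<in>Obj Y'. F0 G (F0 M (F0 F y))), F1 = (\<lambda>t\<in>Arr Y'. F1 G (F1 M (F1 F t))),
		 F2 = (\<lambda>be\<in>Cell Y'. F2 G (F2 M (F2 F be)))\<rparr>"

definition wh_trans where
	"wh_trans Y' G F ph = \<lparr>tsrc = wh_fun Y' G F (tsrc ph), ttgt = wh_fun Y' G F (ttgt ph),
		 tob = (\<lambda>y\<in>Obj Y'. F1 G (tob ph (F0 F y))), tcell = (\<lambda>t\<in>Arr Y'. F2 G (tcell ph (F1 F t)))\<rparr>"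

definition wh_modif where
	"wh_modif Y' G F mu = \<lparr>msrc = wh_trans Y' G F (msrc mu), mtgt = wh_trans Y' G F (mtgt mu),
		 mcmp = (\<lambda>y\<in>Obj Y'. F2 G (mcmp mu (F0 F y)))\<rparr>"

definition whisk where
	"whisk K Y' G F = \<lparr>F0 = (\<lambda>M\<in>Obj K. wh_fun Y' G F M), F1 = (\<lambda>ph\<in>Arr K. wh_trans Y' G F ph),
		 F2 = (\<lambda>mu\<in>Cell K. wh_modif Y' G F mu)\<rparr>"

lemma whisk_sel [simp]:
	"M : Obj K ==> F0 (whisk K Y' G F) M = wh_fun Y' G F M"
	"ph : Arr K ==> F1 (whisk K Y' G F) ph = wh_trans Y' G F ph"
	"mu : Cell K ==> F2 (whisk K Y' G F) mu = wh_modif Y' G F mu"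
	by (simp_all add: whisk_def)

lemma wh_sel [simp]:
	"y : Obj Y' ==> F0 (wh_fun Y' G F M) y = F0 G (F0 M (F0 F y))"
	"t : Arr Y' ==> F1 (wh_fun Y' G F M) t = F1 G (F1 M (F1 F t))"
	"be : Cell Y' ==> F2 (wh_fun Y' G F M) be = F2 G (F2 M (F2 F be))"
	"tsrc (wh_trans Y' G F ph) = wh_fun Y' G F (tsrc ph)" "ttgt (wh_trans Y' G F ph) = wh_fun Y' G F (ttgt ph)"
	"y : Obj Y' ==> tob (wh_trans Y' G F ph) y = F1 G (tob ph (F0 F y))"
	"t : Arr Y' ==> tcell (wh_trans Y' G F ph) t = F2 G (tcell ph (F1 F t))"
	"msrc (wh_modif Y' G F mu) = wh_trans Y' G F (msrc mu)" "mtgt (wh_modif Y' G F mu) = wh_trans Y' G F (mtgt mu)"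
	"y : Obj Y' ==> mcmp (wh_modif Y' G F mu) y = F2 G (mcmp mu (F0 F y))"
	"mcmp (wh_modif Y' G F mu) : extensional (Obj Y')"
	by (simp_all add: wh_fun_def wh_trans_def wh_modif_def)

lemma wh_modif_osrc: "osrc u (wh_modif Y' G F mu) = wh_trans Y' G F (osrc u mu)"
	"otgt u (wh_modif Y' G F mu) = wh_trans Y' G F (otgt u mu)"
	by (simp_all add: osrc_def otgt_def)

locale whiskering = A: funcat Y C v w + B: funcat Y' C' v w + F: twofun Y' Y F + G: twofun C C' G
	for Y :: "('o, 'a, 't) fcat" and C :: "('p, 'b, 's) fcat" and Y' :: "('o1, 'a1, 't1) fcat"
		and C' :: "('p1, 'b1, 's1) fcat" and v w F G +
	fixes P :: "('o, 'a, 't, 'p, 'b, 's) ffun set" and P' :: "('o1, 'a1, 't1, 'p1, 'b1, 's1) ffun set"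
	assumes PP: "M : P ==> ffunctor Y C M ==> wh_fun Y' G F M : P'"
begin

abbreviation Q where "Q \<equiv> full_sub A.K P"
abbreviation Q' where "Q' \<equiv> full_sub B.K P'"
abbreviation Wh where "Wh \<equiv> whisk Q Y' G F"

lemma wh_ffunctor:
	assumes "ffunctor Y C M" shows "ffunctor Y' C' (wh_fun Y' G F M)"
proof -
	interpret M: twofun Y C M by unfold_locales (rule assms)
	show ?thesis
		by (rule ffunctorI) (simp_all add: Tight_arr[OF B.S] B.S.two_category, simp_all add: wh_fun_def)
qed

sublocale oF: twofun "ori w Y'" "ori w Y" F
	by unfold_locales (rule B.S' A.S' ffunctor_ori[OF B.S.two_category A.S.two_category F.ffunctor])+

sublocale oG: twofun "ori w C" "ori w C'" G
	by unfold_locales (rule A.C' B.C' ffunctor_ori[OF A.C.two_category B.C.two_category G.ffunctor])+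

text \<open>Naturality at \<open>t\<close> is \<open>G\<close> applied to the naturality of
  \<open>ph\<close> at the image of \<open>t\<close> under \<open>F\<close>. The second conclusion
  is what tight transformations require.\<close>

lemma wh_loose:
	assumes l: "ph : loose_trans Y C v w"
	shows "wh_trans Y' G F ph : loose_trans Y' C' v w"
		and "(!!t. t : Arr Y ==> strong C v (tcell ph t)) ==> t : Arr Y' ==> strong C' v (tcell (wh_trans Y' G F ph) t)"
proof -
	interpret l: lnatural "ori w Y" "ori w C" ph w by (rule lnaturalI[OF A.S' A.C' A.loose_lnat[OF l]])
	have w: "wh_fun Y' G F (tsrc ph) = wh_fun (ori w Y') G F (tsrc ph)" "wh_fun Y' G F (ttgt ph) = wh_fun (ori w Y') G F (ttgt ph)"
		by (simp_all add: wh_fun_def)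
	note c = l.tob_arr l.Dom_tob l.Cod_tob l.tcell_cell l.Src_tcell l.Tgt_tcell l.strong_tcell l.tcell_Idn l.tcell_Cmp l.tcell_nat
	note c' = c[unfolded ori_simps strong_ori]
	note f = oF.F2_cell oF.Src_F2 oF.Tgt_F2
	note f' = f[unfolded ori_simps]
	note g = oG.F2_VCmp oG.F2_wl oG.F2_wr oG.Src_F2 oG.Tgt_F2
	note g' = g[unfolded ori_simps]
	note m = l.M.F1_arr l.M.Dom_F1 l.M.Cod_F1 l.N.F1_arr l.N.Dom_F1 l.N.Cod_F1 l.M.F2_cell l.M.Src_F2 l.M.Tgt_F2
		l.N.F2_cell l.N.Src_F2 l.N.Tgt_F2
	note m' = m[unfolded ori_simps]
	note o = oF.A.Src_arr oF.A.Tgt_arr oF.A.Dom_Tgt oF.A.Cod_Tgt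
	note o' = o[unfolded ori_simps]
	note ty = oG.A.typing
	note ty' = ty[unfolded ori_simps]
	have "lnat (ori w Y') (ori w C') w (wh_trans Y' G F ph)"
		unfolding lnat_def ori_simps strong_ori wh_sel(4,5)
	proof (intro conjI ballI impI)
		show "ffunctor (ori w Y') (ori w C') (wh_fun Y' G F (tsrc ph))" "ffunctor (ori w Y') (ori w C') (wh_fun Y' G F (ttgt ph))"
			using wh_ffunctor[OF A.loose_src[OF l]] wh_ffunctor[OF A.loose_tgt[OF l]] by (simp_all add: B.ffunctor_ori_iff)
		show "tob (wh_trans Y' G F ph) : extensional (Obj Y')" "tcell (wh_trans Y' G F ph) : extensional (Arr Y')"
			by (simp_all add: wh_trans_def)
		fix t assume t: "t : Arr Y'"
		show "strong C' w (tcell (wh_trans Y' G F ph) t)"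
			using t G.F2_strong[OF c'(4) c'(7)] by simp
	next
		fix s t assume "s : Arr Y'" "t : Arr Y'" "Dom Y' t = Cod Y' s"
		then show "tcell (wh_trans Y' G F ph) (Cmp Y' t s) =
			VCmp (ori w C') (whisker_right C' (tcell (wh_trans Y' G F ph) t) (F1 (wh_fun Y' G F (tsrc ph)) s))
			 (whisker_left C' (F1 (wh_fun Y' G F (ttgt ph)) t) (tcell (wh_trans Y' G F ph) s))"
			by (simp add: c' g' m' ty')
	next
		fix be assume b: "be : Cell Y'"
		have "F2 G (VCmp (ori w C) (tcell ph (Tgt (ori w Y) (F2 F be)))
					(whisker_right C (F2 (ttgt ph) (F2 F be)) (tob ph (Dom Y (Src (ori w Y) (F2 F be)))))) =
				F2 G (VCmp (ori w C) (whisker_left C (tob ph (Cod Y (Src (ori w Y) (F2 F be)))) (F2 (tsrc ph) (F2 F be)))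
					(tcell ph (Src (ori w Y) (F2 F be))))"
			using c'(10)[of "F2 F be"] b by simp
		then show "VCmp (ori w C') (tcell (wh_trans Y' G F ph) (Tgt (ori w Y') be))
				(whisker_right C' (F2 (wh_fun Y' G F (ttgt ph)) be) (tob (wh_trans Y' G F ph) (Dom Y' (Src (ori w Y') be)))) =
			 VCmp (ori w C') (whisker_left C' (tob (wh_trans Y' G F ph) (Cod Y' (Src (ori w Y') be))) (F2 (wh_fun Y' G F (tsrc ph)) be))
				(tcell (wh_trans Y' G F ph) (Src (ori w Y') be))"
			using b by (simp add: c' g' m' ty' f' o')
	qed (simp_all add: c' g' m')
	moreover have st: "strong C' v (tcell (wh_trans Y' G F ph) t)" if "strong C v (tcell ph (F1 F t))" "t : Arr Y'" for t
		using that G.F2_strong[of "tcell ph (F1 F t)" v] by (simp add: c')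
	ultimately show "wh_trans Y' G F ph : loose_trans Y' C' v w"
		using l Tight_arr[OF B.S] unfolding A.loose_iff B.loose_iff by simp
	show "strong C' v (tcell (wh_trans Y' G F ph) t)" if "!!t. t : Arr Y ==> strong C v (tcell ph t)" "t : Arr Y'"
		by (rule st) (use that in simp_all)
qed

lemma wh_Cmp:
	assumes l: "ph : loose_trans Y C v w" "ps : loose_trans Y C v w" "tsrc ps = ttgt ph"
	shows "wh_trans Y' G F (trans_comp Y C w ps ph) = trans_comp Y' C' w (wh_trans Y' G F ps) (wh_trans Y' G F ph)"
proof -
	interpret l: lnatural "ori w Y" "ori w C" ph w by (rule lnaturalI[OF A.S' A.C' A.loose_lnat[OF l(1)]])
	interpret k: lnatural "ori w Y" "ori w C" ps w by (rule lnaturalI[OF A.S' A.C' A.loose_lnat[OF l(2)]])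
	note c = l.tob_arr l.Dom_tob l.Cod_tob l.tcell_cell l.Src_tcell l.Tgt_tcell
		k.tob_arr k.Dom_tob k.Cod_tob k.tcell_cell k.Src_tcell k.Tgt_tcell
	note c' = c[unfolded ori_simps strong_ori]
	note g = oG.F2_VCmp oG.F2_wl oG.F2_wr
	note g' = g[unfolded ori_simps]
	note m = l.M.F1_arr l.M.Dom_F1 l.M.Cod_F1 l.N.F1_arr l.N.Dom_F1 l.N.Cod_F1 k.N.F1_arr k.N.Dom_F1 k.N.Cod_F1
	note m' = m[unfolded ori_simps]
	note ty = oG.A.typing
	note ty' = ty[unfolded ori_simps]
	have t: "tcell (wh_trans Y' G F (trans_comp Y C w ps ph)) t = tcell (trans_comp Y' C' w (wh_trans Y' G F ps) (wh_trans Y' G F ph)) t"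
		if "t : Arr Y'" for t
		using that by (simp add: c' g' m' ty' l(3))
	have o: "tob (wh_trans Y' G F (trans_comp Y C w ps ph)) y = tob (trans_comp Y' C' w (wh_trans Y' G F ps) (wh_trans Y' G F ph)) y"
		if "y : Obj Y'" for y
		using that by (simp add: c' l(3))
	have e: "tob (wh_trans Y' G F \<chi>) : extensional (Obj Y')" "tcell (wh_trans Y' G F \<chi>) : extensional (Arr Y')"
		 "tob (trans_comp Y' C' w a b) : extensional (Obj Y')" "tcell (trans_comp Y' C' w a b) : extensional (Arr Y')" for \<chi> a b
		by (simp_all add: wh_trans_def trans_comp_def)
	show ?thesis
		by (intro wtrans.equality extensionalityI[OF e(1,3)] extensionalityI[OF e(2,4)] o t) simp_all
qed

lemma wh_modif:
	assumes m: "mu : modifications Y C v w"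
	shows "wh_modif Y' G F mu : modifications Y' C' v w"
proof -
	note ls = A.modif_osrc[OF m] and lt = A.modif_otgt[OF m]
	interpret l: lnatural "ori w Y" "ori w C" "osrc w mu" w by (rule lnaturalI[OF A.S' A.C' A.loose_lnat[OF ls]])
	interpret k: lnatural "ori w Y" "ori w C" "otgt w mu" w by (rule lnaturalI[OF A.S' A.C' A.loose_lnat[OF lt]])
	note lm = A.modif_lmodif[OF m, unfolded lmodif_def ori_simps]
	have ends: "tsrc (otgt w mu) = tsrc (osrc w mu)" "ttgt (otgt w mu) = ttgt (osrc w mu)" using lm by auto
	have mc: "mcmp mu y : Cell C" "Src (ori w C) (mcmp mu y) = tob (osrc w mu) y" "Tgt (ori w C) (mcmp mu y) = tob (otgt w mu) y"
		if "y : Obj Y" for y using lm that by auto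
	note c = l.tob_arr l.Dom_tob l.Cod_tob l.tcell_cell l.Src_tcell l.Tgt_tcell
		k.tob_arr k.Dom_tob k.Cod_tob k.tcell_cell k.Src_tcell k.Tgt_tcell
	note c' = c[unfolded ori_simps strong_ori]
	note g = oG.F2_VCmp oG.F2_wl oG.F2_wr oG.Src_F2 oG.Tgt_F2
	note g' = g[unfolded ori_simps]
	note fm = l.M.F1_arr l.M.Dom_F1 l.M.Cod_F1 l.N.F1_arr l.N.Dom_F1 l.N.Cod_F1
	note fm' = fm[unfolded ori_simps]
	note ty = oG.A.typing
	note ty' = ty[unfolded ori_simps]
	have "lmodif (ori w Y') (ori w C') (osrc w (wh_modif Y' G F mu)) (otgt w (wh_modif Y' G F mu)) (mcmp (wh_modif Y' G F mu))"
		unfolding lmodif_def ori_simps wh_modif_osrc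
	proof (intro conjI ballI)
		fix t assume t: "t : Arr Y'"
		have "F2 G (VCmp (ori w C) (tcell (otgt w mu) (F1 F t)) (whisker_left C (F1 (ttgt (osrc w mu)) (F1 F t)) (mcmp mu (Dom Y (F1 F t))))) =
			F2 G (VCmp (ori w C) (whisker_right C (mcmp mu (Cod Y (F1 F t))) (F1 (tsrc (osrc w mu)) (F1 F t))) (tcell (osrc w mu) (F1 F t)))"
			using t by (intro arg_cong[of _ _ "F2 G"] lm[THEN conjunct2, THEN conjunct2, THEN conjunct2, rule_format]) simp
		then show "VCmp (ori w C') (tcell (wh_trans Y' G F (otgt w mu)) t)
				(whisker_left C' (F1 (ttgt (wh_trans Y' G F (osrc w mu))) t) (mcmp (wh_modif Y' G F mu) (Dom Y' t))) =
			 VCmp (ori w C') (whisker_right C' (mcmp (wh_modif Y' G F mu) (Cod Y' t)) (F1 (tsrc (wh_trans Y' G F (osrc w mu))) t))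
				(tcell (wh_trans Y' G F (osrc w mu)) t)"
			using t by (simp add: c' g' fm' ty' mc ends)
	qed (simp_all add: ends mc g')
	then show ?thesis
		unfolding B.modif_iff using wh_loose(1)[OF A.modif_src[OF m]] wh_loose(1)[OF A.modif_tgt[OF m]] by simp
qed

lemma whisk_ffunctor: "ffunctor Q Q' Wh"
proof (rule ffunctorI)
	interpret Q: twocat Q by unfold_locales (rule fcategory_two_category[OF fcategory_full_sub[OF A.fcategory_Fun]])
	show "two_category Q" by (rule Q.two_category)
	show ext: "F0 Wh : extensional (Obj Q)" "F1 Wh : extensional (Arr Q)" "F2 Wh : extensional (Cell Q)"
		by (simp_all only: whisk_def ffun.simps restrict_extensional)
	show "F0 Wh M : Obj Q'" if "M : Obj Q" for M
		using that PP by (simp add: full_sub_sets wh_ffunctor)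
	show arr: "F1 Wh ph : Arr Q'" "Dom Q' (F1 Wh ph) = F0 Wh (Dom Q ph)" "Cod Q' (F1 Wh ph) = F0 Wh (Cod Q ph)"
		if p: "ph : Arr Q" for ph
	proof -
		have l: "ph : loose_trans Y C v w" "tsrc ph : P" "ttgt ph : P" using p by (simp_all add: full_sub_sets)
		show "F1 Wh ph : Arr Q'"
			using wh_loose(1)[OF l(1)] PP[OF l(2) A.loose_src[OF l(1)]] PP[OF l(3) A.loose_tgt[OF l(1)]] p
			by (simp add: full_sub_sets)
		show "Dom Q' (F1 Wh ph) = F0 Wh (Dom Q ph)" "Cod Q' (F1 Wh ph) = F0 Wh (Cod Q ph)"
			using p Q.Dom_ob[OF p] Q.Cod_ob[OF p] by simp_all
	qed
	show "F1 Wh ph : Tight Q'" if p: "ph : Tight Q" for ph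
	proof -
		have q: "ph : Arr Q" using p Tight_arr[OF fcategory_full_sub[OF A.fcategory_Fun]] by blast
		have t: "ph : tight_trans Y C v w" using p by (simp add: full_sub_sets)
		then have l: "ph : loose_trans Y C v w" by (simp add: A.tight_iff)
		have "F1 Wh ph : tight_trans Y' C' v w"
			unfolding B.tight_iff whisk_sel(2)[OF q]
			using wh_loose(1)[OF l] wh_loose(2)[OF l] t by (simp add: A.tight_iff del: wh_sel(7))
		then show ?thesis using arr(1)[OF q] by (simp add: full_sub_sets)
	qed
	show cell: "F2 Wh mu : Cell Q'" if p: "mu : Cell Q" for mu
	proof -
		have m: "mu : modifications Y C v w" "tsrc (msrc mu) : P" "ttgt (msrc mu) : P" using p by (simp_all add: full_sub_sets)
		note l = A.modif_src[OF m(1)]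
		show ?thesis using wh_modif[OF m(1)] PP[OF m(2) A.loose_src[OF l]] PP[OF m(3) A.loose_tgt[OF l]] p
			by (simp add: full_sub_sets)
	qed
	show "Src Q' (F2 Wh mu) = F1 Wh (Src Q mu)" "Tgt Q' (F2 Wh mu) = F1 Wh (Tgt Q mu)" if p: "mu : Cell Q" for mu
		using p Q.Src_arr[OF p] Q.Tgt_arr[OF p] by simp_all
	show "F1 Wh (Idn Q M) = Idn Q' (F0 Wh M)" if p: "M : Obj Q" for M
	proof -
		have "ffunctor Y C M" using p by (simp add: full_sub_sets)
		then interpret M: twofun Y C M by unfold_locales
		have "wh_trans Y' G F (trans_id Y C M) = trans_id Y' C' (wh_fun Y' G F M)"
			unfolding wh_trans_def trans_id_def by (auto intro!: restrict_ext)
		then show ?thesis using p Q.Idn_arr[OF p] by simp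
	qed
	show "F1 Wh (Cmp Q ps ph) = Cmp Q' (F1 Wh ps) (F1 Wh ph)"
		if p: "ph : Arr Q" "ps : Arr Q" "Dom Q ps = Cod Q ph" for ph ps
	proof -
		have l: "ph : loose_trans Y C v w" "ps : loose_trans Y C v w" "tsrc ps = ttgt ph" using p by (simp_all add: full_sub_sets)
		show ?thesis using p Q.Cmp_arr[OF p] wh_Cmp[OF l] by simp
	qed
	show "F2 Wh (VId Q ph) = VId Q' (F1 Wh ph)" if p: "ph : Arr Q" for ph
	proof -
		have l: "ph : loose_trans Y C v w" using p by (simp add: full_sub_sets)
		have "wh_modif Y' G F (VId Q ph) = VId Q' (wh_trans Y' G F ph)"
			by (rule B.modif_eqI) (simp_all add: A.loose_tob[OF l])
		then show ?thesis using p Q.VId_cell[OF p] by (simp del: A.Fun_sel B.Fun_sel full_sub_simps)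
	qed
	show "F2 Wh (VCmp Q nu mu) = VCmp Q' (F2 Wh nu) (F2 Wh mu)"
		if p: "mu : Cell Q" "nu : Cell Q" "Src Q nu = Tgt Q mu" for mu nu
	proof -
		have m: "mu : modifications Y C v w" "nu : modifications Y C v w" "msrc nu = mtgt mu" using p by (simp_all add: full_sub_sets)
		have "wh_modif Y' G F (VCmp Q nu mu) = VCmp Q' (wh_modif Y' G F nu) (wh_modif Y' G F mu)"
			by (rule B.modif_eqI) (simp_all add: A.modif_cell[OF m(1)] A.modif_cell[OF m(2)] A.modif_Src[OF m(2)] A.modif_Tgt[OF m(1)] m(3))
		then show ?thesis using p Q.VCmp_cell[OF p] by (simp del: A.Fun_sel B.Fun_sel full_sub_simps)
	qed
	show "F2 Wh (HCmp Q nu mu) = HCmp Q' (F2 Wh nu) (F2 Wh mu)"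
		if p: "mu : Cell Q" "nu : Cell Q" "Dom Q (Src Q nu) = Cod Q (Src Q mu)" for mu nu
	proof -
		have m: "mu : modifications Y C v w" "nu : modifications Y C v w" "tsrc (msrc nu) = ttgt (msrc mu)"
			using p by (simp_all add: full_sub_sets)
		have e: "tsrc (mtgt nu) = ttgt (mtgt mu)" using m A.modif_ends by simp
		have hc: "Dom C (Src C (mcmp nu x)) = Cod C (Src C (mcmp mu x))" if "x : Obj Y" for x
			using that A.loose_Dom[OF A.modif_src[OF m(2)] that] A.loose_Cod[OF A.modif_src[OF m(1)] that]
			by (simp add: A.modif_Src[OF m(1)] A.modif_Src[OF m(2)] m(3))
		have "wh_modif Y' G F (HCmp Q nu mu) = HCmp Q' (wh_modif Y' G F nu) (wh_modif Y' G F mu)"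
			by (rule B.modif_eqI) (simp_all add: A.modif_cell[OF m(1)] A.modif_cell[OF m(2)] hc
					wh_Cmp[OF A.modif_src[OF m(1)] A.modif_src[OF m(2)] m(3)] wh_Cmp[OF A.modif_tgt[OF m(1)] A.modif_tgt[OF m(2)] e])
		then show ?thesis using p(1,2) Q.HCmp_cell[OF p(1,2)] p(3) by (simp del: A.Fun_sel B.Fun_sel full_sub_simps)
	qed
qed

end

lemma evaluation_sel [simp]:
	"M : Obj K ==> F0 (evaluation K y) M = F0 M y" "ph : Arr K ==> F1 (evaluation K y) ph = tob ph y"
	"mu : Cell K ==> F2 (evaluation K y) mu = mcmp mu y"
	by (simp_all add: evaluation_def)

lemma (in funcat) evaluation_ffunctor:
	assumes y: "y : Obj S"
	shows "ffunctor (full_sub K P) C (evaluation (full_sub K P) y)"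
proof -
	let ?Q = "full_sub K P"
	interpret Q: twocat ?Q by unfold_locales (rule fcategory_two_category[OF fcategory_full_sub[OF fcategory_Fun]])
	have o: "M : Obj ?Q ==> ffunctor S C M" and a: "ph : Arr ?Q ==> ph : loose_trans S C v w"
		and c: "mu : Cell ?Q ==> mu : modifications S C v w" for M ph mu
		by (simp_all add: full_sub_sets)
	have ob: "F0 M y : Obj C" if "M : Obj ?Q" for M
	proof -
		interpret M: twofun S C M by unfold_locales (rule o[OF that])
		show ?thesis using y by simp
	qed
	show ?thesis
	proof (rule ffunctorI)
		show "two_category ?Q" by (rule Q.two_category)
		show "F0 (evaluation ?Q y) : extensional (Obj ?Q)" "F1 (evaluation ?Q y) : extensional (Arr ?Q)"
			"F2 (evaluation ?Q y) : extensional (Cell ?Q)"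
			by (simp_all only: evaluation_def ffun.simps restrict_extensional)
		show "F0 (evaluation ?Q y) M : Obj C" if "M : Obj ?Q" for M using ob[OF that] evaluation_sel(1)[OF that] by simp
		show "F1 (evaluation ?Q y) ph : Arr C" "Dom C (F1 (evaluation ?Q y) ph) = F0 (evaluation ?Q y) (Dom ?Q ph)"
			"Cod C (F1 (evaluation ?Q y) ph) = F0 (evaluation ?Q y) (Cod ?Q ph)" if p: "ph : Arr ?Q" for ph
			unfolding evaluation_sel(2)[OF p] evaluation_sel(1)[OF Q.Dom_ob[OF p]] evaluation_sel(1)[OF Q.Cod_ob[OF p]]
			using loose_tob[OF a[OF p] y] loose_Dom[OF a[OF p] y] loose_Cod[OF a[OF p] y] by simp_all
		show "F1 (evaluation ?Q y) ph : Tight C" if p: "ph : Tight ?Q" for ph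
			using p y evaluation_sel(2)[OF Tight_arr[OF fcategory_full_sub[OF fcategory_Fun] p]]
			by (simp add: full_sub_sets tight_iff)
		show "F2 (evaluation ?Q y) mu : Cell C" "Src C (F2 (evaluation ?Q y) mu) = F1 (evaluation ?Q y) (Src ?Q mu)"
			"Tgt C (F2 (evaluation ?Q y) mu) = F1 (evaluation ?Q y) (Tgt ?Q mu)" if p: "mu : Cell ?Q" for mu
			unfolding evaluation_sel(3)[OF p] evaluation_sel(2)[OF Q.Src_arr[OF p]] evaluation_sel(2)[OF Q.Tgt_arr[OF p]]
			using modif_cell[OF c[OF p] y] modif_Src[OF c[OF p] y] modif_Tgt[OF c[OF p] y] by simp_all
		show "F1 (evaluation ?Q y) (Idn ?Q M) = Idn C (F0 (evaluation ?Q y) M)" if p: "M : Obj ?Q" for M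
			unfolding evaluation_sel(1)[OF p] evaluation_sel(2)[OF Q.Idn_arr[OF p]] using y by simp
		show "F1 (evaluation ?Q y) (Cmp ?Q g f) = Cmp C (F1 (evaluation ?Q y) g) (F1 (evaluation ?Q y) f)"
			if p: "f : Arr ?Q" "g : Arr ?Q" "Dom ?Q g = Cod ?Q f" for f g
			unfolding evaluation_sel(2)[OF p(1)] evaluation_sel(2)[OF p(2)] evaluation_sel(2)[OF Q.Cmp_arr[OF p]] using y by simp
		show "F2 (evaluation ?Q y) (VId ?Q f) = VId C (F1 (evaluation ?Q y) f)" if p: "f : Arr ?Q" for f
			unfolding evaluation_sel(2)[OF p] evaluation_sel(3)[OF Q.VId_cell[OF p]] using y by simp
		show "F2 (evaluation ?Q y) (VCmp ?Q nu mu) = VCmp C (F2 (evaluation ?Q y) nu) (F2 (evaluation ?Q y) mu)"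
			if p: "mu : Cell ?Q" "nu : Cell ?Q" "Src ?Q nu = Tgt ?Q mu" for mu nu
			unfolding evaluation_sel(3)[OF p(1)] evaluation_sel(3)[OF p(2)] evaluation_sel(3)[OF Q.VCmp_cell[OF p]] using y by simp
		show "F2 (evaluation ?Q y) (HCmp ?Q nu mu) = HCmp C (F2 (evaluation ?Q y) nu) (F2 (evaluation ?Q y) mu)"
			if p: "mu : Cell ?Q" "nu : Cell ?Q" "Dom ?Q (Src ?Q nu) = Cod ?Q (Src ?Q mu)" for mu nu
			unfolding evaluation_sel(3)[OF p(1)] evaluation_sel(3)[OF p(2)] evaluation_sel(3)[OF Q.HCmp_cell[OF p]] using y by simp
	qed
qed

lemma Mod_cat_eq: "Mod_cat v w Y Z = full_sub (Fun_cat v w (scat Y) (scat Z)) {M. model Y Z M}"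
	by (simp add: Mod_cat_def)

lemma small_sketch_fcategory: "small_sketch small S ==> fcategory (scat S)"
	by (simp add: small_sketch_def small_fcat_def)

lemma fcategory_Mod:
	assumes "fcategory (scat Y)" "fcategory (scat Z)" "v \<preceq> w"
	shows "fcategory (Mod_cat v w Y Z)"
proof -
	interpret funcat "scat Y" "scat Z" v w by unfold_locales (use assms in auto)
	show ?thesis unfolding Mod_cat_eq by (rule fcategory_full_sub[OF fcategory_Fun])
qed

lemma whiskering_model:
	assumes Y: "small_sketch small Y" and Y': "small_sketch small Y'"
		and Z: "fcategory (scat Z)" and Z': "fcategory (scat Z')"
		and vw: "v \<preceq> w" and F: "model Y' Y F" and G: "model Z Z' G"
	shows "whiskering (scat Y) (scat Z) (scat Y') (scat Z') v w F G {M. model Y Z M} {M. model Y' Z' M}"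
proof -
	note y = small_sketch_fcategory[OF Y] small_sketch_fcategory[OF Y']
	have wf: "wh_fun (scat Y') G F M = ffun_comp (scat Y') (ffun_comp (scat Y) G M) F" if "ffunctor (scat Y') (scat Y) F" for M
	proof -
		interpret F: twofun "scat Y'" "scat Y" F by unfold_locales (use that y in \<open>auto simp: fcategory_two_category\<close>)
		show ?thesis by (auto simp: wh_fun_def ffun_comp_def intro!: restrict_ext)
	qed
	show ?thesis
	proof unfold_locales
		fix M assume "M : {M. model Y Z M}"
		then have "model Y Z' (ffun_comp (scat Y) G M)"
			using model_comp[OF Y fcategory_two_category[OF Z] fcategory_two_category[OF Z'] _ G] by simp
		then have "model Y' Z' (ffun_comp (scat Y') (ffun_comp (scat Y) G M) F)"
			using model_comp[OF Y' fcategory_two_category[OF y(1)] fcategory_two_category[OF Z'] F] by simp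
		then show "wh_fun (scat Y') G F M : {M. model Y' Z' M}" using wf F by (simp add: model_def)
	qed (use y Z Z' vw F G in \<open>auto simp: fcategory_two_category model_def\<close>)
qed

lemma whisk_model:
	assumes Y: "small_sketch small Y" and Y': "small_sketch small Y'"
		and Z: "fcategory (scat Z)" and Z': "fcategory (scat Z')"
		and vw: "v \<preceq> w" and F: "model Y' Y F" and G: "model Z Z' G"
	shows "model (Mod_sketch small v w Y Z) (Mod_sketch small v w Y' Z') (whisk (Mod_cat v w Y Z) (scat Y') G F)"
proof -
	note y = small_sketch_fcategory[OF Y] small_sketch_fcategory[OF Y']
	interpret whiskering "scat Y" "scat Z" "scat Y'" "scat Z'" v w F G "{M. model Y Z M}" "{M. model Y' Z' M}"
		by (rule whiskering_model[OF assms])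
	have fn: "ffunctor (Mod_cat v w Y Z) (Mod_cat v w Y' Z') (whisk (Mod_cat v w Y Z) (scat Y') G F)"
		unfolding Mod_cat_eq by (rule whisk_ffunctor)
	note K = fcategory_Mod[OF y(1) Z vw] and K' = fcategory_Mod[OF y(2) Z' vw]
	have "map_cone (whisk (Mod_cat v w Y Z) (scat Y') G F) c : cones (Mod_sketch small v w Y' Z')"
		if c: "c : cones (Mod_sketch small v w Y Z)" for c
	proof -
		let ?W = "whisk (Mod_cat v w Y Z) (scat Y') G F"
		have wc: "weighted_cone small (Mod_cat v w Y Z) c" using c by (simp add: Mod_sketch_def)
		interpret c: cone_map small "Mod_cat v w Y Z" c "Mod_cat v w Y' Z'" ?W
			by unfold_locales (use K K' wc fn in \<open>auto simp: fcategory_two_category\<close>)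
		have "map_cone (evaluation (Mod_cat v w Y' Z') y) (map_cone ?W c) : cones Z'" if y: "y : Obj (scat Y')" for y
		proof -
			\<comment> \<open>Evaluation at \<open>y\<close> after whiskering is \<open>G\<close> after
			  evaluation at the image of \<open>y\<close> under \<open>F\<close>. The latter sends
			  \<open>c\<close> to a specified cone of \<open>Z\<close>, and \<open>G\<close> preserves
			  specified cones.\<close>
			let ?ev = "evaluation (Mod_cat v w Y Z) (F0 F y)"
			have "map_cone ?ev c : cones Z" using c y by (simp add: Mod_sketch_def)
			then have "map_cone G (map_cone ?ev c) : cones Z'" using G by (simp add: model_def)
			moreover have "map_cone G (map_cone ?ev c) = map_cone (ffun_comp (Mod_cat v w Y Z) G ?ev) c"
				using A.evaluation_ffunctor[of "F0 F y" "{M. model Y Z M}", folded Mod_cat_eq] y by (intro c.map_cone_comp) simp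
			moreover have "map_cone (evaluation (Mod_cat v w Y' Z') y) (map_cone ?W c) =
					map_cone (ffun_comp (Mod_cat v w Y Z) (evaluation (Mod_cat v w Y' Z') y) ?W) c"
				by (rule c.map_cone_comp[OF fn])
			moreover have "map_cone (ffun_comp (Mod_cat v w Y Z) (evaluation (Mod_cat v w Y' Z') y) ?W) c =
					map_cone (ffun_comp (Mod_cat v w Y Z) G ?ev) c"
			proof (rule c.map_cone_cong)
				fix M assume M: "M : Obj (Mod_cat v w Y Z)"
				have "wh_fun (scat Y') G F M : Obj (Mod_cat v w Y' Z')" using c.F.F0_ob[OF M] by (simp add: M)
				then show "F0 (ffun_comp (Mod_cat v w Y Z) (evaluation (Mod_cat v w Y' Z') y) ?W) M = F0 (ffun_comp (Mod_cat v w Y Z) G ?ev) M"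
					using M y by simp
			next
				fix M assume M: "M : Arr (Mod_cat v w Y Z)"
				have "wh_trans (scat Y') G F M : Arr (Mod_cat v w Y' Z')" using c.F.F1_arr[OF M] by (simp add: M)
				then show "F1 (ffun_comp (Mod_cat v w Y Z) (evaluation (Mod_cat v w Y' Z') y) ?W) M = F1 (ffun_comp (Mod_cat v w Y Z) G ?ev) M"
					using M y by simp
			next
				fix M assume M: "M : Cell (Mod_cat v w Y Z)"
				have "wh_modif (scat Y') G F M : Cell (Mod_cat v w Y' Z')" using c.F.F2_cell[OF M] by (simp add: M)
				then show "F2 (ffun_comp (Mod_cat v w Y Z) (evaluation (Mod_cat v w Y' Z') y) ?W) M = F2 (ffun_comp (Mod_cat v w Y Z) G ?ev) M"
					using M y by simp
			qed
			ultimately show ?thesis by simp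
		qed
		then show ?thesis using c.weighted_cone_map by (simp add: Mod_sketch_def)
	qed
	then show ?thesis using fn by (simp add: model_def Mod_sketch_def)
qed

section \<open>Index arithmetic and typing of substitution\<close>

section \<open>Substitution\<close>

lemma length_blocks [simp]: "length (blocks ns xs) = length ns"
	by (induction ns arbitrary: xs) auto

lemma concat_blocks: "length xs = sum_list ns ==> concat (blocks ns xs) = xs"
	by (induction ns arbitrary: xs) auto

lemma map_length_blocks: "length xs = sum_list ns ==> map length (blocks ns xs) = ns"
	by (induction ns arbitrary: xs) auto

lemma blocks_append: "length xs = sum_list ns ==> blocks (ns @ ms) (xs @ ys) = blocks ns xs @ blocks ms ys"
	by (induction ns arbitrary: xs) auto

lemma locate_append: "p < sum_list ns ==> locate (ns @ ms) p = locate ns p"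
	by (induction ns arbitrary: p) auto

text \<open>The length \<open>Suc m\<close> makes the last block nonempty, so that the position
  after all earlier blocks is its first entry.\<close>

lemma locate_append_last: "locate (ns @ [Suc m]) (sum_list ns) = (length ns, 0)"
	by (induction ns) auto

lemma locate_nth:
	"locate (map length xss) p = (k, i) ==> p < length (concat xss) ==>
		k < length xss & i < length (xss ! k) & concat xss ! p = xss ! k ! i"
proof (induction xss arbitrary: p k i)
	case (Cons xs xss)
	show ?case
	proof (cases "p < length xs")
		case False
		obtain k' i' where l: "locate (map length xss) (p - length xs) = (k', i')" by fastforce
		then have "k = Suc k'" "i' = i" using Cons.prems(1) False by simp_all
		moreover have "k' < length xss & i' < length (xss ! k') & concat xss ! (p - length xs) = xss ! k' ! i'"
			using Cons.IH[OF l] Cons.prems(2) False by simp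
		ultimately show ?thesis using False by (simp add: nth_append)
	qed (use Cons.prems in \<open>auto simp: nth_append\<close>)
qed simp

lemma locate_mono:
	"p < q ==> q < sum_list ns ==> locate ns p = (k, i) ==> locate ns q = (l, j) ==> k < l \<or> k = l & i < j"
proof (induction ns arbitrary: p q k l)
	case (Cons n ns)
	show ?case
	proof (cases "p < n")
		case True
		then show ?thesis using Cons.prems by (cases "locate ns (q - n)") (auto split: if_splits)
	next
		case False
		obtain k' i' l' j' where l: "locate ns (p - n) = (k', i')" "locate ns (q - n) = (l', j')" by fastforce
		then show ?thesis using Cons.IH[of "p - n" "q - n" k' l'] Cons.prems False by auto
	qed
qed simp

lemma blocks_update:
	"p < sum_list ns ==> length xs = sum_list ns ==> locate ns p = (k, i) ==>
		blocks ns (xs[p := x]) = (blocks ns xs)[k := (blocks ns xs ! k)[i := x]]"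
proof (induction ns arbitrary: p k xs)
	case (Cons n ns)
	show ?case
	proof (cases "p < n")
		case True
		then show ?thesis using Cons.prems by (auto simp: take_update_swap drop_update_cancel)
	next
		case False
		obtain k' i' where l: "locate ns (p - n) = (k', i')" by fastforce
		then show ?thesis using Cons.IH[of "p - n" "drop n xs" k'] Cons.prems False
			by (auto simp: take_update_cancel drop_update_swap)
	qed
qed simp

lemma tuples_list_all2: "xs : tuples Ss \<longleftrightarrow> list_all2 (\<lambda>x S. x : Obj S) xs Ss"
	by (auto simp: tuples_def list_all2_conv_all_nth)

lemma tuples_append: "xs : tuples (Ss @ Ts) \<longleftrightarrow> take (length Ss) xs : tuples Ss & drop (length Ss) xs : tuples Ts"
proof
	assume "xs : tuples (Ss @ Ts)"
	then obtain us vs where "xs = us @ vs" "length us = length Ss" "us : tuples Ss" "vs : tuples Ts"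
		unfolding tuples_list_all2 list_all2_append2 by blast
	then show "take (length Ss) xs : tuples Ss & drop (length Ss) xs : tuples Ts" by simp
next
	assume "take (length Ss) xs : tuples Ss & drop (length Ss) xs : tuples Ts"
	then have "take (length Ss) xs @ drop (length Ss) xs : tuples (Ss @ Ts)"
		unfolding tuples_list_all2 by (intro list_all2_appendI) auto
	then show "xs : tuples (Ss @ Ts)" by simp
qed

lemma tuples_concat:
	"xs : tuples (concat Sss) ==> k < length Sss ==> blocks (map length Sss) xs ! k : tuples (Sss ! k)"
proof (induction Sss arbitrary: xs k)
	case (Cons Ss Sss)
	then show ?case by (cases k) (auto simp: tuples_append)
qed simp

lemma length_concat_sum: "length (concat Sss) = sum_list (map length Sss)"
	by (induction Sss) auto

text \<open>The tuple of arguments that a substitution hands to the outer multifunctor.\<close>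

definition block_obs where
	"block_obs Sss Ns xs = map2 m0 Ns (blocks (map length Sss) xs)"

lemma subst_sel:
	"xs : tuples (concat Sss) ==> m0 (mfun_subst Sss M Ns) xs = m0 M (block_obs Sss Ns xs)"
	"arr_at (concat Sss) p xs s ==> locate (map length Sss) p = (k, i) ==>
		m1 (mfun_subst Sss M Ns) p xs s = m1 M k (block_obs Sss Ns xs) (m1 (Ns ! k) i (blocks (map length Sss) xs ! k) s)"
	"cell_at (concat Sss) p xs al ==> locate (map length Sss) p = (k, i) ==>
		m2 (mfun_subst Sss M Ns) p xs al = m2 M k (block_obs Sss Ns xs) (m2 (Ns ! k) i (blocks (map length Sss) xs ! k) al)"
	"p < q ==> arr_at (concat Sss) p xs s ==> arr_at (concat Sss) q xs t ==>
		locate (map length Sss) p = (k, i) ==> locate (map length Sss) q = (l, j) ==>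
		mx (mfun_subst Sss M Ns) p q xs s t =
		 (if k = l then m2 M k (block_obs Sss Ns xs) (mx (Ns ! k) i j (blocks (map length Sss) xs ! k) s t)
			else mx M k l (block_obs Sss Ns xs) (m1 (Ns ! k) i (blocks (map length Sss) xs ! k) s)
				(m1 (Ns ! l) j (blocks (map length Sss) xs ! l) t))"
	by (simp_all add: mfun_subst_def Let_def mfun_restrict_sel block_obs_def)

lemma mfun_restrict_subst [simp]: "mfun_restrict (concat Sss) (mfun_subst Sss M Ns) = mfun_subst Sss M Ns"
	by (simp add: mfun_subst_def Let_def)

text \<open>Only the inner multifunctors are fixed. Leaving the outer one open lets the same index
  facts serve a multifunctor and its currying.\<close>

locale substitution =
	fixes Sss :: "('o, 'a, 't) fcat list list" and Ts :: "('p, 'b, 's) fcat list"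
		and Ns :: "('o, 'a, 't, 'p, 'b, 's) mfun list" and v w
	assumes lengths: "length Ts = length Sss" "length Ns = length Sss" and vw: "v \<preceq> w"
		and block_fcats: "k < length Sss ==> fcats (Sss ! k)" and Ts_fcat: "k < length Sss ==> fcategory (Ts ! k)"
		and Ns_mf: "k < length Sss ==> multifunctor v w (Sss ! k) (Ts ! k) (Ns ! k)"
begin

abbreviation ns where "ns \<equiv> map length Sss"
abbreviation B where "B \<equiv> blocks ns"
abbreviation ys where "ys \<equiv> block_obs Sss Ns"

lemma block_setup: "k < length Sss ==> mf_setup (Sss ! k) (Ts ! k)"
	unfolding mf_setup_def mf_setup_axioms_def using block_fcats Ts_fcat by blast

lemma block_nmf: "k < length Sss ==> mf_setup.nmf (Sss ! k) (Ts ! k) (Ns ! k) v w"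
	using mf_setup.multifunctor_iff_nmf[OF block_setup vw] Ns_mf by blast

lemma block_typed: "k < length Sss ==> mf_typed (Sss ! k) (Ts ! k) (Ns ! k) v w"
	using block_nmf[of k] block_setup[of k]
	by (auto simp: mf_typed_def mf_typed_axioms_def mf_setup.nmf_def[OF block_setup])

lemma length_ys [simp]: "length (ys xs) = length Sss"
	by (simp add: block_obs_def lengths)

lemma ys_nth: "k < length Sss ==> ys xs ! k = m0 (Ns ! k) (B xs ! k)"
	by (simp add: block_obs_def lengths)

lemma ys_tuples:
	assumes "xs : tuples (concat Sss)" shows "ys xs : tuples Ts"
	unfolding tuples_def
proof (intro CollectI conjI allI impI)
	fix k assume "k < length Ts"
	then have k: "k < length Sss" by (simp add: lengths)
	show "ys xs ! k : Obj (Ts ! k)"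
		using Ns_mf[OF k, unfolded multifunctor_def, THEN conjunct2, THEN conjunct1, rule_format, OF tuples_concat[OF assms k]]
		by (simp add: ys_nth k)
qed (simp add: lengths)

lemma
	assumes a: "p < length (concat Sss)" "xs : tuples (concat Sss)" and l: "locate ns p = (k, i)"
	shows locate_less: "k < length Sss" "i < length (Sss ! k)"
		and concat_nth: "concat Sss ! p = Sss ! k ! i"
		and xs_nth: "xs ! p = B xs ! k ! i"
		and ys_update: "ys (xs[p := x]) = (ys xs)[k := m0 (Ns ! k) ((B xs ! k)[i := x])]" (is ?G4)
proof -
	show k: "k < length Sss" "i < length (Sss ! k)" "concat Sss ! p = Sss ! k ! i"
		using locate_nth[OF l a(1)] by auto
	have len: "length xs = sum_list ns" using tuples_length[OF a(2)] by (simp add: length_concat_sum)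
	show "xs ! p = B xs ! k ! i"
		using locate_nth[of "B xs" p k i] l a(1) tuples_length[OF a(2)] map_length_blocks[OF len] concat_blocks[OF len] by simp
	have p: "p < sum_list ns" using a(1) by (simp add: length_concat_sum)
	have b: "B (xs[p := x]) = (B xs)[k := (B xs ! k)[i := x]]" by (rule blocks_update[OF p len l])
	show ?G4
	proof (rule nth_equalityI)
		fix m assume "m < length (ys (xs[p := x]))"
		then have m: "m < length Sss" by simp
		show "ys (xs[p := x]) ! m = (ys xs)[k := m0 (Ns ! k) ((B xs ! k)[i := x])] ! m"
			using m k(1) unfolding ys_nth[OF m] b by (cases "m = k") (simp_all add: ys_nth)
	qed simp
qed

lemma
	assumes a: "arr_at (concat Sss) p xs s" and l: "locate ns p = (k, i)"
	shows arr_at_block: "arr_at (Sss ! k) i (B xs ! k) s"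
		and arr_at_ys: "arr_at Ts k (ys xs) (m1 (Ns ! k) i (B xs ! k) s)" (is ?G1)
		and ys_update_Cod: "(ys xs)[k := Cod (Ts ! k) (m1 (Ns ! k) i (B xs ! k) s)] = ys (xs[p := Cod (concat Sss ! p) s])" (is ?G2)
		and k_less: "k < length Sss"
		and tight_block: "s : Tight (concat Sss ! p) \<longleftrightarrow> s : Tight (Sss ! k ! i)" (is ?G4)
proof -
	note t = arr_at_less[OF a] arr_at_tuples[OF a]
	show k: "k < length Sss" by (rule locate_less(1)[OF t l])
	note f = locate_less(2)[OF t l] concat_nth[OF t l] xs_nth[OF t l]
	show b: "arr_at (Sss ! k) i (B xs ! k) s"
		using tuples_concat[OF t(2) k] f arr_at_arr[OF a] arr_at_Dom[OF a] by (simp add: arr_at_def)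
	interpret mf_typed "Sss ! k" "Ts ! k" "Ns ! k" v w by (rule block_typed[OF k])
	show ?G1
		using t1_arr[OF b] t1_Dom[OF b] ys_tuples[OF t(2)] k by (simp add: arr_at_def lengths ys_nth)
	show ?G2
		using t1_Cod[OF b] by (simp add: ys_update[OF t l] f)
	show ?G4 by (simp add: f)
qed

lemma
	assumes a: "cell_at (concat Sss) p xs al" and l: "locate ns p = (k, i)"
	shows cell_at_block: "cell_at (Sss ! k) i (B xs ! k) al"
		and cell_at_ys: "cell_at Ts k (ys xs) (m2 (Ns ! k) i (B xs ! k) al)" (is ?G1)
		and block_Src: "Src (Ts ! k) (m2 (Ns ! k) i (B xs ! k) al) = m1 (Ns ! k) i (B xs ! k) (Src (concat Sss ! p) al)" (is ?G2)
		and block_Tgt: "Tgt (Ts ! k) (m2 (Ns ! k) i (B xs ! k) al) = m1 (Ns ! k) i (B xs ! k) (Tgt (concat Sss ! p) al)" (is ?G3)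
		and cell_k_less: "k < length Sss"
proof -
	have t: "p < length (concat Sss)" "xs : tuples (concat Sss)" using a by (simp_all add: cell_at_def)
	show k: "k < length Sss" by (rule locate_less(1)[OF t l])
	note f = locate_less(2)[OF t l] concat_nth[OF t l] xs_nth[OF t l]
	show b: "cell_at (Sss ! k) i (B xs ! k) al"
		using tuples_concat[OF t(2) k] f a by (simp add: cell_at_def)
	interpret mf_typed "Sss ! k" "Ts ! k" "Ns ! k" v w by (rule block_typed[OF k])
	note m = m2_cell[OF typed_fun[OF f(1)] b] m2_Src[OF typed_fun[OF f(1)] b] m2_Tgt[OF typed_fun[OF f(1)] b]
	show ?G1
		using m t1_Dom[OF arr_at_Src[OF b]] ys_tuples[OF t(2)] k by (simp add: cell_at_def lengths ys_nth)
	show ?G2 ?G3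
		using m f by simp_all
qed

text \<open>For two positions in the same block the interchange cell of the inner multifunctor is a
  2-cell of \<open>Ts ! k\<close>. The outer multifunctor takes it by \<open>m2\<close>, so it has
  to be recognised as a legal argument there.\<close>

lemma
	assumes pq: "p < q" and a: "arr_at (concat Sss) p xs s" "arr_at (concat Sss) q xs t"
		and l: "locate ns p = (k, i)" "locate ns q = (k, j)"
	shows same_less: "i < j"
		and same_cell_at: "cell_at Ts k (ys xs) (mx (Ns ! k) i j (B xs ! k) s t)"
		and same_Src: "Src (ori w (Ts ! k)) (mx (Ns ! k) i j (B xs ! k) s t) =
			Cmp (Ts ! k) (m1 (Ns ! k) j (B (xs[p := Cod (concat Sss ! p) s]) ! k) t) (m1 (Ns ! k) i (B xs ! k) s)"
		and same_Tgt: "Tgt (ori w (Ts ! k)) (mx (Ns ! k) i j (B xs ! k) s t) =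
			Cmp (Ts ! k) (m1 (Ns ! k) i (B (xs[q := Cod (concat Sss ! q) t]) ! k) s) (m1 (Ns ! k) j (B xs ! k) t)"
		and same_strong: "strong (Ts ! k) w (mx (Ns ! k) i j (B xs ! k) s t)" (is ?G4)
proof -
	note t = arr_at_less[OF a(1)] arr_at_tuples[OF a(1)]
	note t' = arr_at_less[OF a(2)] arr_at_tuples[OF a(2)]
	note k = k_less[OF a(1) l(1)]
	have len: "length xs = sum_list ns" using tuples_length[OF t(2)] by (simp add: length_concat_sum)
	have p: "p < sum_list ns" "q < sum_list ns" using t(1) t'(1) by (simp_all add: length_concat_sum)
	show ij: "i < j" using locate_mono[OF pq p(2) l] by auto
	note b = arr_at_block[OF a(1) l(1)] arr_at_block[OF a(2) l(2)]
	interpret mf_typed "Sss ! k" "Ts ! k" "Ns ! k" v w by (rule block_typed[OF k])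
	have B: "B (xs[p := Cod (concat Sss ! p) s]) ! k = (B xs ! k)[i := Cod (Sss ! k ! i) s]"
		"B (xs[q := Cod (concat Sss ! q) t]) ! k = (B xs ! k)[j := Cod (Sss ! k ! j) t]"
		unfolding blocks_update[OF p(1) len l(1)] blocks_update[OF p(2) len l(2)] concat_nth[OF t l(1)] concat_nth[OF t' l(2)]
		using k by simp_all
	show s: "Src (ori w (Ts ! k)) (mx (Ns ! k) i j (B xs ! k) s t) =
			Cmp (Ts ! k) (m1 (Ns ! k) j (B (xs[p := Cod (concat Sss ! p) s]) ! k) t) (m1 (Ns ! k) i (B xs ! k) s)"
		"Tgt (ori w (Ts ! k)) (mx (Ns ! k) i j (B xs ! k) s t) =
			Cmp (Ts ! k) (m1 (Ns ! k) i (B (xs[q := Cod (concat Sss ! q) t]) ! k) s) (m1 (Ns ! k) j (B xs ! k) t)"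
		unfolding B using tx_Src[OF ij b] tx_Tgt[OF ij b] by simp_all
	show ?G4 by (rule tx_strong[OF ij b])
	have c: "arr_at (Sss ! k) j ((B xs ! k)[i := Cod (Sss ! k ! i) s]) t" using arr_at_cross[OF b(2,1)] ij by simp
	have "Dom (Ts ! k) (Src (ori w (Ts ! k)) (mx (Ns ! k) i j (B xs ! k) s t)) = m0 (Ns ! k) (B xs ! k)"
		using tx_Src[OF ij b] b c by simp
	then have "Dom (Ts ! k) (Src (Ts ! k) (mx (Ns ! k) i j (B xs ! k) s t)) = m0 (Ns ! k) (B xs ! k)"
		using C.Dom_Src_ori[OF tx_cell[OF ij b]] by simp
	then show "cell_at Ts k (ys xs) (mx (Ns ! k) i j (B xs ! k) s t)"
		using tx_cell[OF ij b] ys_tuples[OF t(2)] k by (simp add: cell_at_def lengths ys_nth)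
qed

lemma locate_diff:
	assumes "p < q" "arr_at (concat Sss) q xs t" "locate ns p = (k, i)" "locate ns q = (l, j)" "k ~= l"
	shows "k < l"
	using locate_mono[OF assms(1) _ assms(3,4)] arr_at_less[OF assms(2)] assms(5) by (auto simp: length_concat_sum)

end

subsection \<open>Unary multifunctors\<close>

text \<open>Unary multifunctors are the same as 2-functors; with a single position there is no pair
  for \<open>mx\<close>.\<close>

definition unary where
	"unary S F = mfun_restrict [S] \<lparr>m0 = (\<lambda>xs. F0 F (hd xs)), m1 = (\<lambda>i xs s. F1 F s), m2 = (\<lambda>i xs al. F2 F al),
		 mx = (\<lambda>i j xs s t. undefined)\<rparr>"

lemma tuples_single: "xs : tuples [S] \<longleftrightarrow> (\<exists>x\<in>Obj S. xs = [x])"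
	by (auto simp: tuples_def length_Suc_conv)

lemma arr_at_single: "arr_at [S] i xs s \<longleftrightarrow> i = 0 & s : Arr S & xs = [Dom S s] & Dom S s : Obj S"
	by (auto simp: arr_at_def tuples_single)

lemma cell_at_single: "cell_at [S] i xs al \<longleftrightarrow> i = 0 & al : Cell S & xs = [Dom S (Src S al)] & Dom S (Src S al) : Obj S"
	by (auto simp: cell_at_def tuples_single)

lemma unary_sel:
	"x : Obj S ==> m0 (unary S F) [x] = F0 F x"
	"s : Arr S ==> Dom S s : Obj S ==> m1 (unary S F) 0 [Dom S s] s = F1 F s"
	"al : Cell S ==> Dom S (Src S al) : Obj S ==> m2 (unary S F) 0 [Dom S (Src S al)] al = F2 F al"
	by (simp_all add: unary_def mfun_restrict_def tuples_single arr_at_single cell_at_single)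

lemma mfun_id_unary: "mfun_id S = unary S (ffun_id S)"
	unfolding mfun_id_def unary_def
	by (rule mfun_restrict_cong) (auto simp: tuples_single arr_at_single cell_at_single ffun_id_def)

lemma unary_multifunctor:
	assumes S: "fcategory S" and F: "ffunctor S C F"
	shows "multifunctor v w [S] C (unary S F)"
proof -
	interpret S: twocat S by unfold_locales (rule fcategory_two_category[OF S])
	have F': "F0 F : extensional (Obj S)" "F1 F : extensional (Arr S)" "F2 F : extensional (Cell S)"
		"!!x. x : Obj S ==> F0 F x : Obj C"
		using F unfolding ffunctor_def is_functor_def arrow_cat_def vertical_cat_def by (auto simp: PiE_iff)
	have "slice [S] (unary S F) 0 [x] = F" for x
		by (rule ffun.equality) (auto simp: slice_def unary_sel intro!: restrict_eqI F')
	then show ?thesis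
		unfolding multifunctor_def
		using F F'(4) by (auto simp: tuples_single arr_at_single unary_sel) (simp add: unary_def)
qed

lemma unary_cases:
	assumes S: "fcategory S" and f: "multifunctor v w [S] C f"
	obtains F where "ffunctor S C F" "f = unary S F"
proof -
	interpret S: twocat S by unfold_locales (rule fcategory_two_category[OF S])
	\<comment> \<open>\<open>slice\<close> overwrites the only entry, so any list of length one will
	  do, even when \<open>S\<close> has no object.\<close>
	let ?F = "slice [S] f 0 [undefined]"
	have "ffunctor S C ?F"
	proof (cases "Obj S = {}")
		\<comment> \<open>Without objects there is no tuple at which the multifunctor axioms could be
		  used; the functor is then the empty one.\<close>
		case True
		then have "Arr S = {}" "Cell S = {}" using S.Dom_ob S.Src_arr by blast+
		then show ?thesis using True Tight_arr[OF S]
			by (auto simp: ffunctor_def is_functor_def arrow_cat_def vertical_cat_def horizontal_cat_def slice_def)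
	next
		case False
		then obtain x where x: "x : Obj S" by blast
		have "slice [S] f 0 [undefined] = slice [S] f 0 [x]" by (simp add: slice_def)
		moreover have "ffunctor S C (slice [S] f 0 [x])"
			using f x unfolding multifunctor_def by (force simp: tuples_single)
		ultimately show ?thesis by simp
	qed
	moreover have "f = unary S ?F"
	proof (rule mfun_eqI[of "[S]"])
		show "mfun_restrict [S] f = f" using f by (simp add: multifunctor_def)
		show "mfun_restrict [S] (unary S ?F) = unary S ?F" by (simp add: unary_def)
	qed (auto simp: tuples_single arr_at_single cell_at_single unary_sel slice_def)
	ultimately show thesis by (rule that)
qed

lemma ffun_id_sel [simp]:
	"x : Obj S ==> F0 (ffun_id S) x = x" "s : Arr S ==> F1 (ffun_id S) s = s" "al : Cell S ==> F2 (ffun_id S) al = al"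
	by (simp_all add: ffun_id_def)

lemma (in twocat) ffunctor_id: "(!!f. f : Tight C ==> f : Arr C) ==> ffunctor C C (ffun_id C)"
	by (rule ffunctorI) (simp_all add: two_category, simp_all add: ffun_id_def)

lemma map_list_single: "concat (map (\<lambda>S. [S]) Ss) = Ss"
	by (induction Ss) auto

lemma map_length_single: "map length (map (\<lambda>S. [S]) Ss) = replicate (length Ss) 1"
	by (induction Ss) auto

lemma locate_replicate: "p < n ==> locate (replicate n 1) p = (p, 0)"
	by (induction n arbitrary: p) auto

lemma blocks_replicate: "length xs = n ==> blocks (replicate n 1) xs = map (\<lambda>x. [x]) xs"
proof (induction n arbitrary: xs)
	case (Suc n)
	then show ?case by (cases xs) auto
qed simp

context substitution
begin

lemma concat_fcats: "fcats (concat Sss)"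
proof (rule fcats.intro)
	fix p assume "p < length (concat Sss)"
	then obtain Ss where s: "Ss : set Sss" "concat Sss ! p : set Ss" using nth_mem[of p "concat Sss"] by auto
	then obtain k where k: "k < length Sss" "Ss = Sss ! k" by (auto simp: in_set_conv_nth)
	then obtain i where i: "i < length (Sss ! k)" "concat Sss ! p = Sss ! k ! i" using s(2) by (auto simp: in_set_conv_nth)
	then show "fcategory (concat Sss ! p)" using fcats.fcat[OF block_fcats[OF k(1)] i(1)] by simp
qed

lemma blocks_other:
	assumes a: "arr_at (concat Sss) p xs s" and l: "locate ns p = (k, i)" and "m ~= k"
	shows "B (xs[p := x]) ! m = B xs ! m"
	using blocks_update[of p ns xs k i x] arr_at_less[OF a] tuples_length[OF arr_at_tuples[OF a]] l assms(3)
	by (simp add: length_concat_sum)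

text \<open>\<open>ffun_id\<close> is the identity only on the carriers of \<open>C\<close>, so all
  values of the substitution must be shown to lie there.\<close>

lemma subst_post_id:
	assumes C: "fcategory C" and M: "multifunctor v w Ts C M" and Ts: "fcats Ts"
	shows "post (concat Sss) (ffun_id C) (mfun_subst Sss M Ns) = mfun_subst Sss M Ns"
proof -
	interpret Ts: fcats Ts by (rule Ts)
	interpret M: mf_setup Ts C M by unfold_locales (rule C)
	have n: "M.nmf v w" using M M.multifunctor_iff_nmf[OF vw] by simp
	interpret M: mf_typed Ts C M v w by unfold_locales (use n in \<open>auto simp: M.nmf_def\<close>)
	have o: "m0 M zs : Obj C" if "zs : tuples Ts" for zs using n that by (simp add: M.nmf_def)
	show ?thesis
	proof (rule mfun_eqI[of "concat Sss"])
		show "m0 (post (concat Sss) (ffun_id C) (mfun_subst Sss M Ns)) xs = m0 (mfun_subst Sss M Ns) xs"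
			if "xs : tuples (concat Sss)" for xs
			using that o[OF ys_tuples[OF that]] by (simp add: post_sel subst_sel)
		show "m1 (post (concat Sss) (ffun_id C) (mfun_subst Sss M Ns)) p xs s = m1 (mfun_subst Sss M Ns) p xs s"
			if a: "arr_at (concat Sss) p xs s" for p xs s
		proof -
			obtain k i where l: "locate ns p = (k, i)" by fastforce
			show ?thesis by (simp add: post_sel a subst_sel(2)[OF a l] M.t1_arr[OF arr_at_ys[OF a l]])
		qed
		show "m2 (post (concat Sss) (ffun_id C) (mfun_subst Sss M Ns)) p xs s = m2 (mfun_subst Sss M Ns) p xs s"
			if a: "cell_at (concat Sss) p xs s" for p xs s
		proof -
			obtain k i where l: "locate ns p = (k, i)" by fastforce
			show ?thesis by (simp add: post_sel a subst_sel(3)[OF a l] M.t2_cell[OF cell_at_ys[OF a l]])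
		qed
		show "mx (post (concat Sss) (ffun_id C) (mfun_subst Sss M Ns)) p q xs s t = mx (mfun_subst Sss M Ns) p q xs s t"
			if pq: "p < q" and a: "arr_at (concat Sss) p xs s" "arr_at (concat Sss) q xs t" for p q xs s t
		proof -
			obtain k i l j where l: "locate ns p = (k, i)" "locate ns q = (l, j)" by fastforce
			show ?thesis
			proof (cases "k = l")
				case True
				show ?thesis
					using M.t2_cell[OF same_cell_at[OF pq a l(1) l(2)[folded True]]]
					by (simp add: post_sel pq a subst_sel(4)[OF pq a l] True)
			next
				case False
				then show ?thesis
					using M.tx_cell[OF locate_diff[OF pq a(2) l False] arr_at_ys[OF a(1) l(1)] arr_at_ys[OF a(2) l(2)]]
					by (simp add: post_sel pq a subst_sel(4)[OF pq a l])
			qed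
		qed
	qed simp_all
qed

end

lemma post_id:
	assumes Ss: "fcats Ss" and C: "fcategory C" and vw: "v \<preceq> w" and M: "multifunctor v w Ss C M"
	shows "post Ss (ffun_id C) M = M"
proof -
	interpret Ss: fcats Ss by (rule Ss)
	interpret M: mf_setup Ss C M by unfold_locales (rule C)
	have n: "M.nmf v w" using M M.multifunctor_iff_nmf[OF vw] by simp
	interpret M: mf_typed Ss C M v w by unfold_locales (use n in \<open>auto simp: M.nmf_def\<close>)
	have o: "m0 M zs : Obj C" if "zs : tuples Ss" for zs using n that by (simp add: M.nmf_def)
	have r: "mfun_restrict Ss M = M" using n by (simp add: M.nmf_def)
	show ?thesis
		by (rule mfun_eqI[OF _ r]) (simp_all add: post_sel o)
qed

lemma subst_ids:
	assumes Ss: "fcats Ss" and C: "mfun_restrict Ss M = M"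
	shows "mfun_subst (map (\<lambda>S. [S]) Ss) M (map mfun_id Ss) = M"
proof -
	interpret Ss: fcats Ss by (rule Ss)
	let ?Sss = "map (\<lambda>S. [S]) Ss"
	have c: "concat ?Sss = Ss" by (rule map_list_single)
	have l: "map length ?Sss = replicate (length Ss) 1" by (rule map_length_single)
	have b: "blocks (replicate (length Ss) 1) xs = map (\<lambda>x. [x]) xs" if "xs : tuples Ss" for xs
		using tuples_length[OF that] by (rule blocks_replicate)
	have ys: "block_obs ?Sss (map mfun_id Ss) xs = xs" if xs: "xs : tuples Ss" for xs
		unfolding block_obs_def l b[OF xs]
		by (rule nth_equalityI) (use xs in \<open>auto simp: tuples_def mfun_id_unary unary_sel\<close>)
	note lo = locate_replicate[of _ "length Ss"]
	have m: "m1 (map mfun_id Ss ! i) 0 (map (\<lambda>x. [x]) xs ! i) s = s" if a: "arr_at Ss i xs s" for i xs s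
	proof -
		have "xs ! i = Dom (Ss ! i) s" "xs ! i : Obj (Ss ! i)" "i < length xs" using a by (auto simp: arr_at_def tuples_def)
		then show ?thesis using a unary_sel(2)[of s "Ss ! i" "ffun_id (Ss ! i)"] by (simp add: arr_at_def mfun_id_unary)
	qed
	have m': "m2 (map mfun_id Ss ! i) 0 (map (\<lambda>x. [x]) xs ! i) s = s" if a: "cell_at Ss i xs s" for i xs s
	proof -
		have "xs ! i = Dom (Ss ! i) (Src (Ss ! i) s)" "xs ! i : Obj (Ss ! i)" "i < length xs" using a by (auto simp: cell_at_def tuples_def)
		then show ?thesis using a unary_sel(3)[of s "Ss ! i" "ffun_id (Ss ! i)"] by (simp add: cell_at_def mfun_id_unary)
	qed
	show ?thesis
	proof (rule mfun_eqI[OF _ C])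
		show "mfun_restrict Ss (mfun_subst ?Sss M (map mfun_id Ss)) = mfun_subst ?Sss M (map mfun_id Ss)"
			using mfun_restrict_subst[of ?Sss] c by simp
		show "m0 (mfun_subst ?Sss M (map mfun_id Ss)) xs = m0 M xs" if "xs : tuples Ss" for xs
			using subst_sel(1)[of xs ?Sss M "map mfun_id Ss", unfolded c] that ys by simp
		show "m1 (mfun_subst ?Sss M (map mfun_id Ss)) i xs s = m1 M i xs s" if a: "arr_at Ss i xs s" for i xs s
		proof -
			have i: "i < length Ss" "xs : tuples Ss" using a by (simp_all add: arr_at_def)
			show ?thesis
				using subst_sel(2)[of ?Sss i xs s i 0 M "map mfun_id Ss", unfolded c l, OF a lo[OF i(1)]]
				by (simp only: ys[OF i(2)] b[OF i(2)] m[OF a])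
		qed
		show "m2 (mfun_subst ?Sss M (map mfun_id Ss)) i xs s = m2 M i xs s" if a: "cell_at Ss i xs s" for i xs s
		proof -
			have i: "i < length Ss" "xs : tuples Ss" using a by (simp_all add: cell_at_def)
			show ?thesis
				using subst_sel(3)[of ?Sss i xs s i 0 M "map mfun_id Ss", unfolded c l, OF a lo[OF i(1)]]
				by (simp only: ys[OF i(2)] b[OF i(2)] m'[OF a])
		qed
		show "mx (mfun_subst ?Sss M (map mfun_id Ss)) i j xs s t = mx M i j xs s t"
			if ij: "i < j" and a: "arr_at Ss i xs s" "arr_at Ss j xs t" for i j xs s t
		proof -
			have i: "i < length Ss" "xs : tuples Ss" "j < length Ss" "i ~= j" using a ij by (simp_all add: arr_at_def)
			show ?thesis
				using subst_sel(4)[of i j ?Sss xs s t i 0 j 0 M "map mfun_id Ss", unfolded c l, OF ij a lo[OF i(1)] lo[OF i(3)]] i(4)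
				by (simp only: ys[OF i(2)] b[OF i(2)] m[OF a(1)] m[OF a(2)] if_False)
		qed
	qed
qed

section \<open>Naturality of currying under substitution\<close>

section \<open>Currying and substitution\<close>

text \<open>The common setting of all naturality conditions: \<open>Ns\<close> is substituted in the
  first variables of \<open>g\<close>, \<open>F\<close> in the last, and \<open>G\<close> is applied
  to the result.\<close>

locale cur_subst = substitution Sss Ts Ns v w + whiskering Y C Y' C' v w F G P P'
	for Sss :: "('o, 'a, 't) fcat list list" and Ts :: "('p, 'b, 's) fcat list"
		and Ns :: "('o, 'a, 't, 'p, 'b, 's) mfun list" and v w
		and Y :: "('p, 'b, 's) fcat" and C :: "('q, 'c, 'r) fcat" and Y' :: "('o, 'a, 't) fcat"
		and C' :: "('q1, 'c1, 'r1) fcat" and F G P P' +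
	fixes g
	assumes g: "multifunctor v w (Ts @ [Y]) C g" and cg: "zs : tuples Ts ==> cur_fun Ts Y g zs : P"
begin

abbreviation Us where "Us \<equiv> concat Sss"
abbreviation L where "L \<equiv> mfun_subst (Sss @ [[Y']]) g (Ns @ [unary Y' F])"
abbreviation R where "R \<equiv> mfun_subst Sss (cur w Ts Y C g) Ns"

lemma locate_old: "p < length Us ==> locate (map length (Sss @ [[Y']])) p = locate ns p"
	by (simp add: locate_append length_concat_sum)

lemma locate_new: "locate (map length (Sss @ [[Y']])) (length Us) = (length Ts, 0)"
	using locate_append_last[of ns 0] by (simp add: length_concat_sum lengths)

lemma blocks_new: "xs : tuples Us ==> blocks (map length (Sss @ [[Y']])) (xs @ [y]) = B xs @ [[y]]"
	using blocks_append[of xs ns "[1]" "[y]"] tuples_length[of xs Us] by (simp add: length_concat_sum)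

lemma obs_new: "xs : tuples Us ==> y : Obj Y' ==>
		block_obs (Sss @ [[Y']]) (Ns @ [unary Y' F]) (xs @ [y]) = ys xs @ [F0 F y]"
	unfolding block_obs_def blocks_new using lengths by (simp add: unary_sel zip_append)

text \<open>The last block holds the single entry \<open>y\<close>, so earlier positions are located
  as before, and the outer tuple merely gains the entry \<open>F0 F y\<close>. The lemmas that
  follow are the same computation on arrows and cells.\<close>

lemma L0: "xs : tuples Us ==> y : Obj Y' ==> m0 L (xs @ [y]) = m0 g (ys xs @ [F0 F y])"
	using subst_sel(1)[of "xs @ [y]" "Sss @ [[Y']]" g "Ns @ [unary Y' F]"] by (simp add: tuples_snoc obs_new)

lemma L1:
	assumes a: "arr_at Us p xs s" and y: "y : Obj Y'" and l: "locate ns p = (k, i)"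
	shows "m1 L p (xs @ [y]) s = m1 g k (ys xs @ [F0 F y]) (m1 (Ns ! k) i (B xs ! k) s)"
proof -
	note p = arr_at_less[OF a] arr_at_tuples[OF a]
	have "arr_at (concat (Sss @ [[Y']])) p (xs @ [y]) s" using a y p by (simp add: arr_at_snoc)
	from subst_sel(2)[OF this, unfolded locate_old[OF p(1)], OF l, of g "Ns @ [unary Y' F]"]
	show ?thesis using k_less[OF a l] by (simp only: obs_new[OF p(2) y] blocks_new[OF p(2)]) (simp add: nth_append lengths)
qed

lemma L2:
	assumes a: "cell_at Us p xs al" and y: "y : Obj Y'" and l: "locate ns p = (k, i)"
	shows "m2 L p (xs @ [y]) al = m2 g k (ys xs @ [F0 F y]) (m2 (Ns ! k) i (B xs ! k) al)"
proof -
	have p: "p < length Us" "xs : tuples Us" using a by (simp_all add: cell_at_def)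
	have "cell_at (concat (Sss @ [[Y']])) p (xs @ [y]) al" using a y p by (simp add: cell_at_snoc)
	from subst_sel(3)[OF this, unfolded locate_old[OF p(1)], OF l, of g "Ns @ [unary Y' F]"]
	show ?thesis using cell_k_less[OF a l] by (simp only: obs_new[OF p(2) y] blocks_new[OF p(2)]) (simp add: nth_append lengths)
qed

lemma Lx:
	assumes pq: "p < q" and a: "arr_at Us p xs s" "arr_at Us q xs t" and y: "y : Obj Y'"
		and l: "locate ns p = (k, i)" "locate ns q = (l, j)"
	shows "mx L p q (xs @ [y]) s t =
		 (if k = l then m2 g k (ys xs @ [F0 F y]) (mx (Ns ! k) i j (B xs ! k) s t)
			else mx g k l (ys xs @ [F0 F y]) (m1 (Ns ! k) i (B xs ! k) s) (m1 (Ns ! l) j (B xs ! l) t))"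
proof -
	note p = arr_at_less[OF a(1)] arr_at_tuples[OF a(1)] arr_at_less[OF a(2)]
	have "arr_at (concat (Sss @ [[Y']])) p (xs @ [y]) s" "arr_at (concat (Sss @ [[Y']])) q (xs @ [y]) t"
		using a y p by (simp_all add: arr_at_snoc)
	from subst_sel(4)[OF pq this, unfolded locate_old[OF p(1)] locate_old[OF p(3)], OF l, of g "Ns @ [unary Y' F]"]
	show ?thesis using k_less[OF a(1) l(1)] k_less[OF a(2) l(2)]
		by (simp only: obs_new[OF p(2) y] blocks_new[OF p(2)]) (simp add: nth_append lengths)
qed

lemma unary_Dom: "t : Arr Y' ==> Dom Y' t : Obj Y'" "be : Cell Y' ==> Dom Y' (Src Y' be) : Obj Y'"
	by simp_all

lemma L1_last:
	assumes p: "xs : tuples Us" and t: "t : Arr Y'"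
	shows "m1 L (length Us) (xs @ [Dom Y' t]) t = m1 g (length Ts) (ys xs @ [F0 F (Dom Y' t)]) (F1 F t)"
proof -
	have "arr_at (concat (Sss @ [[Y']])) (length Us) (xs @ [Dom Y' t]) t" using p t by (simp add: arr_at_last)
	from subst_sel(2)[OF this locate_new, of g "Ns @ [unary Y' F]"]
	show ?thesis using unary_Dom(1)[OF t] t
		by (simp only: obs_new[OF p unary_Dom(1)[OF t]] blocks_new[OF p]) (simp add: nth_append lengths unary_sel)
qed

lemma L2_last:
	assumes p: "xs : tuples Us" and t: "be : Cell Y'"
	shows "m2 L (length Us) (xs @ [Dom Y' (Src Y' be)]) be = m2 g (length Ts) (ys xs @ [F0 F (Dom Y' (Src Y' be))]) (F2 F be)"
proof -
	have "cell_at (concat (Sss @ [[Y']])) (length Us) (xs @ [Dom Y' (Src Y' be)]) be" using p t by (simp add: cell_at_last)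
	from subst_sel(3)[OF this locate_new, of g "Ns @ [unary Y' F]"]
	show ?thesis using unary_Dom(2)[OF t] t
		by (simp only: obs_new[OF p unary_Dom(2)[OF t]] blocks_new[OF p]) (simp add: nth_append lengths unary_sel)
qed

lemma Lx_last:
	assumes a: "arr_at Us p xs s" and t: "t : Arr Y'" and l: "locate ns p = (k, i)"
	shows "mx L p (length Us) (xs @ [Dom Y' t]) s t =
		 mx g k (length Ts) (ys xs @ [F0 F (Dom Y' t)]) (m1 (Ns ! k) i (B xs ! k) s) (F1 F t)"
proof -
	note p = arr_at_less[OF a] arr_at_tuples[OF a]
	have "arr_at (concat (Sss @ [[Y']])) p (xs @ [Dom Y' t]) s" "arr_at (concat (Sss @ [[Y']])) (length Us) (xs @ [Dom Y' t]) t"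
		using a t p by (simp_all add: arr_at_snoc arr_at_last)
	from subst_sel(4)[OF p(1) this, unfolded locate_old[OF p(1)], OF l locate_new, of g "Ns @ [unary Y' F]"]
	show ?thesis using k_less[OF a l] unary_Dom(1)[OF t] t
		by (simp only: obs_new[OF p(2) unary_Dom(1)[OF t]] blocks_new[OF p(2)]) (simp add: nth_append lengths unary_sel)
qed

sublocale Us: fcats Us by (rule concat_fcats)

abbreviation E where "E \<equiv> post (Us @ [Y']) G L"

lemma Ts_fcats: "fcats Ts" by (rule fcats.intro) (use Ts_fcat lengths in auto)

text \<open>Objects, arrows and 2-cells come before interchange cells, because the ends of the
  latter are composites of the transformations computed here.\<close>

lemma cur_E:
	"xs : tuples Us ==> cur_fun Us Y' E xs = wh_fun Y' G F (cur_fun Ts Y g (ys xs))"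
	"arr_at Us p xs s ==> locate ns p = (k, i) ==>
		 cur_trans Us Y' E p xs s = wh_trans Y' G F (cur_trans Ts Y g k (ys xs) (m1 (Ns ! k) i (B xs ! k) s))"
	"cell_at Us p xs al ==> locate ns p = (k, i) ==>
		 cur_modif Us Y' E p xs al = wh_modif Y' G F (cur_modif Ts Y g k (ys xs) (m2 (Ns ! k) i (B xs ! k) al))"
proof -
	show 0: "cur_fun Us Y' E xs = wh_fun Y' G F (cur_fun Ts Y g (ys xs))" if xs: "xs : tuples Us" for xs
		unfolding cur_fun_def[of Us] wh_fun_def
		using xs by (intro ffun.equality)
			(auto simp: post_sel tuples_snoc arr_at_last cell_at_last L0 L1_last L2_last intro!: restrict_ext)
	show 1: "cur_trans Us Y' E p xs s = wh_trans Y' G F (cur_trans Ts Y g k (ys xs) (m1 (Ns ! k) i (B xs ! k) s))"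
		if a: "arr_at Us p xs s" and l: "locate ns p = (k, i)" for p xs s k i
	proof -
		note p = arr_at_less[OF a] arr_at_tuples[OF a]
		show ?thesis
			unfolding cur_trans_def[of Us] wh_trans_def cur_trans_sel ys_update_Cod[OF a l] 0[OF p(2)] 0[OF Us.update_Cod[OF a]]
			using a p l by (intro wtrans.equality)
				(auto simp: post_sel arr_at_snoc arr_at_last L1 Lx_last intro!: restrict_ext)
	qed
	show "cur_modif Us Y' E p xs al = wh_modif Y' G F (cur_modif Ts Y g k (ys xs) (m2 (Ns ! k) i (B xs ! k) al))"
		if a: "cell_at Us p xs al" and l: "locate ns p = (k, i)"
	proof -
		have p: "p < length Us" "xs : tuples Us" using a by (simp_all add: cell_at_def)
		have s: "arr_at Us p xs (Src (Us ! p) al)" "arr_at Us p xs (Tgt (Us ! p) al)"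
			by (rule Us.arr_at_Src[OF a] Us.arr_at_Tgt[OF a])+
		show ?thesis
			unfolding cur_modif_def[of Us] wh_modif_def cur_modif_sel 1[OF s(1) l] 1[OF s(2) l] block_Src[OF a l] block_Tgt[OF a l]
			using a p l by (intro modif.equality) (auto simp: post_sel cell_at_snoc L2 intro!: restrict_ext)
	qed
qed

text \<open>The one identity behind naturality. Identities for \<open>F\<close> and \<open>G\<close>
  give naturality in the first variables; identities for \<open>Ns\<close> and for one of
  \<open>F\<close> and \<open>G\<close> give naturality in the target or in the last source.\<close>

lemma cur_post_subst: "cur w Us Y' C' E = post Us Wh R"
proof -
	interpret Ts: fcats Ts by (rule Ts_fcats)
	interpret cs: cur_setup Ts Y C v w P by unfold_locales
	note N = cs.cur_multifunctor[OF g cg]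
	have QQ: "fcategory Q" by (rule fcategory_full_sub[OF A.fcategory_Fun])
	interpret Nm: mf_setup Ts Q "cur w Ts Y C g" by unfold_locales (rule QQ)
	have n: "Nm.nmf v w" using N Nm.multifunctor_iff_nmf[OF vw] by simp
	interpret Nt: mf_typed Ts Q "cur w Ts Y C g" v w by unfold_locales (use n in \<open>auto simp: Nm.nmf_def\<close>)
	have tq: "two_category Q" "two_category Q'"
		by (rule fcategory_two_category[OF QQ] fcategory_two_category[OF fcategory_full_sub[OF B.fcategory_Fun]])+
	interpret W: twofun Q Q' Wh by unfold_locales (rule tq whisk_ffunctor)+
	have n0: "m0 (cur w Ts Y C g) zs : Obj Q" if "zs : tuples Ts" for zs using n that by (simp add: Nm.nmf_def)
	have W1: "F1 Wh (m1 (cur w Ts Y C g) k (ys xs) (m1 (Ns ! k) i (B xs ! k) s)) = cur_trans Us Y' E p xs s"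
		if a: "arr_at Us p xs s" and l: "locate ns p = (k, i)" for p xs s k i
		using whisk_sel(2)[OF Nt.t1_arr[OF arr_at_ys[OF a l]], of Y' G F] by (simp add: cur_sel arr_at_ys[OF a l] cur_E(2)[OF a l])
	interpret W': twofun "ori w Q" "ori w Q'" Wh
		by unfold_locales (rule ori_two_category tq ffunctor_ori[OF tq W.ffunctor])+
	note SW = W'.Src_F2 W'.Tgt_F2
	note SW' = SW[unfolded ori_simps]
	have oe: "msrc mu = (if u = Colax then b else a) & mtgt mu = (if u = Colax then a else b)"
		if "Src (ori u Q') mu = a" "Tgt (ori u Q') mu = b" for u mu a b
		using that by (cases "u = Colax") (simp_all add: ori_if)
	show ?thesis
	proof (rule mfun_eqI[of Us])
		show "m0 (cur w Us Y' C' E) xs = m0 (post Us Wh R) xs" if xs: "xs : tuples Us" for xs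
			using whisk_sel(1)[OF n0[OF ys_tuples[OF xs]], of Y' G F]
			by (simp add: cur_sel xs post_sel subst_sel ys_tuples[OF xs] cur_E(1))
		show "m1 (cur w Us Y' C' E) p xs s = m1 (post Us Wh R) p xs s" if a: "arr_at Us p xs s" for p xs s
		proof -
			obtain k i where l: "locate ns p = (k, i)" by fastforce
			show ?thesis by (simp add: cur_sel(2) a post_sel(2) subst_sel(2)[OF a l] W1[OF a l])
		qed
		show "m2 (cur w Us Y' C' E) p xs al = m2 (post Us Wh R) p xs al" if a: "cell_at Us p xs al" for p xs al
		proof -
			obtain k i where l: "locate ns p = (k, i)" by fastforce
			show ?thesis
				using whisk_sel(3)[OF Nt.t2_cell[OF cell_at_ys[OF a l]], of Y' G F]
				by (simp add: cur_sel(3) a post_sel(3) subst_sel(3)[OF a l] cell_at_ys[OF a l] cur_E(3)[OF a l])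
		qed
		show "mx (cur w Us Y' C' E) p q xs s t = mx (post Us Wh R) p q xs s t"
			if pq: "p < q" and a: "arr_at Us p xs s" "arr_at Us q xs t" for p q xs s t
		proof -
			obtain k i l j where l: "locate ns p = (k, i)" "locate ns q = (l, j)" by fastforce
			note p = arr_at_less[OF a(1)] arr_at_tuples[OF a(1)] arr_at_less[OF a(2)]
			have x: "arr_at Us q (xs[p := Cod (Us ! p) s]) t" "arr_at Us p (xs[q := Cod (Us ! q) t]) s"
				using Us.arr_at_cross[OF a(2,1)] Us.arr_at_cross[OF a] pq by simp_all
			let ?N = "cur w Ts Y C g"
			let ?S = "\<lambda>xs. m1 (Ns ! k) i (B xs ! k) s" and ?T = "\<lambda>xs. m1 (Ns ! l) j (B xs ! l) t"
			let ?xp = "xs[p := Cod (Us ! p) s]" and ?xq = "xs[q := Cod (Us ! q) t]"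
			note as = arr_at_ys[OF a(1) l(1)] arr_at_ys[OF a(2) l(2)] arr_at_ys[OF x(1) l(2)] arr_at_ys[OF x(2) l(1)]
			note up = ys_update_Cod[OF a(1) l(1)] ys_update_Cod[OF a(2) l(2)]
			define al where "al = mx R p q xs s t"
			\<comment> \<open>A common description of \<open>al\<close> by its ends and components, so that
			  the comparison below need not distinguish whether \<open>p\<close> and \<open>q\<close> lie in
			  the same block.\<close>
			have A: "al : Cell Q &
					Src (ori w Q) al = Cmp Q (m1 ?N l (ys ?xp) (?T ?xp)) (m1 ?N k (ys xs) (?S xs)) &
					Tgt (ori w Q) al = Cmp Q (m1 ?N k (ys ?xq) (?S ?xq)) (m1 ?N l (ys xs) (?T xs)) &
					(\<forall>z\<in>Obj Y. mcmp al z = (if k = l then m2 g k (ys xs @ [z]) (mx (Ns ! k) i j (B xs ! k) s t)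
						 else mx g k l (ys xs @ [z]) (?S xs) (?T xs)))"
			proof (cases "k = l")
				\<comment> \<open>Here \<open>al\<close> is the image of a 2-cell of \<open>Ts ! k\<close> whose
				  ends are composites; \<open>m1_Cmp\<close> splits the ends of the image accordingly.\<close>
				case True
				note l' = l(2)[folded True]
				note c = same_cell_at[OF pq a l(1) l'] and ss = same_Src[OF pq a l(1) l'] same_Tgt[OF pq a l(1) l']
				have al: "al = m2 ?N k (ys xs) (mx (Ns ! k) i j (B xs ! k) s t)"
					unfolding al_def by (simp add: subst_sel(4)[OF pq a l] True)
				have k: "k < length Ts" using c by (simp add: cell_at_def)
				have d: "Dom (Ts ! k) (m1 (Ns ! k) j (B ?xp ! k) t) = Cod (Ts ! k) (?S xs)" "Dom (Ts ! k) (?S ?xq) = Cod (Ts ! k) (m1 (Ns ! k) j (B xs ! k) t)"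
					unfolding arr_at_Dom[OF as(3)[folded True]] arr_at_Dom[OF as(4)] up(1)[symmetric] up(2)[folded True, symmetric]
					using k by (simp_all only: nth_list_update_eq length_ys lengths)
				note mc = Nm.m1_Cmp[OF Nt.typed_fun[OF k] as(1), of "?T ?xp"] Nm.m1_Cmp[OF Nt.typed_fun[OF k] as(2)[folded True], of "?S ?xq"]
				show ?thesis
					unfolding al Nt.t2_Src[OF c] Nt.t2_Tgt[OF c] ss
					unfolding True[symmetric] mc(1)[unfolded True[symmetric], OF arr_at_arr[OF as(3)[folded True]] d(1)] mc(2)[unfolded True[symmetric], OF arr_at_arr[OF as(4)] d(2)]
						up(1) up(2)[folded True]
					using Nt.t2_cell[OF c] by (simp add: cur_sel c)
			next
				case False
				note kl = locate_diff[OF pq a(2) l False]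
				have al: "al = mx ?N k l (ys xs) (?S xs) (?T xs)"
					unfolding al_def by (simp add: subst_sel(4)[OF pq a l] False)
				have b: "B ?xp ! l = B xs ! l" "B ?xq ! k = B xs ! k"
					using blocks_other[OF a(1) l(1)] blocks_other[OF a(2) l(2)] False by auto
				show ?thesis
					unfolding al Nt.tx_Src[OF kl as(1,2)] Nt.tx_Tgt[OF kl as(1,2)] up b
					using Nt.tx_cell[OF kl as(1,2)] False as(1,2) kl by (simp add: cur_sel cur_cell_sel)
			qed
			note A1 = A[THEN conjunct1] and A2 = A[THEN conjunct2, THEN conjunct1]
				and A3 = A[THEN conjunct2, THEN conjunct2, THEN conjunct1] and A4 = A[THEN conjunct2, THEN conjunct2, THEN conjunct2, rule_format]
			have comp: "Dom Q (m1 ?N l (ys ?xp) (?T ?xp)) = Cod Q (m1 ?N k (ys xs) (?S xs))"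
				"Dom Q (m1 ?N k (ys ?xq) (?S ?xq)) = Cod Q (m1 ?N l (ys xs) (?T xs))"
				unfolding Nt.t1_Dom[OF as(3)] Nt.t1_Dom[OF as(4)] Nt.t1_Cod[OF as(1)] Nt.t1_Cod[OF as(2)] up by (rule refl)+
			\<comment> \<open>\<open>Wh\<close> preserves composites, so it takes the ends of
			  \<open>al\<close> to the composites of the whiskered transformations.\<close>
			have e: "Src (ori w Q') (F2 Wh al) = trans_comp Y' C' w (cur_trans Us Y' E q ?xp t) (cur_trans Us Y' E p xs s)"
				"Tgt (ori w Q') (F2 Wh al) = trans_comp Y' C' w (cur_trans Us Y' E p ?xq s) (cur_trans Us Y' E q xs t)"
				unfolding SW'(1)[OF A1] SW'(2)[OF A1] A2 A3
					W.F1_Cmp[OF Nt.t1_arr[OF as(1)] Nt.t1_arr[OF as(3)] comp(1)] W.F1_Cmp[OF Nt.t1_arr[OF as(2)] Nt.t1_arr[OF as(4)] comp(2)]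
					W1[OF a(1) l(1)] W1[OF a(2) l(2)] W1[OF x(1) l(2)] W1[OF x(2) l(1)] by simp_all
			have R: "mx (post Us Wh R) p q xs s t = wh_modif Y' G F al"
				using whisk_sel(3)[OF A1, of Y' G F] by (simp add: post_sel(4)[OF pq a] al_def)
			have Lc: "mx (cur w Us Y' C' E) p q xs s t = cur_cell w Us Y' C' E p q xs s t" by (rule cur_sel(4)[OF pq a])
			note e' = oe[OF e, unfolded whisk_sel(3)[OF A1]]
			show ?thesis
				unfolding R Lc
			proof (rule B.modif_eqI)
				show "msrc (cur_cell w Us Y' C' E p q xs s t) = msrc (wh_modif Y' G F al)"
					"mtgt (cur_cell w Us Y' C' E p q xs s t) = mtgt (wh_modif Y' G F al)"
					unfolding e'[THEN conjunct1] e'[THEN conjunct2] by (simp_all add: cur_cell_def Let_def)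
				fix y assume y: "y : Obj Y'"
				have "arr_at (Us @ [Y']) p (xs @ [y]) s" "arr_at (Us @ [Y']) q (xs @ [y]) t" using a y p by (simp_all add: arr_at_snoc)
				then have "mx E p q (xs @ [y]) s t = F2 G (mx L p q (xs @ [y]) s t)" by (rule post_sel(4)[OF pq])
				then show "mcmp (cur_cell w Us Y' C' E p q xs s t) y = mcmp (wh_modif Y' G F al) y"
					using y A4[of "F0 F y"] Lx[OF pq a y l] by (simp add: cur_cell_sel(3))
			qed (simp_all add: cur_cell_sel(4))
		qed
	qed simp_all
qed

end

section \<open>Currying and uncurrying of models\<close>

section \<open>Multimodels\<close>

lemma ffunctor_empty:
	assumes S: "fcategory S" "Obj S = {}" and "F0 F : extensional {}" "F1 F : extensional {}" "F2 F : extensional {}"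
	shows "ffunctor S C F"
proof -
	interpret S: twocat S by unfold_locales (rule fcategory_two_category[OF S(1)])
	have "Arr S = {}" "Cell S = {}" using S.Dom_ob S.Src_arr S(2) by blast+
	moreover have "Tight S = {}" using Tight_arr[OF S(1)] calculation by blast
	ultimately show ?thesis using assms
		by (auto simp: ffunctor_def is_functor_def arrow_cat_def vertical_cat_def horizontal_cat_def extensional_def)
qed

text \<open>The apex of a cone is an object.\<close>

lemma cones_empty: "small_sketch small S ==> Obj (scat S) = {} ==> cones S = {}"
	by (fastforce simp: small_sketch_def weighted_cone_def Let_def)

lemma slice_last: "slice (Ss @ [Y]) M (length Ss) (xs @ [y]) = cur_fun Ss Y M xs" if "length xs = length Ss"
	using that by (simp add: slice_def cur_fun_def nth_append flip: that)

lemma sketches_fcats: "(!!X. X : set Xs ==> small_sketch small X) ==> fcats (map scat Xs)"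
	using small_sketch_fcategory[OF _] by (metis fcats.intro length_map nth_map nth_mem)

lemma scat_Mod [simp]: "scat (Mod_sketch small v w Y Z) = Mod_cat v w Y Z"
	by (simp add: Mod_sketch_def)

locale cur_models =
	fixes small :: "'u set => bool" and v w :: weakness and Xs :: "('u, 'o, 'a, 't) sketch list" and Y :: "('u, 'o, 'a, 't) sketch"
		and Z :: "('u, 'p, 'b, 's) sketch"
	assumes vw: "v \<preceq> w" and Xs_fcat: "X : set Xs ==> fcategory (scat X)" and Y_fcat: "fcategory (scat Y)"
		and Xs_cones: "X : set Xs ==> c : cones X ==> weighted_cone small (scat X) c"
		and Y_cones: "c : cones Y ==> weighted_cone small (scat Y) c"
		and Z_fcat: "fcategory (scat Z)"
begin

abbreviation Ss where "Ss \<equiv> map scat Xs"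
abbreviation cr where "cr \<equiv> cur w Ss (scat Y) (scat Z)"
abbreviation MM where "MM \<equiv> Mod_sketch small v w Y Z"

sublocale cur_setup Ss "scat Y" "scat Z" v w "{M. model Y Z M}"
	by unfold_locales (use Xs_fcat Y_fcat Z_fcat vw in auto)

lemma Q_eq: "Q = Mod_cat v w Y Z" by (simp add: Mod_cat_eq)

lemma fcategory_MM: "fcategory (Mod_cat v w Y Z)"
	by (rule fcategory_Mod[OF Y_fcat Z_fcat vw])

text \<open>Specified cones of the hom sketch are detected by evaluations. Through this identity the
  model condition in an earlier variable is therefore the same for \<open>M\<close> at all
  \<open>xs @ [y]\<close> as for its currying at \<open>xs\<close>.\<close>

lemma evaluation_slice:
	assumes i: "i < length Xs" and xs: "xs : tuples Ss" and y: "y : Obj (scat Y)" and c: "c : cones (Xs ! i)"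
		and F: "ffunctor (scat (Xs ! i)) (Mod_cat v w Y Z) (slice Ss (cr M) i xs)"
	shows "map_cone (evaluation (Mod_cat v w Y Z) y) (map_cone (slice Ss (cr M) i xs) c) =
		map_cone (slice (Ss @ [scat Y]) M i (xs @ [y])) c"
proof -
	let ?X = "scat (Xs ! i)"
	have Xi: "Xs ! i : set Xs" using i by simp
	interpret c: cone_map small ?X c "Mod_cat v w Y Z" "slice Ss (cr M) i xs"
		by unfold_locales (use Xs_fcat[OF Xi] Xs_cones[OF Xi c] fcategory_two_category fcategory_MM F in blast)+
	have l: "length xs = length Xs" using tuples_length[OF xs] by simp
	show ?thesis
		unfolding c.map_cone_comp[OF F]
	proof (rule c.map_cone_cong)
		fix x assume x: "x : Obj ?X"
		have "xs[i := x] : tuples Ss" using tuples_update[OF xs] x i by simp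
		then show "F0 (ffun_comp ?X (evaluation (Mod_cat v w Y Z) y) (slice Ss (cr M) i xs)) x =
				F0 (slice (Ss @ [scat Y]) M i (xs @ [y])) x"
			using c.F.F0_ob[OF x] x y i l by (simp add: slice_def nth_append cur_sel list_update_append)
	next
		fix s assume s: "s : Arr ?X"
		have "arr_at Ss i (xs[i := Dom ?X s]) s" using tuples_update[OF xs] s i l by (simp add: arr_at_def)
		then show "F1 (ffun_comp ?X (evaluation (Mod_cat v w Y Z) y) (slice Ss (cr M) i xs)) s =
				F1 (slice (Ss @ [scat Y]) M i (xs @ [y])) s"
			using c.F.F1_arr[OF s] s y i l by (simp add: slice_def nth_append cur_sel list_update_append)
	next
		fix s assume s: "s : Cell ?X"
		have "cell_at Ss i (xs[i := Dom ?X (Src ?X s)]) s" using tuples_update[OF xs] s i l by (simp add: cell_at_def)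
		then show "F2 (ffun_comp ?X (evaluation (Mod_cat v w Y Z) y) (slice Ss (cr M) i xs)) s =
				F2 (slice (Ss @ [scat Y]) M i (xs @ [y])) s"
			using c.F.F2_cell[OF s] s y i l by (simp add: slice_def nth_append cur_sel list_update_append)
	qed
qed

lemma cur_fun_model:
	assumes M: "multimodel v w (Xs @ [Y]) Z M" and xs: "xs : tuples Ss"
	shows "model Y Z (cur_fun Ss (scat Y) M xs)"
proof (cases "Obj (scat Y) = {}")
	\<comment> \<open>The hypothesis concerns tuples \<open>xs @ [y]\<close>, of which there are none
	  now. But then \<open>Y\<close> has no cones either, and being a model is being a functor.\<close>
	case True
	have e: "Arr (scat Y) = {}" "Cell (scat Y) = {}" using F.S.Dom_ob F.S.Src_arr True by blast+
	have "cones Y = {}" using Y_cones True by (fastforce simp: weighted_cone_def Let_def)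
	moreover have "ffunctor (scat Y) (scat Z) (cur_fun Ss (scat Y) M xs)"
		by (rule ffunctor_empty[OF Y_fcat True]) (simp_all add: cur_fun_def True e restrict_def)
	ultimately show ?thesis by (simp add: model_def)
next
	case False
	then obtain y where y: "y : Obj (scat Y)" by blast
	have t: "xs @ [y] : tuples (Ss @ [scat Y])" using xs y by (simp add: tuples_snoc)
	have "\<forall>i<length (Xs @ [Y]). \<forall>zs\<in>tuples (map scat (Xs @ [Y])). model ((Xs @ [Y]) ! i) Z (slice (map scat (Xs @ [Y])) M i zs)"
		by (rule M[unfolded multimodel_def, THEN conjunct2])
	from this[rule_format, of "length Xs" "xs @ [y]"] t
	show ?thesis using slice_last[of xs Ss "scat Y" M y] tuples_length[OF xs] by simp
qed

lemma cur_multimodel: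
	assumes M: "multimodel v w (Xs @ [Y]) Z M"
	shows "multimodel v w Xs MM (cr M)"
proof -
	have m: "multifunctor v w (Ss @ [scat Y]) (scat Z) M" using M by (simp add: multimodel_def)
	have n: "multifunctor v w Ss (Mod_cat v w Y Z) (cr M)"
		using cur_multifunctor[OF m] cur_fun_model[OF M] by (simp add: Q_eq)
	have ms: "\<forall>i<length (Xs @ [Y]). \<forall>zs\<in>tuples (map scat (Xs @ [Y])). model ((Xs @ [Y]) ! i) Z (slice (map scat (Xs @ [Y])) M i zs)"
		by (rule M[unfolded multimodel_def, THEN conjunct2])
	have "model (Xs ! i) MM (slice Ss (cr M) i xs)" if i: "i < length Xs" and xs: "xs : tuples Ss" for i xs
	proof -
		have F: "ffunctor (scat (Xs ! i)) (Mod_cat v w Y Z) (slice Ss (cr M) i xs)"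
			using n[unfolded multifunctor_def] i xs by simp
		have Xi: "Xs ! i : set Xs" using i by simp
		have "map_cone (slice Ss (cr M) i xs) c : cones MM" if c: "c : cones (Xs ! i)" for c
		proof -
			interpret c: cone_map small "scat (Xs ! i)" c "Mod_cat v w Y Z" "slice Ss (cr M) i xs"
				by unfold_locales (use Xs_fcat[OF Xi] Xs_cones[OF Xi c] fcategory_two_category fcategory_MM F in blast)+
			have "map_cone (evaluation (Mod_cat v w Y Z) y) (map_cone (slice Ss (cr M) i xs) c) : cones Z"
				if y: "y : Obj (scat Y)" for y
				unfolding evaluation_slice[OF i xs y c F]
				using ms[rule_format, of i "xs @ [y]"] i xs y c by (simp add: tuples_snoc nth_append model_def)
			then show ?thesis using c.weighted_cone_map by (simp add: Mod_sketch_def)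
		qed
		then show ?thesis using F by (simp add: model_def)
	qed
	then show ?thesis using n by (simp add: multimodel_def)
qed

lemma uncur_multimodel:
	assumes N: "multimodel v w Xs MM N"
	shows "multimodel v w (Xs @ [Y]) Z (uncur Ss (scat Y) N)"
		and cur_uncur_model: "cr (uncur Ss (scat Y) N) = N"
proof -
	have n: "multifunctor v w Ss Q N" using N by (simp add: multimodel_def Q_eq)
	let ?M = "uncur Ss (scat Y) N"
	show cu: "cr ?M = N" by (rule cur_uncur[OF n])
	have "model ((Xs @ [Y]) ! i) Z (slice (Ss @ [scat Y]) ?M i zs)"
		if i: "i < Suc (length Xs)" and zs: "zs : tuples (Ss @ [scat Y])" for i zs
	proof -
		obtain xs y where z: "zs = xs @ [y]" "xs : tuples Ss" "y : Obj (scat Y)"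
			using zs by (rule tuples_snocE)
		have l: "length xs = length Xs" using tuples_length[OF z(2)] by simp
		show ?thesis
		proof (cases "i < length Xs")
			case True
			have F: "model (Xs ! i) MM (slice Ss N i xs)" using N True z(2) by (simp add: multimodel_def)
			then have F': "ffunctor (scat (Xs ! i)) (Mod_cat v w Y Z) (slice Ss (cr ?M) i xs)" by (simp add: model_def cu)
			have "map_cone (slice (Ss @ [scat Y]) ?M i zs) c : cones Z" if c: "c : cones (Xs ! i)" for c
				unfolding z(1) evaluation_slice[OF True z(2,3) c F', symmetric]
				using F c z(3) by (simp add: model_def cu Mod_sketch_def)
			moreover have "ffunctor ((Ss @ [scat Y]) ! i) (scat Z) (slice (Ss @ [scat Y]) ?M i zs)"
				using uncur_multifunctor[OF n, unfolded multifunctor_def, THEN conjunct2, THEN conjunct2, THEN conjunct1, rule_format, OF _ zs]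
					True by simp
			ultimately show ?thesis using True by (simp add: model_def nth_append)
		next
			case False
			then have i: "i = length Ss" using that by simp
			have "m0 N xs : Obj Q" using n z(2) by (simp add: multifunctor_def)
			then have "model Y Z (m0 N xs)" by (simp add: full_sub_sets)
			moreover have "m0 N xs = slice (Ss @ [scat Y]) ?M i zs"
				using arg_cong[OF cu, of "\<lambda>N. m0 N xs"] z l slice_last[of xs Ss "scat Y" ?M y] by (simp add: i cur_sel)
			ultimately show ?thesis by (simp add: i nth_append)
		qed
	qed
	then show "multimodel v w (Xs @ [Y]) Z ?M" using uncur_multifunctor[OF n] by (simp add: multimodel_def)
qed

end

lemma multimodel_post:
	assumes vw: "v \<preceq> w" and Xs: "!!X. X : set Xs ==> small_sketch small X"
		and A: "fcategory (scat A)" and B: "fcategory (scat B)" and N: "multimodel v w Xs A N" and G: "model A B G"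
	shows "multimodel v w Xs B (post (map scat Xs) G N)"
proof -
	note AB = fcategory_two_category[OF A] fcategory_two_category[OF B]
	interpret fcats "map scat Xs" by (rule sketches_fcats) (rule Xs)
	interpret N: mf_setup "map scat Xs" "scat A" N by unfold_locales (rule A)
	have n: "N.nmf v w" using N N.multifunctor_iff_nmf[OF vw] by (simp add: multimodel_def)
	interpret N: mf_typed "map scat Xs" "scat A" N v w by unfold_locales (use n in \<open>auto simp: N.nmf_def\<close>)
	interpret post_setup "map scat Xs" "scat A" N v w "scat B" G
		by unfold_locales (use A B G vw n in \<open>auto simp: fcategory_two_category model_def\<close>)
	have "model (Xs ! i) B (slice (map scat Xs) (post (map scat Xs) G N) i xs)"
		if i: "i < length Xs" and xs: "xs : tuples (map scat Xs)" for i xs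
	proof -
		have "model (Xs ! i) A (slice (map scat Xs) N i xs)" using N i xs by (simp add: multimodel_def)
		from model_comp[OF Xs[OF nth_mem[OF i]] AB this G]
		show ?thesis using slice_post[OF xs, of i G N] i by simp
	qed
	then show ?thesis using post_multifunctor by (simp add: multimodel_def)
qed

lemma slice_unary:
	assumes S: "fcategory S" and F: "ffunctor S C F" shows "slice [S] (unary S F) 0 [x] = F"
proof -
	interpret S: twocat S by unfold_locales (rule fcategory_two_category[OF S])
	have F': "F0 F : extensional (Obj S)" "F1 F : extensional (Arr S)" "F2 F : extensional (Cell S)"
		using F unfolding ffunctor_def is_functor_def arrow_cat_def vertical_cat_def by (auto simp: PiE_iff)
	show ?thesis by (rule ffun.equality) (auto simp: slice_def unary_sel intro!: restrict_eqI F')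
qed

lemma unary_multimodel:
	assumes "fcategory (scat S)" "model S C F"
	shows "multimodel v w [S] C (unary (scat S) F)"
	using assms unary_multifunctor[of "scat S" "scat C" F] slice_unary[of "scat S" "scat C" F]
	by (auto simp: multimodel_def model_def tuples_single)

lemma unary_model_cases:
	assumes S: "small_sketch small S" and f: "multimodel v w [S] C f"
	obtains F where "model S C F" "f = unary (scat S) F"
proof -
	have f': "multifunctor v w [scat S] (scat C) f" using f by (simp add: multimodel_def)
	obtain F where F: "ffunctor (scat S) (scat C) F" "f = unary (scat S) F"
		by (rule unary_cases[OF small_sketch_fcategory[OF S] f'])
	have "model S C F"
	proof (cases "Obj (scat S) = {}")
		case True
		then show ?thesis using cones_empty[OF S] F(1) by (simp add: model_def)
	next
		case False
		then obtain x where "x : Obj (scat S)" by blast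
		then have "[x] : tuples [scat S]" by (simp add: tuples_single)
		then show ?thesis using f slice_unary[OF small_sketch_fcategory[OF S] F(1), of x] F(2)
			by (fastforce simp: multimodel_def)
	qed
	then show thesis using F(2) by (rule that)
qed

lemma unary_at:
	"xs : tuples [S] ==> m0 (unary S F) xs = F0 F (hd xs)"
	"arr_at [S] i xs s ==> m1 (unary S F) i xs s = F1 F s"
	"cell_at [S] i xs al ==> m2 (unary S F) i xs al = F2 F al"
	by (simp_all add: unary_def mfun_restrict_sel)

lemma subst_unary:
	assumes Ss: "fcats Ss" and B: "fcategory B" and vw: "v \<preceq> w" and N: "multifunctor v w Ss B N"
	shows "mfun_subst [Ss] (unary B G) [N] = post Ss G N"
proof -
	interpret s: substitution "[Ss]" "[B]" "[N]" v w by unfold_locales (use assms fcats.fcat[OF Ss] in auto)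
	have l: "locate (map length [Ss]) p = (0, p)" if "p < length Ss" for p using that by simp
	have o: "block_obs [Ss] [N] xs = [m0 N xs]" "blocks (map length [Ss]) xs = [xs]" if "xs : tuples Ss" for xs
		using tuples_length[OF that] by (simp_all add: block_obs_def)
	have c: "concat [Ss] = Ss" by simp
	have r: "mfun_restrict Ss (mfun_subst [Ss] (unary B G) [N]) = mfun_subst [Ss] (unary B G) [N]"
		using mfun_restrict_subst[of "[Ss]"] by simp
	show ?thesis
	proof (rule mfun_eqI[OF r mfun_restrict_post])
		show "m0 (mfun_subst [Ss] (unary B G) [N]) xs = m0 (post Ss G N) xs" if xs: "xs : tuples Ss" for xs
			using subst_sel(1)[of xs "[Ss]" "unary B G" "[N]", unfolded c, OF xs] s.ys_tuples[of xs, unfolded c, OF xs] xs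
			by (simp add: o unary_at post_sel)
		show "m1 (mfun_subst [Ss] (unary B G) [N]) i xs s = m1 (post Ss G N) i xs s" if a: "arr_at Ss i xs s" for i xs s
		proof -
			note i = arr_at_less[OF a] arr_at_tuples[OF a]
			show ?thesis
				using subst_sel(2)[of "[Ss]" i xs s 0 i "unary B G" "[N]", unfolded c, OF a l[OF i(1)]]
					s.arr_at_ys[of i xs s 0 i, unfolded c, OF a l[OF i(1)]] a
				by (simp add: o i tuples_length[OF i(2)] unary_at post_sel)
		qed
		show "m2 (mfun_subst [Ss] (unary B G) [N]) i xs s = m2 (post Ss G N) i xs s" if a: "cell_at Ss i xs s" for i xs s
		proof -
			have i: "i < length Ss" "xs : tuples Ss" using a by (simp_all add: cell_at_def)
			show ?thesis
				using subst_sel(3)[of "[Ss]" i xs s 0 i "unary B G" "[N]", unfolded c, OF a l[OF i(1)]]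
					s.cell_at_ys[of i xs s 0 i, unfolded c, OF a l[OF i(1)]] a
				by (simp add: o i tuples_length[OF i(2)] unary_at post_sel)
		qed
		show "mx (mfun_subst [Ss] (unary B G) [N]) i j xs s t = mx (post Ss G N) i j xs s t"
			if ij: "i < j" and a: "arr_at Ss i xs s" "arr_at Ss j xs t" for i j xs s t
		proof -
			note i = arr_at_less[OF a(1)] arr_at_tuples[OF a(1)] arr_at_less[OF a(2)]
			show ?thesis
				using subst_sel(4)[of i j "[Ss]" xs s t 0 i 0 j "unary B G" "[N]", unfolded c, OF ij a l[OF i(1)] l[OF i(3)]]
					s.same_cell_at[of i j xs s t 0 i j, unfolded c, OF ij a l[OF i(1)] l[OF i(3)]] ij a
				by (simp add: o i tuples_length[OF i(2)] unary_at post_sel)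
		qed
	qed
qed

lemma post_comp:
	assumes Ss: "fcats Ss" and B: "fcategory B" and vw: "v \<preceq> w" and N: "multifunctor v w Ss B N"
	shows "post Ss G' (post Ss G N) = post Ss (ffun_comp B G' G) N"
proof -
	interpret Ss: fcats Ss by (rule Ss)
	interpret N: mf_setup Ss B N by unfold_locales (rule B)
	have n: "N.nmf v w" using N N.multifunctor_iff_nmf[OF vw] by simp
	interpret N: mf_typed Ss B N v w by unfold_locales (use n in \<open>auto simp: N.nmf_def\<close>)
	have o: "m0 N zs : Obj B" if "zs : tuples Ss" for zs using n that by (simp add: N.nmf_def)
	show ?thesis by (rule mfun_eqI[of Ss]) (simp_all add: post_sel o)
qed

text \<open>Associativity of substitution in the case of a unary outermost multimorphism.\<close>

lemma (in substitution) post_subst: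
	assumes "mfun_restrict Ts M = M"
	shows "post (concat Sss) G (mfun_subst Sss M Ns) = mfun_subst Sss (post Ts G M) Ns"
proof (rule mfun_eqI[of "concat Sss"])
	show "m0 (post (concat Sss) G (mfun_subst Sss M Ns)) xs = m0 (mfun_subst Sss (post Ts G M) Ns) xs"
		if "xs : tuples (concat Sss)" for xs
		using that ys_tuples[OF that] by (simp add: post_sel subst_sel)
	show "m1 (post (concat Sss) G (mfun_subst Sss M Ns)) p xs s = m1 (mfun_subst Sss (post Ts G M) Ns) p xs s"
		if a: "arr_at (concat Sss) p xs s" for p xs s
	proof -
		obtain k i where l: "locate ns p = (k, i)" by fastforce
		show ?thesis by (simp add: post_sel a subst_sel(2)[OF a l] arr_at_ys[OF a l])
	qed
	show "m2 (post (concat Sss) G (mfun_subst Sss M Ns)) p xs s = m2 (mfun_subst Sss (post Ts G M) Ns) p xs s"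
		if a: "cell_at (concat Sss) p xs s" for p xs s
	proof -
		obtain k i where l: "locate ns p = (k, i)" by fastforce
		show ?thesis by (simp add: post_sel a subst_sel(3)[OF a l] cell_at_ys[OF a l])
	qed
	show "mx (post (concat Sss) G (mfun_subst Sss M Ns)) p q xs s t = mx (mfun_subst Sss (post Ts G M) Ns) p q xs s t"
		if pq: "p < q" and a: "arr_at (concat Sss) p xs s" "arr_at (concat Sss) q xs t" for p q xs s t
	proof -
		obtain k i l j where l: "locate ns p = (k, i)" "locate ns q = (l, j)" by fastforce
		show ?thesis
		proof (cases "k = l")
			case True
			show ?thesis
				using same_cell_at[OF pq a l(1) l(2)[folded True]]
				by (simp add: post_sel pq a subst_sel(4)[OF pq a l] True)
		next
			case False
			then show ?thesis
				using locate_diff[OF pq a(2) l False] arr_at_ys[OF a(1) l(1)] arr_at_ys[OF a(2) l(2)]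
				by (simp add: post_sel pq a subst_sel(4)[OF pq a l])
		qed
	qed
qed simp_all

section \<open>The right hom bijection and its naturality\<close>

section \<open>Right closedness\<close>

lemma whisk_id:
	assumes "fcategory Y" "fcategory C" "v \<preceq> w"
	shows "whisk (full_sub (Fun_cat v w Y C) P) Y (ffun_id C) (ffun_id Y) = ffun_id (full_sub (Fun_cat v w Y C) P)"
proof -
	interpret A: funcat Y C v w by unfold_locales (use assms in auto)
	let ?Q = "full_sub (Fun_cat v w Y C) P"
	have o: "wh_fun Y (ffun_id C) (ffun_id Y) M = M" if "ffunctor Y C M" for M
	proof -
		interpret M: twofun Y C M by unfold_locales (rule that)
		show ?thesis unfolding wh_fun_def
			by (rule ffun.equality) (auto intro!: restrict_eqI M.F0_ext M.F1_ext M.F2_ext)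
	qed
	have a: "wh_trans Y (ffun_id C) (ffun_id Y) ph = ph" if l: "ph : loose_trans Y C v w" for ph
		unfolding wh_trans_def o[OF A.loose_src[OF l]] o[OF A.loose_tgt[OF l]]
		by (rule wtrans.equality)
			(auto intro!: restrict_eqI A.loose_tob_ext[OF l] A.loose_tcell_ext[OF l] simp: A.loose_tob[OF l] A.loose_cell[OF l])
	have c: "wh_modif Y (ffun_id C) (ffun_id Y) mu = mu" if m: "mu : modifications Y C v w" for mu
		unfolding wh_modif_def a[OF A.modif_src[OF m]] a[OF A.modif_tgt[OF m]]
		by (rule modif.equality) (auto intro!: restrict_eqI A.modif_ext[OF m] simp: A.modif_cell[OF m])
	have m: "M : Obj ?Q ==> ffunctor Y C M" "ph : Arr ?Q ==> ph : loose_trans Y C v w" "mu : Cell ?Q ==> mu : modifications Y C v w"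
		for M ph mu by (simp_all add: full_sub_sets)
	show ?thesis
		unfolding whisk_def ffun_id_def[of ?Q] by (intro ffun.equality) (auto intro!: restrict_ext o a c m)
qed

lemma FSK_sel [simp]:
	"mc_ob (FSK small v w) = {S. small_sketch small S}" "mc_hom (FSK small v w) Ss C = {M. multimodel v w Ss C M}"
	"mc_id (FSK small v w) S = mfun_id (scat S)" "mc_comp (FSK small v w) Sss Ts C M Ns = mfun_subst (map (map scat) Sss) M Ns"
	by (simp_all add: FSK_def)

text \<open>Cones are extensional, so restricting their diagram and legs to the domains, which is
  all that the identity does, gives them back.\<close>

lemma model_id: "fcategory (scat S) ==> (!!c. c : cones S ==> weighted_cone small (scat S) c) ==> model S S (ffun_id (scat S))"
proof -
	assume S: "fcategory (scat S)" and c: "!!c. c : cones S ==> weighted_cone small (scat S) c"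
	interpret S: twocat "scat S" by unfold_locales (rule fcategory_two_category[OF S])
	have "map_cone (ffun_id (scat S)) k = k" if k: "k : cones S" for k
	proof -
		interpret cone small "scat S" k by unfold_locales (use S c[OF k] in auto)
		have 1: "ffun_comp J (ffun_id (scat S)) D = D"
			unfolding ffun_comp_def by (rule ffun.equality) (auto intro!: restrict_eqI D.F0_ext D.F1_ext D.F2_ext)
		have 2: "cfun_comp (lam (F0 W j)) \<lparr>f_ob = F1 (ffun_id (scat S)), f_ar = F2 (ffun_id (scat S))\<rparr> (leg k j) = leg k j" if j: "j : Obj J" for j
		proof -
			have e: "f_ob (leg k j) : extensional (c_ob (lam (F0 W j)))" "f_ar (leg k j) : extensional (c_ar (lam (F0 W j)))"
				using leg[OF j] by (auto simp: is_functor_def PiE_iff)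
			show ?thesis unfolding cfun_comp_def
				by (rule cfun.equality) (auto intro!: restrict_eqI e simp: leg_ob[OF j] leg_ar[OF j])
		qed
		show ?thesis
			unfolding map_cone_def 1 by (rule wcone.equality) (auto intro!: restrict_eqI leg_ext simp: 2)
	qed
	then show ?thesis using S.ffunctor_id Tight_arr[OF S] by (simp add: model_def)
qed

lemma small_sketch_id: "small_sketch small S ==> model S S (ffun_id (scat S))"
	by (rule model_id) (auto simp: small_sketch_def small_fcat_def)

lemma FSK_substitution:
	assumes vw: "v \<preceq> w" and fs: "mc_family (FSK small v w) Vss Xs fs" and Xs: "set Xs \<subseteq> {S. small_sketch small S}"
	shows "substitution (map (map scat) Vss) (map scat Xs) fs v w"
proof (unfold_locales)
	fix k assume "k < length (map (map scat) Vss)"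
	then have k: "k < length Xs" "k < length Vss" using fs by (simp_all add: mc_family_def)
	have V: "set (Vss ! k) \<subseteq> {S. small_sketch small S}" and f: "multimodel v w (Vss ! k) (Xs ! k) (fs ! k)"
		using fs k by (simp_all add: mc_family_def)
	show "fcategory (map scat Xs ! k)" using k small_sketch_fcategory[of small "Xs ! k"] subsetD[OF Xs nth_mem[OF k(1)]] by simp
	show "multifunctor v w (map (map scat) Vss ! k) (map scat Xs ! k) (fs ! k)" using f k by (simp add: multimodel_def)
	fix i assume i: "i < length (map (map scat) Vss ! k)"
	then show "fcategory (map (map scat) Vss ! k ! i)"
		using k small_sketch_fcategory[of small "Vss ! k ! i"] subsetD[OF V nth_mem[of i "Vss ! k"]] by simp
qed (use fs vw in \<open>auto simp: mc_family_def\<close>)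

text \<open>\<open>H\<close> is a copy of the hom sketch with carriers in \<open>'u\<close>. Fixing
  the two halves \<open>F\<close> and \<open>G\<close> of an isomorphism makes the hom bijection
  explicit: currying followed by \<open>G\<close>, with inverse \<open>F\<close> followed by
  uncurrying.\<close>

locale mod_hom =
	fixes small :: "'u set => bool" and v w :: weakness and Y Z H :: "'u sk" and F G
	assumes vw: "v \<preceq> w" and Y: "small_sketch small Y" and Z: "small_sketch small Z" and H: "small_sketch small H"
		and F: "model H (Mod_sketch small v w Y Z) F" and G: "model (Mod_sketch small v w Y Z) H G"
		and GF: "ffun_comp (scat H) G F = ffun_id (scat H)"
		and FG: "ffun_comp (Mod_cat v w Y Z) F G = ffun_id (Mod_cat v w Y Z)"
begin

lemma cur_models: "set Xs \<subseteq> {S. small_sketch small S} ==> cur_models small v w Xs Y Z"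
	using Y Z vw by unfold_locales (auto simp: small_sketch_def small_fcat_def)

definition theta :: "'u sk list => ('u, 'u, 'u, 'u, 'u, 'u) mfun => ('u, 'u, 'u, 'u, 'u, 'u) mfun" where
	"theta Xs M = post (map scat Xs) G (cur w (map scat Xs) (scat Y) (scat Z) M)"

abbreviation untheta where
	"untheta Xs N \<equiv> uncur (map scat Xs) (scat Y) (post (map scat Xs) F N)"

lemmas fcat_H = small_sketch_fcategory[OF H]

lemma fcat_Mod: "fcategory (Mod_cat v w Y Z)"
	by (rule fcategory_Mod[OF small_sketch_fcategory[OF Y] small_sketch_fcategory[OF Z] vw])

lemma post_F_G:
	assumes Xs: "set Xs \<subseteq> {S. small_sketch small S}" and N: "multimodel v w Xs (Mod_sketch small v w Y Z) N"
	shows "post (map scat Xs) F (post (map scat Xs) G N) = N"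
proof -
	have f: "fcats (map scat Xs)" by (rule sketches_fcats) (use Xs in auto)
	have n: "multifunctor v w (map scat Xs) (Mod_cat v w Y Z) N" using N by (simp add: multimodel_def)
	show ?thesis unfolding post_comp[OF f fcat_Mod vw n] FG by (rule post_id[OF f fcat_Mod vw n])
qed

lemma post_G_F:
	assumes Xs: "set Xs \<subseteq> {S. small_sketch small S}" and N: "multimodel v w Xs H N"
	shows "post (map scat Xs) G (post (map scat Xs) F N) = N"
proof -
	have f: "fcats (map scat Xs)" by (rule sketches_fcats) (use Xs in auto)
	have n: "multifunctor v w (map scat Xs) (scat H) N" using N by (simp add: multimodel_def)
	show ?thesis unfolding post_comp[OF f fcat_H vw n] GF by (rule post_id[OF f fcat_H vw n])
qed

lemma theta_bij:
	assumes Xs: "set Xs \<subseteq> {S. small_sketch small S}"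
	shows "bij_betw (theta Xs) {M. multimodel v w (Xs @ [Y]) Z M} {N. multimodel v w Xs H N}"
proof -
	interpret c: cur_models small v w Xs Y Z by (rule cur_models[OF Xs])
	have X: "small_sketch small X" if "X : set Xs" for X using Xs that by auto
	have M: "fcategory (scat (Mod_sketch small v w Y Z))" using fcat_Mod by simp
	show ?thesis
	proof (rule bij_betw_byWitness[where f' = "untheta Xs"]; (intro ballI subsetI)?)
		fix M assume "M : {M. multimodel v w (Xs @ [Y]) Z M}"
		then have m: "multimodel v w (Xs @ [Y]) Z M" by simp
		have "mfun_restrict (map scat Xs @ [scat Y]) M = M" using m by (simp add: multimodel_def multifunctor_def)
		then show "untheta Xs (theta Xs M) = M"
			unfolding theta_def post_F_G[OF Xs c.cur_multimodel[OF m]] by (rule c.uncur_cur)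
	next
		fix N assume "N : {N. multimodel v w Xs H N}"
		then have n: "multimodel v w Xs H N" by simp
		have "cur w (map scat Xs) (scat Y) (scat Z) (untheta Xs N) = post (map scat Xs) F N"
			by (rule c.cur_uncur_model[OF multimodel_post[OF vw X fcat_H M n F]])
		then show "theta Xs (untheta Xs N) = N" using post_G_F[OF Xs n] by (simp only: theta_def)
	next
		fix N assume "N : theta Xs ` {M. multimodel v w (Xs @ [Y]) Z M}"
		then obtain M where m: "multimodel v w (Xs @ [Y]) Z M" "N = theta Xs M" by auto
		show "N : {N. multimodel v w Xs H N}"
			using multimodel_post[OF vw X M fcat_H c.cur_multimodel[OF m(1)] G] m(2) by (simp add: theta_def)
	next
		fix M assume "M : untheta Xs ` {N. multimodel v w Xs H N}"
		then obtain N where n: "multimodel v w Xs H N" "M = untheta Xs N" by auto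
		show "M : {M. multimodel v w (Xs @ [Y]) Z M}"
			using c.uncur_multimodel[OF multimodel_post[OF vw X fcat_H M n(1) F]] n(2) by simp
	qed
qed

text \<open>The identity on the last source is treated as a functor to whisker with, so that
  \<open>cur_post_subst\<close> applies; afterwards the identities are removed by
  \<open>whisk_id\<close> and \<open>subst_post_id\<close>.\<close>

lemma theta_subst:
	assumes Xs: "set Xs \<subseteq> {S. small_sketch small S}" and fs: "mc_family (FSK small v w) Vss Xs fs"
		and g: "multimodel v w (Xs @ [Y]) Z g"
	shows "theta (concat Vss) (mfun_subst (map (map scat) (Vss @ [[Y]])) g (fs @ [mfun_id (scat Y)])) =
		mfun_subst (map (map scat) Vss) (theta Xs g) fs"
proof -
	let ?V = "map (map scat) Vss" and ?T = "map scat Xs" and ?c = "cur w (map scat Xs) (scat Y) (scat Z)"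
	interpret c: cur_models small v w Xs Y Z by (rule cur_models[OF Xs])
	note y = small_sketch_fcategory[OF Y] and z = small_sketch_fcategory[OF Z]
	interpret s: substitution ?V ?T fs v w by (rule FSK_substitution[OF vw fs Xs])
	have fb: "fcategory (scat (Vss ! k ! i))" if "k < length Vss" "i < length (Vss ! k)" for k i
		using fcats.fcat[OF s.block_fcats, of k i] that by simp
	interpret s': substitution "?V @ [[scat Y]]" "?T @ [scat Y]" "fs @ [unary (scat Y) (ffun_id (scat Y))]" v w
		by unfold_locales
			(use s.lengths s.block_fcats s.Ts_fcat s.Ns_mf vw y unary_multifunctor[OF y] twocat.ffunctor_id[OF _ Tight_arr[OF y]] c.F.S.twocat_axioms
				in \<open>auto simp: nth_append less_Suc_eq fb\<close>)
	interpret wh: whiskering "scat Y" "scat Z" "scat Y" "scat Z" v w "ffun_id (scat Y)" "ffun_id (scat Z)" "{M. model Y Z M}" "{M. model Y Z M}"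
		by (rule whiskering_model[OF Y Y z z vw small_sketch_id[OF Y] small_sketch_id[OF Z]])
	have gm: "multifunctor v w (?T @ [scat Y]) (scat Z) g" using g by (simp add: multimodel_def)
	interpret cs: cur_subst ?V ?T fs v w "scat Y" "scat Z" "scat Y" "scat Z" "ffun_id (scat Y)" "ffun_id (scat Z)"
		 "{M. model Y Z M}" "{M. model Y Z M}" g
		by unfold_locales (use gm c.cur_fun_model[OF g] in auto)
	have co: "map scat (concat Vss) = concat ?V" by (simp add: map_concat)
	have cm: "multifunctor v w ?T (Mod_cat v w Y Z) (?c g)" using c.cur_multimodel[OF g] by (simp add: multimodel_def)
	have f': "fcats (?T @ [scat Y])" by (rule fcats.intro) (use y c.fcat in \<open>auto simp: nth_append less_Suc_eq\<close>)
	have E: "post (concat ?V @ [scat Y]) (ffun_id (scat Z)) cs.L = cs.L"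
		using s'.subst_post_id[OF z gm f'] by simp
	have "cur w (concat ?V) (scat Y) (scat Z) cs.L = post (concat ?V) (ffun_id (Mod_cat v w Y Z)) (mfun_subst ?V (?c g) fs)"
		using cs.cur_post_subst unfolding E whisk_id[OF y z vw] by (simp add: Mod_cat_eq)
	also have "\<dots> = mfun_subst ?V (?c g) fs"
		by (rule s.subst_post_id[OF fcat_Mod cm c.fcats_axioms])
	finally have "cur w (concat ?V) (scat Y) (scat Z) cs.L = mfun_subst ?V (?c g) fs" .
	moreover have "mfun_restrict ?T (?c g) = ?c g" by simp
	ultimately show ?thesis
		unfolding theta_def co by (simp add: mfun_id_unary s.post_subst)
qed

end

text \<open>The morphism \<open>h\<close> between the copies goes back to the Mod sketch by
  \<open>F\<close>, whiskers with \<open>ph\<close> and \<open>ps\<close>, and returns by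
  \<open>G'\<close>. Taking \<open>ps\<close> or \<open>ph\<close> to be an identity gives
  naturality in \<open>Y\<close> or in \<open>Z\<close>.\<close>

lemma theta_natural:
	assumes m: "mod_hom small v w Y Z H F G" and m': "mod_hom small v w Y' Z' H' F' G'"
		and f: "model Y' Y ph" and p: "model Z Z' ps"
	defines "h \<equiv> unary (scat H) (ffun_comp (scat H) (ffun_comp (Mod_cat v w Y Z) G' (whisk (Mod_cat v w Y Z) (scat Y') ps ph)) F)"
	shows "multimodel v w [H] H' h"
		and "set Xs \<subseteq> {S. small_sketch small S} ==> multimodel v w (Xs @ [Y]) Z g ==>
			mod_hom.theta w Y' Z' G' Xs (post (map scat Xs @ [scat Y']) ps
				 (mfun_subst (map (\<lambda>S. [S]) (map scat Xs) @ [[scat Y']]) g (map mfun_id (map scat Xs) @ [unary (scat Y') ph]))) =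
			mfun_subst [map scat Xs] h [mod_hom.theta w Y Z G Xs g]"
proof -
	interpret M: mod_hom small v w Y Z H F G by (rule m)
	interpret M': mod_hom small v w Y' Z' H' F' G' by (rule m')
	note y = small_sketch_fcategory[OF M.Y] and z = small_sketch_fcategory[OF M.Z]
		and y' = small_sketch_fcategory[OF M'.Y] and z' = small_sketch_fcategory[OF M'.Z]
	let ?K = "Mod_cat v w Y Z" and ?W = "whisk (Mod_cat v w Y Z) (scat Y') ps ph"
	note W = whisk_model[OF M.Y M'.Y z z' M.vw f p]
	have MM: "fcategory (scat (Mod_sketch small v w Y Z))" "fcategory (scat (Mod_sketch small v w Y' Z'))"
		using M.fcat_Mod M'.fcat_Mod by simp_all
	have GW: "model (Mod_sketch small v w Y Z) H' (ffun_comp ?K G' ?W)"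
		using model_compose[OF MM(1) _ fcategory_two_category[OF MM(2)] fcategory_two_category[OF M'.fcat_H] W M'.G, of small]
		by (simp add: Mod_sketch_def)
	have "model H H' (ffun_comp (scat H) (ffun_comp ?K G' ?W) F)"
		by (rule model_comp[OF M.H fcategory_two_category[OF MM(1)] fcategory_two_category[OF M'.fcat_H] M.F GW])
	then show "multimodel v w [H] H' h" unfolding h_def by (rule unary_multimodel[OF M.fcat_H])
	assume Xs: "set Xs \<subseteq> {S. small_sketch small S}" and g: "multimodel v w (Xs @ [Y]) Z g"
	interpret c: cur_models small v w Xs Y Z by (rule M.cur_models[OF Xs])
	let ?S = "map scat Xs" and ?c = "cur w (map scat Xs) (scat Y) (scat Z)"
	have X: "small_sketch small X" if "X : set Xs" for X using Xs that by auto
	interpret s: substitution "map (\<lambda>S. [S]) ?S" ?S "map mfun_id ?S" v w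
	proof unfold_locales
		fix k assume k: "k < length (map (\<lambda>S. [S]) ?S)"
		then have fk: "fcategory (?S ! k)" using c.fcat by simp
		then show "fcategory (?S ! k)" .
		interpret k: twocat "?S ! k" by unfold_locales (rule fcategory_two_category[OF fk])
		show "multifunctor v w (map (\<lambda>S. [S]) ?S ! k) (?S ! k) (map mfun_id ?S ! k)"
			using unary_multifunctor[OF fk k.ffunctor_id[OF Tight_arr[OF fk]]] k by (simp add: mfun_id_unary)
		fix i assume "i < length (map (\<lambda>S. [S]) ?S ! k)"
		then show "fcategory (map (\<lambda>S. [S]) ?S ! k ! i)" using k fk by simp
	qed (simp_all add: M.vw)
	interpret wh: whiskering "scat Y" "scat Z" "scat Y'" "scat Z'" v w ph ps "{M. model Y Z M}" "{M. model Y' Z' M}"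
		by (rule whiskering_model[OF M.Y M'.Y z z' M.vw f p])
	have gm: "multifunctor v w (?S @ [scat Y]) (scat Z) g" using g by (simp add: multimodel_def)
	interpret cs: cur_subst "map (\<lambda>S. [S]) ?S" ?S "map mfun_id ?S" v w "scat Y" "scat Z" "scat Y'" "scat Z'" ph ps
		 "{M. model Y Z M}" "{M. model Y' Z' M}" g
		by unfold_locales (use gm c.cur_fun_model[OF g] in auto)
	have co: "concat (map (\<lambda>S. [S]) ?S) = ?S" by (rule map_list_single)
	\<comment> \<open>The identities substituted in the first variables disappear by
	  \<open>subst_ids\<close>.\<close>
	have "cur w ?S (scat Y') (scat Z') (post (?S @ [scat Y']) ps cs.L) = post ?S ?W (?c g)"
		using cs.cur_post_subst unfolding co subst_ids[OF c.fcats_axioms mfun_restrict_cur] by (simp add: Mod_cat_eq)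
	then have 1: "M'.theta Xs (post (?S @ [scat Y']) ps cs.L) = post ?S G' (post ?S ?W (?c g))"
		by (simp add: M'.theta_def)
	note cm = c.cur_multimodel[OF g]
	have cf: "multifunctor v w ?S ?K (?c g)" using cm by (simp add: multimodel_def)
	have t: "multimodel v w Xs H (M.theta Xs g)"
		unfolding M.theta_def by (rule multimodel_post[OF M.vw X MM(1) M.fcat_H cm M.G])
	then have tf: "multifunctor v w ?S (scat H) (M.theta Xs g)" by (simp add: multimodel_def)
	have "mfun_subst [?S] h [M.theta Xs g] = post ?S (ffun_comp (scat H) (ffun_comp ?K G' ?W) F) (M.theta Xs g)"
		unfolding h_def by (rule subst_unary[OF c.fcats_axioms M.fcat_H M.vw tf])
	also have "\<dots> = post ?S (ffun_comp ?K G' ?W) (post ?S F (M.theta Xs g))"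
		by (rule post_comp[OF c.fcats_axioms M.fcat_H M.vw tf, symmetric])
	also have "post ?S F (M.theta Xs g) = ?c g" unfolding M.theta_def by (rule M.post_F_G[OF Xs cm])
	also have "post ?S (ffun_comp ?K G' ?W) (?c g) = post ?S G' (post ?S ?W (?c g))"
		by (rule post_comp[OF c.fcats_axioms M.fcat_Mod M.vw cf, symmetric])
	finally show "M'.theta Xs (post (?S @ [scat Y']) ps cs.L) = mfun_subst [?S] h [M.theta Xs g]" using 1 by simp
qed

theorem right_closed_Mod:
	fixes small :: "'u set => bool"
	assumes vw: "v \<preceq> w" and H: "Mod_homs small v w D R"
	shows "right_closed_on (FSK small v w) D R"
proof -
	have "\<forall>p\<in>D. \<exists>FG. mod_hom small v w (fst p) (snd p) (R (fst p) (snd p)) (fst FG) (snd FG)"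
	proof
		fix p assume "p : D"
		then obtain F G where "small_sketch small (fst p)" "small_sketch small (snd p)" "small_sketch small (R (fst p) (snd p))"
			"model (R (fst p) (snd p)) (Mod_sketch small v w (fst p) (snd p)) F"
			"model (Mod_sketch small v w (fst p) (snd p)) (R (fst p) (snd p)) G"
			"ffun_comp (scat (R (fst p) (snd p))) G F = ffun_id (scat (R (fst p) (snd p)))"
			"ffun_comp (Mod_cat v w (fst p) (snd p)) F G = ffun_id (Mod_cat v w (fst p) (snd p))"
			using H unfolding Mod_homs_def sketch_iso_def by fastforce
		then have "mod_hom small v w (fst p) (snd p) (R (fst p) (snd p)) F G" by unfold_locales (rule vw)
		then show "\<exists>FG. mod_hom small v w (fst p) (snd p) (R (fst p) (snd p)) (fst FG) (snd FG)"
			by (intro exI[of _ "(F, G)"]) simp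
	qed
	\<comment> \<open>\<open>Mod_homs\<close> only asserts that isomorphisms exist. One is chosen for
	  each pair, and the bijection depends on the choice.\<close>
	from bchoice[OF this] obtain FG where FG: "\<forall>p\<in>D. mod_hom small v w (fst p) (snd p) (R (fst p) (snd p)) (fst (FG p)) (snd (FG p))"
		by blast
	have m: "mod_hom small v w Y Z (R Y Z) (fst (FG (Y, Z))) (snd (FG (Y, Z)))" if "(Y, Z) : D" for Y Z
		using bspec[OF FG that] by simp
	define \<theta> where "\<theta> Y Z = mod_hom.theta w Y Z (snd (FG (Y, Z)))" for Y Z
	let ?M = "FSK small v w"
	have singles: "map (map scat) (map (\<lambda>X. [X]) Xs @ [[Y']]) = map (\<lambda>S. [S]) (map scat Xs) @ [[scat Y']]" for Xs and Y' :: "'u sk"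
		by simp
	show ?thesis
		unfolding right_closed_on_def
	proof (intro conjI exI[of _ \<theta>], goal_cases)
		case 1 show ?case
			using H by (auto simp: Mod_homs_def)
	next
		case 2 show ?case
			using mod_hom.theta_bij[OF m] by (auto simp: \<theta>_def)
	next
		case 3 show ?case
		proof (clarify)
			fix Y Z Xs Vss fs g
			assume "(Y, Z) : D" "set Xs \<subseteq> mc_ob ?M" "mc_family ?M Vss Xs fs" "g : mc_hom ?M (Xs @ [Y]) Z"
			then show "\<theta> Y Z (concat Vss) (mc_comp ?M (Vss @ [[Y]]) (Xs @ [Y]) Z g (fs @ [mc_id ?M Y])) = mc_comp ?M Vss Xs (R Y Z) (\<theta> Y Z Xs g) fs"
				unfolding \<theta>_def FSK_sel by (intro mod_hom.theta_subst[OF m]) simp_all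
		qed
	next
		case 4 show ?case
		proof (intro allI impI ballI, elim conjE, goal_cases)
			case (1 Y Y' Z f)
			have D: "(Y, Z) : D" "(Y', Z) : D" and f: "f : mc_hom ?M [Y'] Y" by (fact 1)+
			interpret a: mod_hom small v w Y Z "R Y Z" "fst (FG (Y, Z))" "snd (FG (Y, Z))" by (rule m[OF D(1)])
			interpret b: mod_hom small v w Y' Z "R Y' Z" "fst (FG (Y', Z))" "snd (FG (Y', Z))" by (rule m[OF D(2)])
			have f': "multimodel v w [Y'] Y f" using f by simp
			obtain ph where p: "model Y' Y ph" "f = unary (scat Y') ph" by (rule unary_model_cases[OF b.Y f'])
			\<comment> \<open>Naturality in \<open>Y\<close> is the case of the identity on \<open>Z\<close>;
			  postcomposition with it is then absorbed by \<open>post\<close>.\<close>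
			note n = theta_natural[OF m[OF D(1)] m[OF D(2)] p(1) small_sketch_id[OF a.Z]]
			note y = small_sketch_fcategory[OF a.Y] small_sketch_fcategory[OF b.Y] small_sketch_fcategory[OF a.Z]
			have post: "post (map scat Xs @ [scat Y']) (ffun_id (scat Z)) (mfun_subst (map (\<lambda>S. [S]) (map scat Xs) @ [[scat Y']]) g (map mfun_id (map scat Xs) @ [f])) =
					mfun_subst (map (\<lambda>S. [S]) (map scat Xs) @ [[scat Y']]) g (map mfun_id (map scat Xs) @ [f])"
				if Xs: "set Xs \<subseteq> {S. small_sketch small S}" and g: "multimodel v w (Xs @ [Y]) Z g" for Xs g
			proof -
				have x: "fcategory (scat X)" if "X : set Xs" for X using Xs that by (auto intro: small_sketch_fcategory)
				have u: "multifunctor v w [S] S (mfun_id S)" if S: "fcategory S" for S :: "('u, 'u, 'u) fcat"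
				proof -
					interpret twocat S by unfold_locales (rule fcategory_two_category[OF S])
					show ?thesis unfolding mfun_id_unary by (rule unary_multifunctor[OF S ffunctor_id[OF Tight_arr[OF S]]])
				qed
				interpret s: substitution "map (\<lambda>S. [S]) (map scat Xs) @ [[scat Y']]" "map scat Xs @ [scat Y]" "map mfun_id (map scat Xs) @ [f]" v w
					by unfold_locales (use f' x u y vw in \<open>auto simp: nth_append less_Suc_eq multimodel_def\<close>)
				have "fcats (map scat Xs @ [scat Y])" by (rule fcats.intro) (use x y in \<open>auto simp: nth_append less_Suc_eq\<close>)
				moreover have "multifunctor v w (map scat Xs @ [scat Y]) (scat Z) g" using g by (simp add: multimodel_def)
				ultimately have "post (concat (map (\<lambda>S. [S]) (map scat Xs) @ [[scat Y']])) (ffun_id (scat Z))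
						(mfun_subst (map (\<lambda>S. [S]) (map scat Xs) @ [[scat Y']]) g (map mfun_id (map scat Xs) @ [f])) =
					mfun_subst (map (\<lambda>S. [S]) (map scat Xs) @ [[scat Y']]) g (map mfun_id (map scat Xs) @ [f])"
					by (intro s.subst_post_id[OF y(3)])
				then show ?thesis by (simp only: concat_append map_list_single concat.simps append_Nil2 append_Nil append_Cons)
			qed
			have ids: "map (mc_id ?M) Xs = map mfun_id (map scat Xs)" for Xs by simp
			show ?case
				using n(1)
			proof (intro bexI allI impI ballI)
				fix Xs g assume "set Xs \<subseteq> mc_ob ?M" "g : mc_hom ?M (Xs @ [Y]) Z"
				then have "set Xs \<subseteq> {S. small_sketch small S}" "multimodel v w (Xs @ [Y]) Z g" by simp_all
				from n(2)[OF this, folded p(2), unfolded post[OF this]]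
				show "\<theta> Y' Z Xs (mc_comp ?M (map (\<lambda>X. [X]) Xs @ [[Y']]) (Xs @ [Y]) Z g (map (mc_id ?M) Xs @ [f])) =
					mc_comp ?M [Xs] [R Y Z] (R Y' Z) (unary (scat (R Y Z)) (ffun_comp (scat (R Y Z)) (ffun_comp (Mod_cat v w Y Z) (snd (FG (Y', Z)))
						(whisk (Mod_cat v w Y Z) (scat Y') (ffun_id (scat Z)) ph)) (fst (FG (Y, Z))))) [\<theta> Y Z Xs g]"
					unfolding \<theta>_def ids unfolding FSK_sel singles by simp
			qed simp
		qed
	next
		case 5 show ?case
		proof (intro allI impI ballI, elim conjE, goal_cases)
			case (1 Y Z Z' f)
			have D: "(Y, Z) : D" "(Y, Z') : D" and f: "f : mc_hom ?M [Z] Z'" by (fact 1)+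
			interpret a: mod_hom small v w Y Z "R Y Z" "fst (FG (Y, Z))" "snd (FG (Y, Z))" by (rule m[OF D(1)])
			have f': "multimodel v w [Z] Z' f" using f by simp
			obtain ps where p: "model Z Z' ps" "f = unary (scat Z) ps" by (rule unary_model_cases[OF a.Z f'])
			\<comment> \<open>Naturality in \<open>Z\<close> is the case of the identity on \<open>Y\<close>,
			  where the whole substitution consists of identities and collapses to \<open>g\<close>.\<close>
			note n = theta_natural[OF m[OF D(1)] m[OF D(2)] small_sketch_id[OF a.Y] p(1)]
			note y = small_sketch_fcategory[OF a.Y] small_sketch_fcategory[OF a.Z]
			have sub: "mfun_subst (map (\<lambda>S. [S]) (map scat Xs) @ [[scat Y]]) g (map mfun_id (map scat Xs) @ [unary (scat Y) (ffun_id (scat Y))]) = g &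
					mfun_subst [map scat Xs @ [scat Y]] f [g] = post (map scat Xs @ [scat Y]) ps g"
				if Xs: "set Xs \<subseteq> {S. small_sketch small S}" and g: "multimodel v w (Xs @ [Y]) Z g" for Xs g
			proof -
				have x: "fcategory (scat X)" if "X : set Xs" for X using Xs that by (auto intro: small_sketch_fcategory)
				have fc: "fcats (map scat Xs @ [scat Y])" by (rule fcats.intro) (use x y in \<open>auto simp: nth_append less_Suc_eq\<close>)
				have gm: "multifunctor v w (map scat Xs @ [scat Y]) (scat Z) g" using g by (simp add: multimodel_def)
				then have r: "mfun_restrict (map scat Xs @ [scat Y]) g = g" by (simp add: multifunctor_def)
				show ?thesis
					using subst_ids[OF fc r] subst_unary[OF fc y(2) vw gm, of ps, folded p(2)] by (simp add: mfun_id_unary)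
			qed
			show ?case
				using n(1)
			proof (intro bexI allI impI ballI)
				fix Xs g assume "set Xs \<subseteq> mc_ob ?M" "g : mc_hom ?M (Xs @ [Y]) Z"
				then have "set Xs \<subseteq> {S. small_sketch small S}" "multimodel v w (Xs @ [Y]) Z g" by simp_all
				from n(2)[OF this] sub[OF this]
				show "\<theta> Y Z' Xs (mc_comp ?M [Xs @ [Y]] [Z] Z' f [g]) =
					mc_comp ?M [Xs] [R Y Z] (R Y Z') (unary (scat (R Y Z)) (ffun_comp (scat (R Y Z)) (ffun_comp (Mod_cat v w Y Z) (snd (FG (Y, Z')))
						(whisk (Mod_cat v w Y Z) (scat Y) ps (ffun_id (scat Y)))) (fst (FG (Y, Z))))) [\<theta> Y Z Xs g]"
					by (simp add: \<theta>_def)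
			qed simp
		qed
	qed
qed

section \<open>Reversing the order of the variables\<close>

section \<open>Reversal of multimorphisms\<close>

text \<open>Positions are counted from the end. Interchange cells exist only for increasing
  positions, so the pair is swapped, and \<open>reflect\<close> reads the cell in the square with
  its two directions exchanged.\<close>

definition rev_mf where
	"rev_mf Ss C w M = mfun_restrict (rev Ss)
		 \<lparr>m0 = (\<lambda>xs. m0 M (rev xs)), m1 = (\<lambda>i xs s. m1 M (length Ss - Suc i) (rev xs) s),
			m2 = (\<lambda>i xs al. m2 M (length Ss - Suc i) (rev xs) al),
			mx = (\<lambda>i j xs s t. reflect C w (mx M (length Ss - Suc j) (length Ss - Suc i) (rev xs) t s))\<rparr>"

lemma tuples_rev: "xs : tuples (rev Ss) \<longleftrightarrow> rev xs : tuples Ss"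
	by (simp add: tuples_list_all2 list_all2_rev1)

lemma arr_at_rev: "arr_at (rev Ss) i xs s \<longleftrightarrow> i < length Ss & arr_at Ss (length Ss - Suc i) (rev xs) s"
	by (auto simp: arr_at_def tuples_rev rev_nth dest: tuples_length)

lemma cell_at_rev: "cell_at (rev Ss) i xs s \<longleftrightarrow> i < length Ss & cell_at Ss (length Ss - Suc i) (rev xs) s"
	by (auto simp: cell_at_def tuples_rev rev_nth dest: tuples_length)

lemma rev_sel:
	"rev xs : tuples Ss ==> m0 (rev_mf Ss C w M) xs = m0 M (rev xs)"
	"i < length Ss ==> arr_at Ss (length Ss - Suc i) (rev xs) s ==> m1 (rev_mf Ss C w M) i xs s = m1 M (length Ss - Suc i) (rev xs) s"
	"i < length Ss ==> cell_at Ss (length Ss - Suc i) (rev xs) al ==> m2 (rev_mf Ss C w M) i xs al = m2 M (length Ss - Suc i) (rev xs) al"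
	"i < j ==> j < length Ss ==> arr_at Ss (length Ss - Suc i) (rev xs) s ==> arr_at Ss (length Ss - Suc j) (rev xs) t ==>
		 mx (rev_mf Ss C w M) i j xs s t = reflect C w (mx M (length Ss - Suc j) (length Ss - Suc i) (rev xs) t s)"
	by (simp_all add: rev_mf_def mfun_restrict_def tuples_rev arr_at_rev cell_at_rev)

lemma mfun_restrict_rev [simp]: "mfun_restrict (rev Ss) (rev_mf Ss C w M) = rev_mf Ss C w M"
	by (simp add: rev_mf_def)

lemma (in twocat) strong_VCmp_ori:
	assumes "al : Cell C" "be : Cell C" "Src (ori w C) be = Tgt (ori w C) al" "strong C w al" "strong C w be"
	shows "strong C w (VCmp (ori w C) be al)"
proof (cases "w = Strict \<or> w = Pseudo")
	case True
	then have "ori w C = C" by (auto simp: ori_def)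
	then show ?thesis using strong_VCmp assms by simp
next
	case False
	then show ?thesis by (cases w) (simp_all add: strong_def)
qed

text \<open>The side conditions are on oriented sources, the form in which the boundaries of
  interchange cells are known.\<close>

lemma (in twocat)
	assumes a: "al : Cell C" "strong C w al" and f: "f : Arr C"
	shows strong_wl_ori: "Dom C f = Cod C (Src (ori w C) al) ==> strong C w (wl f al)"
		and reflect_wl_ori: "Dom C f = Cod C (Src (ori w C) al) ==> reflect C w (wl f al) = wl f (reflect C w al)"
		and strong_wr_ori: "Dom C (Src (ori w C) al) = Cod C f ==> strong C w (wr al f)"
		and reflect_wr_ori: "Dom C (Src (ori w C) al) = Cod C f ==> reflect C w (wr al f) = wr (reflect C w al) f"
	using strong_wl[OF a f] reflect_wl[OF a f] strong_wr[OF a f] reflect_wr[OF a f] a(1)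
	by (simp_all add: Dom_Src_ori Cod_Src_ori)

lemma (in twocat) reflect_paste:
	assumes c: "al : Cell C" "be : Cell C" "\<gamma> : Cell C" and s: "strong C w al" "strong C w be" "strong C w \<gamma>"
		and e: "Src (ori w C) al = Tgt (ori w C) be" "Src (ori w C) be = Tgt (ori w C) \<gamma>"
	shows "reflect C w (VCmp (ori w C) (VCmp (ori w C) al be) \<gamma>) =
		VCmp (ori (dual w) C) (VCmp (ori (dual w) C) (reflect C w \<gamma>) (reflect C w be)) (reflect C w al)"
proof -
	interpret O: twocat "ori w C" by unfold_locales (rule ori_two_category[OF two_category])
	interpret O': twocat "ori (dual w) C" by unfold_locales (rule ori_two_category[OF two_category])
	note t = O.VCmp_cell[unfolded ori_simps, OF c(2,1) e(1)] O.Src_VCmp[unfolded ori_simps, OF c(2,1) e(1)]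
	have "reflect C w (VCmp (ori w C) (VCmp (ori w C) al be) \<gamma>) =
		 VCmp (ori (dual w) C) (reflect C w \<gamma>) (VCmp (ori (dual w) C) (reflect C w be) (reflect C w al))"
		using reflect_VCmp[OF c(3) s(3) t(1) strong_VCmp_ori[OF c(2,1) e(1) s(2,1)]] reflect_VCmp[OF c(2) s(2) c(1) s(1) e(1)] t(2) e
		by simp
	also have "\<dots> = VCmp (ori (dual w) C) (VCmp (ori (dual w) C) (reflect C w \<gamma>) (reflect C w be)) (reflect C w al)"
		by (rule O'.VCmp_assoc[unfolded ori_simps, symmetric]) (simp_all add: c s e)
	finally show ?thesis .
qed

locale reversible = mf_typed Ss C M v w
	for Ss :: "('o, 'a, 't) fcat list" and C :: "('p, 'b, 's) fcat" and M and v w +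
	assumes vw: "v \<preceq> w" and nm: "nmf v w"
begin

abbreviation n where "n \<equiv> length Ss"
abbreviation R where "R \<equiv> rev_mf Ss C w M"

lemma rev_upd: "xs : tuples (rev Ss) ==> i < n ==> rev (xs[i := x]) = (rev xs)[n - Suc i := x]"
	using tuples_length[of xs "rev Ss"] by (simp add: rev_update)

lemma M_mf: "multifunctor v w Ss C M" using nm multifunctor_iff_nmf[OF vw] by simp

lemma slice_rev:
	assumes xs: "xs : tuples (rev Ss)" and i: "i < n"
	shows "slice (rev Ss) R i xs = slice Ss M (n - Suc i) (rev xs)"
proof -
	have i': "n - Suc i < n" using i by simp
	interpret S: twocat "Ss ! (n - Suc i)" by (rule S_twocat[OF i'])
	have t: "rev xs : tuples Ss" using xs by (simp add: tuples_rev)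
	have r: "rev Ss ! i = Ss ! (n - Suc i)" using i by (simp add: rev_nth)
	have u: "rev (xs[i := x]) = (rev xs)[n - Suc i := x]" for x by (rule rev_upd[OF xs i])
	have a: "arr_at Ss (n - Suc i) ((rev xs)[n - Suc i := Dom (Ss ! (n - Suc i)) s]) s" if "s : Arr (Ss ! (n - Suc i))" for s
		using that t i' tuples_length[OF t] by (simp add: arr_at_def tuples_update)
	have c: "cell_at Ss (n - Suc i) ((rev xs)[n - Suc i := Dom (Ss ! (n - Suc i)) (Src (Ss ! (n - Suc i)) s)]) s" if "s : Cell (Ss ! (n - Suc i))" for s
		using that t i' tuples_length[OF t] by (simp add: cell_at_def tuples_update)
	show ?thesis
		unfolding slice_def r
		by (intro ffun.equality) (auto simp: rev_sel u i tuples_update[OF t] a c intro!: restrict_ext)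
qed

sublocale R: mf_setup "rev Ss" C R
	by unfold_locales (simp_all add: rev_nth fcat C)

context
	notes [simp] = arr_at_cross arr_at_next
begin

text \<open>Reversal exchanges left and right slices on the nose, so conditions (b) and (c) change
  places. The cube axiom is the reflection of a cube of \<open>M\<close> with its positions in
  opposite order.\<close>

lemma rev_multifunctor: "multifunctor (dual v) (dual w) (rev Ss) C R"
proof -
	have fn: "ffunctor (rev Ss ! i) C (slice (rev Ss) R i xs)" if i: "i < n" and xs: "xs : tuples (rev Ss)" for i xs
		using M_mf xs i unfolding slice_rev[OF xs i] multifunctor_def by (simp add: rev_nth tuples_rev)
	then have mf: "mf_fun (rev Ss) C R i" if "i < n" for i using that by (simp add: mf_fun_def)
	have cells: "mf_cells (dual v) (dual w) (rev Ss) C R i j" if ij: "i < j" "j < n" for i j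
		unfolding mf_cells_def
	proof (intro allI impI, elim conjE)
		fix xs s t assume a: "arr_at (rev Ss) i xs s" "arr_at (rev Ss) j xs t"
		note b = a[unfolded arr_at_rev, THEN conjunct2] and xs = arr_at_tuples[OF a(1)]
		have lt: "n - Suc j < n - Suc i" "i < n" using ij by auto
		note c = tx_cell[OF lt(1) b(2,1)] tx_strong[OF lt(1) b(2,1)]
		show "mx R i j xs s t : Cell C &
		 Src (ori (dual w) C) (mx R i j xs s t) = Cmp C (m1 R j (xs[i := Cod (rev Ss ! i) s]) t) (m1 R i xs s) &
		 Tgt (ori (dual w) C) (mx R i j xs s t) = Cmp C (m1 R i (xs[j := Cod (rev Ss ! j) t]) s) (m1 R j xs t) &
		 strong C (dual w) (mx R i j xs s t) &
		 (s : Tight (rev Ss ! i) \<or> t : Tight (rev Ss ! j) --> strong C (dual v) (mx R i j xs s t))"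
			using ij b lt c tx_Src[OF lt(1) b(2,1)] tx_Tgt[OF lt(1) b(2,1)] C.strong_strength_reflect[OF c _ vw] tx_tight[OF lt(1) b(2,1)]
			by (auto simp: rev_sel rev_upd[OF xs] rev_nth C.reflect_cell C.strong_dual_reflect C.Src_reflect C.Tgt_reflect)
	qed
	have cub: "cubical (rev Ss) C (dual w) R i j k xs s t u"
		if ijk: "i < j" "j < k" and a: "arr_at (rev Ss) i xs s" "arr_at (rev Ss) j xs t" "arr_at (rev Ss) k xs u" for i j k xs s t u
	proof -
		define i' j' k' rx where d: "i' = n - Suc i" "j' = n - Suc j" "k' = n - Suc k" "rx = rev xs"
		note xs = arr_at_tuples[OF a(1)]
		have l: "k < n" "j < n" "i < n" using a ijk by (simp_all add: arr_at_rev)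
		have lt: "k' < j'" "j' < i'" "k' < i'" using ijk l by (auto simp: d)
		have b: "arr_at Ss i' rx s" "arr_at Ss j' rx t" "arr_at Ss k' rx u" using a by (simp_all add: arr_at_rev d)
		have ne: "i' ~= j'" "j' ~= i'" "i' ~= k'" "k' ~= i'" "j' ~= k'" "k' ~= j'" using lt by auto
		have sw: "ys[i' := a, j' := b] = ys[j' := b, i' := a]" "ys[i' := a, k' := b] = ys[k' := b, i' := a]"
			"ys[j' := a, k' := b] = ys[k' := b, j' := a]" for ys :: "'o list" and a b
			using ne by (simp_all add: list_update_swap)
		interpret O: twocat "ori w C" by (rule C.ori_twocat)
		interpret O': twocat "ori (dual w) C" by (rule C.ori_twocat)
		note ty = O.typing
		note ty' [simp] = ty[unfolded ori_simps]
		have st: "strong C w (mx M p q zs f g)" if "p < q" "arr_at Ss p zs f" "arr_at Ss q zs g" for p q zs f g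
			by (rule tx_strong[OF that])
		let ?si = "Cod (Ss ! i') s" and ?tj = "Cod (Ss ! j') t" and ?uk = "Cod (Ss ! k') u"
		have m: "m1 R i xs s = m1 M i' rx s" "m1 R j xs t = m1 M j' rx t" "m1 R k xs u = m1 M k' rx u"
			using b l by (simp_all add: rev_sel d)
		have X: "xs[i := c] : tuples (rev Ss)" if "c : Obj (rev Ss ! i)" for c using xs that by (rule tuples_update)
		have rn: "rev Ss ! i = Ss ! i'" "rev Ss ! j = Ss ! j'" "rev Ss ! k = Ss ! k'" using l by (simp_all add: rev_nth d)
		have up: "xs[i := ?si] : tuples (rev Ss)" "xs[j := ?tj] : tuples (rev Ss)" "xs[k := ?uk] : tuples (rev Ss)"
			using R.update_Cod[OF a(1)] R.update_Cod[OF a(2)] R.update_Cod[OF a(3)] by (simp_all add: rn)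
		have ru: "rev (xs[i := ?si]) = rx[i' := ?si]" "rev (xs[j := ?tj]) = rx[j' := ?tj]" "rev (xs[k := ?uk]) = rx[k' := ?uk]"
			"rev (xs[j := ?tj, k := ?uk]) = rx[k' := ?uk, j' := ?tj]" "rev (xs[i := ?si, j := ?tj]) = rx[j' := ?tj, i' := ?si]"
			"rev (xs[i := ?si, k := ?uk]) = rx[k' := ?uk, i' := ?si]"
			using rev_upd[OF xs l(1)] rev_upd[OF xs l(2)] rev_upd[OF xs l(3)]
				rev_upd[OF up(2) l(1)] rev_upd[OF up(1) l(2)] rev_upd[OF up(1) l(1)] by (simp_all add: sw flip: d)
		have m': "m1 R i (xs[j := ?tj, k := ?uk]) s = m1 M i' (rx[k' := ?uk, j' := ?tj]) s"
			"m1 R k (xs[i := ?si, j := ?tj]) u = m1 M k' (rx[j' := ?tj, i' := ?si]) u"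
			"m1 R j (xs[i := ?si, k := ?uk]) t = m1 M j' (rx[k' := ?uk, i' := ?si]) t"
			using b l ne by (simp_all add: rev_sel ru flip: d)
		have x: "mx R i j zs s t = reflect C w (mx M j' i' (rev zs) t s)" if "arr_at Ss i' (rev zs) s" "arr_at Ss j' (rev zs) t" for zs
			using rev_sel(4)[OF ijk(1) l(2)] that by (simp add: d)
		have x2: "mx R j k zs t u = reflect C w (mx M k' j' (rev zs) u t)" if "arr_at Ss j' (rev zs) t" "arr_at Ss k' (rev zs) u" for zs
			using rev_sel(4)[OF ijk(2) l(1)] that by (simp add: d)
		have x3: "mx R i k zs s u = reflect C w (mx M k' i' (rev zs) u s)" if "arr_at Ss i' (rev zs) s" "arr_at Ss k' (rev zs) u" for zs
			using rev_sel(4)[OF less_trans[OF ijk] l(1)] that by (simp add: d)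
		have y: "mx R i j xs s t = reflect C w (mx M j' i' rx t s)" "mx R i j (xs[k := ?uk]) s t = reflect C w (mx M j' i' (rx[k' := ?uk]) t s)"
			"mx R j k xs t u = reflect C w (mx M k' j' rx u t)" "mx R j k (xs[i := ?si]) t u = reflect C w (mx M k' j' (rx[i' := ?si]) u t)"
			"mx R i k xs s u = reflect C w (mx M k' i' rx u s)" "mx R i k (xs[j := ?tj]) s u = reflect C w (mx M k' i' (rx[j' := ?tj]) u s)"
			using b ne by (simp_all add: x x2 x3 ru flip: d)
		\<comment> \<open>Reflecting either side of this cube of \<open>M\<close> gives the corresponding
		  side of the required cube, with its three cells composed in the opposite order.\<close>
		have "cubical Ss C w M k' j' i' rx u t s" using nm lt b unfolding nmf_def by blast
		note c = this[unfolded cubical_ori Let_def, THEN arg_cong[of _ _ "reflect C w"], symmetric]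
		note rp = C.reflect_paste[where w = w] and rw = C.reflect_wl_ori[where w = w] C.reflect_wr_ori[where w = w]
			and sw' = C.strong_wl_ori[where w = w] C.strong_wr_ori[where w = w]
		have l1: "reflect C w
				(VCmp (ori w C) (VCmp (ori w C) (whisker_left C (m1 M k' (rx[j' := ?tj, i' := ?si]) u) (mx M j' i' rx t s))
					 (whisker_right C (mx M k' i' (rx[j' := ?tj]) u s) (m1 M j' rx t)))
				 (whisker_left C (m1 M i' (rx[k' := ?uk, j' := ?tj]) s) (mx M k' j' rx u t))) =
			VCmp (ori (dual w) C) (VCmp (ori (dual w) C)
				 (whisker_left C (m1 M i' (rx[k' := ?uk, j' := ?tj]) s) (reflect C w (mx M k' j' rx u t)))
				 (whisker_right C (reflect C w (mx M k' i' (rx[j' := ?tj]) u s)) (m1 M j' rx t)))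
			 (whisker_left C (m1 M k' (rx[j' := ?tj, i' := ?si]) u) (reflect C w (mx M j' i' rx t s)))"
			by (subst rp) (use lt b ne in \<open>simp_all add: sw st rw sw'\<close>)
		have l2: "reflect C w
				(VCmp (ori w C) (VCmp (ori w C) (whisker_right C (mx M k' j' (rx[i' := ?si]) u t) (m1 M i' rx s))
					 (whisker_left C (m1 M j' (rx[k' := ?uk, i' := ?si]) t) (mx M k' i' rx u s)))
				 (whisker_right C (mx M j' i' (rx[k' := ?uk]) t s) (m1 M k' rx u))) =
			VCmp (ori (dual w) C) (VCmp (ori (dual w) C)
				 (whisker_right C (reflect C w (mx M j' i' (rx[k' := ?uk]) t s)) (m1 M k' rx u))
				 (whisker_left C (m1 M j' (rx[k' := ?uk, i' := ?si]) t) (reflect C w (mx M k' i' rx u s))))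
			 (whisker_right C (reflect C w (mx M k' j' (rx[i' := ?si]) u t)) (m1 M i' rx s))"
			by (subst rp) (use lt b ne in \<open>simp_all add: sw st rw sw'\<close>)
		show ?thesis
			unfolding cubical_ori Let_def rn y m m' using c unfolding l1 l2 by simp
	qed
	\<comment> \<open>After reversal the arrow in position \<open>i\<close> stands behind position
	  \<open>j\<close>, so a right slice becomes a left slice, and \<open>slice_left\<close> contains
	  exactly the reflection built into \<open>rev_mf\<close>.\<close>
	have right: "slice_right (rev Ss) R i j xs s = slice_left Ss C w M (n - Suc j) (n - Suc i) (rev xs) s"
		if ij: "i < j" "j < n" and a: "arr_at (rev Ss) i xs s" for i j xs s
	proof -
		note b = a[unfolded arr_at_rev, THEN conjunct2] and xs = arr_at_tuples[OF a]
		have i: "i < n" and ne: "n - Suc i ~= n - Suc j" "n - Suc j < n" using ij by auto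
		interpret J: twocat "Ss ! (n - Suc j)" by (rule S_twocat[OF ne(2)])
		have up: "xs[i := Cod (Ss ! (n - Suc i)) s] : tuples (rev Ss)" using R.update_Cod[OF a] i by (simp add: rev_nth)
		have rx: "rev xs : tuples Ss" using xs by (simp add: tuples_rev)
		have ay: "arr_at Ss (n - Suc i) ((rev xs)[n - Suc j := y]) s" if "y : Obj (Ss ! (n - Suc j))" for y
			by (rule arr_at_update[OF b ne(1) that])
		have at: "arr_at Ss (n - Suc j) ((rev xs)[n - Suc j := Dom (Ss ! (n - Suc j)) t]) t" if "t : Arr (Ss ! (n - Suc j))" for t
			using tuples_update[OF rx, of "Dom (Ss ! (n - Suc j)) t" "n - Suc j"] that ne(2) tuples_length[OF rx] by (simp add: arr_at_def)
		show ?thesis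
			unfolding slice_right_def slice_left_def
			by (rule wtrans.equality)
				(use ij i in \<open>auto simp: slice_rev[OF xs] slice_rev[OF up] rev_upd[OF xs] rev_nth rev_sel ay at intro!: restrict_ext\<close>)
	qed
	\<comment> \<open>Here the cells are reflected twice, once by \<open>rev_mf\<close> and once by
	  \<open>slice_left\<close>, which gives the cells of \<open>M\<close> back.\<close>
	have left: "slice_left (rev Ss) C (dual w) R i j xs t = slice_right Ss M (n - Suc j) (n - Suc i) (rev xs) t"
		if ij: "i < j" and a: "arr_at (rev Ss) j xs t" for i j xs t
	proof -
		note b = a[unfolded arr_at_rev, THEN conjunct2] and xs = arr_at_tuples[OF a]
		have j: "j < n" using a by (simp add: arr_at_rev)
		then have i: "i < n" and ne: "n - Suc j ~= n - Suc i" "n - Suc i < n" "n - Suc j < n - Suc i" using ij by auto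
		interpret J: twocat "Ss ! (n - Suc i)" by (rule S_twocat[OF ne(2)])
		have up: "xs[j := Cod (Ss ! (n - Suc j)) t] : tuples (rev Ss)" using R.update_Cod[OF a] j by (simp add: rev_nth)
		have rx: "rev xs : tuples Ss" using xs by (simp add: tuples_rev)
		have ay: "arr_at Ss (n - Suc j) ((rev xs)[n - Suc i := y]) t" if "y : Obj (Ss ! (n - Suc i))" for y
			by (rule arr_at_update[OF b ne(1) that])
		have at: "arr_at Ss (n - Suc i) ((rev xs)[n - Suc i := Dom (Ss ! (n - Suc i)) s]) s" if "s : Arr (Ss ! (n - Suc i))" for s
			using tuples_update[OF rx, of "Dom (Ss ! (n - Suc i)) s" "n - Suc i"] that ne(2) tuples_length[OF rx] by (simp add: arr_at_def)
		have rr: "reflect C (dual w) (reflect C w (mx M (n - Suc j) (n - Suc i) ((rev xs)[n - Suc i := Dom (Ss ! (n - Suc i)) s]) t s)) =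
				mx M (n - Suc j) (n - Suc i) ((rev xs)[n - Suc i := Dom (Ss ! (n - Suc i)) s]) t s" if "s : Arr (Ss ! (n - Suc i))" for s
			using that by (intro C.reflect_reflect tx_cell[OF ne(3)] tx_strong[OF ne(3)] ay at) simp_all
		show ?thesis
			unfolding slice_right_def slice_left_def
			by (rule wtrans.equality)
				(use ij i j in \<open>auto simp: slice_rev[OF xs] slice_rev[OF up] rev_upd[OF xs] rev_nth rev_sel ay at rr intro!: restrict_ext\<close>)
	qed
	note D = M_mf[unfolded multifunctor_def]
	note wr = D[THEN conjunct2, THEN conjunct2, THEN conjunct2, THEN conjunct2, THEN conjunct1, rule_format]
		and wl = D[THEN conjunct2, THEN conjunct2, THEN conjunct2, THEN conjunct2, THEN conjunct2, THEN conjunct1, rule_format]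
	show ?thesis
		unfolding multifunctor_def
	proof (intro conjI allI ballI impI; (elim conjE)?)
		show "m0 R xs : Obj C" if "xs : tuples (rev Ss)" for xs
			using that D[THEN conjunct2, THEN conjunct1] by (simp add: rev_sel tuples_rev)
		show "ffunctor (rev Ss ! i) C (slice (rev Ss) R i xs)" if "i < length (rev Ss)" "xs : tuples (rev Ss)" for i xs
			using fn that by simp
		show "let f = m1 R i xs s; g = m1 R j xs t; h = m1 R j (xs[i := Cod (rev Ss ! i) s]) t; k = m1 R i (xs[j := Cod (rev Ss ! j) t]) s
				 in wcell C (dual w) f g h k (mx R i j xs s t) &
						(s : Tight (rev Ss ! i) \<or> t : Tight (rev Ss ! j) --> wcell_at C (dual v) (dual w) f g h k (mx R i j xs s t))"
			if "i < j" "arr_at (rev Ss) i xs s" "arr_at (rev Ss) j xs t" for i j xs s t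
		proof -
			have l: "j < n" "i < n" "i ~= j" using that by (auto simp: arr_at_rev)
			from R.mf_cells_iff[OF mf[OF l(2)] mf[OF l(1)] l(3) dual_mono[OF vw]] cells[OF that(1) l(1)] that(2,3)
			show ?thesis by blast
		qed
		show "wnatural (rev Ss ! j) C (dual w) (slice_right (rev Ss) R i j xs s)"
			if "i < j" "j < length (rev Ss)" "arr_at (rev Ss) i xs s" for i j xs s
		proof -
			have j: "j < n" using that by simp
			have "n - Suc j < n - Suc i" using that(1) j by auto
			from wl[OF conjI, OF this that(3)[unfolded arr_at_rev, THEN conjunct2]]
			show ?thesis unfolding right[OF that(1) j that(3)] using j by (simp add: rev_nth)
		qed
		show "wnatural (rev Ss ! i) C (dual (dual w)) (slice_left (rev Ss) C (dual w) R i j xs t)"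
			if "i < j" "arr_at (rev Ss) j xs t" for i j xs t
		proof -
			have j: "j < n" using that by (simp add: arr_at_rev)
			have "n - Suc j < n - Suc i" "n - Suc i < n" using that(1) j by auto
			from wr[OF conjI, OF this(1) conjI, OF this(2) that(2)[unfolded arr_at_rev, THEN conjunct2]]
			show ?thesis unfolding left[OF that] using j that(1) by (simp add: rev_nth)
		qed
	qed (simp_all add: cub)
qed

end

lemma rev_rev: "rev_mf (rev Ss) C (dual w) R = M"
proof -
	have r: "mfun_restrict Ss M = M" using nm by (simp add: nmf_def)
	have d: "n - Suc (n - Suc i) = i" if "i < n" for i using that by simp
	show ?thesis
	proof (rule mfun_eqI[OF _ r])
		show "mfun_restrict Ss (rev_mf (rev Ss) C (dual w) R) = rev_mf (rev Ss) C (dual w) R"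
			using mfun_restrict_rev[of "rev Ss"] by simp
		show "m0 (rev_mf (rev Ss) C (dual w) R) xs = m0 M xs" if "xs : tuples Ss" for xs
			using that by (simp add: rev_sel tuples_rev)
		show "m1 (rev_mf (rev Ss) C (dual w) R) i xs s = m1 M i xs s" if a: "arr_at Ss i xs s" for i xs s
			using a arr_at_less[OF a] by (simp add: rev_sel arr_at_rev d)
		show "m2 (rev_mf (rev Ss) C (dual w) R) i xs s = m2 M i xs s" if a: "cell_at Ss i xs s" for i xs s
		proof -
			have "i < n" using a by (simp add: cell_at_def)
			then show ?thesis using a by (simp add: rev_sel cell_at_rev d)
		qed
		show "mx (rev_mf (rev Ss) C (dual w) R) i j xs s t = mx M i j xs s t"
			if ij: "i < j" and a: "arr_at Ss i xs s" "arr_at Ss j xs t" for i j xs s t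
		proof -
			have l: "i < n" "j < n" using a by (simp_all add: arr_at_def)
			have lt: "n - Suc j < n - Suc i" using ij l by simp
			show ?thesis
				using a l ij lt C.reflect_reflect[OF tx_cell[OF ij a] tx_strong[OF ij a]] by (simp add: rev_sel arr_at_rev d)
		qed
	qed
qed

end

lemma locate_append_ge: "q < m ==> locate (ns @ [m]) (sum_list ns + q) = (length ns, q)"
	by (induction ns) auto

lemma locate_rev:
	"p < sum_list ns ==> locate ns p = (k, i) ==>
		locate (rev ns) (sum_list ns - Suc p) = (length ns - Suc k, ns ! k - Suc i)"
proof (induction ns arbitrary: p k i)
	case (Cons m ns)
	show ?case
	proof (cases "p < m")
		case True
		have "sum_list (m # ns) - Suc p = sum_list (rev ns) + (m - Suc p)" using True by simp
		then show ?thesis using locate_append_ge[of "m - Suc p" m "rev ns"] Cons.prems True by simp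
	next
		case False
		obtain k' i' where l: "locate ns (p - m) = (k', i')" by fastforce
		have p: "p - m < sum_list ns" using Cons.prems False by simp
		have "sum_list (m # ns) - Suc p = sum_list ns - Suc (p - m)" "sum_list ns - Suc (p - m) < sum_list (rev ns)"
			using False p by simp_all
		moreover have "k = Suc k'" "i' = i" using Cons.prems(2) False l by simp_all
		ultimately show ?thesis using Cons.IH[OF p l] by (simp add: locate_append)
	qed
qed simp

lemma blocks_rev: "length xs = sum_list ns ==> blocks (rev ns) (rev xs) = rev (map rev (blocks ns xs))"
proof (induction ns arbitrary: xs)
	case (Cons m ns)
	have "rev xs = rev (drop m xs) @ rev (take m xs)" by (metis append_take_drop_id rev_append)
	moreover have "length (rev (drop m xs)) = sum_list (rev ns)" using Cons.prems by simp
	ultimately have "blocks (rev (m # ns)) (rev xs) = blocks (rev ns) (rev (drop m xs)) @ blocks [m] (rev (take m xs))"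
		by (simp add: blocks_append)
	then show ?case using Cons.IH[of "drop m xs"] Cons.prems by simp
qed simp

context substitution
begin

abbreviation rSss where "rSss \<equiv> rev (map rev Sss)"
abbreviation rNs where "rNs \<equiv> rev (map (\<lambda>k. rev_mf (Sss ! k) (Ts ! k) w (Ns ! k)) [0..<length Sss])"

lemma concat_rSss: "concat rSss = rev (concat Sss)"
	by (simp add: rev_concat rev_map)

lemma lengths_rSss: "map length rSss = rev ns"
	by (simp add: rev_map comp_def)

text \<open>Both the order of the blocks and the order inside each block are reversed. Cells between
  different blocks are reflected by the outer multifunctor, cells inside a block already by the
  inner one.\<close>

lemma subst_rev:
	assumes Ts: "fcats Ts" and C: "fcategory C" and M: "multifunctor v w Ts C M"
	shows "rev_mf (concat Sss) C w (mfun_subst Sss M Ns) = mfun_subst rSss (rev_mf Ts C w M) rNs"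
proof -
	let ?U = "concat Sss" and ?R = "rev_mf Ts C w M"
	interpret U: fcats ?U by (rule concat_fcats)
	interpret Ts: fcats Ts by (rule Ts)
	interpret M: mf_setup Ts C M by unfold_locales (rule C)
	have n: "M.nmf v w" using M M.multifunctor_iff_nmf[OF vw] by simp
	interpret M: mf_typed Ts C M v w by unfold_locales (use n in \<open>auto simp: M.nmf_def\<close>)
	let ?m = "length Sss"
	have len: "length xs = sum_list ns" if "xs : tuples ?U" for xs using tuples_length[OF that] by (simp add: length_concat_sum)
	have rN: "rNs ! (?m - Suc k) = rev_mf (Sss ! k) (Ts ! k) w (Ns ! k)" if "k < ?m" for k
		using that by (simp add: rev_nth)
	have rB: "blocks (map length rSss) xs ! (?m - Suc k) = rev (B (rev xs) ! k)" if "k < ?m" "rev xs : tuples ?U" for xs k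
		using blocks_rev[of "rev xs" ns] len[OF that(2)] that(1) unfolding lengths_rSss by (simp add: rev_nth)
	have Bt: "B xs ! k : tuples (Sss ! k)" if "k < ?m" "xs : tuples ?U" for xs k by (rule tuples_concat[OF that(2,1)])
	have obs: "block_obs rSss rNs xs = rev (ys (rev xs))" if xs: "rev xs : tuples ?U" for xs
	proof (rule nth_equalityI)
		fix k assume "k < length (block_obs rSss rNs xs)"
		then have k: "k < ?m" by (simp add: block_obs_def)
		define k' where "k' = ?m - Suc k"
		have k': "k' < ?m" "k = ?m - Suc k'" using k by (auto simp: k'_def)
		have "block_obs rSss rNs xs ! k = m0 (rNs ! k) (blocks (map length rSss) xs ! k)" using k by (simp add: block_obs_def)
		also have "\<dots> = m0 (Ns ! k') (B (rev xs) ! k')"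
			unfolding k'(2) rN[OF k'(1)] rB[OF k'(1) xs] using Bt[OF k'(1) xs] by (simp add: rev_sel)
		also have "\<dots> = rev (ys (rev xs)) ! k" using k by (simp add: rev_nth ys_nth k'_def)
		finally show "block_obs rSss rNs xs ! k = rev (ys (rev xs)) ! k" .
	qed (simp add: block_obs_def lengths)
	have loc: "locate (map length rSss) p = (?m - Suc k, length (Sss ! k) - Suc i)"
		if p: "p < length ?U" and l: "locate ns (length ?U - Suc p) = (k, i)" and k: "k < ?m" for p k i
	proof -
		have "sum_list ns - Suc (length ?U - Suc p) = p" using p by (simp add: length_concat_sum)
		moreover have "length ?U - Suc p < sum_list ns" using p by (simp add: length_concat_sum)
		ultimately show ?thesis using locate_rev[OF _ l] k unfolding lengths_rSss by simp
	qed
	show ?thesis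
	proof (rule mfun_eqI[of "rev ?U"])
		show "mfun_restrict (rev ?U) (mfun_subst rSss ?R rNs) = mfun_subst rSss ?R rNs"
			using mfun_restrict_subst[of rSss ?R rNs] unfolding concat_rSss .
		show "m0 (rev_mf ?U C w (mfun_subst Sss M Ns)) xs = m0 (mfun_subst rSss ?R rNs) xs" if xs: "xs : tuples (rev ?U)" for xs
		proof -
			have t: "rev xs : tuples ?U" using xs by (simp add: tuples_rev)
			show ?thesis
				using subst_sel(1)[of xs rSss ?R rNs, unfolded concat_rSss, OF xs] ys_tuples[OF t] t
				by (simp add: rev_sel subst_sel(1)[OF t] obs[OF t])
		qed
		have one: "m1 (rev_mf (Sss ! k) (Ts ! k) w (Ns ! k)) (length (Sss ! k) - Suc i) (rev (B xs ! k)) s = m1 (Ns ! k) i (B xs ! k) s"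
			if a: "arr_at ?U p xs s" and l: "locate ns p = (k, i)" for p xs s k i
			using arr_at_block[OF a l] arr_at_less[OF arr_at_block[OF a l]] by (simp add: rev_sel)
		show "m1 (rev_mf ?U C w (mfun_subst Sss M Ns)) p xs s = m1 (mfun_subst rSss ?R rNs) p xs s"
			if a: "arr_at (rev ?U) p xs s" for p xs s
		proof -
			obtain k i where l: "locate ns (length ?U - Suc p) = (k, i)" by fastforce
			have p: "p < length ?U" and b: "arr_at ?U (length ?U - Suc p) (rev xs) s" using a by (simp_all add: arr_at_rev)
			note t = arr_at_tuples[OF b] and k = k_less[OF b l] and at = arr_at_ys[OF b l]
			have "m1 (mfun_subst rSss ?R rNs) p xs s = m1 ?R (?m - Suc k) (rev (ys (rev xs))) (m1 (Ns ! k) i (B (rev xs) ! k) s)"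
				using subst_sel(2)[of rSss p xs s _ _ ?R rNs, unfolded concat_rSss, OF a loc[OF p l k]]
				unfolding obs[OF t] rN[OF k] rB[OF k t] one[OF b l] .
			then show ?thesis using k at p b by (simp add: rev_sel subst_sel(2)[OF b l] lengths)
		qed
		show "m2 (rev_mf ?U C w (mfun_subst Sss M Ns)) p xs s = m2 (mfun_subst rSss ?R rNs) p xs s"
			if a: "cell_at (rev ?U) p xs s" for p xs s
		proof -
			obtain k i where l: "locate ns (length ?U - Suc p) = (k, i)" by fastforce
			have p: "p < length ?U" and b: "cell_at ?U (length ?U - Suc p) (rev xs) s" using a by (simp_all add: cell_at_rev)
			have t: "rev xs : tuples ?U" using b by (simp add: cell_at_def)
			note k = cell_k_less[OF b l] and at = cell_at_ys[OF b l] and bl = cell_at_block[OF b l]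
			have i: "i < length (Sss ! k)" using bl by (simp add: cell_at_def)
			have "m2 (rev_mf (Sss ! k) (Ts ! k) w (Ns ! k)) (length (Sss ! k) - Suc i) (rev (B (rev xs) ! k)) s = m2 (Ns ! k) i (B (rev xs) ! k) s"
				using bl i by (simp add: rev_sel)
			then have "m2 (mfun_subst rSss ?R rNs) p xs s = m2 ?R (?m - Suc k) (rev (ys (rev xs))) (m2 (Ns ! k) i (B (rev xs) ! k) s)"
				using subst_sel(3)[of rSss p xs s _ _ ?R rNs, unfolded concat_rSss, OF a loc[OF p l k]]
				unfolding obs[OF t] rN[OF k] rB[OF k t] by simp
			then show ?thesis using k at p b by (simp add: rev_sel subst_sel(3)[OF b l] lengths)
		qed
		show "mx (rev_mf ?U C w (mfun_subst Sss M Ns)) p q xs s t = mx (mfun_subst rSss ?R rNs) p q xs s t"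
			if pq: "p < q" and a: "arr_at (rev ?U) p xs s" "arr_at (rev ?U) q xs t" for p q xs s t
		proof -
			obtain k i where l: "locate ns (length ?U - Suc p) = (k, i)" by fastforce
			obtain h j where l': "locate ns (length ?U - Suc q) = (h, j)" by fastforce
			have p: "p < length ?U" "q < length ?U" and b: "arr_at ?U (length ?U - Suc p) (rev xs) s" "arr_at ?U (length ?U - Suc q) (rev xs) t"
				using a by (simp_all add: arr_at_rev)
			have qp: "length ?U - Suc q < length ?U - Suc p" using pq p by auto
			note x = arr_at_tuples[OF b(1)] and k = k_less[OF b(1) l] and h = k_less[OF b(2) l']
				and at = arr_at_ys[OF b(1) l] arr_at_ys[OF b(2) l'] and bl = arr_at_block[OF b(1) l] arr_at_block[OF b(2) l']
			note S1 = subst_sel(4)[of p q rSss xs s t _ _ _ _ ?R rNs, unfolded concat_rSss, OF pq a loc[OF p(1) l k] loc[OF p(2) l' h],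
					unfolded obs[OF x] rN[OF k] rN[OF h] rB[OF k x] rB[OF h x] one[OF b(1) l] one[OF b(2) l']]
			have S2: "mx (rev_mf ?U C w (mfun_subst Sss M Ns)) p q xs s t =
					reflect C w (mx (mfun_subst Sss M Ns) (length ?U - Suc q) (length ?U - Suc p) (rev xs) t s)"
				by (rule rev_sel(4)[OF pq p(2) b])
			show ?thesis
			proof (cases "h = k")
				\<comment> \<open>The inner cell is reflected before the outer multifunctor is applied, on the
				  other side afterwards. The slice of \<open>M\<close> in position \<open>k\<close> is a
				  2-functor and so commutes with reflection.\<close>
				case True
				note l'' = l'[unfolded True]
				let ?al = "mx (Ns ! k) j i (B (rev xs) ! k) t s"
				interpret K: mf_typed "Sss ! k" "Ts ! k" "Ns ! k" v w by (rule block_typed[OF k])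
				note ji = same_less[OF qp b(2,1) l'' l] and sc = same_cell_at[OF qp b(2,1) l'' l]
				have il: "i < length (Sss ! k)" using bl(1) by (simp add: arr_at_def)
				have kl: "k < length Ts" using k by (simp add: lengths)
				have yt: "ys (rev xs) : tuples Ts" by (rule ys_tuples[OF x])
				interpret F: twofun "Ts ! k" C "slice Ts M k (ys (rev xs))"
					by (rule M.slice_twofun[OF M.typed_fun[OF kl] yt kl])
				have m2s: "m2 M k (ys (rev xs)) be = F2 (slice Ts M k (ys (rev xs))) be" if "cell_at Ts k (ys (rev xs)) be" for be
					using that by (simp add: slice_def cell_at_def)
				have al: "?al : Cell (Ts ! k)" "strong (Ts ! k) w ?al"
					using K.tx_cell[OF ji bl(2)[unfolded True] bl(1)] K.tx_strong[OF ji bl(2)[unfolded True] bl(1)] by simp_all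
				have rc: "cell_at Ts k (ys (rev xs)) (reflect (Ts ! k) w ?al)"
					using sc al K.C.Dom_Src_reflect[OF al] K.C.reflect_cell[OF al] by (simp add: cell_at_def)
				have rm: "mx (rev_mf (Sss ! k) (Ts ! k) w (Ns ! k)) (length (Sss ! k) - Suc i) (length (Sss ! k) - Suc j) (rev (B (rev xs) ! k)) s t
						= reflect (Ts ! k) w ?al"
					using ji il bl(1) bl(2)[unfolded True] by (simp add: rev_sel)
				have "mx (mfun_subst rSss ?R rNs) p q xs s t = m2 ?R (?m - Suc k) (rev (ys (rev xs))) (reflect (Ts ! k) w ?al)"
					using S1 rm True by simp
				also have "\<dots> = m2 M k (ys (rev xs)) (reflect (Ts ! k) w ?al)" using rc kl lengths by (simp add: rev_sel)
				also have "\<dots> = reflect C w (m2 M k (ys (rev xs)) ?al)"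
					unfolding m2s[OF rc] m2s[OF sc] by (rule F.F2_reflect[OF al])
				also have "\<dots> = mx (rev_mf ?U C w (mfun_subst Sss M Ns)) p q xs s t"
					unfolding S2 using subst_sel(4)[OF qp b(2,1) l'' l, of M] by simp
				finally show ?thesis by simp
			next
				case False
				have hk: "h < k" by (rule locate_diff[OF qp b(1) l' l False])
				have ne: "?m - Suc k ~= ?m - Suc h" "?m - Suc k < ?m - Suc h" using hk k h by auto
				have "mx (mfun_subst rSss ?R rNs) p q xs s t =
						mx ?R (?m - Suc k) (?m - Suc h) (rev (ys (rev xs))) (m1 (Ns ! k) i (B (rev xs) ! k) s) (m1 (Ns ! h) j (B (rev xs) ! h) t)"
					using S1 ne(1) by simp
				also have "\<dots> = reflect C w (mx M h k (ys (rev xs)) (m1 (Ns ! h) j (B (rev xs) ! h) t) (m1 (Ns ! k) i (B (rev xs) ! k) s))"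
					using at ne(2) k h lengths by (simp add: rev_sel)
				also have "\<dots> = mx (rev_mf ?U C w (mfun_subst Sss M Ns)) p q xs s t"
					unfolding S2 using subst_sel(4)[OF qp b(2,1) l' l, of M] False by simp
				finally show ?thesis by simp
			qed
		qed
	qed simp
qed

end

section \<open>Transfer of closedness along a reversal of multicategories\<close>

section \<open>Left closedness\<close>

lemma rev_map_upt: "k < n ==> rev (map f [0..<n]) ! k = f (n - Suc k)"
	by (simp add: rev_nth)

text \<open>An isomorphism onto a multicategory with the same objects that reverses the lists of
  sources, with inverse \<open>\<sigma>\<close>. In this abstract form the passage from right to
  left homs is free of sketches.\<close>

locale reversal =
	fixes M N :: "('x, 'm) multicat" and \<rho> \<sigma> :: "'x list => 'x => 'm => 'm"
	assumes ob: "mc_ob N = mc_ob M"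
		and id_hom: "X : mc_ob M ==> mc_id M X : mc_hom M [X] X"
		and rho: "set Xs \<subseteq> mc_ob M ==> Z : mc_ob M ==> f : mc_hom M Xs Z ==> \<rho> Xs Z f : mc_hom N (rev Xs) Z"
		and sigma: "set Xs \<subseteq> mc_ob M ==> Z : mc_ob M ==> f : mc_hom N Xs Z ==> \<sigma> Xs Z f : mc_hom M (rev Xs) Z"
		and sigma_rho: "set Xs \<subseteq> mc_ob M ==> Z : mc_ob M ==> f : mc_hom M Xs Z ==> \<sigma> (rev Xs) Z (\<rho> Xs Z f) = f"
		and rho_sigma: "set Xs \<subseteq> mc_ob M ==> Z : mc_ob M ==> f : mc_hom N Xs Z ==> \<rho> (rev Xs) Z (\<sigma> Xs Z f) = f"
		and rho_id: "X : mc_ob M ==> \<rho> [X] X (mc_id M X) = mc_id N X"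
		and rho_comp: "set Ys \<subseteq> mc_ob M ==> Z : mc_ob M ==> mc_family M Vss Ys fs ==> g : mc_hom M Ys Z ==>
			\<rho> (concat Vss) Z (mc_comp M Vss Ys Z g fs) =
			mc_comp N (rev (map rev Vss)) (rev Ys) Z (\<rho> Ys Z g) (rev (map (\<lambda>k. \<rho> (Vss ! k) (Ys ! k) (fs ! k)) [0..<length Ys]))"
		and sigma_comp: "set Ys \<subseteq> mc_ob M ==> Z : mc_ob M ==> mc_family N Vss Ys fs ==> g : mc_hom N Ys Z ==>
			\<sigma> (concat Vss) Z (mc_comp N Vss Ys Z g fs) =
			mc_comp M (rev (map rev Vss)) (rev Ys) Z (\<sigma> Ys Z g) (rev (map (\<lambda>k. \<sigma> (Vss ! k) (Ys ! k) (fs ! k)) [0..<length Ys]))"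
begin

abbreviation rhos where "rhos Vss Ys fs \<equiv> rev (map (\<lambda>k. \<rho> (Vss ! k) (Ys ! k) (fs ! k)) [0..<length Ys])"

lemma rho_family:
	assumes "mc_family M Vss Ys fs" "set Ys \<subseteq> mc_ob M"
	shows "mc_family N (rev (map rev Vss)) (rev Ys) (rhos Vss Ys fs)"
	unfolding mc_family_def
proof (intro conjI allI impI)
	fix k assume "k < length (rev Ys)"
	then have k: "length Ys - Suc k < length Ys" "k < length Ys" and l: "length Vss = length Ys" using assms(1) by (auto simp: mc_family_def)
	have "set (Vss ! (length Ys - Suc k)) \<subseteq> mc_ob M"
		"fs ! (length Ys - Suc k) : mc_hom M (Vss ! (length Ys - Suc k)) (Ys ! (length Ys - Suc k))"
		using assms(1) k(1) by (simp_all add: mc_family_def)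
	moreover have "Ys ! (length Ys - Suc k) : mc_ob M" using assms(2) nth_mem[OF k(1)] by blast
	ultimately show "set (rev (map rev Vss) ! k) \<subseteq> mc_ob N" "rhos Vss Ys fs ! k : mc_hom N (rev (map rev Vss) ! k) (rev Ys ! k)"
		using k l rho by (simp_all add: ob rev_nth)
qed (use assms in \<open>simp_all add: mc_family_def\<close>)

lemma rhos_singles:
	assumes "set Ys \<subseteq> mc_ob M"
	shows "rhos (map (\<lambda>Y. [Y]) Ys) Ys (map (mc_id M) Ys) = map (mc_id N) (rev Ys)"
proof -
	have "map (\<lambda>k. \<rho> (map (\<lambda>Y. [Y]) Ys ! k) (Ys ! k) (map (mc_id M) Ys ! k)) [0..<length Ys] = map (mc_id N) Ys"
		by (rule nth_equalityI) (use assms rho_id nth_mem in \<open>auto simp: subset_iff\<close>)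
	then show ?thesis by (simp add: rev_map)
qed

text \<open>A first argument becomes the last one after reversal, which is where right closedness
  acts.\<close>

lemma rhos_Cons: "rhos (V # Vss) (Y # Ys) (f # fs) = rhos Vss Ys fs @ [\<rho> V Y f]"
proof -
	have "[0..<length (Y # Ys)] = 0 # map Suc [0..<length Ys]" by (simp add: map_Suc_upt upt_conv_Cons del: upt_Suc)
	then show ?thesis by (simp add: comp_def)
qed

lemma rev_involution:
	assumes V: "mc_family M Vss Ys fs" and Ys: "set Ys \<subseteq> mc_ob M"
	shows "rev (map (\<lambda>k. \<sigma> (rev (map rev Vss) ! k) (rev Ys ! k) (rhos Vss Ys fs ! k)) [0..<length (rev Ys)]) = fs"
proof (rule nth_equalityI)
	show "length (rev (map (\<lambda>k. \<sigma> (rev (map rev Vss) ! k) (rev Ys ! k) (rhos Vss Ys fs ! k)) [0..<length (rev Ys)])) = length fs"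
		using V by (simp add: mc_family_def)
	fix k assume "k < length (rev (map (\<lambda>k. \<sigma> (rev (map rev Vss) ! k) (rev Ys ! k) (rhos Vss Ys fs ! k)) [0..<length (rev Ys)]))"
	then have k: "k < length Ys" by simp
	have l: "length Vss = length Ys" "set (Vss ! k) \<subseteq> mc_ob M" "fs ! k : mc_hom M (Vss ! k) (Ys ! k)"
		using V k by (simp_all add: mc_family_def)
	have k2: "k < length (rev Ys)" "length (rev Ys) - Suc k < length Ys" using k by simp_all
	have "Ys ! k : mc_ob M" using Ys nth_mem[OF k] by blast
	then show "rev (map (\<lambda>k. \<sigma> (rev (map rev Vss) ! k) (rev Ys ! k) (rhos Vss Ys fs ! k)) [0..<length (rev Ys)]) ! k = fs ! k"
		unfolding rev_map_upt[OF k2(1)] rev_map_upt[OF k2(2)]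
		using sigma_rho[OF l(2) _ l(3)] k l(1) by (simp add: rev_nth)
qed

text \<open>The left bijection is the right one conjugated by the reversal: \<open>\<rho>\<close>
  moves \<open>X\<close> from the front to the end, \<open>\<theta>\<close> removes it there, and
  \<open>\<sigma>\<close> restores the order of the other sources. Each naturality condition is
  transported in the same way.\<close>

theorem left_closed_reversal:
	assumes R: "right_closed_on N D H"
	shows "left_closed_on M D H"
proof -
	obtain \<theta> where
		obs: "\<forall>(Y, Z)\<in>D. Y : mc_ob N & Z : mc_ob N & H Y Z : mc_ob N"
		and bij: "\<forall>(Y, Z)\<in>D. \<forall>Xs. set Xs \<subseteq> mc_ob N --> bij_betw (\<theta> Y Z Xs) (mc_hom N (Xs @ [Y]) Z) (mc_hom N Xs (H Y Z))"
		and n1: "\<forall>(Y, Z)\<in>D. \<forall>Xs Vss fs. set Xs \<subseteq> mc_ob N & mc_family N Vss Xs fs -->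
					(\<forall>g\<in>mc_hom N (Xs @ [Y]) Z.
						 \<theta> Y Z (concat Vss) (mc_comp N (Vss @ [[Y]]) (Xs @ [Y]) Z g (fs @ [mc_id N Y])) =
						 mc_comp N Vss Xs (H Y Z) (\<theta> Y Z Xs g) fs)"
		and n2: "\<forall>Y Y' Z. (Y, Z) : D & (Y', Z) : D -->
					(\<forall>f\<in>mc_hom N [Y'] Y. \<exists>h\<in>mc_hom N [H Y Z] (H Y' Z).
						 \<forall>Xs. set Xs \<subseteq> mc_ob N --> (\<forall>g\<in>mc_hom N (Xs @ [Y]) Z.
							 \<theta> Y' Z Xs (mc_comp N (map (\<lambda>X. [X]) Xs @ [[Y']]) (Xs @ [Y]) Z g (map (mc_id N) Xs @ [f])) =
							 mc_comp N [Xs] [H Y Z] (H Y' Z) h [\<theta> Y Z Xs g]))"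
		and n3: "\<forall>Y Z Z'. (Y, Z) : D & (Y, Z') : D -->
					(\<forall>f\<in>mc_hom N [Z] Z'. \<exists>h\<in>mc_hom N [H Y Z] (H Y Z').
						 \<forall>Xs. set Xs \<subseteq> mc_ob N --> (\<forall>g\<in>mc_hom N (Xs @ [Y]) Z.
							 \<theta> Y Z' Xs (mc_comp N [Xs @ [Y]] [Z] Z' f [g]) =
							 mc_comp N [Xs] [H Y Z] (H Y Z') h [\<theta> Y Z Xs g]))"
		using R unfolding right_closed_on_def by (elim conjE exE) (rule that)
	have D: "X : mc_ob M" "Z : mc_ob M" "H X Z : mc_ob M" if "(X, Z) : D" for X Z
		using bspec[OF obs that] by (simp_all add: ob)
	have bij': "bij_betw (\<theta> X Z Xs) (mc_hom N (Xs @ [X]) Z) (mc_hom N Xs (H X Z))" if "(X, Z) : D" "set Xs \<subseteq> mc_ob M" for X Z Xs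
		using bspec[OF bij that(1)] that(2) by (simp add: ob)
	define \<eta> where "\<eta> X Z Ys g = \<sigma> (rev Ys) (H X Z) (\<theta> X Z (rev Ys) (\<rho> (X # Ys) Z g))" for X Z Ys g
	have rg: "\<rho> (X # Ys) Z g : mc_hom N (rev Ys @ [X]) Z" and tg: "\<theta> X Z (rev Ys) (\<rho> (X # Ys) Z g) : mc_hom N (rev Ys) (H X Z)"
		and eg: "\<eta> X Z Ys g : mc_hom M Ys (H X Z)"
		if d: "(X, Z) : D" and Ys: "set Ys \<subseteq> mc_ob M" and g: "g : mc_hom M (X # Ys) Z" for X Z Ys g
	proof -
		show 1: "\<rho> (X # Ys) Z g : mc_hom N (rev Ys @ [X]) Z" using rho[of "X # Ys" Z g] D[OF d] Ys g by simp
		show 2: "\<theta> X Z (rev Ys) (\<rho> (X # Ys) Z g) : mc_hom N (rev Ys) (H X Z)"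
			using bij_betw_apply[OF bij'[OF d, of "rev Ys"] 1] Ys by simp
		show "\<eta> X Z Ys g : mc_hom M Ys (H X Z)"
			using sigma[of "rev Ys", OF _ D(3)[OF d] 2] Ys by (simp add: \<eta>_def)
	qed
	\<comment> \<open>A list with one entry is its own reverse, so composition with a unary
	  \<open>h\<close> passes through \<open>\<sigma>\<close>.\<close>
	have single: "\<sigma> (rev Ys) Z' (mc_comp N [rev Ys] [K] Z' h [k]) = mc_comp M [Ys] [K] Z' (\<sigma> [K] Z' h) [\<sigma> (rev Ys) K k]"
		if "set Ys \<subseteq> mc_ob M" "K : mc_ob M" "Z' : mc_ob M" "h : mc_hom N [K] Z'" "k : mc_hom N (rev Ys) K" for Ys K Z' h k
		using sigma_comp[of "[K]" Z' "[rev Ys]" "[k]" h] that by (simp add: mc_family_def ob)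
	show ?thesis
		unfolding left_closed_on_def
	proof (intro conjI exI[of _ \<eta>], goal_cases)
		case 1 show ?case using D by blast
	next
		case 2 show ?case
		proof (clarify)
			fix X Z Ys assume d: "(X, Z) : D" and Ys: "set Ys \<subseteq> mc_ob M"
			have Y': "set (rev Ys) \<subseteq> mc_ob M" "set (X # Ys) \<subseteq> mc_ob M" "set (rev Ys @ [X]) \<subseteq> mc_ob M" using Ys D[OF d] by auto
			have 1: "bij_betw (\<rho> (X # Ys) Z) (mc_hom M (X # Ys) Z) (mc_hom N (rev Ys @ [X]) Z)"
				using rho[OF Y'(2) D(2)[OF d]] sigma[OF Y'(3) D(2)[OF d]] sigma_rho[OF Y'(2) D(2)[OF d]] rho_sigma[OF Y'(3) D(2)[OF d]]
				by (intro bij_betw_byWitness[where f' = "\<sigma> (rev Ys @ [X]) Z"]) auto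
			have 2: "bij_betw (\<sigma> (rev Ys) (H X Z)) (mc_hom N (rev Ys) (H X Z)) (mc_hom M Ys (H X Z))"
				using rho[OF Ys D(3)[OF d]] sigma[OF Y'(1) D(3)[OF d]] sigma_rho[OF Ys D(3)[OF d]] rho_sigma[OF Y'(1) D(3)[OF d]]
				by (intro bij_betw_byWitness[where f' = "\<rho> Ys (H X Z)"]) auto
			have "bij_betw (\<sigma> (rev Ys) (H X Z) \<circ> (\<theta> X Z (rev Ys) \<circ> \<rho> (X # Ys) Z)) (mc_hom M (X # Ys) Z) (mc_hom M Ys (H X Z))"
				by (rule bij_betw_trans[OF bij_betw_trans[OF 1 bij'[OF d Y'(1)]] 2])
			then show "bij_betw (\<eta> X Z Ys) (mc_hom M (X # Ys) Z) (mc_hom M Ys (H X Z))"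
				by (rule bij_betw_cong[THEN iffD1, rotated]) (simp add: \<eta>_def)
		qed
	next
		case 3 show ?case
		proof (clarify)
			fix X Z Ys Vss fs g
			assume d: "(X, Z) : D" and Ys: "set Ys \<subseteq> mc_ob M" and fs: "mc_family M Vss Ys fs" and g: "g : mc_hom M (X # Ys) Z"
			let ?c = "mc_comp M ([X] # Vss) (X # Ys) Z g (mc_id M X # fs)"
			have XY: "set (X # Ys) \<subseteq> mc_ob M" "set (rev Ys) \<subseteq> mc_ob M" using Ys D[OF d] by auto
			have fam: "mc_family M ([X] # Vss) (X # Ys) (mc_id M X # fs)"
				using fs D[OF d] id_hom[OF D(1)[OF d]] by (auto simp: mc_family_def nth_Cons split: nat.splits)
			have cr: "rev (concat Vss) = concat (rev (map rev Vss))" by (simp add: rev_concat rev_map)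
			have "\<rho> (X # concat Vss) Z (?c) =
					mc_comp N (rev (map rev Vss) @ [[X]]) (rev Ys @ [X]) Z (\<rho> (X # Ys) Z g) (rhos Vss Ys fs @ [mc_id N X])"
				using rho_comp[OF XY(1) D(2)[OF d] fam g] unfolding rhos_Cons rho_id[OF D(1)[OF d]] by simp
			then have "\<theta> X Z (rev (concat Vss)) (\<rho> (X # concat Vss) Z (?c)) =
					mc_comp N (rev (map rev Vss)) (rev Ys) (H X Z) (\<theta> X Z (rev Ys) (\<rho> (X # Ys) Z g)) (rhos Vss Ys fs)"
				using bspec[OF n1 d] rho_family[OF fs Ys] rg[OF d Ys g] XY(2) by (simp add: cr ob)
			then have "\<eta> X Z (concat Vss) (?c) =
					\<sigma> (concat (rev (map rev Vss))) (H X Z) (mc_comp N (rev (map rev Vss)) (rev Ys) (H X Z) (\<theta> X Z (rev Ys) (\<rho> (X # Ys) Z g)) (rhos Vss Ys fs))"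
				by (simp only: \<eta>_def cr)
			\<comment> \<open>Reversing lists and blocks twice restores \<open>Vss\<close>, \<open>Ys\<close>
			  and \<open>fs\<close>.\<close>
			also have "\<dots> = mc_comp M (rev (map rev (rev (map rev Vss)))) (rev (rev Ys)) (H X Z) (\<eta> X Z Ys g) fs"
				unfolding sigma_comp[OF XY(2) D(3)[OF d] rho_family[OF fs Ys] tg[OF d Ys g]] rev_involution[OF fs Ys] by (simp only: \<eta>_def)
			finally show "\<eta> X Z (concat Vss) (?c) =
						 mc_comp M Vss Ys (H X Z) (\<eta> X Z Ys g) fs" by (simp add: rev_map comp_def)
		qed
	next
		case 4 show ?case
		proof (intro allI impI ballI, elim conjE, goal_cases)
			case (1 X X' Z f)
			have d: "(X, Z) : D" "(X', Z) : D" and f: "f : mc_hom M [X'] X" by (fact 1)+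
			have rf: "\<rho> [X'] X f : mc_hom N [X'] X" using rho[of "[X']" X f] D[OF d(1)] D[OF d(2)] f by simp
			then obtain h where h: "h : mc_hom N [H X Z] (H X' Z)"
				and hn: "!!Xs g. set Xs \<subseteq> mc_ob M ==> g : mc_hom N (Xs @ [X]) Z ==>
							 \<theta> X' Z Xs (mc_comp N (map (\<lambda>X. [X]) Xs @ [[X']]) (Xs @ [X]) Z g (map (mc_id N) Xs @ [\<rho> [X'] X f])) =
							 mc_comp N [Xs] [H X Z] (H X' Z) h [\<theta> X Z Xs g]"
				using n2[unfolded ob, rule_format, OF conjI[OF d] rf] by blast
			show ?case
			proof (intro bexI[of _ "\<sigma> [H X Z] (H X' Z) h"] allI impI ballI)
				show "\<sigma> [H X Z] (H X' Z) h : mc_hom M [H X Z] (H X' Z)" using sigma[of "[H X Z]" "H X' Z" h] D[OF d(1)] D[OF d(2)] h by simp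
				fix Ys g assume Ys: "set Ys \<subseteq> mc_ob M" and g: "g : mc_hom M (X # Ys) Z"
				let ?c = "mc_comp M ([X'] # map (\<lambda>Y. [Y]) Ys) (X # Ys) Z g (f # map (mc_id M) Ys)"
				have XY: "set (X # Ys) \<subseteq> mc_ob M" "set (rev Ys) \<subseteq> mc_ob M" using Ys D[OF d(1)] by auto
				have fam: "mc_family M ([X'] # map (\<lambda>Y. [Y]) Ys) (X # Ys) (f # map (mc_id M) Ys)"
					unfolding mc_family_def
				proof (intro conjI allI impI)
					fix k assume k: "k < length (X # Ys)"
					show "set (([X'] # map (\<lambda>Y. [Y]) Ys) ! k) \<subseteq> mc_ob M"
						"(f # map (mc_id M) Ys) ! k : mc_hom M (([X'] # map (\<lambda>Y. [Y]) Ys) ! k) ((X # Ys) ! k)"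
						using f D[OF d(2)] k id_hom[OF subsetD[OF Ys nth_mem]] subsetD[OF Ys nth_mem] by (cases k; simp)+
				qed simp_all
				have c: "concat ([X'] # map (\<lambda>Y. [Y]) Ys) = X' # Ys" by (simp add: map_list_single[of Ys])
				have s: "rev (map rev ([X'] # map (\<lambda>Y. [Y]) Ys)) = map (\<lambda>Y. [Y]) (rev Ys) @ [[X']]" by (simp add: comp_def rev_map)
				have "\<rho> (X' # Ys) Z (?c) =
					mc_comp N (map (\<lambda>Y. [Y]) (rev Ys) @ [[X']]) (rev Ys @ [X]) Z (\<rho> (X # Ys) Z g) (map (mc_id N) (rev Ys) @ [\<rho> [X'] X f])"
					using rho_comp[OF XY(1) D(2)[OF d(1)] fam g] unfolding c s rhos_Cons rhos_singles[OF Ys] by simp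
				then have "\<eta> X' Z Ys (?c) =
						\<sigma> (rev Ys) (H X' Z) (mc_comp N [rev Ys] [H X Z] (H X' Z) h [\<theta> X Z (rev Ys) (\<rho> (X # Ys) Z g)])"
					using hn[OF XY(2) rg[OF d(1) Ys g]] by (simp only: \<eta>_def)
				also have "\<dots> = mc_comp M [Ys] [H X Z] (H X' Z) (\<sigma> [H X Z] (H X' Z) h) [\<eta> X Z Ys g]"
					using single[OF Ys D(3)[OF d(1)] D(3)[OF d(2)] h tg[OF d(1) Ys g]] by (simp only: \<eta>_def)
				finally show "\<eta> X' Z Ys (?c) =
							 mc_comp M [Ys] [H X Z] (H X' Z) (\<sigma> [H X Z] (H X' Z) h) [\<eta> X Z Ys g]" .
			qed
		qed
	next
		case 5 show ?case
		proof (intro allI impI ballI, elim conjE, goal_cases)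
			case (1 X Z Z' f)
			have d: "(X, Z) : D" "(X, Z') : D" and f: "f : mc_hom M [Z] Z'" by (fact 1)+
			have rf: "\<rho> [Z] Z' f : mc_hom N [Z] Z'" using rho[of "[Z]" Z' f] D[OF d(1)] D[OF d(2)] f by simp
			then obtain h where h: "h : mc_hom N [H X Z] (H X Z')"
				and hn: "!!Xs g. set Xs \<subseteq> mc_ob M ==> g : mc_hom N (Xs @ [X]) Z ==>
							 \<theta> X Z' Xs (mc_comp N [Xs @ [X]] [Z] Z' (\<rho> [Z] Z' f) [g]) = mc_comp N [Xs] [H X Z] (H X Z') h [\<theta> X Z Xs g]"
				using n3[unfolded ob, rule_format, OF conjI[OF d] rf] by blast
			show ?case
			proof (intro bexI[of _ "\<sigma> [H X Z] (H X Z') h"] allI impI ballI)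
				show "\<sigma> [H X Z] (H X Z') h : mc_hom M [H X Z] (H X Z')" using sigma[of "[H X Z]" "H X Z'" h] D[OF d(1)] D[OF d(2)] h by simp
				fix Ys g assume Ys: "set Ys \<subseteq> mc_ob M" and g: "g : mc_hom M (X # Ys) Z"
				let ?c = "mc_comp M [X # Ys] [Z] Z' f [g]"
				have XY: "set (X # Ys) \<subseteq> mc_ob M" "set (rev Ys) \<subseteq> mc_ob M" using Ys D[OF d(1)] by auto
				have "\<rho> (X # Ys) Z' (?c) = mc_comp N [rev Ys @ [X]] [Z] Z' (\<rho> [Z] Z' f) [\<rho> (X # Ys) Z g]"
					using rho_comp[of "[Z]" Z' "[X # Ys]" "[g]" f] f g D[OF d(1)] D[OF d(2)] XY(1) by (simp add: mc_family_def)
				then have "\<eta> X Z' Ys (?c) =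
						\<sigma> (rev Ys) (H X Z') (mc_comp N [rev Ys] [H X Z] (H X Z') h [\<theta> X Z (rev Ys) (\<rho> (X # Ys) Z g)])"
					using hn[OF XY(2) rg[OF d(1) Ys g]] by (simp only: \<eta>_def)
				also have "\<dots> = mc_comp M [Ys] [H X Z] (H X Z') (\<sigma> [H X Z] (H X Z') h) [\<eta> X Z Ys g]"
					using single[OF Ys D(3)[OF d(1)] D(3)[OF d(2)] h tg[OF d(1) Ys g]] by (simp only: \<eta>_def)
				finally show "\<eta> X Z' Ys (?c) =
							 mc_comp M [Ys] [H X Z] (H X Z') (\<sigma> [H X Z] (H X Z') h) [\<eta> X Z Ys g]" .
			qed
		qed
	qed
qed

end

lemma multimodel_reversible:
	assumes "v \<preceq> w" "set Xs \<subseteq> {S. small_sketch small S}" "fcategory (scat Z)" "multimodel v w Xs Z f"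
	shows "reversible (map scat Xs) (scat Z) f v w"
proof -
	interpret fcats "map scat Xs" by (rule sketches_fcats) (use assms(2) in auto)
	interpret N: mf_setup "map scat Xs" "scat Z" f by unfold_locales (rule assms)
	have n: "N.nmf v w" using assms(4) N.multifunctor_iff_nmf[OF assms(1)] by (simp add: multimodel_def)
	show ?thesis by unfold_locales (use n assms in \<open>auto simp: N.nmf_def\<close>)
qed

lemma rev_multimodel:
	assumes vw: "v \<preceq> w" and Xs: "set Xs \<subseteq> {S. small_sketch small S}" and Z: "fcategory (scat Z)" and f: "multimodel v w Xs Z f"
	shows "multimodel (dual v) (dual w) (rev Xs) Z (rev_mf (map scat Xs) (scat Z) w f)"
		and "rev_mf (map scat (rev Xs)) (scat Z) (dual w) (rev_mf (map scat Xs) (scat Z) w f) = f"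
proof -
	interpret reversible "map scat Xs" "scat Z" f v w by (rule multimodel_reversible[OF assms])
	show "rev_mf (map scat (rev Xs)) (scat Z) (dual w) (rev_mf (map scat Xs) (scat Z) w f) = f"
		using rev_rev by (simp add: rev_map)
	have "model (rev Xs ! i) Z (slice (rev (map scat Xs)) R i xs)" if i: "i < length Xs" and xs: "xs : tuples (rev (map scat Xs))" for i xs
		using slice_rev[OF xs] f i xs by (simp add: multimodel_def rev_nth tuples_rev)
	then show "multimodel (dual v) (dual w) (rev Xs) Z (rev_mf (map scat Xs) (scat Z) w f)"
		using rev_multifunctor by (simp add: multimodel_def rev_map)
qed

lemma rev_mfun_id: "rev_mf [S] C w (mfun_id S) = mfun_id S"
proof (rule mfun_eqI[of "[S]"])
	show "mfun_restrict [S] (rev_mf [S] C w (mfun_id S)) = rev_mf [S] C w (mfun_id S)" by (simp add: rev_mf_def)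
	show "mfun_restrict [S] (mfun_id S) = mfun_id S" by (simp add: mfun_id_def)
qed (auto simp: rev_mf_def mfun_restrict_def tuples_single arr_at_single cell_at_single)

lemma rev_comp:
	assumes vw: "v \<preceq> w" and Ys: "set Ys \<subseteq> {S. small_sketch small S}" and Z: "fcategory (scat Z)"
		and fs: "mc_family (FSK small v w) Vss Ys fs" and g: "multimodel v w Ys Z g"
	shows "rev_mf (map scat (concat Vss)) (scat Z) w (mfun_subst (map (map scat) Vss) g fs) =
		mfun_subst (map (map scat) (rev (map rev Vss))) (rev_mf (map scat Ys) (scat Z) w g)
			(rev (map (\<lambda>k. rev_mf (map scat (Vss ! k)) (scat (Ys ! k)) w (fs ! k)) [0..<length Ys]))"
proof -
	interpret substitution "map (map scat) Vss" "map scat Ys" fs v w by (rule FSK_substitution[OF vw fs Ys])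
	have l: "length Vss = length Ys" using fs by (simp add: mc_family_def)
	have 1: "map (map scat) (rev (map rev Vss)) = rev (map rev (map (map scat) Vss))" by (simp add: rev_map)
	have 2: "rNs = rev (map (\<lambda>k. rev_mf (map scat (Vss ! k)) (scat (Ys ! k)) w (fs ! k)) [0..<length Ys])"
		by (simp add: l)
	have "fcats (map scat Ys)" by (rule sketches_fcats) (use Ys in auto)
	moreover have "multifunctor v w (map scat Ys) (scat Z) g" using g by (simp add: multimodel_def)
	ultimately show ?thesis unfolding 1 map_concat using subst_rev[OF _ Z] by (simp only: 2)
qed

text \<open>Reversal turns \<open>FSK small v w\<close> into the multicategory for the dual
  weaknesses, and its inverse is reversal for these. The hom sketches themselves are untouched,
  which is why they carry dual weaknesses here.\<close>

theorem left_closed_Mod: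
	fixes small :: "'u set => bool"
	assumes vw: "v \<preceq> w" and H: "Mod_homs small (dual v) (dual w) D L"
	shows "left_closed_on (FSK small v w) D L"
proof -
	note vw' = dual_mono[OF vw]
	interpret reversal "FSK small v w" "FSK small (dual v) (dual w)" "\<lambda>Xs Z f. rev_mf (map scat Xs) (scat Z) w f"
		"\<lambda>Xs Z f. rev_mf (map scat Xs) (scat Z) (dual w) f"
	proof
		fix Xs :: "'u sk list" and Z :: "'u sk" and f
		assume "set Xs \<subseteq> mc_ob (FSK small v w)" "Z : mc_ob (FSK small v w)"
		then have a: "set Xs \<subseteq> {S. small_sketch small S}" "fcategory (scat Z)" by (auto intro: small_sketch_fcategory)
		show "rev_mf (map scat Xs) (scat Z) w f : mc_hom (FSK small (dual v) (dual w)) (rev Xs) Z"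
			"rev_mf (map scat (rev Xs)) (scat Z) (dual w) (rev_mf (map scat Xs) (scat Z) w f) = f" if "f : mc_hom (FSK small v w) Xs Z"
			using rev_multimodel[OF vw a] that by simp_all
		show "rev_mf (map scat Xs) (scat Z) (dual w) f : mc_hom (FSK small v w) (rev Xs) Z"
			"rev_mf (map scat (rev Xs)) (scat Z) w (rev_mf (map scat Xs) (scat Z) (dual w) f) = f" if "f : mc_hom (FSK small (dual v) (dual w)) Xs Z"
			using rev_multimodel[OF vw' a] that by simp_all
	next
		fix Ys :: "'u sk list" and Z :: "'u sk" and Vss fs g
		assume "set Ys \<subseteq> mc_ob (FSK small v w)" "Z : mc_ob (FSK small v w)"
		then have a: "set Ys \<subseteq> {S. small_sketch small S}" "fcategory (scat Z)" by (auto intro: small_sketch_fcategory)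
		show "rev_mf (map scat (concat Vss)) (scat Z) w (mc_comp (FSK small v w) Vss Ys Z g fs) =
			mc_comp (FSK small (dual v) (dual w)) (rev (map rev Vss)) (rev Ys) Z (rev_mf (map scat Ys) (scat Z) w g)
			 (rev (map (\<lambda>k. rev_mf (map scat (Vss ! k)) (scat (Ys ! k)) w (fs ! k)) [0..<length Ys]))"
			if "mc_family (FSK small v w) Vss Ys fs" "g : mc_hom (FSK small v w) Ys Z"
			using rev_comp[OF vw a that(1)] that(2) by simp
		show "rev_mf (map scat (concat Vss)) (scat Z) (dual w) (mc_comp (FSK small (dual v) (dual w)) Vss Ys Z g fs) =
			mc_comp (FSK small v w) (rev (map rev Vss)) (rev Ys) Z (rev_mf (map scat Ys) (scat Z) (dual w) g)
			 (rev (map (\<lambda>k. rev_mf (map scat (Vss ! k)) (scat (Ys ! k)) (dual w) (fs ! k)) [0..<length Ys]))"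
			if "mc_family (FSK small (dual v) (dual w)) Vss Ys fs" "g : mc_hom (FSK small (dual v) (dual w)) Ys Z"
			using rev_comp[OF vw' a that(1)] that(2) by simp
	next
		fix X :: "'u sk" assume "X : mc_ob (FSK small v w)"
		then have X: "small_sketch small X" by simp
		show "mc_id (FSK small v w) X : mc_hom (FSK small v w) [X] X"
			using unary_multimodel[OF small_sketch_fcategory[OF X] small_sketch_id[OF X]] by (simp add: mfun_id_unary)
	qed (simp_all add: rev_mfun_id)
	show ?thesis by (rule left_closed_reversal[OF right_closed_Mod[OF vw' H]])
qed

section \<open>Transport of a sketch along injections of its carriers\<close>

section \<open>Small copies of sketches\<close>

text \<open>The structure of \<open>K\<close> carried along three injections;
  \<open>inv_into\<close> reads an element of the image back.\<close>

definition transport where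
	"transport K fo fa ft =
		 (let ho = inv_into (Obj K) fo; ha = inv_into (Arr K) fa; ht = inv_into (Cell K) ft in
			\<lparr>Obj = fo ` Obj K, Arr = fa ` Arr K, Tight = fa ` Tight K, Cell = ft ` Cell K,
			 Dom = (\<lambda>f. fo (Dom K (ha f))), Cod = (\<lambda>f. fo (Cod K (ha f))),
			 Idn = (\<lambda>x. fa (Idn K (ho x))), Cmp = (\<lambda>g f. fa (Cmp K (ha g) (ha f))),
			 Src = (\<lambda>t. fa (Src K (ht t))), Tgt = (\<lambda>t. fa (Tgt K (ht t))),
			 VId = (\<lambda>f. ft (VId K (ha f))), VCmp = (\<lambda>t s. ft (VCmp K (ht t) (ht s))),
			 HCmp = (\<lambda>t s. ft (HCmp K (ht t) (ht s)))\<rparr>)"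

locale transported =
	fixes K :: "('o, 'a, 't) fcat" and fo :: "'o => 'u" and fa :: "'a => 'u" and ft :: "'t => 'u"
	assumes K: "fcategory K" and inj: "inj_on fo (Obj K)" "inj_on fa (Arr K)" "inj_on ft (Cell K)"
begin

sublocale K: twocat K by unfold_locales (rule fcategory_two_category[OF K])

abbreviation T where "T \<equiv> transport K fo fa ft"

lemma inv [simp]:
	"x : Obj K ==> inv_into (Obj K) fo (fo x) = x" "f : Arr K ==> inv_into (Arr K) fa (fa f) = f"
	"t : Cell K ==> inv_into (Cell K) ft (ft t) = t"
	using inj by simp_all

lemma eqs [simp]:
	"x : Obj K ==> y : Obj K ==> fo x = fo y \<longleftrightarrow> x = y" "f : Arr K ==> g : Arr K ==> fa f = fa g \<longleftrightarrow> f = g"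
	using inj by (auto dest: inj_onD)

lemma T_sel [simp]:
	"Obj T = fo ` Obj K" "Arr T = fa ` Arr K" "Tight T = fa ` Tight K" "Cell T = ft ` Cell K"
	"f : Arr K ==> Dom T (fa f) = fo (Dom K f)" "f : Arr K ==> Cod T (fa f) = fo (Cod K f)"
	"x : Obj K ==> Idn T (fo x) = fa (Idn K x)"
	"f : Arr K ==> g : Arr K ==> Cmp T (fa g) (fa f) = fa (Cmp K g f)"
	"t : Cell K ==> Src T (ft t) = fa (Src K t)" "t : Cell K ==> Tgt T (ft t) = fa (Tgt K t)"
	"f : Arr K ==> VId T (fa f) = ft (VId K f)"
	"s : Cell K ==> t : Cell K ==> VCmp T (ft t) (ft s) = ft (VCmp K t s)"
	"s : Cell K ==> t : Cell K ==> HCmp T (ft t) (ft s) = ft (HCmp K t s)"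
	by (simp_all add: transport_def Let_def)

lemma fcategory_T: "fcategory T"
proof -
	note ta = Tight_arr[OF K]
	have "category (arrow_cat T)"
		unfolding category_def by (simp add: arrow_cat_def)
	moreover have "category (vertical_cat T)"
		unfolding category_def by (simp add: vertical_cat_def)
	moreover have "category (horizontal_cat T)"
		unfolding category_def by (simp add: horizontal_cat_def K.HCmp_assoc)
	ultimately have "two_category T"
		unfolding two_category_def by (simp add: K.interchange K.HCmp_VId)
	moreover have "fo x : fo ` Obj K ==> Idn T (fo x) : Tight T" if "x : Obj K" for x
		using that Idn_tight[OF K] by simp
	ultimately show ?thesis
		unfolding fcategory_def using ta Cmp_tight[OF K] by auto
qed

definition to_T where
	"to_T = \<lparr>F0 = (\<lambda>x\<in>Obj K. fo x), F1 = (\<lambda>f\<in>Arr K. fa f), F2 = (\<lambda>t\<in>Cell K. ft t)\<rparr>"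

definition from_T where
	"from_T = \<lparr>F0 = (\<lambda>x\<in>Obj T. inv_into (Obj K) fo x), F1 = (\<lambda>f\<in>Arr T. inv_into (Arr K) fa f),
		 F2 = (\<lambda>t\<in>Cell T. inv_into (Cell K) ft t)\<rparr>"

lemma to_T: "ffunctor K T to_T"
	by (rule ffunctorI) (auto simp: to_T_def Tight_arr[OF K] K.two_category)

lemma from_T: "ffunctor T K from_T"
proof (rule ffunctorI)
	note t = fcategory_two_category[OF fcategory_T]
	then interpret T: twocat T by unfold_locales
	show "two_category T" by (rule t)
	show "F0 from_T : extensional (Obj T)" "F1 from_T : extensional (Arr T)" "F2 from_T : extensional (Cell T)"
		by (simp_all add: from_T_def del: T_sel)
	have s: "x : Obj K ==> F0 from_T (fo x) = x" "f : Arr K ==> F1 from_T (fa f) = f" "c : Cell K ==> F2 from_T (ft c) = c" for x f c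
		by (simp_all add: from_T_def)
	fix f assume "f : Tight T"
	then show "F1 from_T f : Tight K" using Tight_arr[OF K] by (auto simp: s)
next
	have s: "x : Obj K ==> F0 from_T (fo x) = x" "f : Arr K ==> F1 from_T (fa f) = f" "c : Cell K ==> F2 from_T (ft c) = c" for x f c
		by (simp_all add: from_T_def)
	show "F0 from_T x : Obj K" if "x : Obj T" for x using that by (auto simp: s)
	show "F1 from_T (Idn T x) = Idn K (F0 from_T x)" if "x : Obj T" for x using that by (auto simp: s)
	show "F1 from_T f : Arr K" "Dom K (F1 from_T f) = F0 from_T (Dom T f)" "Cod K (F1 from_T f) = F0 from_T (Cod T f)"
		"F2 from_T (VId T f) = VId K (F1 from_T f)" if "f : Arr T" for f using that by (auto simp: s)
	show "F1 from_T (Cmp T g f) = Cmp K (F1 from_T g) (F1 from_T f)" if "f : Arr T" "g : Arr T" "Dom T g = Cod T f" for f g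
		using that by (auto simp: s)
	show "F2 from_T c : Cell K" "Src K (F2 from_T c) = F1 from_T (Src T c)" "Tgt K (F2 from_T c) = F1 from_T (Tgt T c)"
		if "c : Cell T" for c using that by (auto simp: s)
	show "F2 from_T (VCmp T d c) = VCmp K (F2 from_T d) (F2 from_T c)" if "c : Cell T" "d : Cell T" "Src T d = Tgt T c" for c d
		using that by (auto simp: s)
	show "F2 from_T (HCmp T d c) = HCmp K (F2 from_T d) (F2 from_T c)" if "c : Cell T" "d : Cell T" "Dom T (Src T d) = Cod T (Src T c)" for c d
		using that by (auto simp: s)
qed

lemma from_to: "ffun_comp K from_T to_T = ffun_id K"
	unfolding ffun_comp_def ffun_id_def by (auto simp: to_T_def from_T_def intro!: restrict_ext)

lemma to_from: "ffun_comp T to_T from_T = ffun_id T"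
	unfolding ffun_comp_def ffun_id_def by (auto simp: to_T_def from_T_def intro!: restrict_ext)

end

text \<open>Objects, arrows and 2-cells are copied by injections with small images, and the cones
  are pulled back along the inverse functor.\<close>

lemma sketch_copy:
	fixes S :: "('u, 'o, 'a, 't) sketch"
	assumes S: "fcategory (scat S)" "!!c. c : cones S ==> weighted_cone small (scat S) c"
		and inj: "inj_on fo (Obj (scat S))" "inj_on fa (Arr (scat S))" "inj_on ft (Cell (scat S))"
		and sm: "small (fo ` Obj (scat S))" "small (fa ` Arr (scat S))" "small (ft ` Cell (scat S))"
	shows "\<exists>H :: 'u sk. small_sketch small H & sketch_iso H S"
proof -
	interpret transported "scat S" fo fa ft by unfold_locales (use S inj in auto)
	\<comment> \<open>Cones are specified on the copy by their image under \<open>from_T\<close>, so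
	  that this functor is a model by definition and only \<open>to_T\<close> needs an
	  argument.\<close>
	define H where "H = \<lparr>scat = T, cones = {c. weighted_cone small T c & map_cone from_T c : cones S}\<rparr>"
	have "small_sketch small H" using fcategory_T sm by (simp add: H_def small_sketch_def small_fcat_def)
	moreover have "model H S from_T" using from_T by (simp add: H_def model_def)
	moreover have "model S H to_T"
	proof -
		have "map_cone to_T c : cones H" if c: "c : cones S" for c
		proof -
			interpret c: cone_map small "scat S" c T to_T
				by unfold_locales (use S(1) S(2)[OF c] to_T K.two_category fcategory_two_category[OF fcategory_T] in auto)
			\<comment> \<open>The sketch with the single cone \<open>c\<close> turns \<open>model_id\<close>
			  into the equation that the identity functor fixes \<open>c\<close>.\<close>
			have "model \<lparr>scat = scat S, cones = {c}\<rparr> \<lparr>scat = scat S, cones = {c}\<rparr> (ffun_id (scat S))"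
				using model_id[of "\<lparr>scat = scat S, cones = {c}\<rparr>" small] S(1) S(2)[OF c] by simp
			then have "map_cone from_T (map_cone to_T c) = c"
				unfolding c.map_cone_comp[OF to_T] from_to by (simp add: model_def)
			then show ?thesis using c.weighted_cone_map c by (simp add: H_def)
		qed
		then show ?thesis using to_T by (simp add: H_def model_def)
	qed
	moreover have "ffun_comp (scat H) to_T from_T = ffun_id (scat H)" "ffun_comp (scat S) from_T to_T = ffun_id (scat S)"
		using to_from from_to by (simp_all add: H_def)
	ultimately show ?thesis unfolding sketch_iso_def by blast
qed

section \<open>Cardinality bounds for the hom sketches\<close>

section \<open>Size\<close>

locale univ =
	fixes small :: "'u set => bool"
	assumes univ: "universe small"
begin

text \<open>Smallness for sets of any type, since functors, transformations and modifications do not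
  live in \<open>'u\<close>.\<close>

definition sm :: "'b set => bool" where
	"sm A \<longleftrightarrow> (\<exists>P. small P & A \<lesssim> P)"

lemma small_lepoll: "small A ==> B \<lesssim> A ==> small B"
	using univ unfolding universe_def by blast

lemma sm_small: "small A ==> sm A"
	unfolding sm_def using lepoll_refl by blast

lemma sm_lepoll: "sm A ==> B \<lesssim> A ==> sm B"
	unfolding sm_def using lepoll_trans by blast

lemma sm_inj: "sm B ==> inj_on f A ==> f ` A \<subseteq> B ==> sm A"
	by (rule sm_lepoll) (auto simp: lepoll_def)

lemma sm_copy:
	assumes "sm A" shows "\<exists>f :: _ => 'u. inj_on f A & small (f ` A)"
proof -
	obtain P f where P: "small P" "inj_on f A" "f ` A \<subseteq> P" using assms by (auto simp: sm_def lepoll_def)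
	then show ?thesis using small_lepoll[OF P(1) subset_imp_lepoll[OF P(3)]] by blast
qed

lemma sm_Pow: assumes "sm A" shows "sm (Pow A)"
proof -
	obtain P f where P: "small P" "inj_on f A" "f ` A \<subseteq> P" using assms by (auto simp: sm_def lepoll_def)
	have "inj_on ((`) f) (Pow A)" using P(2) by (rule inj_on_image_Pow)
	then have "Pow A \<lesssim> Pow P" using P(3) by (auto simp: lepoll_def)
	moreover obtain P' where "small P'" "Pow P \<lesssim> P'" using univ P(1) unfolding universe_def by blast
	ultimately show ?thesis unfolding sm_def using lepoll_trans by blast
qed

lemma small_Un:
	assumes "small A" "small B" shows "small (A \<union> B)"
proof -
	\<comment> \<open>A union of two sets is a union over a two-element index set. The universe
	  postulates only the empty set, so such an index set is obtained by taking power sets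
	  twice.\<close>
	have "sm (Pow (Pow ({} :: 'u set)))" using univ by (intro sm_Pow sm_small) (simp add: universe_def)
	then obtain f :: "'u set set => 'u" where f: "inj_on f (Pow (Pow {}))" "small (f ` Pow (Pow {}))" using sm_copy by blast
	have ne: "f {} ~= f {{}}" using inj_onD[OF f(1), of "{}" "{{}}"] by auto
	define F where "F a = (if a = f {} then A else B)" for a
	have "small (\<Union>a\<in>f ` Pow (Pow {}). F a)"
		by (rule univ[unfolded universe_def, THEN conjunct2, THEN conjunct2, THEN conjunct2, rule_format])
			(use f(2) assms in \<open>auto simp: F_def\<close>)
	moreover have "f ` Pow (Pow {}) = {f {}, f {{}}}" by (simp add: Pow_insert insert_commute)
	then have "(\<Union>a\<in>f ` Pow (Pow {}). F a) = A \<union> B" using ne by (auto simp: F_def)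
	ultimately show ?thesis by simp
qed

lemma sm_Times:
	assumes "sm A" "sm B" shows "sm (A \<times> B)"
proof -
	obtain P Q where P: "small P" "A \<lesssim> P" "small Q" "B \<lesssim> Q" using assms by (auto simp: sm_def)
	let ?U = "P \<union> Q"
	have "sm (Pow (Pow ?U))" by (intro sm_Pow sm_small small_Un P)
	\<comment> \<open>Kuratowski pairs embed the product into a double power set.\<close>
	moreover have "inj_on (\<lambda>(a, b). {{a}, {a, b}}) (?U \<times> ?U)" by (rule inj_onI) (clarsimp simp: doubleton_eq_iff, blast)
	moreover have "(\<lambda>(a, b). {{a}, {a, b}}) ` (?U \<times> ?U) \<subseteq> Pow (Pow ?U)" by auto
	ultimately have "sm (?U \<times> ?U)" by (rule sm_inj)
	moreover have "A \<lesssim> ?U" "B \<lesssim> ?U"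
		using lepoll_trans[OF P(2) subset_imp_lepoll[of P ?U]] lepoll_trans[OF P(4) subset_imp_lepoll[of Q ?U]] by auto
	ultimately show ?thesis using sm_lepoll times_lepoll_mono by blast
qed

lemma sm_PiE:
	assumes "sm A" "sm B" shows "sm (A \<rightarrow>\<^sub>E B)"
proof (rule sm_inj[OF sm_Pow[OF sm_Times[OF assms]]])
	\<comment> \<open>A function is replaced by its graph, a subset of the product; extensionality
	  makes this injective.\<close>
	show "inj_on (\<lambda>f. (\<lambda>a. (a, f a)) ` A) (A \<rightarrow>\<^sub>E B)"
		by (rule inj_onI, rule PiE_ext) (auto simp: set_eq_iff image_iff)
qed auto

text \<open>Functors are triples of extensional functions between small sets; a transformation adds
  two such functions to its end functors, and a modification adds one to its end
  transformations.\<close>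

lemma Mod_small:
	assumes vw: "v \<preceq> w" and X: "small_sketch small X" and Z: "small_sketch small Z"
	shows "sm (Obj (Mod_cat v w X Z))" "sm (Arr (Mod_cat v w X Z))" "sm (Cell (Mod_cat v w X Z))"
proof -
	let ?X = "scat X" and ?Z = "scat Z"
	interpret funcat ?X ?Z v w by unfold_locales (use small_sketch_fcategory X Z vw in auto)
	have s: "sm (Obj ?X)" "sm (Arr ?X)" "sm (Cell ?X)" "sm (Obj ?Z)" "sm (Arr ?Z)" "sm (Cell ?Z)"
		using X Z by (auto simp: small_sketch_def small_fcat_def intro: sm_small)
	have 0: "sm {M. ffunctor ?X ?Z M}"
	proof (rule sm_inj[OF sm_Times[OF sm_PiE[OF s(1,4)] sm_Times[OF sm_PiE[OF s(2,5)] sm_PiE[OF s(3,6)]]]])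
		show "inj_on (\<lambda>M. (F0 M, F1 M, F2 M)) {M. ffunctor ?X ?Z M}" by (rule inj_onI) (simp add: ffun.equality)
	qed (auto simp: ffunctor_def is_functor_def arrow_cat_def vertical_cat_def)
	have 1: "sm (loose_trans ?X ?Z v w)"
	proof (rule sm_inj[OF sm_Times[OF 0 sm_Times[OF 0 sm_Times[OF sm_PiE[OF s(1,5)] sm_PiE[OF s(2,6)]]]]])
		show "inj_on (\<lambda>ph. (tsrc ph, ttgt ph, tob ph, tcell ph)) (loose_trans ?X ?Z v w)" by (rule inj_onI) (simp add: wtrans.equality)
		show "(\<lambda>ph. (tsrc ph, ttgt ph, tob ph, tcell ph)) ` loose_trans ?X ?Z v w \<subseteq> {M. ffunctor ?X ?Z M} \<times> {M. ffunctor ?X ?Z M} \<times>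
				(Obj ?X \<rightarrow>\<^sub>E Arr ?Z) \<times> (Arr ?X \<rightarrow>\<^sub>E Cell ?Z)"
		proof (intro image_subsetI)
			fix ph assume l: "ph : loose_trans ?X ?Z v w"
			show "(tsrc ph, ttgt ph, tob ph, tcell ph) : {M. ffunctor ?X ?Z M} \<times> {M. ffunctor ?X ?Z M} \<times>
				(Obj ?X \<rightarrow>\<^sub>E Arr ?Z) \<times> (Arr ?X \<rightarrow>\<^sub>E Cell ?Z)"
				by (simp add: PiE_iff loose_src[OF l] loose_tgt[OF l] loose_tob[OF l] loose_cell[OF l] loose_tob_ext[OF l] loose_tcell_ext[OF l])
		qed
	qed
	have 2: "sm (modifications ?X ?Z v w)"
	proof (rule sm_inj[OF sm_Times[OF 1 sm_Times[OF 1 sm_PiE[OF s(1,6)]]]])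
		show "inj_on (\<lambda>mu. (msrc mu, mtgt mu, mcmp mu)) (modifications ?X ?Z v w)" by (rule inj_onI) (simp add: modif.equality)
		show "(\<lambda>mu. (msrc mu, mtgt mu, mcmp mu)) ` modifications ?X ?Z v w \<subseteq> loose_trans ?X ?Z v w \<times> loose_trans ?X ?Z v w \<times> (Obj ?X \<rightarrow>\<^sub>E Cell ?Z)"
		proof (intro image_subsetI)
			fix mu assume m: "mu : modifications ?X ?Z v w"
			show "(msrc mu, mtgt mu, mcmp mu) : loose_trans ?X ?Z v w \<times> loose_trans ?X ?Z v w \<times> (Obj ?X \<rightarrow>\<^sub>E Cell ?Z)"
				by (simp add: PiE_iff modif_src[OF m] modif_tgt[OF m] modif_cell[OF m] modif_ext[OF m])
		qed
	qed
	show "sm (Obj (Mod_cat v w X Z))"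
		by (rule sm_lepoll[OF 0 subset_imp_lepoll]) (auto simp: Mod_cat_eq full_sub_sets)
	show "sm (Arr (Mod_cat v w X Z))"
		by (rule sm_lepoll[OF 1 subset_imp_lepoll]) (auto simp: Mod_cat_eq full_sub_sets)
	show "sm (Cell (Mod_cat v w X Z))"
		by (rule sm_lepoll[OF 2 subset_imp_lepoll]) (auto simp: Mod_cat_eq full_sub_sets)
qed

lemma Mod_homs_exist:
	assumes vw: "v \<preceq> w"
	shows "\<exists>H. Mod_homs small v w ({S. small_sketch small S} \<times> {S. small_sketch small S}) H"
proof -
	have "\<exists>H :: 'u sk. small_sketch small H & sketch_iso H (Mod_sketch small v w X Z)"
		if X: "small_sketch small X" and Z: "small_sketch small Z" for X Z :: "'u sk"
	proof -
		note s = Mod_small[OF vw X Z]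
		obtain fo :: "_ => 'u" where fo: "inj_on fo (Obj (Mod_cat v w X Z))" "small (fo ` Obj (Mod_cat v w X Z))" using sm_copy[OF s(1)] by blast
		obtain fa :: "_ => 'u" where fa: "inj_on fa (Arr (Mod_cat v w X Z))" "small (fa ` Arr (Mod_cat v w X Z))" using sm_copy[OF s(2)] by blast
		obtain ft :: "_ => 'u" where ft: "inj_on ft (Cell (Mod_cat v w X Z))" "small (ft ` Cell (Mod_cat v w X Z))" using sm_copy[OF s(3)] by blast
		have "fcategory (scat (Mod_sketch small v w X Z))"
			using fcategory_Mod[OF small_sketch_fcategory[OF X] small_sketch_fcategory[OF Z] vw] by simp
		moreover have "weighted_cone small (scat (Mod_sketch small v w X Z)) c" if "c : cones (Mod_sketch small v w X Z)" for c
			using that by (simp add: Mod_sketch_def)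
		ultimately show ?thesis using sketch_copy[of "Mod_sketch small v w X Z" small fo fa ft] fo fa ft by simp
	qed
	note ex = this
	define H :: "'u sk => 'u sk => 'u sk" where "H X Z = (SOME H. small_sketch small H & sketch_iso H (Mod_sketch small v w X Z))" for X Z
	have "small_sketch small (H X Z) & sketch_iso (H X Z) (Mod_sketch small v w X Z)" if "small_sketch small X" "small_sketch small Z" for X Z
		unfolding H_def by (rule someI_ex[OF ex[OF that]])
	then show ?thesis by (intro exI[of _ H]) (simp add: Mod_homs_def)
qed

end

theorem proposition6p18:
  fixes small :: "'u set \<Rightarrow> bool" and w' w :: weakness
  assumes "w' \<preceq> w"
  shows "(universe small \<longrightarrow>
            (\<exists>L. Mod_homs small (dual w') (dual w)
                    ({S. small_sketch small S} \<times> {S. small_sketch small S}) L \<and>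
                 left_closed (FSK small w' w) L) \<and>
            (\<exists>R. Mod_homs small w' w
                    ({S. small_sketch small S} \<times> {S. small_sketch small S}) R \<and>
                 right_closed (FSK small w' w) R)) \<and>
         (\<forall>D L. Mod_homs small (dual w') (dual w) D L \<longrightarrow>
                left_closed_on (FSK small w' w) D L) \<and>
         (\<forall>D R. Mod_homs small w' w D R \<longrightarrow>
                right_closed_on (FSK small w' w) D R)"
proof (intro conjI impI allI)
  note closed = left_closed_Mod[OF assms] right_closed_Mod[OF assms]
  show "left_closed_on (FSK small w' w) D L" if "Mod_homs small (dual w') (dual w) D L" for D L
    by (rule closed(1)[OF that])
  show "right_closed_on (FSK small w' w) D R" if "Mod_homs small w' w D R" for D R
    by (rule closed(2)[OF that])
  \<comment> \<open>The universe supplies small copies of the hom sketches for all pairs; closedness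
    over them is then an instance of the relative statements just proved.\<close>
  assume "universe small"
  then interpret univ small by unfold_locales
  obtain L where L: "Mod_homs small (dual w') (dual w) ({S. small_sketch small S} \<times> {S. small_sketch small S}) L"
    using Mod_homs_exist[OF dual_mono[OF assms]] by blast
  then show "\<exists>L. Mod_homs small (dual w') (dual w) ({S. small_sketch small S} \<times> {S. small_sketch small S}) L \<and>
      left_closed (FSK small w' w) L"
    using closed(1)[OF L] by (intro exI[of _ L] conjI) (simp_all only: left_closed_def FSK_sel(1))
  obtain R where R: "Mod_homs small w' w ({S. small_sketch small S} \<times> {S. small_sketch small S}) R"
    using Mod_homs_exist[OF assms] by blast
  then show "\<exists>R. Mod_homs small w' w ({S. small_sketch small S} \<times> {S. small_sketch small S}) R \<and>
      right_closed (FSK small w' w) R"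
    using closed(2)[OF R] by (intro exI[of _ R] conjI) (simp_all only: right_closed_def FSK_sel(1))
qed

end
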